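(* Let $\Lambda$ be a (path) algebra of affine type $\widetilde{D}_n$ (with $n+1$ vertices), whose cluster category is modelled by the twice-punctured disk $\mathbb{D}(n)$ with punctures $P,Q$ and $n-2$ marked points on the boundary. Then the translation quiver $\Gamma(\mathbb{D}(n))=\Gamma_0\sqcup\Gamma_1$ of interior arcs of $\mathbb{D}(n)$ is isomorphic, as a translation quiver, to the disjoint union $\mathcal{T}_2\sqcup\mathcal{T}_3$ of the two tubes of rank $2$ in the Auslander–Reiten quiver of the cluster category of $\Lambda$.
   Context: The regular part of the Auslander–Reiten quiver of the cluster category of an algebra of affine type $\widetilde{D}_n$ consists of a $\mathbb{P}^1(k)$-family of stable tubes: one tube $\mathcal{T}_1$ of rank $n-2$, two tubes $\mathcal{T}_2,\mathcal{T}_3$ of rank $2$, and all others of rank $1$ (translation is the Auslander–Reiten translation $\tau$). Interior arcs of $\mathbb{D}(n)$ are (generalized, possibly self-crossing) tagged curves up to homotopy fixing endpoints with both endpoints at punctures, possibly cutting out a once-punctured monogon, in which case the two ends carry different tags. They are encoded as $[x,y]$: in the universal cover of a cylinder with $P$ on the lower boundary (preimages = odd integers) and $Q$ on the upper boundary (preimages = even integers), $[x,y]$ is the arc from the puncture of $x$, winding counterclockwise around both punctures $\lfloor |\,\|y\|-\|x\|\,|/2\rfloor$ times, to the puncture of $y$, where for $a\in\mathbb{Z}\sqcup\mathbb{Z}^\ast$, $\|a\|$ is the underlying integer, $\operatorname{tag}(a)$ is notched iff $a\in\mathbb{Z}^\ast$, and $a^\ast$ is $a$ with tag changed. Normal form: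 $x\in\{0,0^\ast,1,1^\ast\}$, $y\in\mathbb{Z}_{>0}\sqcup(\mathbb{Z}_{>0})^\ast$, $\|x\|<\|y\|$; if $\|y\|-\|x\|$ is odd then $\|x\|=0$ when the tags of $x,y$ agree and $\|x\|=1$ when they differ; if $\|y\|-\|x\|$ is even then the tags of $x,y$ differ. The quiver $\Gamma(\mathbb{D}(n))$ has as vertices the arcs $[x,y]$ in normal form, with an arrow $[x,y]\to[a,b]$ if: when $\|x\|=0$, ($a=x$, $b=y^\ast+1$) or ($a=x^\ast$, $b=y-1$); when $\|x\|=1$, ($a=x$, $b=y+1$) or ($a=x^\ast$, $b=y^\ast-1$) (here $y\pm1$ shifts the integer keeping the tag). Its translation is $\tau([x,y])=[x^\ast,y^\ast]$. $\Gamma_0$ is the component of arcs with $\|x\|=0$ and $\Gamma_1$ the component of arcs with $\|x\|=1$. *)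

theory Defs
  imports
    "HOL-Library.Function_Algebras"
    "HOL-Computational_Algebra.Polynomial"
    "Jordan_Normal_Form.Matrix"
begin

section \<open>Translation quivers\<close>

text \<open>Between two vertices \<open>x\<close>, \<open>y\<close> there are \<open>arr x y\<close> arrows. All translation quivers below are
  stable, so the translation is a total map on the vertices.\<close>

record 'v tquiver =
  verts :: "'v set"
  arr :: "'v \<Rightarrow> 'v \<Rightarrow> nat"
  trans :: "'v \<Rightarrow> 'v"

definition stable_translation_quiver :: "'v tquiver \<Rightarrow> bool" where
  "stable_translation_quiver Q \<longleftrightarrow>
     bij_betw (trans Q) (verts Q) (verts Q) \<and>
     (\<forall>x\<in>verts Q. \<forall>y\<in>verts Q. arr Q (trans Q x) y = arr Q y x)"

definition tq_iso :: "'v tquiver \<Rightarrow> 'w tquiver \<Rightarrow> bool" where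
  "tq_iso Q R \<longleftrightarrow> (\<exists>\<phi>. bij_betw \<phi> (verts Q) (verts R) \<and>
     (\<forall>x\<in>verts Q. \<forall>y\<in>verts Q. arr R (\<phi> x) (\<phi> y) = arr Q x y) \<and>
     (\<forall>x\<in>verts Q. \<phi> (trans Q x) = trans R (\<phi> x)))"

definition tq_restrict :: "'v tquiver \<Rightarrow> 'v set \<Rightarrow> 'v tquiver" where
  "tq_restrict Q V = Q\<lparr>verts := V\<rparr>"

definition tq_sum :: "'v tquiver \<Rightarrow> 'w tquiver \<Rightarrow> ('v + 'w) tquiver" where
  "tq_sum Q R = \<lparr>
     verts = verts Q <+> verts R,
     arr = (\<lambda>x y. case (x, y) of
              (Inl a, Inl b) \<Rightarrow> arr Q a b
            | (Inr a, Inr b) \<Rightarrow> arr R a b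
            | _ \<Rightarrow> 0),
     trans = map_sum (trans Q) (trans R)\<rparr>"

definition tq_adj :: "'v tquiver \<Rightarrow> 'v \<Rightarrow> 'v \<Rightarrow> bool" where
  "tq_adj Q x y \<longleftrightarrow> x \<in> verts Q \<and> y \<in> verts Q \<and> (arr Q x y \<noteq> 0 \<or> arr Q y x \<noteq> 0)"

text \<open>Connected components, as sets of vertices.\<close>

definition tq_components :: "'v tquiver \<Rightarrow> 'v set set" where
  "tq_components Q = {{y. (tq_adj Q)\<^sup>*\<^sup>* x y} | x. x \<in> verts Q}"

definition ZA_inf :: "(int \<times> nat) tquiver" where
  "ZA_inf = \<lparr>
     verts = UNIV,
     arr = (\<lambda>(i, j) (i', j').
              if (i' = i \<and> j' = j + 1) \<or> (i' = i + 1 \<and> j = j' + 1) then 1 else 0),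
     trans = (\<lambda>(i, j). (i - 1, j))\<rparr>"

definition cyclic_orbit :: "('v \<Rightarrow> 'v) \<Rightarrow> 'v \<Rightarrow> 'v set" where
  "cyclic_orbit g x = {y. \<exists>m. y = (g ^^ m) x \<or> x = (g ^^ m) y}"

text \<open>The quotient by the cyclic group generated by an automorphism \<open>g\<close> all of whose powers
  \<open>g\<^sup>m\<close>, \<open>m \<noteq> 0\<close>, act without fixed vertices: arrows from the orbit of \<open>x\<close> to the orbit \<open>V\<close>
  modulo the group correspond to arrows from \<open>x\<close> to elements of \<open>V\<close>.\<close>

definition tq_quotient :: "'v tquiver \<Rightarrow> ('v \<Rightarrow> 'v) \<Rightarrow> 'v set tquiver" where
  "tq_quotient Q g = \<lparr>
     verts = cyclic_orbit g ` verts Q,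
     arr = (\<lambda>U V. \<Sum>y\<in>{y \<in> V. arr Q (SOME x. x \<in> U) y \<noteq> 0}. arr Q (SOME x. x \<in> U) y),
     trans = (\<lambda>U. trans Q ` U)\<rparr>"

definition is_stable_tube :: "nat \<Rightarrow> 'v tquiver \<Rightarrow> bool" where
  "is_stable_tube r T \<longleftrightarrow> r > 0 \<and> tq_iso T (tq_quotient ZA_inf (trans ZA_inf ^^ r))"


section \<open>The quiver of interior arcs\<close>

datatype tint = Plain int | Notched int

fun tnorm :: "tint \<Rightarrow> int" where
  "tnorm (Plain i) = i"
| "tnorm (Notched i) = i"

fun notched :: "tint \<Rightarrow> bool" where
  "notched (Plain i) = False"
| "notched (Notched i) = True"

fun tstar :: "tint \<Rightarrow> tint" where
  "tstar (Plain i) = Notched i"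
| "tstar (Notched i) = Plain i"

fun tshift :: "int \<Rightarrow> tint \<Rightarrow> tint" where
  "tshift d (Plain i) = Plain (i + d)"
| "tshift d (Notched i) = Notched (i + d)"

definition interior_arcs :: "(tint \<times> tint) set" where
  "interior_arcs = {(x, y).
     x \<in> {Plain 0, Notched 0, Plain 1, Notched 1} \<and> tnorm y > 0 \<and> tnorm x < tnorm y \<and>
     (odd (tnorm y - tnorm x) \<longrightarrow> tnorm x = (if notched x = notched y then 0 else 1)) \<and>
     (even (tnorm y - tnorm x) \<longrightarrow> notched x \<noteq> notched y)}"

definition arc_arrow :: "tint \<times> tint \<Rightarrow> tint \<times> tint \<Rightarrow> bool" where
  "arc_arrow v w \<longleftrightarrow> v \<in> interior_arcs \<and> w \<in> interior_arcs \<and>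
     (let (x, y) = v; (a, b) = w in
        (tnorm x = 0 \<and> ((a = x \<and> b = tshift 1 (tstar y)) \<or> (a = tstar x \<and> b = tshift (-1) y))) \<or>
        (tnorm x = 1 \<and> ((a = x \<and> b = tshift 1 y) \<or> (a = tstar x \<and> b = tshift (-1) (tstar y)))))"

text \<open>In this encoding the interior arcs of the twice-punctured disk, and the quiver they form, do
  not involve the marked points on the boundary.\<close>

definition Gamma :: "(tint \<times> tint) tquiver" where
  "Gamma = \<lparr>
     verts = interior_arcs,
     arr = (\<lambda>v w. if arc_arrow v w then 1 else 0),
     trans = (\<lambda>(x, y). (tstar x, tstar y))\<rparr>"

definition Gamma0 :: "(tint \<times> tint) set" where
  "Gamma0 = {(x, y) \<in> interior_arcs. tnorm x = 0}"

definition Gamma1 :: "(tint \<times> tint) set" where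
  "Gamma1 = {(x, y) \<in> interior_arcs. tnorm x = 1}"

lemma stable_translation_quiver_Gamma: "stable_translation_quiver Gamma"
proof -
  have star: "tstar (tstar x) = x" "tnorm (tstar x) = tnorm x" "notched (tstar x) = (\<not> notched x)"
    for x by (cases x; simp)+
  have cl: "(tstar x, tstar y) \<in> interior_arcs" if "(x, y) \<in> interior_arcs" for x y
    using that by (auto simp: interior_arcs_def star)
  have "bij_betw (trans Gamma) (verts Gamma) (verts Gamma)"
    by (rule bij_betw_byWitness[where f' = "trans Gamma"]) (auto simp: Gamma_def star cl)
  moreover have "arc_arrow (tstar x, tstar y) (a, b) = arc_arrow (a, b) (x, y)"
    if "(x, y) \<in> interior_arcs" "(a, b) \<in> interior_arcs" for x y a b
  proof -
    have sh: "(b = tshift d z) = (z = tshift (- d) b)" "tshift d (tstar z) = tstar (tshift d z)"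
      "(a = tstar c) = (c = tstar a)" for b d z c
      by (cases b; cases z; cases a; cases c; auto)+
    have "tnorm x = tnorm a" if "a = x \<or> a = tstar x" using that star by auto
    then show ?thesis
      using that cl[OF that(1)] unfolding arc_arrow_def
      by (simp add: star) (metis sh star minus_minus)
  qed
  ultimately show ?thesis
    by (auto simp: stable_translation_quiver_def Gamma_def)
qed


section \<open>Path algebras of type \<open>D\<^sub>n\<close> tilde and their finite-dimensional modules\<close>

definition Dtilde_edges :: "nat \<Rightarrow> nat set set" where
  "Dtilde_edges n = {{0, 2}, {1, 2}, {n - 2, n - 1}, {n - 2, n}} \<union>
     {{i, i + 1} | i. 2 \<le> i \<and> i + 1 \<le> n - 2}"

text \<open>An orientation of the graph with vertices \<open>0, \<dots>, n\<close>; the arrow \<open>(i, j)\<close> goes from \<open>i\<close> to \<open>j\<close>.\<close>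

definition orientation_Dtilde :: "nat \<Rightarrow> (nat \<times> nat) set \<Rightarrow> bool" where
  "orientation_Dtilde n A \<longleftrightarrow>
     (\<forall>i j. (i, j) \<in> A \<or> (j, i) \<in> A \<longleftrightarrow> {i, j} \<in> Dtilde_edges n) \<and>
     (\<forall>i j. (i, j) \<in> A \<longrightarrow> (j, i) \<notin> A)"

text \<open>A path is the list of vertices it visits; \<open>[i]\<close> is the trivial path at \<open>i\<close>.\<close>

definition paths :: "nat set \<Rightarrow> (nat \<times> nat) set \<Rightarrow> nat list set" where
  "paths V A = {p. p \<noteq> [] \<and> set p \<subseteq> V \<and> successively (\<lambda>i j. (i, j) \<in> A) p}"

text \<open>The product \<open>q r\<close> of paths is \<open>r\<close> followed by \<open>q\<close>. It equals \<open>p\<close> iff \<open>r = take (Suc i) p\<close> and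
  \<open>q = drop i p\<close> for some position \<open>i\<close> of \<open>p\<close>.\<close>

definition path_algebra ::
    "nat set \<Rightarrow> (nat \<times> nat) set \<Rightarrow> ('k::field, nat list \<Rightarrow> 'k) module" where
  "path_algebra V A = \<lparr>
     carrier = {a. finite {p. a p \<noteq> 0} \<and> {p. a p \<noteq> 0} \<subseteq> paths V A},
     monoid.mult = (\<lambda>a b p. \<Sum>i<length p. a (drop i p) * b (take (Suc i) p)),
     one = (\<lambda>p. if \<exists>v\<in>V. p = [v] then 1 else 0),
     zero = (\<lambda>p. 0),
     add = (\<lambda>a b p. a p + b p),
     smult = (\<lambda>c a p. c * a p)\<rparr>"

text \<open>A finite-dimensional left module is a space \<open>k\<^sup>m\<close> on which the algebra acts by matrices.\<close>

record ('a, 'k) fdmod =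
  mdim :: nat
  mact :: "'a \<Rightarrow> 'k mat"

definition is_fdmod :: "('k::field, 'a) module \<Rightarrow> ('a, 'k) fdmod \<Rightarrow> bool" where
  "is_fdmod \<Lambda> M \<longleftrightarrow>
     (\<forall>a\<in>carrier \<Lambda>. mact M a \<in> carrier_mat (mdim M) (mdim M)) \<and>
     (\<forall>a\<in>carrier \<Lambda>. \<forall>b\<in>carrier \<Lambda>. mact M (a \<oplus>\<^bsub>\<Lambda>\<^esub> b) = mact M a + mact M b) \<and>
     (\<forall>c. \<forall>a\<in>carrier \<Lambda>. mact M (c \<odot>\<^bsub>\<Lambda>\<^esub> a) = c \<cdot>\<^sub>m mact M a) \<and>
     (\<forall>a\<in>carrier \<Lambda>. \<forall>b\<in>carrier \<Lambda>. mact M (a \<otimes>\<^bsub>\<Lambda>\<^esub> b) = mact M a * mact M b) \<and>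
     mact M \<one>\<^bsub>\<Lambda>\<^esub> = 1\<^sub>m (mdim M)"

definition mod_hom ::
    "('k::field, 'a) module \<Rightarrow> ('a, 'k) fdmod \<Rightarrow> ('a, 'k) fdmod \<Rightarrow> 'k mat set" where
  "mod_hom \<Lambda> M N = {f \<in> carrier_mat (mdim N) (mdim M).
     \<forall>a\<in>carrier \<Lambda>. f * mact M a = mact N a * f}"


section \<open>Bounded complexes of modules\<close>

record ('a, 'k) cplx =
  cobj :: "int \<Rightarrow> ('a, 'k) fdmod"
  diff :: "int \<Rightarrow> 'k mat"

definition bounded_complexes :: "('k::field, 'a) module \<Rightarrow> ('a, 'k) cplx set" where
  "bounded_complexes \<Lambda> = {X.
     (\<forall>i. is_fdmod \<Lambda> (cobj X i)) \<and>
     (\<forall>i. diff X i \<in> mod_hom \<Lambda> (cobj X i) (cobj X (i + 1))) \<and>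
     (\<forall>i. diff X (i + 1) * diff X i = 0\<^sub>m (mdim (cobj X (i + 2))) (mdim (cobj X i))) \<and>
     finite {i. mdim (cobj X i) \<noteq> 0}}"

definition chain_maps ::
    "('k::field, 'a) module \<Rightarrow> ('a, 'k) cplx \<Rightarrow> ('a, 'k) cplx \<Rightarrow> (int \<Rightarrow> 'k mat) set" where
  "chain_maps \<Lambda> X Y = {f. \<forall>i. f i \<in> mod_hom \<Lambda> (cobj X i) (cobj Y i) \<and>
     f (i + 1) * diff X i = diff Y i * f i}"

definition chain_homotopic ::
    "('k::field, 'a) module \<Rightarrow> ('a, 'k) cplx \<Rightarrow> ('a, 'k) cplx
      \<Rightarrow> (int \<Rightarrow> 'k mat) \<Rightarrow> (int \<Rightarrow> 'k mat) \<Rightarrow> bool" where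
  "chain_homotopic \<Lambda> X Y f g \<longleftrightarrow>
     (\<exists>h. (\<forall>i. h i \<in> mod_hom \<Lambda> (cobj X i) (cobj Y (i - 1))) \<and>
          (\<forall>i. f i - g i = diff Y (i - 1) * h i + h (i + 1) * diff X i))"

definition cycles :: "('a, 'k::field) cplx \<Rightarrow> int \<Rightarrow> 'k vec set" where
  "cycles X i =
     {v \<in> carrier_vec (mdim (cobj X i)). diff X i *\<^sub>v v = 0\<^sub>v (mdim (cobj X (i + 1)))}"

definition boundaries :: "('a, 'k::field) cplx \<Rightarrow> int \<Rightarrow> 'k vec set" where
  "boundaries X i = (\<lambda>w. diff X (i - 1) *\<^sub>v w) ` carrier_vec (mdim (cobj X (i - 1)))"

text \<open>Chain maps inducing injective and surjective maps on all cohomology spaces.\<close>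

definition quasi_isos ::
    "('k::field, 'a) module \<Rightarrow> ('a, 'k) cplx \<Rightarrow> ('a, 'k) cplx \<Rightarrow> (int \<Rightarrow> 'k mat) set" where
  "quasi_isos \<Lambda> X Y = {f \<in> chain_maps \<Lambda> X Y. \<forall>i.
     (\<forall>v\<in>cycles X i. f i *\<^sub>v v \<in> boundaries Y i \<longrightarrow> v \<in> boundaries X i) \<and>
     (\<forall>w\<in>cycles Y i. \<exists>v\<in>cycles X i. f i *\<^sub>v v - w \<in> boundaries Y i)}"

definition cplx_shift :: "('a, 'k::field) cplx \<Rightarrow> ('a, 'k) cplx" where
  "cplx_shift X = \<lparr>cobj = (\<lambda>i. cobj X (i + 1)), diff = (\<lambda>i. - diff X (i + 1))\<rparr>"


section \<open>Linear categories and functors\<close>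

text \<open>The morphism spaces of a \<open>k\<close>-linear category are subspaces of one ambient space \<open>'m\<close>. This is
  no restriction: one may take the direct sum of all morphism spaces.\<close>

record ('o, 'm, 'k) lincat =
  obj :: "'o set"
  hom :: "'o \<Rightarrow> 'o \<Rightarrow> 'm set"
  comp :: "'m \<Rightarrow> 'm \<Rightarrow> 'm"
  ident :: "'o \<Rightarrow> 'm"
  scl :: "'k \<Rightarrow> 'm \<Rightarrow> 'm"

definition linear_category :: "('o, 'm::ab_group_add, 'k::field) lincat \<Rightarrow> bool" where
  "linear_category C \<longleftrightarrow>
     vector_space (scl C) \<and>
     (\<forall>X\<in>obj C. \<forall>Y\<in>obj C. module.subspace (scl C) (hom C X Y)) \<and>
     (\<forall>X\<in>obj C. ident C X \<in> hom C X X) \<and>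
     (\<forall>X\<in>obj C. \<forall>Y\<in>obj C. \<forall>f\<in>hom C X Y.
        comp C f (ident C X) = f \<and> comp C (ident C Y) f = f) \<and>
     (\<forall>X\<in>obj C. \<forall>Y\<in>obj C. \<forall>Z\<in>obj C. \<forall>f\<in>hom C X Y. \<forall>g\<in>hom C Y Z.
        comp C g f \<in> hom C X Z \<and>
        (\<forall>c. \<forall>f'\<in>hom C X Y. comp C g (scl C c f + f') = scl C c (comp C g f) + comp C g f') \<and>
        (\<forall>c. \<forall>g'\<in>hom C Y Z. comp C (scl C c g + g') f = scl C c (comp C g f) + comp C g' f)) \<and>
     (\<forall>W\<in>obj C. \<forall>X\<in>obj C. \<forall>Y\<in>obj C. \<forall>Z\<in>obj C.
        \<forall>f\<in>hom C W X. \<forall>g\<in>hom C X Y. \<forall>h\<in>hom C Y Z.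
        comp C h (comp C g f) = comp C (comp C h g) f)"

definition iso_mor :: "('o, 'm, 'k) lincat \<Rightarrow> 'o \<Rightarrow> 'o \<Rightarrow> 'm \<Rightarrow> bool" where
  "iso_mor C X Y f \<longleftrightarrow> f \<in> hom C X Y \<and>
     (\<exists>g\<in>hom C Y X. comp C g f = ident C X \<and> comp C f g = ident C Y)"

definition iso_class :: "('o, 'm, 'k) lincat \<Rightarrow> 'o \<Rightarrow> 'o set" where
  "iso_class C X = {Y \<in> obj C. \<exists>f. iso_mor C X Y f}"

record ('o, 'm) lfunctor =
  fobj :: "'o \<Rightarrow> 'o"
  fmor :: "'m \<Rightarrow> 'm"

definition linear_endofunctor ::
    "('o, 'm::ab_group_add, 'k::field) lincat \<Rightarrow> ('o, 'm) lfunctor \<Rightarrow> bool" where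
  "linear_endofunctor C F \<longleftrightarrow>
     (\<forall>X\<in>obj C. fobj F X \<in> obj C \<and> fmor F (ident C X) = ident C (fobj F X)) \<and>
     (\<forall>X\<in>obj C. \<forall>Y\<in>obj C. \<forall>f\<in>hom C X Y.
        fmor F f \<in> hom C (fobj F X) (fobj F Y) \<and>
        (\<forall>c. \<forall>f'\<in>hom C X Y. fmor F (scl C c f + f') = scl C c (fmor F f) + fmor F f')) \<and>
     (\<forall>X\<in>obj C. \<forall>Y\<in>obj C. \<forall>Z\<in>obj C. \<forall>f\<in>hom C X Y. \<forall>g\<in>hom C Y Z.
        fmor F (comp C g f) = comp C (fmor F g) (fmor F f))"

definition inverse_automorphisms ::
    "('o, 'm::ab_group_add, 'k::field) lincat \<Rightarrow> ('o, 'm) lfunctor \<Rightarrow> ('o, 'm) lfunctor \<Rightarrow> bool" where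
  "inverse_automorphisms C F G \<longleftrightarrow>
     linear_endofunctor C F \<and> linear_endofunctor C G \<and>
     (\<forall>X\<in>obj C. fobj G (fobj F X) = X \<and> fobj F (fobj G X) = X) \<and>
     (\<forall>X\<in>obj C. \<forall>Y\<in>obj C. \<forall>f\<in>hom C X Y. fmor G (fmor F f) = f \<and> fmor F (fmor G f) = f)"

definition functor_comp :: "('o, 'm) lfunctor \<Rightarrow> ('o, 'm) lfunctor \<Rightarrow> ('o, 'm) lfunctor" where
  "functor_comp G F = \<lparr>fobj = fobj G \<circ> fobj F, fmor = fmor G \<circ> fmor F\<rparr>"

text \<open>\<open>F\<^sup>i\<close> for an integer \<open>i\<close>, where \<open>G\<close> is the inverse of \<open>F\<close>.\<close>

definition fpow :: "('o, 'm) lfunctor \<Rightarrow> ('o, 'm) lfunctor \<Rightarrow> int \<Rightarrow> ('o, 'm) lfunctor" where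
  "fpow F G i = (if 0 \<le> i
     then \<lparr>fobj = fobj F ^^ nat i, fmor = fmor F ^^ nat i\<rparr>
     else \<lparr>fobj = fobj G ^^ nat (- i), fmor = fmor G ^^ nat (- i)\<rparr>)"


section \<open>The derived category and the cluster category\<close>

text \<open>\<open>L\<close> (given by \<open>Lo\<close> on complexes and by \<open>Lm X Y\<close> on chain maps from \<open>X\<close> to \<open>Y\<close>) exhibits \<open>D\<close> as the
  bounded derived category of finite-dimensional \<open>\<Lambda>\<close>-modules, the localization of the category of
  bounded complexes at the quasi-isomorphisms: up to isomorphism every object comes from a complex,
  every morphism is a fraction, and two chain maps agree in \<open>D\<close> iff they become homotopic after
  composition with a quasi-isomorphism. These conditions determine \<open>D\<close> up to equivalence.\<close>

definition is_derived_category ::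
    "('k::field, 'a) module \<Rightarrow> ('o, 'm::ab_group_add, 'k) lincat \<Rightarrow> (('a, 'k) cplx \<Rightarrow> 'o)
      \<Rightarrow> (('a, 'k) cplx \<Rightarrow> ('a, 'k) cplx \<Rightarrow> (int \<Rightarrow> 'k mat) \<Rightarrow> 'm) \<Rightarrow> bool" where
  "is_derived_category \<Lambda> D Lo Lm \<longleftrightarrow>
     linear_category D \<and>
     (\<forall>X\<in>bounded_complexes \<Lambda>. Lo X \<in> obj D \<and>
        Lm X X (\<lambda>i. 1\<^sub>m (mdim (cobj X i))) = ident D (Lo X)) \<and>
     (\<forall>X\<in>bounded_complexes \<Lambda>. \<forall>Y\<in>bounded_complexes \<Lambda>. \<forall>f\<in>chain_maps \<Lambda> X Y.
        Lm X Y f \<in> hom D (Lo X) (Lo Y) \<and>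
        (\<forall>c. \<forall>g\<in>chain_maps \<Lambda> X Y.
           Lm X Y (\<lambda>i. c \<cdot>\<^sub>m f i + g i) = scl D c (Lm X Y f) + Lm X Y g)) \<and>
     (\<forall>X\<in>bounded_complexes \<Lambda>. \<forall>Y\<in>bounded_complexes \<Lambda>. \<forall>Z\<in>bounded_complexes \<Lambda>.
        \<forall>f\<in>chain_maps \<Lambda> X Y. \<forall>g\<in>chain_maps \<Lambda> Y Z.
        Lm X Z (\<lambda>i. g i * f i) = comp D (Lm Y Z g) (Lm X Y f)) \<and>
     (\<forall>X\<in>bounded_complexes \<Lambda>. \<forall>Y\<in>bounded_complexes \<Lambda>. \<forall>s\<in>quasi_isos \<Lambda> X Y.
        iso_mor D (Lo X) (Lo Y) (Lm X Y s)) \<and>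
     (\<forall>U\<in>obj D. \<exists>X\<in>bounded_complexes \<Lambda>. U \<in> iso_class D (Lo X)) \<and>
     (\<forall>X\<in>bounded_complexes \<Lambda>. \<forall>Y\<in>bounded_complexes \<Lambda>. \<forall>h\<in>hom D (Lo X) (Lo Y).
        \<exists>Z\<in>bounded_complexes \<Lambda>. \<exists>s\<in>quasi_isos \<Lambda> Z X. \<exists>f\<in>chain_maps \<Lambda> Z Y.
        comp D h (Lm Z X s) = Lm Z Y f) \<and>
     (\<forall>X\<in>bounded_complexes \<Lambda>. \<forall>Y\<in>bounded_complexes \<Lambda>.
        \<forall>f\<in>chain_maps \<Lambda> X Y. \<forall>g\<in>chain_maps \<Lambda> X Y.
        Lm X Y f = Lm X Y g \<longleftrightarrow>
        (\<exists>Z\<in>bounded_complexes \<Lambda>. \<exists>s\<in>quasi_isos \<Lambda> Z X.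
           chain_homotopic \<Lambda> Z Y (\<lambda>i. f i * s i) (\<lambda>i. g i * s i)))"

text \<open>\<open>S\<close> is, up to natural isomorphism, the functor induced on \<open>D\<close> by the shift of complexes.\<close>

definition is_shift_functor ::
    "('k::field, 'a) module \<Rightarrow> ('o, 'm::ab_group_add, 'k) lincat \<Rightarrow> (('a, 'k) cplx \<Rightarrow> 'o)
      \<Rightarrow> (('a, 'k) cplx \<Rightarrow> ('a, 'k) cplx \<Rightarrow> (int \<Rightarrow> 'k mat) \<Rightarrow> 'm) \<Rightarrow> ('o, 'm) lfunctor \<Rightarrow> bool" where
  "is_shift_functor \<Lambda> D Lo Lm S \<longleftrightarrow> (\<exists>\<theta>.
     (\<forall>X\<in>bounded_complexes \<Lambda>. iso_mor D (fobj S (Lo X)) (Lo (cplx_shift X)) (\<theta> X)) \<and>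
     (\<forall>X\<in>bounded_complexes \<Lambda>. \<forall>Y\<in>bounded_complexes \<Lambda>. \<forall>f\<in>chain_maps \<Lambda> X Y.
        comp D (\<theta> Y) (fmor S (Lm X Y f)) =
        comp D (Lm (cplx_shift X) (cplx_shift Y) (\<lambda>i. f (i + 1))) (\<theta> X)))"

text \<open>A Serre functor \<open>N\<close>: an isomorphism from \<open>Hom(X, Y)\<close> to the dual space of \<open>Hom(Y, N X)\<close>, natural in
  \<open>X\<close> and \<open>Y\<close>, written as a pairing \<open>B X Y\<close>. (All functors \<open>N\<close> to which this is applied are
  automorphisms.)\<close>

definition is_serre_functor ::
    "('o, 'm::ab_group_add, 'k::field) lincat \<Rightarrow> ('o, 'm) lfunctor \<Rightarrow> bool" where
  "is_serre_functor D N \<longleftrightarrow> (\<exists>B :: 'o \<Rightarrow> 'o \<Rightarrow> 'm \<Rightarrow> 'm \<Rightarrow> 'k.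
     (\<forall>X\<in>obj D. \<forall>Y\<in>obj D.
        (\<forall>c. \<forall>f\<in>hom D X Y. \<forall>f'\<in>hom D X Y. \<forall>g\<in>hom D Y (fobj N X).
           B X Y (scl D c f + f') g = c * B X Y f g + B X Y f' g) \<and>
        (\<forall>c. \<forall>f\<in>hom D X Y. \<forall>g\<in>hom D Y (fobj N X). \<forall>g'\<in>hom D Y (fobj N X).
           B X Y f (scl D c g + g') = c * B X Y f g + B X Y f g') \<and>
        (\<forall>\<phi>. (\<forall>c. \<forall>g\<in>hom D Y (fobj N X). \<forall>g'\<in>hom D Y (fobj N X).
                 \<phi> (scl D c g + g') = c * \<phi> g + \<phi> g') \<longrightarrow>
             (\<exists>!f. f \<in> hom D X Y \<and> (\<forall>g\<in>hom D Y (fobj N X). B X Y f g = \<phi> g)))) \<and>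
     (\<forall>X'\<in>obj D. \<forall>X\<in>obj D. \<forall>Y\<in>obj D.
        \<forall>u\<in>hom D X' X. \<forall>f\<in>hom D X Y. \<forall>g\<in>hom D Y (fobj N X').
        B X' Y (comp D f u) g = B X Y f (comp D (fmor N u) g)) \<and>
     (\<forall>X\<in>obj D. \<forall>Y\<in>obj D. \<forall>Y'\<in>obj D.
        \<forall>v\<in>hom D Y Y'. \<forall>f\<in>hom D X Y. \<forall>g\<in>hom D Y' (fobj N X).
        B X Y' (comp D v f) g = B X Y f (comp D g v)))"

text \<open>The orbit category \<open>D / F\<close>, where \<open>G\<close> is the inverse of \<open>F\<close>: a morphism from \<open>X\<close> to \<open>Y\<close> is an element
  \<open>(f\<^sub>i)\<close> of the direct sum of the spaces \<open>Hom(X, F\<^sup>i Y)\<close>, and \<open>g\<^sub>j\<close> after \<open>f\<^sub>i\<close> is \<open>F\<^sup>i(g\<^sub>j) \<circ> f\<^sub>i\<close>.\<close>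

definition orbit_category ::
    "('o, 'm::ab_group_add, 'k) lincat \<Rightarrow> ('o, 'm) lfunctor \<Rightarrow> ('o, 'm) lfunctor
      \<Rightarrow> ('o, int \<Rightarrow> 'm, 'k) lincat" where
  "orbit_category D F G = \<lparr>
     obj = obj D,
     hom = (\<lambda>X Y. {f. finite {i. f i \<noteq> 0} \<and> (\<forall>i. f i \<in> hom D X (fobj (fpow F G i) Y))}),
     comp = (\<lambda>g f l. \<Sum>i\<in>{i. f i \<noteq> 0}. comp D (fmor (fpow F G i) (g (l - i))) (f i)),
     ident = (\<lambda>X i. if i = 0 then ident D X else 0),
     scl = (\<lambda>c f i. scl D c (f i))\<rparr>"

text \<open>The cluster category is the orbit category of \<open>F = \<tau>\<^sup>-\<^sup>1[1]\<close>, with inverse \<open>[-1]\<tau>\<close>.\<close>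

definition cluster_category ::
    "('o, 'm::ab_group_add, 'k) lincat \<Rightarrow> ('o, 'm) lfunctor \<Rightarrow> ('o, 'm) lfunctor
      \<Rightarrow> ('o, 'm) lfunctor \<Rightarrow> ('o, 'm) lfunctor \<Rightarrow> ('o, int \<Rightarrow> 'm, 'k) lincat" where
  "cluster_category D shift shift_inv \<tau> \<tau>_inv =
     orbit_category D (functor_comp \<tau>_inv shift) (functor_comp shift_inv \<tau>)"


section \<open>Auslander--Reiten quivers\<close>

definition zero_object :: "('o, 'm::zero, 'k) lincat \<Rightarrow> 'o \<Rightarrow> bool" where
  "zero_object C X \<longleftrightarrow> ident C X = 0"

definition is_biproduct :: "('o, 'm::ab_group_add, 'k) lincat \<Rightarrow> 'o \<Rightarrow> 'o \<Rightarrow> 'o \<Rightarrow> bool" where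
  "is_biproduct C X A B \<longleftrightarrow>
     (\<exists>i\<in>hom C A X. \<exists>j\<in>hom C B X. \<exists>p\<in>hom C X A. \<exists>q\<in>hom C X B.
        comp C p i = ident C A \<and> comp C q j = ident C B \<and>
        comp C p j = 0 \<and> comp C q i = 0 \<and>
        comp C i p + comp C j q = ident C X)"

definition indecomposable :: "('o, 'm::ab_group_add, 'k) lincat \<Rightarrow> 'o \<Rightarrow> bool" where
  "indecomposable C X \<longleftrightarrow> X \<in> obj C \<and> \<not> zero_object C X \<and>
     (\<forall>A\<in>obj C. \<forall>B\<in>obj C. is_biproduct C X A B \<longrightarrow> zero_object C A \<or> zero_object C B)"

definition radical :: "('o, 'm::ab_group_add, 'k) lincat \<Rightarrow> 'o \<Rightarrow> 'o \<Rightarrow> 'm set" where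
  "radical C X Y =
     {f \<in> hom C X Y. \<forall>g\<in>hom C Y X. iso_mor C X X (ident C X - comp C g f)}"

definition radical_sq ::
    "('o, 'm::ab_group_add, 'k::field) lincat \<Rightarrow> 'o \<Rightarrow> 'o \<Rightarrow> 'm set" where
  "radical_sq C X Y = module.span (scl C)
     {comp C g f | f g Z. Z \<in> obj C \<and> f \<in> radical C X Z \<and> g \<in> radical C Z Y}"

definition irr_dim :: "('o, 'm::ab_group_add, 'k::field) lincat \<Rightarrow> 'o \<Rightarrow> 'o \<Rightarrow> nat" where
  "irr_dim C X Y =
     vector_space.dim (scl C) (radical C X Y) - vector_space.dim (scl C) (radical_sq C X Y)"

text \<open>The vertices are the isomorphism classes of indecomposable objects, the number of arrows is the
  dimension of the space of irreducible maps (the field is algebraically closed), and the translation is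
  induced by \<open>\<tau>\<close>.\<close>

definition AR_quiver ::
    "('o, 'm::ab_group_add, 'k::field) lincat \<Rightarrow> ('o, 'm') lfunctor \<Rightarrow> 'o set tquiver" where
  "AR_quiver C \<tau> = \<lparr>
     verts = {iso_class C X | X. indecomposable C X},
     arr = (\<lambda>U V. irr_dim C (SOME X. X \<in> U) (SOME Y. Y \<in> V)),
     trans = (\<lambda>U. \<Union>X\<in>U. iso_class C (fobj \<tau> X))\<rparr>"

end

theory Submission
  imports Defs
begin

text \<open>Both components of the quiver of interior arcs are explicit copies of \<open>\<int>A\<^sub>\<infinity>\<close> modulo the square of the
  translation, so they match the tubes as soon as \<open>\<tau>\<close> maps each tube to itself. An isomorphism of translation
  quivers, as defined, says nothing about translates outside the vertex set, so this has to come from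
  Auslander--Reiten theory: an arrow \<open>Y \<rightarrow> X\<close> has to produce an arrow \<open>\<tau> X \<rightarrow> Y\<close> in the cluster category.

  Serre duality makes all morphism spaces of the derived category finite-dimensional and provides almost split
  triangles \<open>\<tau> X \<rightarrow> M \<rightarrow> X\<close>, once indecomposable objects have local endomorphism rings. The latter follows from the
  truncation triangles and the vanishing of \<open>Ext\<^sup>2\<close>: indecomposables live in a single degree, where idempotents
  split. The vanishing holds because a representation of a quiver may prescribe the action of the arrows freely.
  A morphism in the radical of the orbit category has no split component, so the almost split
  triangles of the derived category keep their factorization property in the cluster category.\<close>

section \<open>Isomorphisms of translation quivers\<close>

text \<open>The derived category is given by localization axioms alone: there is no triangulated
  structure, and nothing relates the shift to the translation except Serre duality. A triangle
  therefore means a sequence on which covariant Hom is exact. The contravariant half, needed for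
  left almost split maps, is recovered by dualizing with the Serre pairing, which rests on
  finite-dimensional Hom-spaces. That shift and translation commute on objects follows from
  uniqueness of the object representing a dual.

  Degrees carry the passage to the cluster category. The functor \<open>F\<close> lowers
  cohomological degree by at least one, so an indecomposable object has endomorphisms only in orbit
  degrees 0 and 1, and a product of two of degree 1 vanishes. Hence units, and with them the
  radical, are visible in degree 0.

  The middle term of the almost split triangle is never decomposed and arrow multiplicities are
  never compared: adjacency is all that a component sees, so a nonzero number of arrows
  suffices.\<close>

lemma tq_iso_trans:
  assumes "tq_iso Q R" "tq_iso R P"
  shows "tq_iso Q P"
proof -
  obtain \<phi> where \<phi>: "bij_betw \<phi> (verts Q) (verts R)"
    "\<forall>x\<in>verts Q. \<forall>y\<in>verts Q. arr R (\<phi> x) (\<phi> y) = arr Q x y"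
    "\<forall>x\<in>verts Q. \<phi> (trans Q x) = trans R (\<phi> x)"
    using assms(1) unfolding tq_iso_def by blast
  obtain \<psi> where \<psi>: "bij_betw \<psi> (verts R) (verts P)"
    "\<forall>x\<in>verts R. \<forall>y\<in>verts R. arr P (\<psi> x) (\<psi> y) = arr R x y"
    "\<forall>x\<in>verts R. \<psi> (trans R x) = trans P (\<psi> x)"
    using assms(2) unfolding tq_iso_def by blast
  have "\<phi> x \<in> verts R" if "x \<in> verts Q" for x
    using \<phi>(1) that by (rule bij_betwE[rule_format])
  then show ?thesis
    unfolding tq_iso_def using \<phi> \<psi> bij_betw_trans[OF \<phi>(1) \<psi>(1)]
    by (intro exI[of _ "\<psi> \<circ> \<phi>"]) simp
qed

text \<open>The closure hypothesis is not automatic: an isomorphism in the sense of \<^const>\<open>tq_iso\<close> may send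
  a translate lying outside the vertex set anywhere.\<close>

lemma tq_iso_sym:
  assumes "tq_iso Q R" "\<And>x. x \<in> verts Q \<Longrightarrow> trans Q x \<in> verts Q"
  shows "tq_iso R Q"
proof -
  obtain \<phi> where \<phi>: "bij_betw \<phi> (verts Q) (verts R)"
    "\<forall>x\<in>verts Q. \<forall>y\<in>verts Q. arr R (\<phi> x) (\<phi> y) = arr Q x y"
    "\<forall>x\<in>verts Q. \<phi> (trans Q x) = trans R (\<phi> x)"
    using assms(1) unfolding tq_iso_def by blast
  let ?\<psi> = "inv_into (verts Q) \<phi>"
  have bij: "bij_betw ?\<psi> (verts R) (verts Q)" using \<phi>(1) by (rule bij_betw_inv_into)
  have V: "?\<psi> y \<in> verts Q" "\<phi> (?\<psi> y) = y" if "y \<in> verts R" for y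
    using bij_betwE[OF bij] that bij_betw_inv_into_right[OF \<phi>(1)] by auto
  have "?\<psi> (trans R y) = trans Q (?\<psi> y)" if "y \<in> verts R" for y
  proof -
    have "trans R y = \<phi> (trans Q (?\<psi> y))" using \<phi>(3) V[OF that] by simp
    then show ?thesis
      using bij_betw_inv_into_left[OF \<phi>(1)] assms(2) V(1)[OF that] by simp
  qed
  moreover have "arr Q (?\<psi> x) (?\<psi> y) = arr R x y" if "x \<in> verts R" "y \<in> verts R" for x y
    using \<phi>(2) V[OF that(1)] V[OF that(2)] by metis
  ultimately show ?thesis
    unfolding tq_iso_def using bij by (intro exI[of _ ?\<psi>]) simp
qed

lemma tq_iso_sum:
  assumes "tq_iso Q Q'" "tq_iso R R'"
  shows "tq_iso (tq_sum Q R) (tq_sum Q' R')"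
proof -
  obtain \<phi> where \<phi>: "bij_betw \<phi> (verts Q) (verts Q')"
    "\<forall>x\<in>verts Q. \<forall>y\<in>verts Q. arr Q' (\<phi> x) (\<phi> y) = arr Q x y"
    "\<forall>x\<in>verts Q. \<phi> (trans Q x) = trans Q' (\<phi> x)"
    using assms(1) unfolding tq_iso_def by blast
  obtain \<psi> where \<psi>: "bij_betw \<psi> (verts R) (verts R')"
    "\<forall>x\<in>verts R. \<forall>y\<in>verts R. arr R' (\<psi> x) (\<psi> y) = arr R x y"
    "\<forall>x\<in>verts R. \<psi> (trans R x) = trans R' (\<psi> x)"
    using assms(2) unfolding tq_iso_def by blast
  have "bij_betw (map_sum \<phi> \<psi>) (verts Q <+> verts R) (verts Q' <+> verts R')"
  proof (rule bij_betw_imageI)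
    show "inj_on (map_sum \<phi> \<psi>) (verts Q <+> verts R)"
      using bij_betw_imp_inj_on[OF \<phi>(1)] bij_betw_imp_inj_on[OF \<psi>(1)]
      by (intro inj_onI) (auto dest: inj_onD)
    have "map_sum \<phi> \<psi> ` (verts Q <+> verts R) = \<phi> ` verts Q <+> \<psi> ` verts R"
      by (auto simp: Plus_def image_Un image_comp comp_def)
    then show "map_sum \<phi> \<psi> ` (verts Q <+> verts R) = verts Q' <+> verts R'"
      using bij_betw_imp_surj_on[OF \<phi>(1)] bij_betw_imp_surj_on[OF \<psi>(1)] by simp
  qed
  then show ?thesis
    unfolding tq_iso_def using \<phi>(2,3) \<psi>(2,3)
    by (intro exI[of _ "map_sum \<phi> \<psi>"]) (auto simp: tq_sum_def)
qed

lemma tq_iso_sum_restrict: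
  assumes "verts Q = V \<union> W" "V \<inter> W = {}"
    and "\<And>x. x \<in> V \<Longrightarrow> trans Q x \<in> V" "\<And>x. x \<in> W \<Longrightarrow> trans Q x \<in> W"
    and "\<And>x y. x \<in> V \<Longrightarrow> y \<in> W \<Longrightarrow> arr Q x y = 0" "\<And>x y. x \<in> W \<Longrightarrow> y \<in> V \<Longrightarrow> arr Q x y = 0"
  shows "tq_iso Q (tq_sum (tq_restrict Q V) (tq_restrict Q W))"
proof -
  let ?\<phi> = "\<lambda>x. if x \<in> V then Inl x else Inr x"
  have "bij_betw ?\<phi> (V \<union> W) (V <+> W)"
    using assms(2) unfolding bij_betw_def inj_on_def by (auto simp: image_def Plus_def)
  moreover have "trans Q x \<notin> V" if "x \<in> W" for x using assms(2,4) that by blast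
  ultimately show ?thesis
    unfolding tq_iso_def using assms
    by (intro exI[of _ ?\<phi>]) (auto simp: tq_sum_def tq_restrict_def)
qed

section \<open>The rank-two tube and the interior arcs\<close>

text \<open>A fundamental domain for the rank-two quotient: the Boolean is the parity of the first
  coordinate of \<open>ZA_inf\<close>, with \<open>True\<close> for odd. Ascending arrows keep that
  coordinate and descending ones raise it by one, hence the flip.\<close>

definition double_tube :: "(bool \<times> nat) tquiver" where
  "double_tube = \<lparr>
     verts = UNIV,
     arr = (\<lambda>(s, j) (s', j'). if (s' = s \<and> j' = j + 1) \<or> (s' \<noteq> s \<and> j = j' + 1) then 1 else 0),
     trans = (\<lambda>(s, j). (\<not> s, j))\<rparr>"

lemma cyclic_orbit_ZA_inf:
  "cyclic_orbit (trans ZA_inf ^^ 2) (i, j) = {(i', j'). j' = j \<and> even (i' - i)}"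
proof -
  have pw: "((trans ZA_inf ^^ 2) ^^ m) (i, j) = (i - 2 * int m, j)" for m i j
    by (induct m) (auto simp: ZA_inf_def numeral_2_eq_2)
  show ?thesis
  proof (intro Set.set_eqI iffI)
    fix p assume "p \<in> cyclic_orbit (trans ZA_inf ^^ 2) (i, j)"
    then show "p \<in> {(i', j'). j' = j \<and> even (i' - i)}"
      by (cases p) (auto simp: cyclic_orbit_def pw)
  next
    fix p assume "p \<in> {(i', j'). j' = j \<and> even (i' - i)}"
    then obtain i' where i': "p = (i', j)" "even (i' - i)" by auto
    from i'(2) obtain k where "i' - i = 2 * k" by (rule evenE)
    note p = i'(1) this
    \<comment> \<open>\<open>cyclic_orbit\<close> uses nonnegative powers in both directions; the
      sign of \<open>k\<close> decides which disjunct holds.\<close>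
    have "p = (i - 2 * int (nat (- k)), j) \<or> (i, j) = (i' - 2 * int (nat k), j)"
      using p by auto
    then show "p \<in> cyclic_orbit (trans ZA_inf ^^ 2) (i, j)"
      unfolding cyclic_orbit_def using p(1) pw by (metis (mono_tags, lifting) mem_Collect_eq)
  qed
qed

lemma tq_iso_double_tube_quotient:
  "tq_iso double_tube (tq_quotient ZA_inf (trans ZA_inf ^^ 2))"
proof -
  let ?g = "trans ZA_inf ^^ 2"
  let ?Q = "tq_quotient ZA_inf ?g"
  define \<phi> where "\<phi> p = cyclic_orbit ?g (of_bool (fst p), snd p)" for p :: "bool \<times> nat"
  have \<phi>: "\<phi> (s, j) = {(i', j'). j' = j \<and> even (i' - of_bool s)}" for s j
    by (simp add: \<phi>_def cyclic_orbit_ZA_inf)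
  have mem: "(i, j) \<in> \<phi> (odd i, j)" for i j by (auto simp: \<phi>)
  have "inj \<phi>"
  proof (rule injI)
    fix p q assume eq: "\<phi> p = \<phi> q"
    have "(of_bool (fst p), snd p) \<in> \<phi> p" by (cases p) (simp add: \<phi>)
    then show "p = q" unfolding eq by (cases p; cases q) (auto simp: \<phi> split: if_splits)
  qed
  moreover have "verts ?Q = range \<phi>"
  proof (intro Set.set_eqI iffI)
    fix U assume "U \<in> verts ?Q"
    then obtain i j where "U = cyclic_orbit ?g (i, j)" by (auto simp: tq_quotient_def)
    then have "U = \<phi> (odd i, j)" by (auto simp: \<phi> cyclic_orbit_ZA_inf)
    then show "U \<in> range \<phi>" by simp
  qed (auto simp: tq_quotient_def \<phi>_def ZA_inf_def)
  ultimately have "bij_betw \<phi> (verts double_tube) (verts ?Q)"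
    by (simp add: double_tube_def bij_betw_def)
  moreover have "\<phi> (trans double_tube p) = trans ?Q (\<phi> p)" for p
  proof -
    obtain s j where p: "p = (s, j)" by (cases p)
    have "(i', j') \<in> (\<lambda>(i, j). (i - 1, j)) ` X \<longleftrightarrow> (i' + 1, j') \<in> X" for i' j' and X :: "(int \<times> nat) set"
      by force
    then show ?thesis
      by (auto simp: p double_tube_def tq_quotient_def \<phi> ZA_inf_def)
  qed
  moreover have "arr ?Q (\<phi> p) (\<phi> q) = arr double_tube p q" for p q
  proof -
    obtain s j s' j' where pq: "p = (s, j)" "q = (s', j')" by (cases p, cases q)
    define x where "x = (SOME x. x \<in> \<phi> p)"
    have "x \<in> \<phi> p" unfolding x_def by (rule someI[of _ "(of_bool s, j)"]) (simp add: pq \<phi>)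
    then obtain i where x: "x = (i, j)" "even (i - of_bool s)" by (auto simp: pq \<phi>)
    \<comment> \<open>The first coordinate of the vertex picked by \<open>SOME\<close> is known only
      modulo 2, but any such vertex has at most one arrow into a given orbit, so the sum defining
      \<open>arr\<close> has at most one term.\<close>
    have set: "{y \<in> \<phi> q. arr ZA_inf x y \<noteq> 0} =
       (if s' = s \<and> j' = j + 1 then {(i, j')} else if s' \<noteq> s \<and> j = j' + 1 then {(i + 1, j')} else {})"
      using x by (auto simp: pq \<phi> ZA_inf_def split: if_splits)
    show ?thesis
      using x unfolding tq_quotient_def tquiver.simps x_def[symmetric] set
      by (auto simp: double_tube_def pq ZA_inf_def)
  qed
  ultimately show ?thesis unfolding tq_iso_def by (intro exI[of _ \<phi>]) simp
qed

text \<open>With a first end of norm 0 the normal form asks for equal tags at odd distance and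
  different tags at even distance. The distance is \<open>j + 1\<close>, so the second tag depends
  on the parity of \<open>j\<close>.\<close>

lemma bij_arcs0:
  "bij_betw (\<lambda>(s, j). ((if s then Notched else Plain) 0,
     (if s = even j then Notched else Plain) (int j + 1))) UNIV Gamma0"
  (is "bij_betw ?f _ _")
proof (rule bij_betw_byWitness[where f' = "\<lambda>(x, y). (notched x, nat (tnorm y - 1))"])
  show "\<forall>a\<in>UNIV. (case ?f a of (x, y) \<Rightarrow> (notched x, nat (tnorm y - 1))) = a" by auto
  show "\<forall>a'\<in>Gamma0. ?f (case a' of (x, y) \<Rightarrow> (notched x, nat (tnorm y - 1))) = a'"
  proof
    fix a assume "a \<in> Gamma0"
    then show "?f (case a of (x, y) \<Rightarrow> (notched x, nat (tnorm y - 1))) = a"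
      by (cases a; cases "fst a"; cases "snd a")
        (auto simp: Gamma0_def interior_arcs_def even_nat_iff)
  qed
  show "range ?f \<subseteq> Gamma0" by (auto simp: Gamma0_def interior_arcs_def split: if_splits)
  show "(\<lambda>(x, y). (notched x, nat (tnorm y - 1))) ` Gamma0 \<subseteq> UNIV" by simp
qed

text \<open>With a first end of norm 1 both parities of the distance force different tags, so the
  parity of \<open>j\<close> does not enter; the least norm of the second end is now 2.\<close>

lemma bij_arcs1:
  "bij_betw (\<lambda>(s, j). ((if s then Notched else Plain) 1,
     (if s then Plain else Notched) (int j + 2))) UNIV Gamma1"
  (is "bij_betw ?f _ _")
proof (rule bij_betw_byWitness[where f' = "\<lambda>(x, y). (notched x, nat (tnorm y - 2))"])
  show "\<forall>a\<in>UNIV. (case ?f a of (x, y) \<Rightarrow> (notched x, nat (tnorm y - 2))) = a" by auto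
  show "\<forall>a'\<in>Gamma1. ?f (case a' of (x, y) \<Rightarrow> (notched x, nat (tnorm y - 2))) = a'"
  proof
    fix a assume "a \<in> Gamma1"
    then show "?f (case a of (x, y) \<Rightarrow> (notched x, nat (tnorm y - 2))) = a"
      by (cases a; cases "fst a"; cases "snd a")
        (auto simp: Gamma1_def interior_arcs_def)
  qed
  show "range ?f \<subseteq> Gamma1" by (auto simp: Gamma1_def interior_arcs_def split: if_splits)
  show "(\<lambda>(x, y). (notched x, nat (tnorm y - 2))) ` Gamma1 \<subseteq> UNIV" by simp
qed

lemma tq_iso_double_tube_Gamma0: "tq_iso double_tube (tq_restrict Gamma Gamma0)"
  unfolding tq_iso_def
proof (intro exI conjI ballI)
  let ?f = "\<lambda>(s, j). ((if s then Notched else Plain) 0, (if s = even j then Notched else Plain) (int j + 1))"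
  show "bij_betw ?f (verts double_tube) (verts (tq_restrict Gamma Gamma0))"
    using bij_arcs0 by (simp add: double_tube_def tq_restrict_def)
  fix p :: "bool \<times> nat"
  show "?f (trans double_tube p) = trans (tq_restrict Gamma Gamma0) (?f p)"
    by (cases p) (auto simp: double_tube_def tq_restrict_def Gamma_def)
  fix q :: "bool \<times> nat"
  have "arc_arrow (?f p) (?f q) \<longleftrightarrow> arr double_tube p q = 1"
    unfolding arc_arrow_def
    by (cases p; cases q; cases "fst p"; cases "fst q") (auto simp: double_tube_def interior_arcs_def)
  moreover have "arr double_tube p q = 0 \<or> arr double_tube p q = 1"
    by (cases p; cases q) (simp add: double_tube_def)
  ultimately show "arr (tq_restrict Gamma Gamma0) (?f p) (?f q) = arr double_tube p q"
    by (auto simp: tq_restrict_def Gamma_def)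
qed

lemma tq_iso_double_tube_Gamma1: "tq_iso double_tube (tq_restrict Gamma Gamma1)"
  unfolding tq_iso_def
proof (intro exI conjI ballI)
  let ?f = "\<lambda>(s, j). ((if s then Notched else Plain) 1, (if s then Plain else Notched) (int j + 2))"
  show "bij_betw ?f (verts double_tube) (verts (tq_restrict Gamma Gamma1))"
    using bij_arcs1 by (simp add: double_tube_def tq_restrict_def)
  fix p :: "bool \<times> nat"
  show "?f (trans double_tube p) = trans (tq_restrict Gamma Gamma1) (?f p)"
    by (cases p) (auto simp: double_tube_def tq_restrict_def Gamma_def)
  fix q :: "bool \<times> nat"
  have "arc_arrow (?f p) (?f q) \<longleftrightarrow> arr double_tube p q = 1"
    unfolding arc_arrow_def
    by (cases p; cases q; cases "fst p"; cases "fst q") (auto simp: double_tube_def interior_arcs_def)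
  moreover have "arr double_tube p q = 0 \<or> arr double_tube p q = 1"
    by (cases p; cases q) (simp add: double_tube_def)
  ultimately show "arr (tq_restrict Gamma Gamma1) (?f p) (?f q) = arr double_tube p q"
    by (auto simp: tq_restrict_def Gamma_def)
qed

section \<open>Connected components of the arc quiver\<close>

lemma tq_adj_sym: "tq_adj Q x y \<Longrightarrow> tq_adj Q y x"
  by (auto simp: tq_adj_def)

text \<open>Ascending arrows join each copy to its vertex at level 0, and the descending arrow from
  \<open>(s, 1)\<close> to level 0 of the other copy links the two copies.\<close>

lemma double_tube_connected: "(tq_adj double_tube)\<^sup>*\<^sup>* p q"
proof -
  have sym: "(tq_adj double_tube)\<^sup>*\<^sup>* b a" if "(tq_adj double_tube)\<^sup>*\<^sup>* a b" for a b
    using that by (induct rule: rtranclp_induct) (auto intro: converse_rtranclp_into_rtranclp tq_adj_sym)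
  have up: "(tq_adj double_tube)\<^sup>*\<^sup>* (s, 0) (s, j)" for s j
  proof (induct j)
    case (Suc j)
    have "tq_adj double_tube (s, j) (s, Suc j)" by (auto simp: tq_adj_def double_tube_def)
    with Suc show ?case by (rule rtranclp.rtrancl_into_rtrancl)
  qed simp
  have "tq_adj double_tube (s, 1) (\<not> s, 0)" for s by (auto simp: tq_adj_def double_tube_def)
  then have flip: "(tq_adj double_tube)\<^sup>*\<^sup>* (s, 0) (\<not> s, 0)" for s
    using up[of s 1] by (meson rtranclp.rtrancl_into_rtrancl)
  have "(tq_adj double_tube)\<^sup>*\<^sup>* (True, 0) (s, 0)" for s using flip[of True] by (cases s) auto
  then have "(tq_adj double_tube)\<^sup>*\<^sup>* (True, 0) p" for p
    using up by (cases p) (meson rtranclp_trans)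
  then show ?thesis using sym by (meson rtranclp_trans)
qed

lemma tq_iso_rtranclp_adj:
  assumes "tq_iso Q (tq_restrict R V)" "V \<subseteq> verts R" "\<And>p q. (tq_adj Q)\<^sup>*\<^sup>* p q"
    and "verts Q = UNIV" "x \<in> V" "y \<in> V"
  shows "(tq_adj R)\<^sup>*\<^sup>* x y"
proof -
  obtain \<phi> where \<phi>: "bij_betw \<phi> UNIV V" "\<forall>x y. arr R (\<phi> x) (\<phi> y) = arr Q x y"
    using assms(1,4) unfolding tq_iso_def tq_restrict_def by auto
  have "(tq_adj R)\<^sup>*\<^sup>* (\<phi> p) (\<phi> q)" for p q
    using assms(3)[of p q]
  proof (induct rule: rtranclp_induct)
    case (step b c)
    have "tq_adj R (\<phi> b) (\<phi> c)"
      using step(2) \<phi> assms(2) unfolding tq_adj_def by (auto simp: bij_betw_def)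
    with step(3) show ?case by (rule rtranclp.rtrancl_into_rtrancl)
  qed simp
  then show ?thesis using \<phi>(1) assms(5,6) by (auto simp: bij_betw_def)
qed

lemma Gamma_split:
  "verts Gamma = Gamma0 \<union> Gamma1" "Gamma0 \<inter> Gamma1 = {}"
  "x \<in> Gamma0 \<Longrightarrow> trans Gamma x \<in> Gamma0" "x \<in> Gamma1 \<Longrightarrow> trans Gamma x \<in> Gamma1"
  "v \<in> Gamma0 \<Longrightarrow> w \<in> Gamma1 \<Longrightarrow> arr Gamma v w = 0" "v \<in> Gamma1 \<Longrightarrow> w \<in> Gamma0 \<Longrightarrow> arr Gamma v w = 0"
proof -
  have [simp]: "tnorm (tstar x) = tnorm x" "notched (tstar x) = (\<not> notched x)" for x by (cases x; simp)+
  show "verts Gamma = Gamma0 \<union> Gamma1" "Gamma0 \<inter> Gamma1 = {}"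
    by (auto simp: Gamma_def Gamma0_def Gamma1_def interior_arcs_def)
  show "trans Gamma x \<in> Gamma0" if "x \<in> Gamma0"
    using that by (cases x; cases "fst x"; cases "snd x") (auto simp: Gamma_def Gamma0_def interior_arcs_def)
  show "trans Gamma x \<in> Gamma1" if "x \<in> Gamma1"
    using that by (cases x; cases "fst x"; cases "snd x") (auto simp: Gamma_def Gamma1_def interior_arcs_def)
  show "v \<in> Gamma0 \<Longrightarrow> w \<in> Gamma1 \<Longrightarrow> arr Gamma v w = 0" "v \<in> Gamma1 \<Longrightarrow> w \<in> Gamma0 \<Longrightarrow> arr Gamma v w = 0"
    by (auto simp: Gamma_def Gamma0_def Gamma1_def arc_arrow_def)
qed

lemma tq_components_Gamma: "tq_components Gamma = {Gamma0, Gamma1}" "Gamma0 \<noteq> Gamma1"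
proof -
  have con0: "(tq_adj Gamma)\<^sup>*\<^sup>* x y" if "x \<in> Gamma0" "y \<in> Gamma0" for x y
    by (rule tq_iso_rtranclp_adj[OF tq_iso_double_tube_Gamma0 _ double_tube_connected _ that])
      (auto simp: Gamma_split(1) double_tube_def)
  have con1: "(tq_adj Gamma)\<^sup>*\<^sup>* x y" if "x \<in> Gamma1" "y \<in> Gamma1" for x y
    by (rule tq_iso_rtranclp_adj[OF tq_iso_double_tube_Gamma1 _ double_tube_connected _ that])
      (auto simp: Gamma_split(1) double_tube_def)
  have cl: "(y \<in> Gamma0) = (x \<in> Gamma0) \<and> (y \<in> Gamma1) = (x \<in> Gamma1)" if "(tq_adj Gamma)\<^sup>*\<^sup>* x y" for x y
    using that
  proof (induct rule: rtranclp_induct)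
    case (step b c)
    then have "b \<in> Gamma0 \<union> Gamma1" "c \<in> Gamma0 \<union> Gamma1" "arr Gamma b c \<noteq> 0 \<or> arr Gamma c b \<noteq> 0"
      by (auto simp: tq_adj_def Gamma_split(1))
    then show ?case using step(3) Gamma_split(2,5,6) by (metis Int_iff Un_iff empty_iff)
  qed simp
  have c0: "{y. (tq_adj Gamma)\<^sup>*\<^sup>* x y} = Gamma0" if "x \<in> Gamma0" for x
    using con0[OF that] cl[of x] that by blast
  have c1: "{y. (tq_adj Gamma)\<^sup>*\<^sup>* x y} = Gamma1" if "x \<in> Gamma1" for x
    using con1[OF that] cl[of x] that by blast
  have ne: "(Plain 0, Plain 1) \<in> Gamma0" "(Plain 1, Notched 2) \<in> Gamma1"
    by (auto simp: Gamma0_def Gamma1_def interior_arcs_def)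
  show "Gamma0 \<noteq> Gamma1" using ne Gamma_split(2) by blast
  show "tq_components Gamma = {Gamma0, Gamma1}"
  proof (intro Set.set_eqI iffI)
    fix K assume "K \<in> tq_components Gamma"
    then obtain x where x: "x \<in> Gamma0 \<union> Gamma1" "K = {y. (tq_adj Gamma)\<^sup>*\<^sup>* x y}"
      unfolding tq_components_def Gamma_split(1) by blast
    then show "K \<in> {Gamma0, Gamma1}" using c0[of x] c1[of x] by auto
  next
    fix K assume "K \<in> {Gamma0, Gamma1}"
    then show "K \<in> tq_components Gamma"
      unfolding tq_components_def Gamma_split(1) using c0[OF ne(1)] c1[OF ne(2)] ne by blast
  qed
qed

text \<open>Both sides are compared with \<open>double_tube\<close>. The given isomorphisms point
  from the tubes to the quotient and have to be reversed, which is where closure under translation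
  enters.\<close>

lemma tq_iso_Gamma_tubes:
  assumes "is_stable_tube 2 T" "\<And>x. x \<in> verts T \<Longrightarrow> trans T x \<in> verts T"
    and "is_stable_tube 2 T'" "\<And>x. x \<in> verts T' \<Longrightarrow> trans T' x \<in> verts T'"
  shows "tq_iso Gamma (tq_sum T T')"
proof -
  have dt: "tq_iso double_tube R"
    if "is_stable_tube 2 R" "\<And>x. x \<in> verts R \<Longrightarrow> trans R x \<in> verts R" for R :: "'x tquiver"
    using that tq_iso_trans[OF tq_iso_double_tube_quotient tq_iso_sym] by (auto simp: is_stable_tube_def)
  have "tq_iso (tq_restrict Gamma Gamma0) T" 
    by (rule tq_iso_trans[OF tq_iso_sym[OF tq_iso_double_tube_Gamma0] dt[OF assms(1,2)]])
      (simp_all add: double_tube_def)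
  moreover have "tq_iso (tq_restrict Gamma Gamma1) T'" 
    by (rule tq_iso_trans[OF tq_iso_sym[OF tq_iso_double_tube_Gamma1] dt[OF assms(3,4)]])
      (simp_all add: double_tube_def)
  moreover have "tq_iso Gamma (tq_sum (tq_restrict Gamma Gamma0) (tq_restrict Gamma Gamma1))"
    by (rule tq_iso_sum_restrict) (use Gamma_split in auto)
  ultimately show ?thesis using tq_iso_trans[OF _ tq_iso_sum] by blast
qed

text \<open>Provides the arrow from which \<open>AR_component_trans\<close> deduces that the
  translate stays in the component. The descending arrow from level \<open>j + 1\<close> exists even
  at the mouth of the tube, where no ascending arrow arrives.\<close>

lemma tube_predecessor:
  assumes "is_stable_tube 2 T" "x \<in> verts T"
  shows "\<exists>y\<in>verts T. arr T y x \<noteq> 0"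
proof -
  let ?Q = "tq_quotient ZA_inf (trans ZA_inf ^^ 2)"
  have "tq_iso ?Q double_tube"
    by (rule tq_iso_sym[OF tq_iso_double_tube_quotient]) (simp add: double_tube_def)
  then have "tq_iso T double_tube" using assms(1) tq_iso_trans by (auto simp: is_stable_tube_def)
  then obtain \<phi> where \<phi>: "bij_betw \<phi> (verts T) (verts double_tube)"
    "\<forall>x\<in>verts T. \<forall>y\<in>verts T. arr double_tube (\<phi> x) (\<phi> y) = arr T x y"
    unfolding tq_iso_def by blast
  obtain s j where sj: "\<phi> x = (s, j)" by (cases "\<phi> x")
  have "(\<not> s, j + 1) \<in> \<phi> ` verts T" using \<phi>(1) by (simp add: bij_betw_def double_tube_def)
  then obtain y where y: "y \<in> verts T" "\<phi> y = (\<not> s, j + 1)" by auto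
  then have "arr T y x = arr double_tube (\<not> s, j + 1) (s, j)" using \<phi>(2) assms(2) sj by metis
  then have "arr T y x \<noteq> 0" by (simp add: double_tube_def)
  with y show ?thesis by auto
qed

section \<open>Linear categories\<close>

locale lcat =
  fixes C :: "('o, 'm::ab_group_add, 'k::field) lincat"
  assumes lin: "linear_category C"
begin

abbreviation cmp (infixl "\<cdot>" 70) where "g \<cdot> f \<equiv> comp C g f"
abbreviation idn ("\<iota>") where "\<iota> \<equiv> ident C"

text \<open>An element of \<open>'m\<close> does not determine its ends (0 lies in every Hom-space),
  so typing is carried by a predicate that includes membership of both ends in
  \<open>obj C\<close>.\<close>

definition ar :: "'m \<Rightarrow> 'o \<Rightarrow> 'o \<Rightarrow> bool" where
  "ar f X Y \<longleftrightarrow> X \<in> obj C \<and> Y \<in> obj C \<and> f \<in> hom C X Y"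

lemma arI: "X \<in> obj C \<Longrightarrow> Y \<in> obj C \<Longrightarrow> f \<in> hom C X Y \<Longrightarrow> ar f X Y"
  by (simp add: ar_def)

lemma arD: assumes "ar f X Y" shows "X \<in> obj C" "Y \<in> obj C" "f \<in> hom C X Y"
  using assms by (auto simp: ar_def)

sublocale V: vector_space "scl C"
  using lin by (simp add: linear_category_def)

lemma subspace_hom: "X \<in> obj C \<Longrightarrow> Y \<in> obj C \<Longrightarrow> V.subspace (hom C X Y)"
  using lin by (simp add: linear_category_def)

lemma id_ar: "X \<in> obj C \<Longrightarrow> ar (\<iota> X) X X"
  using lin by (simp add: linear_category_def ar_def)

lemma cmp_ar: "ar f X Y \<Longrightarrow> ar g Y Z \<Longrightarrow> ar (g \<cdot> f) X Z"
  using lin unfolding linear_category_def ar_def by blast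

lemma id_left: "ar f X Y \<Longrightarrow> \<iota> Y \<cdot> f = f" and id_right: "ar f X Y \<Longrightarrow> f \<cdot> \<iota> X = f"
  using lin unfolding linear_category_def ar_def by blast+

lemma assoc: "ar f W X \<Longrightarrow> ar g X Y \<Longrightarrow> ar h Y Z \<Longrightarrow> (h \<cdot> g) \<cdot> f = h \<cdot> (g \<cdot> f)"
  using lin unfolding linear_category_def ar_def by metis

lemma zero_ar: "X \<in> obj C \<Longrightarrow> Y \<in> obj C \<Longrightarrow> ar 0 X Y"
  using V.subspace_0[OF subspace_hom] by (simp add: ar_def)

lemma add_ar: "ar f X Y \<Longrightarrow> ar g X Y \<Longrightarrow> ar (f + g) X Y"
  using V.subspace_add[OF subspace_hom] by (auto simp: ar_def)

lemma scl_ar: "ar f X Y \<Longrightarrow> ar (scl C c f) X Y"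
  using V.subspace_scale[OF subspace_hom] by (auto simp: ar_def)

lemma neg_ar: "ar f X Y \<Longrightarrow> ar (- f) X Y"
  using V.subspace_neg[OF subspace_hom] by (auto simp: ar_def)

lemma diff_ar: "ar f X Y \<Longrightarrow> ar g X Y \<Longrightarrow> ar (f - g) X Y"
  using V.subspace_diff[OF subspace_hom] by (auto simp: ar_def)

lemma sum_ar: "X \<in> obj C \<Longrightarrow> Y \<in> obj C \<Longrightarrow> (\<And>i. i \<in> I \<Longrightarrow> ar (f i) X Y) \<Longrightarrow> ar (\<Sum>i\<in>I. f i) X Y"
  using V.subspace_sum[OF subspace_hom, of X Y I f] by (auto simp: ar_def)

lemma cmp_lin_right:
  "ar f X Y \<Longrightarrow> ar f' X Y \<Longrightarrow> ar g Y Z \<Longrightarrow> g \<cdot> (scl C c f + f') = scl C c (g \<cdot> f) + g \<cdot> f'"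
  using lin unfolding linear_category_def ar_def by blast

lemma cmp_lin_left:
  "ar f X Y \<Longrightarrow> ar g Y Z \<Longrightarrow> ar g' Y Z \<Longrightarrow> (scl C c g + g') \<cdot> f = scl C c (g \<cdot> f) + g' \<cdot> f"
  using lin unfolding linear_category_def ar_def by blast

lemma cmp_add_right: "ar f X Y \<Longrightarrow> ar f' X Y \<Longrightarrow> ar g Y Z \<Longrightarrow> g \<cdot> (f + f') = g \<cdot> f + g \<cdot> f'"
  using cmp_lin_right[of f X Y f' g Z 1] by simp

lemma cmp_add_left: "ar f X Y \<Longrightarrow> ar g Y Z \<Longrightarrow> ar g' Y Z \<Longrightarrow> (g + g') \<cdot> f = g \<cdot> f + g' \<cdot> f"
  using cmp_lin_left[of f X Y g Z g' 1] by simp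

lemma cmp_zero_right: "X \<in> obj C \<Longrightarrow> ar g Y Z \<Longrightarrow> g \<cdot> 0 = 0"
  using cmp_add_right[OF zero_ar zero_ar, of X Y g Z] arD[of g Y Z] by simp

lemma cmp_zero_left: "Z \<in> obj C \<Longrightarrow> ar f X Y \<Longrightarrow> 0 \<cdot> f = 0"
  using cmp_add_left[OF _ zero_ar zero_ar, of f X Y Z] arD[of f X Y] by simp

lemma cmp_scl_right: "ar f X Y \<Longrightarrow> ar g Y Z \<Longrightarrow> g \<cdot> scl C c f = scl C c (g \<cdot> f)"
  using cmp_lin_right[OF _ zero_ar, of f X Y g Z c] arD[of f X Y] arD[of g Y Z] cmp_zero_right[of X g Y Z] by simp

lemma cmp_scl_left: "ar f X Y \<Longrightarrow> ar g Y Z \<Longrightarrow> scl C c g \<cdot> f = scl C c (g \<cdot> f)"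
  using cmp_lin_left[OF _ _ zero_ar, of f X Y g Z c] arD[of f X Y] arD[of g Y Z] cmp_zero_left[of Z f X Y] by simp

lemma cmp_neg_right: "ar f X Y \<Longrightarrow> ar g Y Z \<Longrightarrow> g \<cdot> (- f) = - (g \<cdot> f)"
  using cmp_scl_right[of f X Y g Z "-1"] by simp

lemma cmp_neg_left: "ar f X Y \<Longrightarrow> ar g Y Z \<Longrightarrow> (- g) \<cdot> f = - (g \<cdot> f)"
  using cmp_scl_left[of f X Y g Z "-1"] by simp

lemma cmp_diff_right: "ar f X Y \<Longrightarrow> ar f' X Y \<Longrightarrow> ar g Y Z \<Longrightarrow> g \<cdot> (f - f') = g \<cdot> f - g \<cdot> f'"
  using cmp_add_right[OF _ neg_ar, of f X Y f' g Z] cmp_neg_right[of f' X Y g Z] by simp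

lemma cmp_diff_left: "ar f X Y \<Longrightarrow> ar g Y Z \<Longrightarrow> ar g' Y Z \<Longrightarrow> (g - g') \<cdot> f = g \<cdot> f - g' \<cdot> f"
  using cmp_add_left[OF _ _ neg_ar, of f X Y g Z g'] cmp_neg_left[of f X Y g' Z] by simp

lemma cmp_sum_right:
  assumes "X \<in> obj C" "ar g Y Z" "\<And>i. i \<in> I \<Longrightarrow> ar (f i) X Y"
  shows "g \<cdot> (\<Sum>i\<in>I. f i) = (\<Sum>i\<in>I. g \<cdot> f i)"
  using assms(3)
proof (induct I rule: infinite_finite_induct)
  case (insert i I)
  have "ar (sum f I) X Y" using insert arD[OF assms(2)] assms(1) by (intro sum_ar) auto
  with insert show ?case using cmp_add_right[of "f i" X Y "sum f I" g Z] assms(2) by simp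
qed (use assms cmp_zero_right[of X g Y Z] in auto)

lemma cmp_sum_left:
  assumes "Z \<in> obj C" "ar f X Y" "\<And>i. i \<in> I \<Longrightarrow> ar (g i) Y Z"
  shows "(\<Sum>i\<in>I. g i) \<cdot> f = (\<Sum>i\<in>I. g i \<cdot> f)"
  using assms(3)
proof (induct I rule: infinite_finite_induct)
  case (insert i I)
  have "ar (sum g I) Y Z" using insert arD[OF assms(2)] assms(1) by (intro sum_ar) auto
  with insert show ?case using cmp_add_left[of f X Y "g i" Z "sum g I"] assms(2) by simp
qed (use assms cmp_zero_left[of Z f X Y] in auto)

lemma ar_eq_0_if_source_0: "ar f X Y \<Longrightarrow> \<iota> X = 0 \<Longrightarrow> f = 0"
  using cmp_zero_right[of X f X Y] id_right[of f X Y] arD[of f X Y] by simp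

lemma ar_eq_0_if_target_0: "ar f X Y \<Longrightarrow> \<iota> Y = 0 \<Longrightarrow> f = 0"
  using cmp_zero_left[of Y f X Y] id_left[of f X Y] arD[of f X Y] by simp

definition iso :: "'m \<Rightarrow> 'o \<Rightarrow> 'o \<Rightarrow> bool" where
  "iso f X Y \<longleftrightarrow> ar f X Y \<and> (\<exists>g. ar g Y X \<and> g \<cdot> f = \<iota> X \<and> f \<cdot> g = \<iota> Y)"

lemma iso_mor_iff: "X \<in> obj C \<Longrightarrow> Y \<in> obj C \<Longrightarrow> iso_mor C X Y f \<longleftrightarrow> iso f X Y"
  by (auto simp: iso_mor_def iso_def ar_def)

lemma isoI: "ar f X Y \<Longrightarrow> ar g Y X \<Longrightarrow> g \<cdot> f = \<iota> X \<Longrightarrow> f \<cdot> g = \<iota> Y \<Longrightarrow> iso f X Y"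
  by (auto simp: iso_def)

lemma isoE:
  assumes "iso f X Y"
  obtains g where "ar f X Y" "ar g Y X" "g \<cdot> f = \<iota> X" "f \<cdot> g = \<iota> Y" "iso g Y X"
  using assms unfolding iso_def by blast

lemma iso_id: "X \<in> obj C \<Longrightarrow> iso (\<iota> X) X X"
  using id_ar[of X] id_left[of "\<iota> X" X X] by (auto intro!: isoI)

lemma iso_cmp:
  assumes "iso f X Y" "iso g Y Z"
  shows "iso (g \<cdot> f) X Z"
proof -
  obtain f' where f: "ar f X Y" "ar f' Y X" "f' \<cdot> f = \<iota> X" "f \<cdot> f' = \<iota> Y" using assms(1) by (rule isoE)
  obtain g' where g: "ar g Y Z" "ar g' Z Y" "g' \<cdot> g = \<iota> Y" "g \<cdot> g' = \<iota> Z" using assms(2) by (rule isoE)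
  show ?thesis
  proof (rule isoI[OF cmp_ar[OF f(1) g(1)] cmp_ar[OF g(2) f(2)]])
    show "f' \<cdot> g' \<cdot> (g \<cdot> f) = \<iota> X"
      using assoc[OF cmp_ar[OF f(1) g(1)] g(2) f(2)] assoc[OF f(1) g(1,2)] f g id_left[OF f(1)] by simp
    show "g \<cdot> f \<cdot> (f' \<cdot> g') = \<iota> Z"
      using assoc[OF cmp_ar[OF g(2) f(2)] f(1) g(1)] assoc[OF g(2) f(2,1)] f g id_left[OF g(2)] by simp
  qed
qed

definition isom :: "'o \<Rightarrow> 'o \<Rightarrow> bool" where "isom X Y \<longleftrightarrow> (\<exists>f. iso f X Y)"

lemma isom_refl: "X \<in> obj C \<Longrightarrow> isom X X" using iso_id by (auto simp: isom_def)
lemma isom_sym: "isom X Y \<Longrightarrow> isom Y X" unfolding isom_def by (meson isoE)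
lemma isom_trans: "isom X Y \<Longrightarrow> isom Y Z \<Longrightarrow> isom X Z" unfolding isom_def by (meson iso_cmp)
lemma isom_obj: "isom X Y \<Longrightarrow> X \<in> obj C \<and> Y \<in> obj C" by (auto simp: isom_def iso_def ar_def)

lemma iso_class_eq: "X \<in> obj C \<Longrightarrow> iso_class C X = {Y. isom X Y}"
  using iso_mor_iff[of X] isom_obj[of X] unfolding iso_class_def isom_def by blast

lemma iso_class_eq_iff: "X \<in> obj C \<Longrightarrow> Y \<in> obj C \<Longrightarrow> iso_class C X = iso_class C Y \<longleftrightarrow> isom X Y"
  unfolding iso_class_eq using isom_refl isom_sym isom_trans by blast

text \<open>Jacobson's identity: \<open>1 + g (1 - f g)\<^sup>-\<^sup>1 f\<close> inverts \<open>1 - g f\<close>.\<close>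

lemma iso_one_minus_swap:
  assumes f: "ar f X Y" and g: "ar g Y X" and iso: "iso (\<iota> Y - f \<cdot> g) Y Y"
  shows "iso (\<iota> X - g \<cdot> f) X X"
proof -
  note X = id_ar[OF arD(1)[OF f]] and Y = id_ar[OF arD(2)[OF f]]
  note fg = cmp_ar[OF g f] and gf = cmp_ar[OF f g]
  obtain h where h: "ar h Y Y" "h \<cdot> (\<iota> Y - f \<cdot> g) = \<iota> Y" "(\<iota> Y - f \<cdot> g) \<cdot> h = \<iota> Y"
    using iso by (auto simp: iso_def)
  have h1: "h \<cdot> (f \<cdot> g) = h - \<iota> Y" and h2: "f \<cdot> g \<cdot> h = h - \<iota> Y"
    using h(2,3) cmp_diff_right[OF Y fg h(1)] cmp_diff_left[OF h(1) Y fg] id_left[OF h(1)] id_right[OF h(1)]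
    by (simp_all add: algebra_simps)
  note hf = cmp_ar[OF f h(1)]
  note ghf = cmp_ar[OF hf g]
  have a: "g \<cdot> (h \<cdot> f) \<cdot> (g \<cdot> f) = g \<cdot> (h \<cdot> f) - g \<cdot> f"
  proof -
    have "h \<cdot> f \<cdot> (g \<cdot> f) = h \<cdot> (f \<cdot> g) \<cdot> f"
      using assoc[OF gf f h(1)] assoc[OF f g f] assoc[OF f fg h(1)] by simp
    also have "\<dots> = h \<cdot> f - f" using h1 cmp_diff_left[OF f h(1) Y] id_left[OF f] by simp
    finally show ?thesis
      using assoc[OF gf hf g] cmp_diff_right[OF hf f g] by simp
  qed
  have b: "g \<cdot> f \<cdot> (g \<cdot> (h \<cdot> f)) = g \<cdot> (h \<cdot> f) - g \<cdot> f"
  proof -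
    have "f \<cdot> (g \<cdot> (h \<cdot> f)) = f \<cdot> g \<cdot> h \<cdot> f"
      using assoc[OF hf g f] assoc[OF f h(1) fg] by simp
    also have "\<dots> = h \<cdot> f - f" using h2 cmp_diff_left[OF f h(1) Y] id_left[OF f] by simp
    finally show ?thesis
      using assoc[OF ghf f g] cmp_diff_right[OF hf f g] by simp
  qed
  show ?thesis
  proof (rule isoI[OF diff_ar[OF X gf] add_ar[OF X ghf]])
    show "(\<iota> X + g \<cdot> (h \<cdot> f)) \<cdot> (\<iota> X - g \<cdot> f) = \<iota> X"
      using cmp_diff_right[OF X gf add_ar[OF X ghf]] id_right[OF add_ar[OF X ghf]]
        cmp_add_left[OF gf X ghf] id_left[OF gf] a by simp
    show "(\<iota> X - g \<cdot> f) \<cdot> (\<iota> X + g \<cdot> (h \<cdot> f)) = \<iota> X"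
      using cmp_diff_left[OF add_ar[OF X ghf] X gf] id_left[OF add_ar[OF X ghf]]
        cmp_add_right[OF X ghf gf] id_right[OF gf] b by simp
  qed
qed

lemma iso_cancel_left:
  assumes "iso u Y Z" "ar f X Y" "iso (u \<cdot> f) X Z"
  shows "iso f X Y"
proof -
  obtain u' where u: "ar u Y Z" "ar u' Z Y" "u' \<cdot> u = \<iota> Y" "iso u' Z Y" using assms(1) by (rule isoE) 
  have "iso (u' \<cdot> (u \<cdot> f)) X Y" by (rule iso_cmp[OF assms(3) u(4)])
  then show ?thesis using assoc[OF assms(2) u(1,2)] u(3) id_left[OF assms(2)] by simp
qed

subsection \<open>Objects with local endomorphism ring\<close>

definition loc :: "'o \<Rightarrow> bool" where
  "loc X \<longleftrightarrow> X \<in> obj C \<and> \<iota> X \<noteq> 0 \<and> (\<forall>f. ar f X X \<longrightarrow> iso f X X \<or> iso (\<iota> X - f) X X)"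

text \<open>An idempotent unit is the identity, by cancelling one factor; locality makes
  \<open>e\<close> or its complement a unit, and both are idempotent.\<close>

lemma loc_idempotent:
  assumes "loc X" "ar e X X" "e \<cdot> e = e"
  shows "e = 0 \<or> e = \<iota> X"
proof -
  have X: "ar (\<iota> X) X X" using assms(1) id_ar by (simp add: loc_def)
  have unit: "e' = \<iota> X" if u: "iso e' X X" and "e' \<cdot> e' = e'" for e'
  proof -
    obtain g where g: "ar e' X X" "ar g X X" "g \<cdot> e' = \<iota> X" using u by (rule isoE)
    have "e' = g \<cdot> e' \<cdot> e'" using g id_left[OF g(1)] by simp
    also have "\<dots> = \<iota> X" using assoc[OF g(1,1,2)] that g(3) by simp
    finally show ?thesis .
  qed
  have ee: "(\<iota> X - e) \<cdot> (\<iota> X - e) = \<iota> X - e"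
    using cmp_diff_left[OF diff_ar[OF X assms(2)] X assms(2)] id_left[OF diff_ar[OF X assms(2)]]
      cmp_diff_right[OF X assms(2,2)] id_right[OF assms(2)] assms(3) by simp
  have "iso e X X \<or> iso (\<iota> X - e) X X" using assms by (simp add: loc_def)
  then show ?thesis using unit[OF _ assms(3)] unit[OF _ ee] by auto
qed

text \<open>The composite \<open>f \<cdot> g\<close> is idempotent, and it is not 0 because
  \<open>g \<cdot> (f \<cdot> g) = g\<close> while \<open>g \<cdot> f\<close> is a nonzero
  identity.\<close>

lemma loc_retract_iso:
  assumes "loc Z" "X \<in> obj C" "\<iota> X \<noteq> 0" "ar f X Z" "ar g Z X" "g \<cdot> f = \<iota> X"
  shows "iso f X Z"
proof -
  note f = assms(4) and g = assms(5)
  have gfg: "g \<cdot> (f \<cdot> g) = g" using assoc[OF g f g] assms(6) id_left[OF g] by simp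
  have "f \<cdot> g \<cdot> (f \<cdot> g) = f \<cdot> g" using assoc[OF cmp_ar[OF g f] g f] gfg by simp
  then have "f \<cdot> g = 0 \<or> f \<cdot> g = \<iota> Z" by (rule loc_idempotent[OF assms(1) cmp_ar[OF g f]])
  moreover have "f \<cdot> g \<noteq> 0"
  proof
    assume "f \<cdot> g = 0"
    then have "g = 0" using gfg cmp_zero_right[OF arD(1)[OF g] g] by simp
    then show False using assms(3,6) cmp_zero_left[OF assms(2) f] by simp
  qed
  ultimately show ?thesis using f g assms(6) by (auto intro: isoI)
qed

lemma loc_unit_factor:
  assumes "loc Z" "loc X" "ar f X Z" "ar g Z X" "iso (g \<cdot> f) X X"
  shows "iso f X Z"
proof -
  note f = assms(3) and g = assms(4)
  obtain h where h: "ar h X X" "h \<cdot> (g \<cdot> f) = \<iota> X" using assms(5) by (auto simp: iso_def)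
  have "h \<cdot> g \<cdot> f = \<iota> X" using assoc[OF f g h(1)] h(2) by simp
  then show ?thesis
    using loc_retract_iso[OF assms(1) _ _ f cmp_ar[OF g h(1)]] assms(2) by (simp add: loc_def)
qed

lemma loc_one_nonunit: "loc X \<Longrightarrow> ar f X X \<Longrightarrow> \<not> iso f X X \<Longrightarrow> iso (\<iota> X - f) X X"
  by (auto simp: loc_def)

text \<open>If \<open>u\<close> inverts the sum, then \<open>u \<cdot> g\<close> is the complement
  of \<open>u \<cdot> f\<close>, so one of the two is a unit, and cancelling \<open>u\<close> makes
  \<open>f\<close> or \<open>g\<close> a unit.\<close>

lemma loc_nonunit_add:
  assumes "loc X" "ar f X X" "ar g X X" "\<not> iso f X X" "\<not> iso g X X"
  shows "\<not> iso (f + g) X X"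
proof
  assume "iso (f + g) X X"
  then obtain u where u: "ar u X X" "u \<cdot> (f + g) = \<iota> X" "iso u X X" by (rule isoE)
  have "u \<cdot> f + u \<cdot> g = \<iota> X" using u(2) cmp_add_right[OF assms(2,3) u(1)] by simp
  then have "u \<cdot> g = \<iota> X - u \<cdot> f" by (simp add: algebra_simps)
  then have "iso (u \<cdot> f) X X \<or> iso (u \<cdot> g) X X"
    using assms(1) cmp_ar[OF assms(2) u(1)] by (auto simp: loc_def)
  then show False using iso_cancel_left[OF u(3)] assms by blast
qed

lemma loc_zero_nonunit: "loc X \<Longrightarrow> \<not> iso 0 X X"
proof
  assume X: "loc X" and "iso 0 X X"
  then obtain g where g: "ar g X X" "g \<cdot> 0 = \<iota> X" by (auto simp: iso_def)
  then show False using cmp_zero_right[OF arD(1)[OF g(1)] g(1)] X by (simp add: loc_def)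
qed

lemma loc_nonunit_sum:
  assumes "loc X" "\<And>i. i \<in> I \<Longrightarrow> ar (f i) X X \<and> \<not> iso (f i) X X"
  shows "\<not> iso (\<Sum>i\<in>I. f i) X X"
  using assms(2)
proof (induct I rule: infinite_finite_induct)
  case (insert i I)
  have "ar (sum f I) X X" using insert assms(1) by (intro sum_ar) (auto simp: loc_def)
  with insert show ?case using loc_nonunit_add[OF assms(1), of "f i" "sum f I"] by simp
qed (use loc_zero_nonunit[OF assms(1)] in auto)

lemma loc_nonunit_scl:
  assumes "loc X" "ar f X X" "\<not> iso f X X"
  shows "\<not> iso (scl C c f) X X"
proof
  assume "iso (scl C c f) X X"
  then obtain g where g: "ar g X X" "g \<cdot> scl C c f = \<iota> X" by (auto simp: iso_def)
  then have "scl C c g \<cdot> f = \<iota> X" using cmp_scl_right[OF assms(2) g(1)] cmp_scl_left[OF assms(2) g(1)] by simp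
  then show False using loc_retract_iso[OF assms(1) _ _ assms(2) scl_ar[OF g(1)]] assms(1,3) by (auto simp: loc_def)
qed

end

section \<open>Dual spaces\<close>

text \<open>A homogeneous system with more unknowns than equations, solved by Gaussian elimination:
  an equation \<open>s\<close> with a nonzero entry at \<open>y\<close> eliminates the unknown at
  \<open>y\<close> from the others.\<close>

lemma exists_common_kernel_coeffs:
  fixes \<phi> :: "'s \<Rightarrow> 'b \<Rightarrow> 'k::field"
  assumes "finite S" "finite b" "card S < card b"
  shows "\<exists>c. (\<exists>x\<in>b. c x \<noteq> 0) \<and> (\<forall>s\<in>S. (\<Sum>x\<in>b. c x * \<phi> s x) = 0)"
  using assms
proof (induct S arbitrary: b \<phi> rule: finite_induct)
  case empty
  then obtain x where "x \<in> b" by fastforce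
  then show ?case by (intro exI[of _ "\<lambda>_. 1"]) auto
next
  case (insert s S)
  show ?case
  proof (cases "\<forall>x\<in>b. \<phi> s x = 0")
    case True
    have "card S < card b" using insert by simp
    from insert(3)[OF insert(4) this, of \<phi>] show ?thesis using True by auto
  next
    case False
    then obtain y where y: "y \<in> b" "\<phi> s y \<noteq> 0" by auto
    let ?b = "b - {y}"
    have "card S < card ?b" using insert y by (simp add: card_Diff_singleton)
    from insert(3)[OF _ this, of "\<lambda>t x. \<phi> t x - \<phi> t y * \<phi> s x / \<phi> s y"] insert(4)
    obtain c x where c: "x \<in> ?b" "c x \<noteq> 0"
      "\<forall>t\<in>S. (\<Sum>x\<in>?b. c x * (\<phi> t x - \<phi> t y * \<phi> s x / \<phi> s y)) = 0" by auto
    \<comment> \<open>The value at \<open>y\<close> is the one that equation \<open>s\<close>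
      forces.\<close>
    define c' where "c' = c(y := - (\<Sum>x\<in>?b. c x * \<phi> s x) / \<phi> s y)"
    have sum: "(\<Sum>x\<in>b. c' x * \<phi> t x) = (\<Sum>x\<in>?b. c x * \<phi> t x) - (\<Sum>x\<in>?b. c x * \<phi> s x) * \<phi> t y / \<phi> s y" for t
    proof -
      have "(\<Sum>x\<in>b. c' x * \<phi> t x) = c' y * \<phi> t y + (\<Sum>x\<in>?b. c' x * \<phi> t x)"
        using insert(4) y(1) by (rule sum.remove)
      also have "(\<Sum>x\<in>?b. c' x * \<phi> t x) = (\<Sum>x\<in>?b. c x * \<phi> t x)"
        by (rule sum.cong) (auto simp: c'_def)
      finally show ?thesis by (simp add: c'_def)
    qed
    have "(\<Sum>x\<in>b. c' x * \<phi> t x) = (\<Sum>x\<in>?b. c x * (\<phi> t x - \<phi> t y * \<phi> s x / \<phi> s y))" for t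
      unfolding sum sum_distrib_right sum_divide_distrib sum_subtractf[symmetric]
      by (rule sum.cong) (auto simp: algebra_simps)
    then have "\<forall>t\<in>S. (\<Sum>x\<in>b. c' x * \<phi> t x) = 0" using c(3) by simp
    moreover have "(\<Sum>x\<in>b. c' x * \<phi> s x) = 0" using sum[of s] y(2) by simp
    moreover have "c' x \<noteq> 0" "x \<in> b" using c by (auto simp: c'_def)
    ultimately show ?thesis by (intro exI[of _ c']) auto
  qed
qed

text \<open>Makes room inside an infinite basis for pairwise disjoint blocks indexed by all finite
  lists of basis elements. The length of the list is coded separately because the iterated pairing
  \<open>en\<close> is shown injective only on lists of equal length.\<close>

lemma infinite_lists_times_nat_inj:
  fixes I :: "'a set"
  assumes "infinite I"
  shows "\<exists>e :: 'a list \<Rightarrow> nat \<Rightarrow> 'a. (\<forall>xs\<in>lists I. \<forall>k. e xs k \<in> I) \<and>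
    (\<forall>xs\<in>lists I. \<forall>ys\<in>lists I. \<forall>k l. e xs k = e ys l \<longrightarrow> xs = ys \<and> k = l)"
proof -
  have "(card_of (I \<times> I), card_of I) \<in> ordIso" using assms by (rule card_of_Times_same_infinite)
  then obtain p where p: "bij_betw p (I \<times> I) I" using card_of_ordIso by blast
  obtain \<nu> :: "nat \<Rightarrow> 'a" where \<nu>: "inj \<nu>" "range \<nu> \<subseteq> I" using assms infinite_countable_subset by blast
  have pI: "p (x, y) \<in> I" if "x \<in> I" "y \<in> I" for x y using p that by (auto simp: bij_betw_def)
  have pinj: "p (x, y) = p (x', y') \<longleftrightarrow> x = x' \<and> y = y'" if "x \<in> I" "y \<in> I" "x' \<in> I" "y' \<in> I" for x y x' y'
    using p that by (auto simp: bij_betw_def inj_on_def)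
  define en where "en = foldr (\<lambda>x r. p (x, r))"
  have enI: "en xs (\<nu> 0) \<in> I" if "xs \<in> lists I" for xs
    using that by (induct xs) (use \<nu>(2) pI in \<open>auto simp: en_def\<close>)
  have eninj: "xs = ys" if "xs \<in> lists I" "ys \<in> lists I" "length xs = length ys" "en xs (\<nu> 0) = en ys (\<nu> 0)" for xs ys
    using that(3,1,2,4)
  proof (induct xs ys rule: list_induct2)
    case (Cons x xs y ys)
    then show ?case using pinj[of x "en xs (\<nu> 0)" y "en ys (\<nu> 0)"] enI by (auto simp: en_def)
  qed simp
  have \<nu>I: "\<nu> k \<in> I" for k using \<nu>(2) by auto
  define e where "e xs k = p (\<nu> (length xs), p (en xs (\<nu> 0), \<nu> k))" for xs k
  have "e xs k \<in> I" if "xs \<in> lists I" for xs k using that enI pI \<nu>I by (simp add: e_def)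
  moreover have "xs = ys \<and> k = l" if "xs \<in> lists I" "ys \<in> lists I" "e xs k = e ys l" for xs ys k l
  proof -
    have "\<nu> (length xs) = \<nu> (length ys)" "p (en xs (\<nu> 0), \<nu> k) = p (en ys (\<nu> 0), \<nu> l)"
      using that pinj[OF \<nu>I pI[OF enI \<nu>I] \<nu>I pI[OF enI \<nu>I], of xs ys] unfolding e_def by auto
    then have "length xs = length ys" "en xs (\<nu> 0) = en ys (\<nu> 0)" "k = l"
      using that pinj[OF enI \<nu>I enI \<nu>I, of xs ys] injD[OF \<nu>(1)] by auto
    then show ?thesis using eninj that by blast
  qed
  ultimately show ?thesis by (intro exI[of _ e]) blast
qed

context vector_space begin

lemma scalar_pair: "vector_space_pair scale ((*) :: 'a \<Rightarrow> 'a \<Rightarrow> 'a)"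
proof -
  interpret s: vector_space "(*) :: 'a \<Rightarrow> 'a \<Rightarrow> 'a"
    by unfold_locales (simp_all add: distrib_left distrib_right mult.assoc)
  show ?thesis ..
qed

lemma exists_scalar_extension:
  assumes "independent b"
  shows "\<exists>\<phi>. Vector_Spaces.linear scale ((*) :: 'a \<Rightarrow> 'a \<Rightarrow> 'a) \<phi> \<and> (\<forall>x\<in>b. \<phi> x = \<psi> x)"
  by (rule vector_space_pair.linear_independent_extend[OF scalar_pair assms])

text \<open>A diagonal argument: the blocks \<open>{e xs 0, \<dots>, e xs (length xs)}\<close> of basis vectors are disjoint, and
  on the block of \<open>xs\<close> the functional \<open>\<phi>\<close> is chosen outside the span of the functionals listed by \<open>xs\<close>.\<close>

lemma functionals_not_spanned:
  fixes t :: "'b \<Rightarrow> 'x" and P :: "'x \<Rightarrow> 'b \<Rightarrow> 'a"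
  assumes I: "independent I" "infinite I"
    and P: "\<And>i x y c. i \<in> I \<Longrightarrow> x \<in> span I \<Longrightarrow> y \<in> span I \<Longrightarrow> P (t i) (scale c x + y) = c * P (t i) x + P (t i) y"
  shows "\<exists>\<phi>. Vector_Spaces.linear scale ((*) :: 'a \<Rightarrow> 'a \<Rightarrow> 'a) \<phi> \<and>
    (\<forall>F a. finite F \<longrightarrow> F \<subseteq> I \<longrightarrow> (\<exists>w\<in>span I. (\<Sum>s\<in>F. a s * P (t s) w) \<noteq> \<phi> w))"
proof -
  obtain e :: "'b list \<Rightarrow> nat \<Rightarrow> 'b" where e0: "\<forall>xs\<in>lists I. \<forall>k. e xs k \<in> I"
    "\<forall>xs\<in>lists I. \<forall>ys\<in>lists I. \<forall>k l. e xs k = e ys l \<longrightarrow> xs = ys \<and> k = l"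
    using infinite_lists_times_nat_inj[OF I(2)] by (elim exE conjE)
  note e = e0(1)[rule_format] e0(2)[rule_format]
  define b where "b xs = e xs ` {..length xs}" for xs
  have b: "finite (b xs)" "b xs \<subseteq> I" "card (set xs) < card (b xs)" if "xs \<in> lists I" for xs
  proof -
    have "inj_on (e xs) {..length xs}" using e(2)[OF that that] by (auto intro: inj_onI)
    then have "card (b xs) = Suc (length xs)" by (simp add: b_def card_image)
    then show "card (set xs) < card (b xs)" using card_length[of xs] by simp
  qed (use e(1)[OF that] in \<open>auto simp: b_def\<close>)
  have "\<exists>c. (\<exists>x\<in>b xs. c x \<noteq> 0) \<and> (\<forall>s\<in>set xs. (\<Sum>x\<in>b xs. c x * P (t s) x) = 0)" if "xs \<in> lists I" for xs
    by (rule exists_common_kernel_coeffs[OF finite_set b(1)[OF that] b(3)[OF that]])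
  then obtain c where c: "\<And>xs. xs \<in> lists I \<Longrightarrow> \<exists>x\<in>b xs. c xs x \<noteq> 0"
    "\<And>xs s. xs \<in> lists I \<Longrightarrow> s \<in> set xs \<Longrightarrow> (\<Sum>x\<in>b xs. c xs x * P (t s) x) = 0" by metis
  obtain p where p: "\<And>xs. xs \<in> lists I \<Longrightarrow> p xs \<in> b xs" "\<And>xs. xs \<in> lists I \<Longrightarrow> c xs (p xs) \<noteq> 0"
    using c(1) by metis
  \<comment> \<open>\<open>\<phi>\<close> is 1 on \<open>I\<close> exactly at the pivots. As the
    blocks are disjoint, the combination of the block of \<open>xs\<close> with coefficients
    \<open>c xs\<close> meets a single pivot, so \<open>\<phi>\<close> does not vanish there while
    all functionals listed by \<open>xs\<close> do.\<close>
  obtain \<phi> where \<phi>: "Vector_Spaces.linear scale ((*) :: 'a \<Rightarrow> 'a \<Rightarrow> 'a) \<phi>" "\<forall>x\<in>I. \<phi> x = of_bool (x \<in> p ` lists I)"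
    using exists_scalar_extension[OF I(1), of "\<lambda>x. of_bool (x \<in> p ` lists I)"] by auto
  interpret \<phi>: Vector_Spaces.linear scale "(*) :: 'a \<Rightarrow> 'a \<Rightarrow> 'a" \<phi> by (rule \<phi>(1))
  have "\<exists>w\<in>span I. (\<Sum>s\<in>F. a s * P (t s) w) \<noteq> \<phi> w" if F: "finite F" "F \<subseteq> I" for F a
  proof -
    obtain xs where xs: "set xs = F" using F(1) finite_list by blast
    then have xI: "xs \<in> lists I" using F(2) by auto
    define w where "w = (\<Sum>x\<in>b xs. scale (c xs x) x)"
    have ws: "(\<Sum>x\<in>A. scale (c xs x) x) \<in> span I" if "A \<subseteq> b xs" for A
      using b(2)[OF xI] that by (intro span_sum span_scale) (auto intro: span_base)
    have "P (t s) (\<Sum>x\<in>A. scale (c xs x) x) = (\<Sum>x\<in>A. c xs x * P (t s) x)" if "s \<in> F" "A \<subseteq> b xs" for s A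
    proof -
      have P0: "P (t s) 0 = 0" using P[of s 0 0 "-1"] that F(2) by (auto simp: span_zero)
      have "finite A" using that(2) b(1)[OF xI] finite_subset by blast
      from this that(2) show ?thesis
      proof (induct A rule: finite_induct)
        case (insert x A)
        then show ?case using P[of s x "\<Sum>x\<in>A. scale (c xs x) x" "c xs x"] that(1) F(2) ws[of A] b(2)[OF xI]
          by (auto simp: span_base subset_iff)
      qed (simp add: P0)
    qed
    then have "P (t s) w = 0" if "s \<in> F" for s unfolding w_def using c(2)[OF xI] that xs by simp
    moreover have "\<phi> w = c xs (p xs)"
    proof -
      have "\<phi> x = of_bool (x = p xs)" if x: "x \<in> b xs" for x
      proof -
        have "x = p xs" if "ys \<in> lists I" "x = p ys" for ys
        proof -
          have "p ys \<in> b ys" "p ys \<in> b xs" using p(1)[OF that(1)] x that(2) by auto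
          then obtain k l where "p ys = e ys k" "p ys = e xs l" unfolding b_def by (elim imageE)
          then have "xs = ys" using e(2)[OF xI that(1), of l k] by simp
          with that(2) show ?thesis by simp
        qed
        then have "x \<in> p ` lists I \<longleftrightarrow> x = p xs" using xI by blast
        moreover have "x \<in> I" using b(2)[OF xI] x by blast
        ultimately show ?thesis using \<phi>(2) by simp
      qed
      then have "\<phi> w = (\<Sum>x\<in>b xs. c xs x * of_bool (x = p xs))"
        unfolding w_def \<phi>.sum \<phi>.scale by (intro sum.cong) auto
      also have "\<dots> = c xs (p xs)" using p(1)[OF xI] b(1)[OF xI]
        by (simp add: of_bool_def if_distrib[of "\<lambda>z. _ * z"] cong: if_cong)
      finally show ?thesis .
    qed
    moreover have "w \<in> span I" using ws[of "b xs"] by (simp add: w_def)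
    ultimately show ?thesis using p(2)[OF xI] by (intro bexI[of _ w]) simp_all
  qed
  with \<phi>(1) show ?thesis by (intro exI[of _ \<phi>]) simp
qed

end

text \<open>Composition and pairing are linear only on Hom-spaces; this extends them to the ambient
  space so that right inverses of linear maps become available.\<close>

lemma (in vector_space_pair) exists_linear_extension:
  assumes "vs1.subspace U" "\<And>c x y. x \<in> U \<Longrightarrow> y \<in> U \<Longrightarrow> f (s1 c x + y) = s2 c (f x) + f y"
  shows "\<exists>g. Vector_Spaces.linear s1 s2 g \<and> (\<forall>x\<in>U. g x = f x)"
proof -
  obtain b where b: "b \<subseteq> U" "vs1.independent b" "U \<subseteq> vs1.span b" by (rule vs1.basis_exists[of U])
  obtain g where g: "Vector_Spaces.linear s1 s2 g" "\<forall>x\<in>b. g x = f x"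
    using linear_independent_extend[OF b(2), of f] by (elim exE conjE)
  interpret g: Vector_Spaces.linear s1 s2 g by (rule g(1))
  have f0: "f 0 = 0" using assms(2)[of 0 0 "-1"] vs1.subspace_0[OF assms(1)] by simp
  have "x \<in> U \<and> g x = f x" if "x \<in> vs1.span b" for x
    using that
  proof (induct rule: vs1.span_induct_alt)
    case (step c x y)
    then have "x \<in> U" "y \<in> U" using b(1) by auto
    with step show ?case using g(2) assms(2)[of x y c] vs1.subspace_add[OF assms(1) vs1.subspace_scale[OF assms(1)]]
      by (simp add: g.add g.scale)
  qed (simp add: f0 g.zero vs1.subspace_0[OF assms(1)])
  then show ?thesis using g(1) b(3) by (intro exI[of _ g]) auto
qed

section \<open>Serre functors\<close>

text \<open>Exposes the pairing that \<open>is_serre_functor\<close> hides under an existential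
  quantifier, so that a locale can fix it.\<close>

definition serre_pairing ::
    "('o, 'm::ab_group_add, 'k::field) lincat \<Rightarrow> ('o, 'm) lfunctor \<Rightarrow> ('o \<Rightarrow> 'o \<Rightarrow> 'm \<Rightarrow> 'm \<Rightarrow> 'k) \<Rightarrow> bool" where
  "serre_pairing D N B \<longleftrightarrow>
     (\<forall>X\<in>obj D. \<forall>Y\<in>obj D.
        (\<forall>c. \<forall>f\<in>hom D X Y. \<forall>f'\<in>hom D X Y. \<forall>g\<in>hom D Y (fobj N X).
           B X Y (scl D c f + f') g = c * B X Y f g + B X Y f' g) \<and>
        (\<forall>c. \<forall>f\<in>hom D X Y. \<forall>g\<in>hom D Y (fobj N X). \<forall>g'\<in>hom D Y (fobj N X).
           B X Y f (scl D c g + g') = c * B X Y f g + B X Y f g') \<and>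
        (\<forall>\<phi>. (\<forall>c. \<forall>g\<in>hom D Y (fobj N X). \<forall>g'\<in>hom D Y (fobj N X).
                 \<phi> (scl D c g + g') = c * \<phi> g + \<phi> g') \<longrightarrow>
             (\<exists>!f. f \<in> hom D X Y \<and> (\<forall>g\<in>hom D Y (fobj N X). B X Y f g = \<phi> g)))) \<and>
     (\<forall>X'\<in>obj D. \<forall>X\<in>obj D. \<forall>Y\<in>obj D.
        \<forall>u\<in>hom D X' X. \<forall>f\<in>hom D X Y. \<forall>g\<in>hom D Y (fobj N X').
        B X' Y (comp D f u) g = B X Y f (comp D (fmor N u) g)) \<and>
     (\<forall>X\<in>obj D. \<forall>Y\<in>obj D. \<forall>Y'\<in>obj D.
        \<forall>v\<in>hom D Y Y'. \<forall>f\<in>hom D X Y. \<forall>g\<in>hom D Y' (fobj N X).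
        B X Y' (comp D v f) g = B X Y f (comp D g v))"

lemma is_serre_functor_iff: "is_serre_functor D N \<longleftrightarrow> (\<exists>B. serre_pairing D N B)"
  unfolding is_serre_functor_def serre_pairing_def ..

locale lauto = lcat C for C :: "('o, 'm::ab_group_add, 'k::field) lincat" +
  fixes F G :: "('o, 'm) lfunctor"
  assumes inv: "inverse_automorphisms C F G"
begin

lemma swap: "lauto C G F" using inv lcat_axioms by (auto simp: lauto_def lauto_axioms_def inverse_automorphisms_def)

lemma F_obj: "X \<in> obj C \<Longrightarrow> fobj F X \<in> obj C"
  and G_obj: "X \<in> obj C \<Longrightarrow> fobj G X \<in> obj C"
  and F_id: "X \<in> obj C \<Longrightarrow> fmor F (\<iota> X) = \<iota> (fobj F X)"
  using inv by (auto simp: inverse_automorphisms_def linear_endofunctor_def)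

lemma GF_obj: "X \<in> obj C \<Longrightarrow> fobj G (fobj F X) = X" and FG_obj: "X \<in> obj C \<Longrightarrow> fobj F (fobj G X) = X"
  using inv by (auto simp: inverse_automorphisms_def)

lemma GF: "ar f X Y \<Longrightarrow> fmor G (fmor F f) = f" and FG: "ar f X Y \<Longrightarrow> fmor F (fmor G f) = f"
  using inv by (auto simp: inverse_automorphisms_def ar_def)

lemma F_ar: "ar f X Y \<Longrightarrow> ar (fmor F f) (fobj F X) (fobj F Y)"
  using inv F_obj by (auto simp: inverse_automorphisms_def linear_endofunctor_def ar_def)

lemma G_ar: "ar f X Y \<Longrightarrow> ar (fmor G f) (fobj G X) (fobj G Y)"
  using inv G_obj by (auto simp: inverse_automorphisms_def linear_endofunctor_def ar_def)

lemma G_ar': "ar f (fobj F X) (fobj F Y) \<Longrightarrow> X \<in> obj C \<Longrightarrow> Y \<in> obj C \<Longrightarrow> ar (fmor G f) X Y"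
  using G_ar[of f "fobj F X" "fobj F Y"] GF_obj by simp

lemma F_cmp: "ar f X Y \<Longrightarrow> ar g Y Z \<Longrightarrow> fmor F (g \<cdot> f) = fmor F g \<cdot> fmor F f"
proof -
  have "\<forall>X\<in>obj C. \<forall>Y\<in>obj C. \<forall>Z\<in>obj C. \<forall>f\<in>hom C X Y. \<forall>g\<in>hom C Y Z. fmor F (g \<cdot> f) = fmor F g \<cdot> fmor F f"
    using inv unfolding inverse_automorphisms_def linear_endofunctor_def by (elim conjE)
  then show "ar f X Y \<Longrightarrow> ar g Y Z \<Longrightarrow> ?thesis" unfolding ar_def by blast
qed

lemma F_lin: "ar f X Y \<Longrightarrow> ar f' X Y \<Longrightarrow> fmor F (scl C c f + f') = scl C c (fmor F f) + fmor F f'"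
  using inv unfolding inverse_automorphisms_def linear_endofunctor_def ar_def by auto

lemma F_add: "ar f X Y \<Longrightarrow> ar f' X Y \<Longrightarrow> fmor F (f + f') = fmor F f + fmor F f'"
  using F_lin[of f X Y f' 1] by simp

lemma F_zero: "X \<in> obj C \<Longrightarrow> fmor F 0 = 0"
  using F_add[OF zero_ar zero_ar, of X X] by simp

lemma F_neg: "ar f X Y \<Longrightarrow> fmor F (- f) = - fmor F f"
  using F_lin[OF _ zero_ar, of f X Y "-1"] F_zero[of X] arD[of f X Y] by simp

lemma F_diff: "ar f X Y \<Longrightarrow> ar f' X Y \<Longrightarrow> fmor F (f - f') = fmor F f - fmor F f'"
  using F_add[OF _ neg_ar, of f X Y f'] F_neg[of f' X Y] by simp

lemma F_sum:
  assumes "X \<in> obj C" "Y \<in> obj C" "\<And>i. i \<in> I \<Longrightarrow> ar (f i) X Y"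
  shows "fmor F (\<Sum>i\<in>I. f i) = (\<Sum>i\<in>I. fmor F (f i))"
  using assms(3)
proof (induct I rule: infinite_finite_induct)
  case (insert i I)
  have "ar (sum f I) X Y" using insert assms by (intro sum_ar) auto
  with insert show ?case using F_add[of "f i" X Y "sum f I"] by simp
qed (use F_zero[OF assms(1)] in auto)

lemma F_eq_0: "ar f X Y \<Longrightarrow> fmor F f = 0 \<Longrightarrow> f = 0"
  using GF[of f X Y] lauto.F_zero[OF swap F_obj, of X] arD[of f X Y] by simp

lemma F_iso: "iso f X Y \<Longrightarrow> iso (fmor F f) (fobj F X) (fobj F Y)"
  using F_ar F_cmp F_id unfolding iso_def by (metis arD(1,2))

lemma F_isom: "isom X Y \<Longrightarrow> isom (fobj F X) (fobj F Y)"
  using F_iso by (auto simp: isom_def)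

lemma loc_F: assumes "loc X" shows "loc (fobj F X)"
proof -
  have X: "X \<in> obj C" "\<iota> X \<noteq> 0" using assms by (auto simp: loc_def)
  have "\<iota> (fobj F X) \<noteq> 0" using F_eq_0[OF id_ar[OF X(1)]] F_id[OF X(1)] X by auto
  moreover have "iso f (fobj F X) (fobj F X) \<or> iso (\<iota> (fobj F X) - f) (fobj F X) (fobj F X)"
    if f: "ar f (fobj F X) (fobj F X)" for f
  proof -
    have g: "ar (fmor G f) X X" by (rule G_ar'[OF f X(1) X(1)])
    have "iso (fmor G f) X X \<or> iso (\<iota> X - fmor G f) X X" using assms g by (simp add: loc_def)
    then show ?thesis
      using F_iso[of "fmor G f" X X] F_iso[of "\<iota> X - fmor G f" X X] FG[OF f] F_diff[OF id_ar[OF X(1)] g] F_id[OF X(1)]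
      by auto
  qed
  ultimately show ?thesis using F_obj[OF X(1)] by (simp add: loc_def)
qed

end

lemma (in lcat) inverse_automorphisms_comp:
  assumes "inverse_automorphisms C F G" "inverse_automorphisms C F' G'"
  shows "inverse_automorphisms C (functor_comp F F') (functor_comp G' G)"
proof -
  interpret a: lauto C F G using assms(1) by unfold_locales
  interpret b: lauto C F' G' using assms(2) by unfold_locales
  interpret a': lauto C G F by (rule a.swap)
  interpret b': lauto C G' F' by (rule b.swap)
  have "linear_endofunctor C (functor_comp F F')" if "lauto C F G" "lauto C F' G'" for F G F' G'
  proof -
    interpret a: lauto C F G using that(1) .
    interpret b: lauto C F' G' using that(2) .
    show ?thesis
      unfolding linear_endofunctor_def functor_comp_def lfunctor.simps o_apply
    proof (intro conjI ballI allI)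
      fix X assume X: "X \<in> obj C"
      show "fobj F (fobj F' X) \<in> obj C" "fmor F (fmor F' (\<iota> X)) = \<iota> (fobj F (fobj F' X))"
        using X a.F_obj b.F_obj a.F_id b.F_id by auto
      fix Y assume Y: "Y \<in> obj C"
      fix f assume "f \<in> hom C X Y"
      then have f: "ar f X Y" using X Y by (simp add: ar_def)
      show "fmor F (fmor F' f) \<in> hom C (fobj F (fobj F' X)) (fobj F (fobj F' Y))"
        using arD(3)[OF a.F_ar[OF b.F_ar[OF f]]] .
      show "fmor F (fmor F' (scl C c f + f')) = scl C c (fmor F (fmor F' f)) + fmor F (fmor F' f')"
        if "f' \<in> hom C X Y" for c f'
        using a.F_lin[OF b.F_ar[OF f] b.F_ar] b.F_lin[OF f] arI[OF X Y that] by simp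
      show "fmor F (fmor F' (g \<cdot> f)) = fmor F (fmor F' g) \<cdot> fmor F (fmor F' f)"
        if "Z \<in> obj C" "g \<in> hom C Y Z" for Z g
        using b.F_cmp[OF f arI[OF Y that]] a.F_cmp[OF b.F_ar[OF f] b.F_ar[OF arI[OF Y that]]] by simp
    qed
  qed
  then have "linear_endofunctor C (functor_comp F F')" "linear_endofunctor C (functor_comp G' G)"
    using a.lauto_axioms b.lauto_axioms a'.lauto_axioms b'.lauto_axioms by simp_all
  moreover have "fmor G' (fmor G (fmor F (fmor F' f))) = f" "fmor F (fmor F' (fmor G' (fmor G f))) = f"
    if "ar f X Y" for f X Y
    using a.GF[OF b.F_ar[OF that]] b.GF[OF that] b.FG[OF a'.F_ar[OF that]] a.FG[OF that] by simp_all
  ultimately show ?thesis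
    unfolding inverse_automorphisms_def functor_comp_def
    using a.F_obj b.F_obj a.G_obj b.G_obj a.GF_obj b.GF_obj a.FG_obj b.FG_obj by (auto simp: ar_def)
qed

locale serre_cat = lcat C + N: lauto C N Ni
  for C :: "('o, 'm::ab_group_add, 'k::field) lincat" and N Ni :: "('o, 'm) lfunctor" +
  fixes B :: "'o \<Rightarrow> 'o \<Rightarrow> 'm \<Rightarrow> 'm \<Rightarrow> 'k"
  assumes serre: "serre_pairing C N B"
begin

lemma B_lin_left: "ar f X Y \<Longrightarrow> ar f' X Y \<Longrightarrow> ar g Y (fobj N X) \<Longrightarrow>
    B X Y (scl C c f + f') g = c * B X Y f g + B X Y f' g"
  and B_lin_right: "ar f X Y \<Longrightarrow> ar g Y (fobj N X) \<Longrightarrow> ar g' Y (fobj N X) \<Longrightarrow>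
    B X Y f (scl C c g + g') = c * B X Y f g + B X Y f g'"
  using serre by (simp_all add: serre_pairing_def ar_def)

lemma B_nat_left: "ar u X' X \<Longrightarrow> ar f X Y \<Longrightarrow> ar g Y (fobj N X') \<Longrightarrow>
    B X' Y (f \<cdot> u) g = B X Y f (fmor N u \<cdot> g)"
  and B_nat_right: "ar v Y Y' \<Longrightarrow> ar f X Y \<Longrightarrow> ar g Y' (fobj N X) \<Longrightarrow>
    B X Y' (v \<cdot> f) g = B X Y f (g \<cdot> v)"
  using serre by (simp_all add: serre_pairing_def ar_def)

lemma B_ex1:
  assumes "X \<in> obj C" "Y \<in> obj C"
    and "\<And>c g g'. ar g Y (fobj N X) \<Longrightarrow> ar g' Y (fobj N X) \<Longrightarrow> \<phi> (scl C c g + g') = c * \<phi> g + \<phi> g'"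
  shows "\<exists>!f. ar f X Y \<and> (\<forall>g. ar g Y (fobj N X) \<longrightarrow> B X Y f g = \<phi> g)"
proof -
  have "\<forall>\<phi>. (\<forall>c. \<forall>g\<in>hom C Y (fobj N X). \<forall>g'\<in>hom C Y (fobj N X). \<phi> (scl C c g + g') = c * \<phi> g + \<phi> g') \<longrightarrow>
      (\<exists>!f. f \<in> hom C X Y \<and> (\<forall>g\<in>hom C Y (fobj N X). B X Y f g = \<phi> g))"
    using serre assms(1,2) by (simp add: serre_pairing_def)
  moreover have "\<forall>c. \<forall>g\<in>hom C Y (fobj N X). \<forall>g'\<in>hom C Y (fobj N X). \<phi> (scl C c g + g') = c * \<phi> g + \<phi> g'"
    using assms N.F_obj by (simp add: ar_def)
  ultimately have "\<exists>!f. f \<in> hom C X Y \<and> (\<forall>g\<in>hom C Y (fobj N X). B X Y f g = \<phi> g)" by simp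
  then show ?thesis using assms N.F_obj by (simp add: ar_def Ball_def)
qed

lemma B_zero_left: "Y \<in> obj C \<Longrightarrow> X \<in> obj C \<Longrightarrow> ar g Y (fobj N X) \<Longrightarrow> B X Y 0 g = 0"
  using B_lin_left[OF zero_ar zero_ar, of X Y g "-1"] by simp

lemma B_zero_right: "ar f X Y \<Longrightarrow> B X Y f 0 = 0"
  using B_lin_right[OF _ zero_ar zero_ar, of f X Y "-1"] arD[of f X Y] N.F_obj by simp

lemma B_sum_left:
  assumes "X \<in> obj C" "Y \<in> obj C" "ar g Y (fobj N X)" "\<And>i. i \<in> I \<Longrightarrow> ar (f i) X Y"
  shows "B X Y (\<Sum>i\<in>I. scl C (a i) (f i)) g = (\<Sum>i\<in>I. a i * B X Y (f i) g)"
  using assms(4)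
proof (induct I rule: infinite_finite_induct)
  case (insert i I)
  have "ar (\<Sum>i\<in>I. scl C (a i) (f i)) X Y" using insert assms scl_ar by (intro sum_ar) auto
  with insert show ?case using B_lin_left[of "f i" X Y "\<Sum>i\<in>I. scl C (a i) (f i)" g "a i"] assms(3) by simp
qed (use assms B_zero_left in auto)

lemma B_sum_right:
  assumes "ar f X Y" "\<And>i. i \<in> I \<Longrightarrow> ar (g i) Y (fobj N X)"
  shows "B X Y f (\<Sum>i\<in>I. scl C (a i) (g i)) = (\<Sum>i\<in>I. a i * B X Y f (g i))"
  using assms(2)
proof (induct I rule: infinite_finite_induct)
  case (insert i I)
  have "ar (\<Sum>i\<in>I. scl C (a i) (g i)) Y (fobj N X)"
    using insert assms scl_ar arD[OF assms(1)] N.F_obj by (intro sum_ar) auto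
  with insert show ?case using B_lin_right[of f X Y "g i" "\<Sum>i\<in>I. scl C (a i) (g i)" "a i"] assms(1) by simp
qed (use assms B_zero_right in auto)

lemma basis_hom:
  assumes "X \<in> obj C" "Y \<in> obj C"
  obtains b where "V.independent b" "V.span b = hom C X Y" "\<And>x. x \<in> b \<Longrightarrow> ar x X Y"
proof -
  obtain b where b: "b \<subseteq> hom C X Y" "V.independent b" "hom C X Y \<subseteq> V.span b" by (rule V.basis_exists)
  have "V.span b = hom C X Y" using V.span_minimal[OF b(1) subspace_hom[OF assms]] b(3) by simp
  with b that assms show thesis by (auto simp: ar_def)
qed

text \<open>Some linear functional detects a nonzero \<open>g\<close>, and by definition of a Serre
  functor that functional is pairing with some \<open>f\<close>.\<close>

lemma B_nondegenerate:
  assumes g: "ar g Y (fobj N X)" and "X \<in> obj C" and 0: "\<And>f. ar f X Y \<Longrightarrow> B X Y f g = 0"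
  shows "g = 0"
proof (rule ccontr)
  assume "g \<noteq> 0"
  then have "V.independent {g}" by simp
  then obtain \<phi> where \<phi>: "Vector_Spaces.linear (scl C) ((*) :: 'k \<Rightarrow> 'k \<Rightarrow> 'k) \<phi>" "\<phi> g = 1"
    using V.exists_scalar_extension[of "{g}" "\<lambda>_. 1"] by auto
  interpret \<phi>: Vector_Spaces.linear "scl C" "(*) :: 'k \<Rightarrow> 'k \<Rightarrow> 'k" \<phi> by (rule \<phi>(1))
  have "\<exists>!f. ar f X Y \<and> (\<forall>g. ar g Y (fobj N X) \<longrightarrow> B X Y f g = \<phi> g)"
    by (rule B_ex1) (use assms arD[OF g] in \<open>simp_all add: \<phi>.add \<phi>.scale\<close>)
  then obtain f where "ar f X Y" "\<forall>g. ar g Y (fobj N X) \<longrightarrow> B X Y f g = \<phi> g" by auto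
  then show False using 0[of f] g \<phi>(2) by simp
qed

lemma B_nondegenerate_eq:
  assumes "ar g Y (fobj N X)" "ar g' Y (fobj N X)" "X \<in> obj C" "\<And>f. ar f X Y \<Longrightarrow> B X Y f g = B X Y f g'"
  shows "g = g'"
proof -
  have "g' - g = 0"
  proof (rule B_nondegenerate[OF diff_ar[OF assms(2,1)] assms(3)])
    fix f assume f: "ar f X Y"
    show "B X Y f (g' - g) = 0" using B_lin_right[OF f assms(1,2), of "-1"] assms(4)[OF f] by simp
  qed
  then show ?thesis by simp
qed

text \<open>Hom(X, Y) is the full dual of Hom(Y, N X), and the dual of an infinite-dimensional space
  has strictly larger dimension than the space itself.\<close>

lemma card_spanning_set_hom:
  assumes X: "X \<in> obj C" "Y \<in> obj C"
    and I: "V.independent I" "V.span I = hom C Y (fobj N X)" "infinite I"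
    and J: "hom C X Y \<subseteq> V.span J" "J \<subseteq> hom C X Y"
  shows "(card_of J, card_of I) \<notin> ordLeq"
proof
  assume "(card_of J, card_of I) \<in> ordLeq"
  then obtain \<psi> where \<psi>: "inj_on \<psi> J" "\<psi> ` J \<subseteq> I" using card_of_ordLeq[of J I] by auto
  \<comment> \<open>Enumerates \<open>J\<close> by indices in \<open>I\<close>, padded with 0, as
    \<open>functionals_not_spanned\<close> expects functionals indexed by the basis.\<close>
  define t where "t i = (if i \<in> \<psi> ` J then inv_into J \<psi> i else 0)" for i
  have t: "ar (t i) X Y" for i
    using J(2) X zero_ar by (auto simp: t_def ar_def inv_into_into \<psi>(1) subset_iff)
  have hI: "ar x Y (fobj N X)" if "x \<in> V.span I" for x using that I(2) X N.F_obj by (simp add: ar_def)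
  obtain \<phi> where \<phi>: "Vector_Spaces.linear (scl C) ((*) :: 'k \<Rightarrow> 'k \<Rightarrow> 'k) \<phi>"
    "\<forall>F a. finite F \<longrightarrow> F \<subseteq> I \<longrightarrow> (\<exists>w\<in>V.span I. (\<Sum>s\<in>F. a s * B X Y (t s) w) \<noteq> \<phi> w)"
    using V.functionals_not_spanned[OF I(1,3), of "B X Y" t] B_lin_right[OF t hI hI] by auto
  interpret \<phi>: Vector_Spaces.linear "scl C" "(*) :: 'k \<Rightarrow> 'k \<Rightarrow> 'k" \<phi> by (rule \<phi>(1))
  have "\<exists>!f. ar f X Y \<and> (\<forall>g. ar g Y (fobj N X) \<longrightarrow> B X Y f g = \<phi> g)"
    by (rule B_ex1) (use X in \<open>simp_all add: \<phi>.add \<phi>.scale\<close>)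
  then obtain f where f: "ar f X Y" "\<forall>g. ar g Y (fobj N X) \<longrightarrow> B X Y f g = \<phi> g" by auto
  have "f \<in> V.span J" using f(1) J(1) by (auto simp: ar_def)
  then obtain T r where T: "finite T" "T \<subseteq> J" "f = (\<Sum>a\<in>T. scl C (r a) a)"
    unfolding V.span_explicit by auto
  have "(\<Sum>s\<in>\<psi> ` T. r (t s) * B X Y (t s) w) = \<phi> w" if w: "w \<in> V.span I" for w
  proof -
    have ti: "t (\<psi> j) = j" if "j \<in> T" for j using that T(2) inv_into_f_f[OF \<psi>(1), of j] by (auto simp: t_def)
    have arT: "ar j X Y" if "j \<in> T" for j using that T(2) J(2) X by (auto simp: ar_def)
    have "inj_on \<psi> T" using \<psi>(1) T(2) inj_on_subset by blast
    then have "(\<Sum>s\<in>\<psi> ` T. r (t s) * B X Y (t s) w) = (\<Sum>j\<in>T. r j * B X Y j w)"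
      by (simp add: sum.reindex ti)
    also have "\<dots> = B X Y f w" unfolding T(3) by (rule B_sum_left[OF X hI[OF w] arT, symmetric])
    finally show ?thesis using f(2) hI[OF w] by simp
  qed
  moreover have "finite (\<psi> ` T)" "\<psi> ` T \<subseteq> I" using T(1,2) \<psi>(2) by auto
  ultimately show False using \<phi>(2)[rule_format, of "\<psi> ` T" "\<lambda>s. r (t s)"] by simp
qed

text \<open>Serre duality makes \<open>Hom(X, Y)\<close> isomorphic to its double dual, which forces it to be
  finite-dimensional.\<close>

lemma finite_basis_hom:
  assumes X: "X \<in> obj C" "Y \<in> obj C" and b: "V.independent b" "V.span b = hom C X Y"
  shows "finite b"
proof (rule ccontr)
  assume inf: "infinite b"
  \<comment> \<open>By two applications of the strict growth, dim Hom(X, Y) < dim Hom(?Y, X) < dim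
    Hom(?X, ?Y), although \<open>Ni\<close> identifies the two outer spaces.\<close>
  let ?X = "fobj Ni X" and ?Y = "fobj Ni Y"
  interpret Ni: lauto C Ni N by (rule N.swap)
  have obj: "?X \<in> obj C" "?Y \<in> obj C" "fobj N ?X = X" "fobj N ?Y = Y" using X N.G_obj N.FG_obj by auto
  obtain I where I: "V.independent I" "V.span I = hom C ?Y X" "\<And>x. x \<in> I \<Longrightarrow> ar x ?Y X"
    using basis_hom[OF obj(2) X(1)] by metis
  have "(card_of I, card_of b) \<notin> ordLeq"
    by (rule card_spanning_set_hom[OF obj(2) X(1) b(1) _ inf]) (use I b obj in \<open>auto simp: ar_def\<close>)
  then have le: "(card_of b, card_of I) \<in> ordLeq"
    using ordLeq_total[OF card_of_Well_order card_of_Well_order, of b I] by auto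
  have "infinite I" using card_of_ordLeq_infinite[OF le inf] .
  let ?J = "fmor Ni ` b"
  have "hom C ?X ?Y \<subseteq> V.span ?J"
  proof
    fix f assume "f \<in> hom C ?X ?Y"
    then have f: "ar f ?X ?Y" using obj by (simp add: ar_def)
    have ar: "ar x X Y" if "x \<in> V.span b" for x using that b X by (simp add: ar_def)
    have "fmor Ni x \<in> V.span ?J" if "x \<in> V.span b" for x
    proof -
      have "x \<in> V.span b \<and> fmor Ni x \<in> V.span ?J" using that
      proof (induct rule: V.span_induct_alt)
        case base
        then show ?case using Ni.F_zero[OF X(1)] by (simp add: V.span_zero)
      next
        case (step c x y)
        then show ?case using Ni.F_lin[of x X Y y c] ar V.span_base[of x b]
          by (auto intro!: V.span_add V.span_scale intro: V.span_base)
      qed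
      then show ?thesis ..
    qed
    moreover have "fmor N f \<in> V.span b" using N.F_ar[OF f] obj b by (simp add: ar_def)
    ultimately show "f \<in> V.span ?J" using N.GF[OF f] by metis
  qed
  moreover have "?J \<subseteq> hom C ?X ?Y" using b Ni.F_ar[of _ X Y] X V.span_base[of _ b] by (auto simp: ar_def)
  moreover have "V.span I = hom C ?Y (fobj N ?X)" using I(2) obj by simp
  ultimately have "(card_of ?J, card_of I) \<notin> ordLeq"
    using card_spanning_set_hom[OF obj(1,2) I(1) _ \<open>infinite I\<close>] by blast
  then show False using ordLeq_transitive[OF card_of_image le] by blast
qed

text \<open>The definition represents functionals of the second argument only. Finite dimension
  makes the pairing perfect on the other side too: \<open>g\<close> is assembled from a basis of
  Hom(Y, N X) and its dual family \<open>d\<close>.\<close>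

lemma B_represent:
  assumes X: "X \<in> obj C" "Y \<in> obj C"
    and lin: "\<And>c f f'. ar f X Y \<Longrightarrow> ar f' X Y \<Longrightarrow> \<phi> (scl C c f + f') = c * \<phi> f + \<phi> f'"
  shows "\<exists>g. ar g Y (fobj N X) \<and> (\<forall>f. ar f X Y \<longrightarrow> B X Y f g = \<phi> f)"
proof -
  obtain b where b: "V.independent b" "V.span b = hom C Y (fobj N X)" "\<And>x. x \<in> b \<Longrightarrow> ar x Y (fobj N X)"
    using basis_hom[OF X(2) N.F_obj[OF X(1)]] by metis
  have fin: "finite b" by (rule finite_basis_hom[OF X(2) N.F_obj[OF X(1)] b(1,2)])
  have "\<exists>f. ar f X Y \<and> (\<forall>y\<in>b. B X Y f y = of_bool (y = x))" for x
  proof -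
    obtain \<psi> where \<psi>: "Vector_Spaces.linear (scl C) ((*) :: 'k \<Rightarrow> 'k \<Rightarrow> 'k) \<psi>" "\<forall>y\<in>b. \<psi> y = of_bool (y = x)"
      using V.exists_scalar_extension[OF b(1), of "\<lambda>y. of_bool (y = x)"] by auto
    interpret \<psi>: Vector_Spaces.linear "scl C" "(*) :: 'k \<Rightarrow> 'k \<Rightarrow> 'k" \<psi> by (rule \<psi>(1))
    have "\<exists>!f. ar f X Y \<and> (\<forall>g. ar g Y (fobj N X) \<longrightarrow> B X Y f g = \<psi> g)"
      by (rule B_ex1) (use X in \<open>simp_all add: \<psi>.add \<psi>.scale\<close>)
    then show ?thesis using \<psi>(2) b(3) by metis
  qed
  then obtain d where d: "\<And>x. ar (d x) X Y" "\<And>x y. y \<in> b \<Longrightarrow> B X Y (d x) y = of_bool (y = x)" by metis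
  define g where "g = (\<Sum>x\<in>b. scl C (\<phi> (d x)) x)"
  have g: "ar g Y (fobj N X)" unfolding g_def using b(3) scl_ar X N.F_obj by (intro sum_ar) auto
  have "B X Y f g = \<phi> f" if f: "ar f X Y" for f
  proof -
    define f' where "f' = (\<Sum>x\<in>b. scl C (B X Y f x) (d x))"
    have f': "ar f' X Y" unfolding f'_def using d(1) scl_ar X by (intro sum_ar) auto
    have on_b: "B X Y f' y = B X Y f y" if "y \<in> b" for y
    proof -
      have "B X Y f' y = (\<Sum>x\<in>b. B X Y f x * B X Y (d x) y)"
        unfolding f'_def by (rule B_sum_left[OF X b(3)[OF that] d(1)])
      also have "\<dots> = B X Y f y" using that fin by (simp add: d(2) of_bool_def if_distrib[of "\<lambda>z. _ * z"] cong: if_cong)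
      finally show ?thesis .
    qed
    have eq: "B X Y f' y = B X Y f y" if y: "ar y Y (fobj N X)" for y
    proof -
      have "y \<in> V.span b" using y b(2) by (simp add: ar_def)
      then obtain T r where T: "T \<subseteq> b" "y = (\<Sum>a\<in>T. scl C (r a) a)" unfolding V.span_explicit by auto
      have "B X Y f' y = (\<Sum>a\<in>T. r a * B X Y f' a)" "B X Y f y = (\<Sum>a\<in>T. r a * B X Y f a)"
        unfolding T(2) by (rule B_sum_right[OF f' b(3)] B_sum_right[OF f b(3)]; use T(1) in blast)+
      moreover have "(\<Sum>a\<in>T. r a * B X Y f' a) = (\<Sum>a\<in>T. r a * B X Y f a)"
        using on_b T(1) by (intro sum.cong) auto
      ultimately show ?thesis by simp
    qed
    \<comment> \<open>\<open>f\<close> and \<open>f'\<close> induce the same functional of the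
      second argument, and the representing morphism is unique.\<close>
    have "\<exists>!h. ar h X Y \<and> (\<forall>y. ar y Y (fobj N X) \<longrightarrow> B X Y h y = B X Y f y)"
      by (rule B_ex1[OF X]) (rule B_lin_right[OF f])
    then have "f = f'" using f f' eq by auto
    have phi_sum: "\<phi> (\<Sum>x\<in>A. scl C (r x) (d x)) = (\<Sum>x\<in>A. r x * \<phi> (d x))" if "finite A" for A r
      using that
    proof (induct A rule: finite_induct)
      case empty
      then show ?case using lin[OF zero_ar[OF X] zero_ar[OF X], of "-1"] by simp
    next
      case (insert x A)
      have "ar (\<Sum>x\<in>A. scl C (r x) (d x)) X Y" using d(1) scl_ar X by (intro sum_ar) auto
      then show ?case using insert lin[OF d(1), of "\<Sum>x\<in>A. scl C (r x) (d x)" "r x" x] by simp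
    qed
    have "B X Y f g = (\<Sum>x\<in>b. \<phi> (d x) * B X Y f x)" unfolding g_def by (rule B_sum_right[OF f b(3)])
    also have "\<dots> = \<phi> f'" unfolding f'_def phi_sum[OF fin] by (simp add: mult.commute)
    finally show ?thesis using \<open>f = f'\<close> by simp
  qed
  then show ?thesis using g by auto
qed

text \<open>Contravariant exactness deduced from covariant exactness by duality: pairing with
  \<open>h\<close> kills everything that factors through \<open>u\<close>, hence descends along
  composition with \<open>v\<close>, and the morphism representing the descended functional is
  \<open>s\<close>.\<close>

lemma weak_cokernel:
  assumes u: "ar u U X" and v: "ar v X Y" and h: "ar h X W" "h \<cdot> u = 0"
    and ex: "\<And>Z g. ar g Z X \<Longrightarrow> v \<cdot> g = 0 \<Longrightarrow> \<exists>t. ar t Z U \<and> g = u \<cdot> t"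
  shows "\<exists>s. ar s Y W \<and> h = s \<cdot> v"
proof -
  let ?W = "fobj Ni W"
  have W: "W \<in> obj C" "?W \<in> obj C" "fobj N ?W = W" using arD[OF h(1)] N.G_obj N.FG_obj by auto
  note XY = arD(1,2)[OF v]
  interpret VP: vector_space_pair "scl C" "scl C" ..
  interpret VQ: vector_space_pair "scl C" "(*) :: 'k \<Rightarrow> 'k \<Rightarrow> 'k" by (rule V.scalar_pair)
  have arW: "ar x ?W X \<longleftrightarrow> x \<in> hom C ?W X" for x using W XY by (simp add: ar_def)
  note sub = subspace_hom[OF W(2) XY(1)]
  obtain L where L: "Vector_Spaces.linear (scl C) (scl C) L" "\<forall>x\<in>hom C ?W X. L x = v \<cdot> x"
    using VP.exists_linear_extension[OF sub, of "\<lambda>x. v \<cdot> x"] cmp_lin_right[OF _ _ v] arW by metis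
  have hW: "ar h X (fobj N ?W)" using h(1) W by simp
  obtain l where l: "Vector_Spaces.linear (scl C) ((*) :: 'k \<Rightarrow> 'k \<Rightarrow> 'k) l" "\<forall>x\<in>hom C ?W X. l x = B ?W X x h"
    using VQ.exists_linear_extension[OF sub, of "\<lambda>x. B ?W X x h"] B_lin_left[OF _ _ hW] arW by metis
  \<comment> \<open>\<open>R\<close> picks preimages under composition with \<open>v\<close>; two
    choices differ by a multiple of \<open>u\<close>, on which pairing with \<open>h\<close>
    vanishes.\<close>
  obtain R where R: "range R \<subseteq> hom C ?W X" "Vector_Spaces.linear (scl C) (scl C) R" "\<forall>y\<in>L ` hom C ?W X. L (R y) = y"
    using VP.linear_exists_right_inverse_on[OF L(1) sub] by metis
  interpret l: Vector_Spaces.linear "scl C" "(*) :: 'k \<Rightarrow> 'k \<Rightarrow> 'k" l by (rule l(1))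
  interpret L: Vector_Spaces.linear "scl C" "scl C" L by (rule L(1))
  interpret R: Vector_Spaces.linear "scl C" "scl C" R by (rule R(2))
  have \<mu>: "l (R (v \<cdot> x)) = B ?W X x h" if x: "ar x ?W X" for x
  proof -
    have x': "x \<in> hom C ?W X" using x arW by simp
    have Rx: "R (v \<cdot> x) \<in> hom C ?W X" using R(1) by auto
    have "L (R (v \<cdot> x)) = v \<cdot> x" using R(3) L(2) x' by (metis imageI)
    then have "L (R (v \<cdot> x) - x) = 0" using L(2) x' by (simp add: L.diff)
    then have "v \<cdot> (R (v \<cdot> x) - x) = 0" using L(2) V.subspace_diff[OF sub Rx x'] by simp
    moreover have d: "ar (R (v \<cdot> x) - x) ?W X" using diff_ar[OF _ x, of "R (v \<cdot> x)"] Rx arW by blast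
    ultimately obtain t where t: "ar t ?W U" "R (v \<cdot> x) - x = u \<cdot> t" using ex by blast
    have "l (R (v \<cdot> x) - x) = B ?W X (u \<cdot> t) h" using l(2) d t(2) arW by simp
    also have "\<dots> = B ?W U t (h \<cdot> u)" by (rule B_nat_right[OF u t(1) hW])
    also have "\<dots> = 0" using h(2) B_zero_right[OF t(1)] by simp
    finally have "l (R (v \<cdot> x)) = l x" by (simp add: l.diff)
    then show ?thesis using l(2) x' by simp
  qed
  obtain s where s: "ar s Y (fobj N ?W)" "\<forall>y. ar y ?W Y \<longrightarrow> B ?W Y y s = l (R y)"
    using B_represent[OF W(2) XY(2), of "\<lambda>y. l (R y)"] by (auto simp: R.add R.scale l.add l.scale)
  have "h = s \<cdot> v"
  proof (rule B_nondegenerate_eq[OF hW cmp_ar[OF v s(1)] W(2)])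
    fix x assume x: "ar x ?W X"
    have "B ?W X x (s \<cdot> v) = B ?W Y (v \<cdot> x) s" by (rule B_nat_right[OF v x s(1), symmetric])
    then show "B ?W X x h = B ?W X x (s \<cdot> v)" using s(2) cmp_ar[OF x v] \<mu>[OF x] by simp
  qed
  then show ?thesis using s(1) W by auto
qed

end

text \<open>Used contrapositively: in a finite-dimensional algebra some power of an element lies in
  the span of the higher powers.\<close>

lemma (in vector_space) independent_descending:
  fixes p :: "nat \<Rightarrow> 'b"
  assumes "\<And>n. p n \<notin> span (p ` {n<..})"
  shows "independent (p ` {n..<n + k}) \<and> card (p ` {n..<n + k}) = k"
proof (induct k arbitrary: n)
  case (Suc k)
  have eq: "p ` {n..<n + Suc k} = insert (p n) (p ` {Suc n..<Suc n + k})"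
    by (subst image_insert[symmetric]) (intro arg_cong[where f = "image p"], auto)
  have "p n \<notin> span (p ` {Suc n..<Suc n + k})"
    using assms[of n] span_mono[of "p ` {Suc n..<Suc n + k}" "p ` {n<..}"] by force
  then show ?case unfolding eq using Suc[of "Suc n"] span_base[of "p n" "p ` {Suc n..<Suc n + k}"]
    by (metis card_insert_disjoint finite_atLeastLessThan finite_imageI independent_insertI)
qed (simp add: independent_empty)

subsection \<open>Powers of an endomorphism\<close>

context lcat begin

primrec pw :: "'o \<Rightarrow> 'm \<Rightarrow> nat \<Rightarrow> 'm" where
  "pw X f 0 = \<iota> X" | "pw X f (Suc n) = f \<cdot> pw X f n"

lemma pw_ar: "ar f X X \<Longrightarrow> ar (pw X f n) X X"
  by (induct n) (auto intro: id_ar cmp_ar dest: arD)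

lemma pw_commute:
  assumes "ar f X X" "ar g X X" "g \<cdot> f = f \<cdot> g"
  shows "g \<cdot> pw X f n = pw X f n \<cdot> g"
proof (induct n)
  case (Suc n)
  note p = pw_ar[OF assms(1), of n]
  show ?case
    using assoc[OF p assms(1,2)] assoc[OF p assms(2,1)] assoc[OF assms(2) p assms(1)] assms(3) Suc by simp
qed (use id_left[OF assms(2)] id_right[OF assms(2)] in simp)

lemma pw_add:
  assumes "ar f X X"
  shows "pw X f (m + n) = pw X f m \<cdot> pw X f n"
  by (induct m) (use id_left[OF pw_ar[OF assms]] assoc[OF pw_ar[OF assms] pw_ar[OF assms] assms] in auto)

text \<open>The inverse is the finite geometric series in \<open>f\<close>.\<close>

lemma nilpotent_iso:
  assumes f: "ar f X X" and "pw X f n = 0"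
  shows "iso (\<iota> X - f) X X"
proof -
  have X: "X \<in> obj C" and 1: "ar (\<iota> X) X X" using arD[OF f] id_ar by auto
  note p = pw_ar[OF f]
  let ?s = "\<lambda>n. \<Sum>i<n. pw X f i"
  have s: "ar (?s n) X X" for n using X p by (intro sum_ar) auto
  have a: "(\<iota> X - f) \<cdot> ?s n = \<iota> X - pw X f n" for n
  proof (induct n)
    case 0
    show ?case using cmp_zero_right[OF X diff_ar[OF 1 f]] by simp
  next
    case (Suc n)
    have "(\<iota> X - f) \<cdot> pw X f n = pw X f n - pw X f (Suc n)"
      using cmp_diff_left[OF p 1 f] id_left[OF p] by simp
    then show ?case using Suc cmp_add_right[OF s p diff_ar[OF 1 f], of n n] by simp
  qed
  have "f \<cdot> ?s n = ?s n \<cdot> f"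
    using cmp_sum_right[OF X f, of "{..<n}" "pw X f"] cmp_sum_left[OF X f, of "{..<n}" "pw X f"] p pw_commute[OF f f refl] by simp
  then have "?s n \<cdot> (\<iota> X - f) = (\<iota> X - f) \<cdot> ?s n"
    using cmp_diff_right[OF 1 f s] cmp_diff_left[OF s 1 f] id_left[OF s] id_right[OF s] by simp
  then show ?thesis using a[of n] assms(2) isoI[OF diff_ar[OF 1 f] s] by simp
qed

text \<open>Finite dimension expresses a power of \<open>f\<close> as the next power times some
  \<open>h\<close> commuting with \<open>f\<close>. Iterating this reaches twice the exponent, which
  is what makes the power of \<open>f\<close> times \<open>g\<close> idempotent.\<close>

lemma fitting:
  assumes f: "ar f X X" and b: "finite b" "hom C X X \<subseteq> V.span b"
  obtains n g where "ar g X X" "g \<cdot> f = f \<cdot> g" "pw X f (Suc n) = pw X f (Suc n) \<cdot> (pw X f (Suc n) \<cdot> g)"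
proof -
  have X: "X \<in> obj C" and 1: "ar (\<iota> X) X X" using arD[OF f] id_ar by auto
  note p = pw_ar[OF f]
  have "\<exists>n. pw X f n \<in> V.span (pw X f ` {n<..})"
  proof (rule ccontr)
    assume "\<not> ?thesis"
    then have "V.independent (pw X f ` {0..<0 + Suc (card b)}) \<and> card (pw X f ` {0..<0 + Suc (card b)}) = Suc (card b)"
      by (intro V.independent_descending) auto
    moreover have "pw X f ` {0..<0 + Suc (card b)} \<subseteq> V.span b" using b(2) p by (auto simp: ar_def)
    ultimately show False using V.independent_span_bound[OF b(1)] by fastforce
  qed
  then obtain n where n: "pw X f n \<in> V.span (pw X f ` {n<..})" by blast
  have "\<exists>h. ar h X X \<and> h \<cdot> f = f \<cdot> h \<and> x = pw X f (Suc n) \<cdot> h" if "x \<in> V.span (pw X f ` {n<..})" for x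
    using that
  proof (induct rule: V.span_induct_alt)
    case base
    show ?case
      using zero_ar[OF X X] cmp_zero_right[OF X f] cmp_zero_left[OF X f] cmp_zero_right[OF X p, of "Suc n"]
      by (intro exI[of _ 0]) auto
  next
    case (step c x y)
    then obtain h i where h: "ar h X X" "h \<cdot> f = f \<cdot> h" "y = pw X f (Suc n) \<cdot> h" and i: "n < i" "x = pw X f i" by auto
    let ?q = "pw X f (i - Suc n)"
    have x: "x = pw X f (Suc n) \<cdot> ?q" using i pw_add[OF f, of "Suc n" "i - Suc n"] by simp
    have "(scl C c ?q + h) \<cdot> f = f \<cdot> (scl C c ?q + h)"
      using cmp_lin_left[OF f p h(1)] cmp_lin_right[OF p h(1) f] h(2) pw_commute[OF f f refl] by simp
    then show ?case using cmp_lin_right[OF p h(1) p[of "Suc n"], of c "i - Suc n"] x h add_ar[OF scl_ar[OF p] h(1)] by (intro exI[of _ "scl C c ?q + h"]) auto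
  qed
  from this[OF n] obtain h where h: "ar h X X" "h \<cdot> f = f \<cdot> h" "pw X f n = pw X f (Suc n) \<cdot> h" by auto
  note q = pw_ar[OF h(1)]
  \<comment> \<open>A positive exponent, so that a factor \<open>f\<close> can be split off in
    \<open>loc_if_no_idempotents\<close>.\<close>
  let ?m = "Suc n"
  have m: "pw X f ?m = pw X f (?m + 1) \<cdot> h"
    using h(3) assoc[OF h(1) p[of "Suc n"] f] by simp
  have hk: "pw X f ?m = pw X f (?m + k) \<cdot> pw X h k" for k
  proof (induct k)
    case 0
    then show ?case using id_right[OF p[of ?m]] by simp
  next
    case (Suc k)
    have "pw X f (?m + k) = pw X f (k + ?m)" by (simp add: add.commute)
    also have "\<dots> = pw X f k \<cdot> (pw X f (?m + 1) \<cdot> h)" using pw_add[OF f, of k ?m] m by simp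
    also have "\<dots> = pw X f k \<cdot> pw X f (?m + 1) \<cdot> h" by (rule assoc[OF h(1) p p, symmetric])
    also have "\<dots> = pw X f (?m + Suc k) \<cdot> h" using pw_add[OF f, of k "?m + 1"] by (simp add: add.commute)
    finally have "pw X f (?m + k) = pw X f (?m + Suc k) \<cdot> h" .
    then show ?case using Suc assoc[OF q[of k] h(1) p[of "?m + Suc k"]] by simp
  qed
  have "pw X f ?m = pw X f (?m + ?m) \<cdot> pw X h ?m" by (rule hk)
  also have "\<dots> = pw X f ?m \<cdot> pw X f ?m \<cdot> pw X h ?m" by (simp only: pw_add[OF f])
  also have "\<dots> = pw X f ?m \<cdot> (pw X f ?m \<cdot> pw X h ?m)" by (rule assoc[OF q p p])
  finally have main: "pw X f ?m = pw X f ?m \<cdot> (pw X f ?m \<cdot> pw X h ?m)" .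
  show thesis by (rule that[OF q _ main]) (rule pw_commute[OF h(1) f h(2)[symmetric], symmetric])
qed

text \<open>The idempotent supplied by \<open>fitting\<close> is 0 or the identity; \<open>f\<close>
  is nilpotent in the former case and invertible in the latter.\<close>

lemma loc_if_no_idempotents:
  assumes X: "X \<in> obj C" "\<iota> X \<noteq> 0" and b: "finite b" "hom C X X \<subseteq> V.span b"
    and idem: "\<And>e. ar e X X \<Longrightarrow> e \<cdot> e = e \<Longrightarrow> e = 0 \<or> e = \<iota> X"
  shows "loc X"
  unfolding loc_def
proof (intro conjI allI impI X)
  fix f assume f: "ar f X X"
  note p = pw_ar[OF f]
  obtain n g where g: "ar g X X" "g \<cdot> f = f \<cdot> g" "pw X f (Suc n) = pw X f (Suc n) \<cdot> (pw X f (Suc n) \<cdot> g)"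
    using fitting[OF f b] by blast
  let ?p = "pw X f (Suc n)"
  note pg = cmp_ar[OF g(1) p[of "Suc n"]]
  have gp: "g \<cdot> ?p = ?p \<cdot> g" by (rule pw_commute[OF f g(1,2)])
  have "?p \<cdot> g \<cdot> (?p \<cdot> g) = ?p \<cdot> (g \<cdot> (?p \<cdot> g))" by (rule assoc[OF pg g(1) p])
  also have "g \<cdot> (?p \<cdot> g) = ?p \<cdot> g \<cdot> g" using assoc[OF g(1) p[of "Suc n"] g(1)] gp by simp
  also have "?p \<cdot> (?p \<cdot> g \<cdot> g) = ?p \<cdot> (?p \<cdot> g) \<cdot> g" using assoc[OF g(1) pg p[of "Suc n"]] by simp
  also have "\<dots> = ?p \<cdot> g" using g(3) by simp
  finally have "?p \<cdot> g = 0 \<or> ?p \<cdot> g = \<iota> X" by (rule idem[OF pg])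
  then show "iso f X X \<or> iso (\<iota> X - f) X X"
  proof
    assume "?p \<cdot> g = 0"
    then have "?p = 0" using g(3) cmp_zero_right[OF X(1) p, of "Suc n"] by simp
    then show ?thesis using nilpotent_iso[OF f] by blast
  next
    assume 1: "?p \<cdot> g = \<iota> X"
    let ?q = "pw X f n \<cdot> g"
    note q = cmp_ar[OF g(1) p[of n]]
    have "f \<cdot> ?q = \<iota> X" using assoc[OF g(1) p[of n] f] 1 by simp
    moreover have "?q \<cdot> f = f \<cdot> ?q"
      using assoc[OF f g(1) p[of n]] assoc[OF g(1) f p[of n]] assoc[OF g(1) p[of n] f] g(2) pw_commute[OF f f refl, of n] by simp
    ultimately show ?thesis using isoI[OF f q] by simp
  qed
qed

definition biprod where
  "biprod X A W i j p q \<longleftrightarrow> ar i A X \<and> ar j W X \<and> ar p X A \<and> ar q X W \<and> p \<cdot> i = \<iota> A \<and> q \<cdot> j = \<iota> W \<and>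
     p \<cdot> j = 0 \<and> q \<cdot> i = 0 \<and> i \<cdot> p + j \<cdot> q = \<iota> X"

lemma biprod_is_biproduct: "biprod X A W i j p q \<Longrightarrow> is_biproduct C X A W"
  unfolding biprod_def is_biproduct_def ar_def by blast

lemma biprod_swap: "biprod X A W i j p q \<Longrightarrow> biprod X W A j i q p"
  by (auto simp: biprod_def add.commute)

lemma biprod_isom:
  assumes "biprod X A W i j p q" "q = 0"
  shows "isom A X"
proof -
  have "i \<cdot> p = \<iota> X" using assms cmp_zero_right[of X j W X] by (auto simp: biprod_def ar_def)
  then show ?thesis using assms unfolding isom_def biprod_def by (blast intro: isoI)
qed

end

section \<open>Triangles read as exact Hom sequences\<close>

context lauto begin

text \<open>A substitute for distinguished triangles: besides the vanishing of consecutive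
  composites it records exactness of the functors Hom(W, -) at \<open>Y\<close>, \<open>Z\<close>
  and \<open>fobj F X\<close>.\<close>

definition tri :: "'o \<Rightarrow> 'o \<Rightarrow> 'o \<Rightarrow> 'm \<Rightarrow> 'm \<Rightarrow> 'm \<Rightarrow> bool" where
  "tri X Y Z u v w \<longleftrightarrow> ar u X Y \<and> ar v Y Z \<and> ar w Z (fobj F X) \<and>
     v \<cdot> u = 0 \<and> w \<cdot> v = 0 \<and> fmor F u \<cdot> w = 0 \<and>
     (\<forall>W g. ar g W Y \<longrightarrow> v \<cdot> g = 0 \<longrightarrow> (\<exists>t. ar t W X \<and> g = u \<cdot> t)) \<and>
     (\<forall>W g. ar g W Z \<longrightarrow> w \<cdot> g = 0 \<longrightarrow> (\<exists>t. ar t W Y \<and> g = v \<cdot> t)) \<and>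
     (\<forall>W g. ar g W (fobj F X) \<longrightarrow> fmor F u \<cdot> g = 0 \<longrightarrow> (\<exists>t. ar t W Z \<and> g = w \<cdot> t))"

text \<open>Exactness at \<open>fobj F X\<close> makes \<open>fmor F y\<close> factor through the
  connecting map, which is 0.\<close>

lemma tri_mono:
  assumes "tri X Y Z u v 0" "ar y W X" "u \<cdot> y = 0"
  shows "y = 0"
proof -
  have u: "ar u X Y" and z: "ar 0 Z (fobj F X)" using assms(1) by (auto simp: tri_def)
  have "fmor F u \<cdot> fmor F y = 0" using F_cmp[OF assms(2) u] assms(3) F_zero[OF arD(1)[OF u]] by simp
  then obtain t where t: "ar t (fobj F W) Z" "fmor F y = 0 \<cdot> t"
    using assms(1) F_ar[OF assms(2)] unfolding tri_def by blast
  then have "fmor F y = 0" using cmp_zero_left[OF arD(2)[OF z] t(1)] by simp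
  then show ?thesis by (rule F_eq_0[OF assms(2)])
qed

text \<open>With a vanishing connecting map the identity of \<open>Z\<close> lifts to a section
  \<open>j\<close>; the complement of \<open>j \<cdot> v\<close> is killed by \<open>v\<close> and
  lifts to a retraction \<open>p\<close>.\<close>

lemma tri_split:
  assumes t: "tri X Y Z u v 0"
  shows "\<exists>j p. biprod Y X Z u j p v"
proof -
  have u: "ar u X Y" and v: "ar v Y Z" and vu: "v \<cdot> u = 0" using t by (auto simp: tri_def)
  note Z = arD(2)[OF v] and Y = arD(1)[OF v] and X = arD(1)[OF u]
  have "0 \<cdot> \<iota> Z = 0" using cmp_zero_left[OF F_obj[OF X] id_ar[OF Z]] .
  then obtain j where j: "ar j Z Y" "\<iota> Z = v \<cdot> j" using t id_ar[OF Z] unfolding tri_def by blast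
  note jv = cmp_ar[OF v j(1)]
  note d = diff_ar[OF id_ar[OF Y] jv]
  have "v \<cdot> (\<iota> Y - j \<cdot> v) = 0"
    using cmp_diff_right[OF id_ar[OF Y] jv v] assoc[OF v j(1) v] j(2) id_left[OF v] id_right[OF v] by simp
  then obtain p where p: "ar p Y X" "\<iota> Y - j \<cdot> v = u \<cdot> p" using t d unfolding tri_def by blast
  have "u \<cdot> (p \<cdot> u - \<iota> X) = 0"
  proof -
    have "u \<cdot> (p \<cdot> u) = (\<iota> Y - j \<cdot> v) \<cdot> u" using assoc[OF u p(1) u] p(2) by simp
    also have "\<dots> = u" using cmp_diff_left[OF u id_ar[OF Y] jv] id_left[OF u] assoc[OF u v j(1)] vu cmp_zero_right[OF X j(1)] by simp
    finally show ?thesis using cmp_diff_right[OF cmp_ar[OF u p(1)] id_ar[OF X] u] id_right[OF u] by simp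
  qed
  then have pu: "p \<cdot> u = \<iota> X" using tri_mono[OF t diff_ar[OF cmp_ar[OF u p(1)] id_ar[OF X]]] by simp
  have "u \<cdot> (p \<cdot> j) = (\<iota> Y - j \<cdot> v) \<cdot> j" using assoc[OF j(1) p(1) u] p(2) by simp
  also have "\<dots> = 0" using cmp_diff_left[OF j(1) id_ar[OF Y] jv] id_left[OF j(1)] assoc[OF j(1) v j(1)] j(2) id_right[OF j(1)] by simp
  finally have "p \<cdot> j = 0" by (rule tri_mono[OF t cmp_ar[OF j(1) p(1)]])
  moreover have "u \<cdot> p + j \<cdot> v = \<iota> Y" using p(2) by (metis diff_add_cancel)
  ultimately show ?thesis unfolding biprod_def using u v j p pu vu by auto
qed

end

section \<open>Hereditary categories with Serre duality\<close>

text \<open>\<open>LE a\<close> and \<open>GE a\<close> stand for the objects with cohomology in degrees \<open>\<le> a\<close> and \<open>\<ge> a\<close>; the axiom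
  \<open>hereditary\<close> is the vanishing of \<open>Ext\<^sup>i\<close> for \<open>i \<ge> 2\<close>.\<close>

locale hered = lcat C + S: lauto C S Si + T: lauto C T Ti + serre_cat C "functor_comp T S" "functor_comp Si Ti" B
  for C :: "('o, 'm::ab_group_add, 'k::field) lincat" and S Si T Ti :: "('o, 'm) lfunctor" and B +
  fixes LE GE :: "int \<Rightarrow> 'o \<Rightarrow> bool"
  assumes tri_ex: "ar u X Y \<Longrightarrow> \<exists>Z v w. S.tri X Y Z u v w"
    and LE_isom: "LE a X \<Longrightarrow> isom X Y \<Longrightarrow> LE a Y"
    and GE_isom: "GE a X \<Longrightarrow> isom X Y \<Longrightarrow> GE a Y"
    and LE_S: "X \<in> obj C \<Longrightarrow> LE a X \<Longrightarrow> LE (a - 1) (fobj S X)"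
    and LE_Si: "X \<in> obj C \<Longrightarrow> LE a X \<Longrightarrow> LE (a + 1) (fobj Si X)"
    and GE_Si: "X \<in> obj C \<Longrightarrow> GE a X \<Longrightarrow> GE (a + 1) (fobj Si X)"
    and orth: "LE a X \<Longrightarrow> GE b Y \<Longrightarrow> a < b \<Longrightarrow> ar f X Y \<Longrightarrow> f = 0"
    and hereditary: "GE a X \<Longrightarrow> LE b Y \<Longrightarrow> b + 2 \<le> a \<Longrightarrow> ar f X Y \<Longrightarrow> f = 0"
    and trunc: "X \<in> obj C \<Longrightarrow> \<exists>A W u v w. S.tri A X W u v w \<and> LE a A \<and> GE (a + 1) W"
    and bounded: "X \<in> obj C \<Longrightarrow> \<exists>a b. GE a X \<and> LE b X"
begin

abbreviation "N \<equiv> functor_comp T S"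
abbreviation "Ni \<equiv> functor_comp Si Ti"

text \<open>The connecting map of the truncation triangle runs from degrees at least
  \<open>a + 1\<close> to degrees at most \<open>a - 1\<close>, so \<open>hereditary\<close> kills
  it. Every object is thus the direct sum of its two truncations.\<close>

lemma split:
  assumes "X \<in> obj C"
  obtains A W i j p q where "LE a A" "GE (a + 1) W" "biprod X A W i j p q"
proof -
  obtain A W u v w where t: "S.tri A X W u v w" "LE a A" "GE (a + 1) W" using trunc[OF assms] by blast
  have w: "ar w W (fobj S A)" and u: "ar u A X" using t(1) by (auto simp: S.tri_def)
  have "w = 0" using hereditary[OF t(3) LE_S[OF arD(1)[OF u] t(2)] _ w] by simp
  then show thesis using S.tri_split t that by blast
qed

lemma LE_if_orth:
  assumes "X \<in> obj C" "\<And>W f. GE (a + 1) W \<Longrightarrow> ar f X W \<Longrightarrow> f = 0"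
  shows "LE a X"
proof -
  obtain A W i j p q where *: "LE a A" "GE (a + 1) W" "biprod X A W i j p q" using split[OF assms(1)] by blast
  have "q = 0" using assms(2)[OF *(2)] *(3) by (auto simp: biprod_def)
  then show ?thesis using biprod_isom[OF *(3)] LE_isom[OF *(1)] by simp
qed

lemma GE_if_orth:
  assumes "X \<in> obj C" "\<And>W f. LE a W \<Longrightarrow> ar f W X \<Longrightarrow> f = 0"
  shows "GE (a + 1) X"
proof -
  obtain A W i j p q where *: "LE a A" "GE (a + 1) W" "biprod X A W i j p q" using split[OF assms(1)] by blast
  have "i = 0" using assms(2)[OF *(1)] *(3) by (auto simp: biprod_def)
  then have "\<iota> A = 0" using *(3) cmp_zero_right[of A p X A] by (auto simp: biprod_def ar_def)
  then have "p = 0" using *(3) ar_eq_0_if_target_0[of p X A] by (auto simp: biprod_def)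
  then show ?thesis using biprod_isom[OF biprod_swap[OF *(3)]] GE_isom[OF *(2)] by simp
qed

lemma hom_0_dual:
  assumes "X \<in> obj C" "Y \<in> obj C" "\<And>g. ar g Y (fobj N X) \<Longrightarrow> g = 0" "ar f X Y"
  shows "f = 0"
proof -
  have "\<exists>!f. ar f X Y \<and> (\<forall>g. ar g Y (fobj N X) \<longrightarrow> B X Y f g = 0)" by (rule B_ex1) (use assms in auto)
  moreover have "B X Y f g = 0" "B X Y 0 g = 0" if "ar g Y (fobj N X)" for g
    using assms(3)[OF that] B_zero_right[OF assms(4)] B_zero_right[OF zero_ar[OF assms(1,2)]] by auto
  ultimately show ?thesis using assms(4) zero_ar[OF assms(1,2)] by auto
qed

text \<open>Hom(Ni X, W) is dual to Hom(W, X), which vanishes by \<open>hereditary\<close> as soon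
  as \<open>W\<close> lives in degrees at least \<open>a + 2\<close>.\<close>

lemma LE_Ni:
  assumes X: "X \<in> obj C" and "LE a X"
  shows "LE (a + 1) (fobj Ni X)"
proof (rule LE_if_orth[OF N.G_obj[OF X]])
  fix W f assume W: "GE (a + 1 + 1) W" and f: "ar f (fobj Ni X) W"
  show "f = 0"
    by (rule hom_0_dual[OF arD(1,2)[OF f] _ f]) (use hereditary[OF W assms(2)] N.FG_obj[OF X] in auto)
qed

lemma GE_N:
  assumes X: "X \<in> obj C" and "GE a X"
  shows "GE (a - 1) (fobj N X)"
proof -
  have "GE (a - 2 + 1) (fobj N X)"
  proof (rule GE_if_orth[OF N.F_obj[OF X]])
    fix W f assume W: "LE (a - 2) W" and f: "ar f W (fobj N X)"
    show "f = 0"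
      by (rule B_nondegenerate[OF f X]) (use hereditary[OF assms(2) W] B_zero_left[OF arD(1)[OF f] X f] in auto)
  qed
  then show ?thesis by simp
qed

abbreviation "F \<equiv> functor_comp Ti S"
abbreviation "G \<equiv> functor_comp Si T"

text \<open>On objects \<open>F\<close> is \<open>S\<close> after \<open>Ni\<close> after
  \<open>S\<close>: each \<open>S\<close> lowers the bound by one and \<open>Ni\<close> raises it by
  one. This is what bounds Hom-spaces into the translates of an object under
  \<open>F\<close>.\<close>

lemma LE_F: assumes X: "X \<in> obj C" and "LE a X" shows "LE (a - 1) (fobj F X)"
proof -
  have SX: "fobj S X \<in> obj C" using S.F_obj[OF X] .
  have "LE (a - 1 + 1) (fobj Ni (fobj S X))" using LE_Ni[OF SX LE_S[OF X assms(2)]] .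
  then have "LE (a - 1) (fobj S (fobj Ni (fobj S X)))" using LE_S[OF N.G_obj[OF SX], of a] by simp
  then show ?thesis using S.FG_obj[OF T.G_obj[OF SX]] by (simp add: functor_comp_def)
qed

lemma GE_G: assumes X: "X \<in> obj C" and "GE a X" shows "GE (a + 1) (fobj G X)"
proof -
  have SX: "fobj Si X \<in> obj C" using S.G_obj[OF X] .
  have "GE a (fobj N (fobj Si X))" using GE_N[OF SX GE_Si[OF X assms(2)]] by simp
  then have "GE (a + 1) (fobj Si (fobj N (fobj Si X)))" using GE_Si[OF N.F_obj[OF SX]] by simp
  then show ?thesis using S.FG_obj[OF X] by (simp add: functor_comp_def)
qed

text \<open>The lower bound on cohomology prevents the upper bounds from decreasing forever, so some
  \<open>a\<close> is an upper bound while \<open>a - 1\<close> is not. Of the splitting at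
  \<open>a - 1\<close> only the upper summand can then be nonzero.\<close>

lemma pure_degree:
  assumes "indecomposable C X"
  obtains a where "LE a X" "GE a X"
proof -
  have X: "X \<in> obj C" "\<iota> X \<noteq> 0" using assms by (auto simp: indecomposable_def zero_object_def)
  obtain m M where mM: "GE m X" "LE M X" using bounded[OF X(1)] by blast
  have le: "m \<le> k" if "LE k X" for k
    using orth[OF that mM(1) _ id_ar[OF X(1)]] X(2) by (meson not_less)
  have "\<exists>a. LE a X \<and> \<not> LE (a - 1) X"
  proof (rule ccontr)
    assume "\<not> ?thesis"
    then have "LE (M - int k) X" for k
    proof (induct k)
      case (Suc k)
      then have "LE (M - int k - 1) X" by blast
      then show ?case by (simp add: algebra_simps)
    qed (use mM(2) in simp)
    from le[OF this[of "nat (M - m + 1)"]] show False using le[OF mM(2)] by simp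
  qed
  then obtain a where a: "LE a X" "\<not> LE (a - 1) X" by blast
  obtain A W i j p q where *: "LE (a - 1) A" "GE (a - 1 + 1) W" "biprod X A W i j p q" using split[OF X(1)] by blast
  have "zero_object C A \<or> zero_object C W"
    using assms biprod_is_biproduct[OF *(3)] *(3) unfolding indecomposable_def biprod_def ar_def by blast
  then have "p = 0 \<or> q = 0"
    using *(3) ar_eq_0_if_target_0 unfolding biprod_def zero_object_def by blast
  moreover have "q \<noteq> 0" using a(2) biprod_isom[OF *(3)] LE_isom[OF *(1)] by auto
  ultimately have "GE a X" using biprod_isom[OF biprod_swap[OF *(3)]] GE_isom[OF *(2)] by simp
  from that[OF a(1) this] show thesis .
qed

text \<open>The kernel of \<open>e\<close> in the heart, obtained by truncating a cocone of \<open>e\<close>.\<close>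

lemma heart_kernel:
  assumes X: "LE a X" "GE a X" and e: "ar e X X"
  obtains A k where "LE a A" "ar k A X" "e \<cdot> k = 0"
    "\<And>g. ar g X X \<Longrightarrow> e \<cdot> g = 0 \<Longrightarrow> \<exists>t. ar t X A \<and> g = k \<cdot> t"
    "\<And>W y. LE a W \<Longrightarrow> ar y W A \<Longrightarrow> k \<cdot> y = 0 \<Longrightarrow> y = 0"
proof -
  note oX = arD(1)[OF e]
  interpret Si: lauto C Si S by (rule S.swap)
  obtain Z v w where t: "S.tri X X Z e v w" using tri_ex[OF e] by blast
  have w: "ar w Z (fobj S X)" and v: "ar v X Z" and ew: "fmor S e \<cdot> w = 0" using t by (auto simp: S.tri_def)
  \<comment> \<open>The part of the third object \<open>Z\<close> below degree \<open>a\<close> is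
    the kernel moved down by one degree; \<open>Si\<close> brings it back to degree \<open>a\<close>
    at the end.\<close>
  obtain A W i j p q where *: "LE (a - 1) A" "GE (a - 1 + 1) W" "biprod Z A W i j p q"
    using split[OF arD(2)[OF v]] by blast
  have ar: "ar i A Z" "ar j W Z" "ar p Z A" "ar q Z W" and pi: "p \<cdot> i = \<iota> A" and ipjq: "i \<cdot> p + j \<cdot> q = \<iota> Z"
    using *(3) by (auto simp: biprod_def)
  note oA = arD(1)[OF ar(1)]
  note Se = S.F_ar[OF e]
  let ?k = "w \<cdot> i"
  note k = cmp_ar[OF ar(1) w]
  have ek: "fmor S e \<cdot> ?k = 0" using assoc[OF ar(1) w Se] ew cmp_zero_left[OF arD(2)[OF Se] ar(1)] by simp
  have lift: "\<exists>t. ar t (fobj S X) A \<and> g = ?k \<cdot> t" if g: "ar g (fobj S X) (fobj S X)" "fmor S e \<cdot> g = 0" for g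
  proof -
    obtain s where s: "ar s (fobj S X) Z" "g = w \<cdot> s" using t g unfolding S.tri_def by blast
    have "q \<cdot> s = 0" using orth[OF LE_S[OF oX X(1)] *(2) _ cmp_ar[OF s(1) ar(4)]] by simp
    then have "j \<cdot> q \<cdot> s = 0" using assoc[OF s(1) ar(4,2)] cmp_zero_right[OF arD(1)[OF s(1)] ar(2)] by simp
    then have "s = i \<cdot> (p \<cdot> s)"
      using ipjq id_left[OF s(1)] cmp_add_left[OF s(1) cmp_ar[OF ar(3,1)] cmp_ar[OF ar(4,2)]] assoc[OF s(1) ar(3,1)] by simp
    then have "g = ?k \<cdot> (p \<cdot> s)" using s(2) assoc[OF cmp_ar[OF s(1) ar(3)] ar(1) w] by simp
    then show ?thesis using cmp_ar[OF s(1) ar(3)] by blast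
  qed
  have mono: "y = 0" if y: "LE (a - 1) W" "ar y W A" "?k \<cdot> y = 0" for W y
  proof -
    have "w \<cdot> (i \<cdot> y) = 0" using assoc[OF y(2) ar(1) w] y(3) by simp
    then obtain z where z: "ar z W X" "i \<cdot> y = v \<cdot> z" using t cmp_ar[OF y(2) ar(1)] unfolding S.tri_def by blast
    have "z = 0" using orth[OF y(1) X(2) _ z(1)] by simp
    then have "i \<cdot> y = 0" using z(2) cmp_zero_right[OF arD(1)[OF y(2)] v] by simp
    then have "p \<cdot> i \<cdot> y = 0" using assoc[OF y(2) ar(1,3)] cmp_zero_right[OF arD(1)[OF y(2)] ar(3)] by simp
    then show ?thesis using pi id_left[OF y(2)] by simp
  qed
  let ?A = "fobj Si A" and ?k' = "fmor Si ?k"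
  have k': "ar ?k' ?A X" using Si.F_ar[OF k] S.GF_obj[OF oX] by simp
  have Sk': "fmor S ?k' = ?k" using S.FG[OF k] .
  have SA: "fobj S ?A = A" using S.FG_obj[OF oA] .
  show thesis
  proof (rule that[of ?A ?k'])
    show "LE a ?A" using LE_Si[OF oA *(1)] by simp
    show "ar ?k' ?A X" by (rule k')
    have "fmor S (e \<cdot> ?k') = 0" using S.F_cmp[OF k' e] Sk' ek by simp
    then show "e \<cdot> ?k' = 0" by (rule S.F_eq_0[OF cmp_ar[OF k' e]])
  next
    fix g assume g: "ar g X X" "e \<cdot> g = 0"
    have "fmor S e \<cdot> fmor S g = 0" using S.F_cmp[OF g(1) e] g(2) S.F_zero[OF oX] by simp
    then obtain s where s: "ar s (fobj S X) A" "fmor S g = ?k \<cdot> s" using lift[OF S.F_ar[OF g(1)]] by blast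
    have "g = ?k' \<cdot> fmor Si s" using S.GF[OF g(1)] s(2) Si.F_cmp[OF s(1) k] by simp
    then show "\<exists>t. ar t X ?A \<and> g = ?k' \<cdot> t" using Si.F_ar[OF s(1)] S.GF_obj[OF oX] by auto
  next
    fix W y assume y: "LE a W" "ar y W ?A" "?k' \<cdot> y = 0"
    have "?k \<cdot> fmor S y = 0" using S.F_cmp[OF y(2) k'] y(3) Sk' S.F_zero[OF oX] by simp
    moreover have "ar (fmor S y) (fobj S W) A" using S.F_ar[OF y(2)] SA by simp
    ultimately have "fmor S y = 0" using mono LE_S[OF arD(1)[OF y(2)] y(1)] by blast
    then show "y = 0" by (rule S.F_eq_0[OF y(2)])
  qed
qed

text \<open>The heart kernels of \<open>e\<close> and of its complement are complementary summands:
  each of the two idempotents factors through the kernel of the other, and the monomorphism property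
  of \<open>heart_kernel\<close> turns these factorizations into retractions.\<close>

lemma indecomposable_idempotent:
  assumes ind: "indecomposable C X" and e: "ar e X X" "e \<cdot> e = e"
  shows "e = 0 \<or> e = \<iota> X"
proof -
  obtain a where a: "LE a X" "GE a X" using pure_degree[OF ind] .
  note oX = arD(1)[OF e(1)]
  note 1 = id_ar[OF oX]
  let ?f = "\<iota> X - e"
  note f = diff_ar[OF 1 e(1)]
  have ef: "e \<cdot> ?f = 0" using cmp_diff_right[OF 1 e(1,1)] id_right[OF e(1)] e(2) by simp
  have fe: "?f \<cdot> e = 0" using cmp_diff_left[OF e(1) 1 e(1)] id_left[OF e(1)] e(2) by simp
  obtain A k where k: "LE a A" "ar k A X" "e \<cdot> k = 0"
    "\<And>g. ar g X X \<Longrightarrow> e \<cdot> g = 0 \<Longrightarrow> \<exists>t. ar t X A \<and> g = k \<cdot> t"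
    "\<And>W y. LE a W \<Longrightarrow> ar y W A \<Longrightarrow> k \<cdot> y = 0 \<Longrightarrow> y = 0"
    using heart_kernel[OF a e(1)] by metis
  obtain A' k' where k': "LE a A'" "ar k' A' X" "?f \<cdot> k' = 0"
    "\<And>g. ar g X X \<Longrightarrow> ?f \<cdot> g = 0 \<Longrightarrow> \<exists>t. ar t X A' \<and> g = k' \<cdot> t"
    "\<And>W y. LE a W \<Longrightarrow> ar y W A' \<Longrightarrow> k' \<cdot> y = 0 \<Longrightarrow> y = 0"
    using heart_kernel[OF a f] by metis
  obtain r where r: "ar r X A" "?f = k \<cdot> r" using k(4)[OF f ef] by blast
  obtain r' where r': "ar r' X A'" "e = k' \<cdot> r'" using k'(4)[OF e(1) fe] by blast
  have fk: "?f \<cdot> k = k" using cmp_diff_left[OF k(2) 1 e(1)] id_left[OF k(2)] k(3) by simp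
  have ek': "e \<cdot> k' = k'" using cmp_diff_left[OF k'(2) 1 e(1)] id_left[OF k'(2)] k'(3) by simp
  have sec: "r \<cdot> k = \<iota> A"
    if "ar k A X" "ar r X A" "k \<cdot> r \<cdot> k = k" "LE a A" "\<And>y. ar y A A \<Longrightarrow> k \<cdot> y = 0 \<Longrightarrow> y = 0" for k r A
  proof -
    note rk = cmp_ar[OF that(1,2)] and 1 = id_ar[OF arD(1)[OF that(1)]]
    have "k \<cdot> (r \<cdot> k - \<iota> A) = 0" using cmp_diff_right[OF rk 1 that(1)] assoc[OF that(1,2,1)] that(3) id_right[OF that(1)] by simp
    then show ?thesis using that(5)[OF diff_ar[OF rk 1]] by simp
  qed
  have rk: "r \<cdot> k = \<iota> A" by (rule sec[OF k(2) r(1) _ k(1)]) (use fk r(2) k(5)[OF k(1)] in auto)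
  have rk': "r' \<cdot> k' = \<iota> A'" by (rule sec[OF k'(2) r'(1) _ k'(1)]) (use ek' r'(2) k'(5)[OF k'(1)] in auto)
  have "k \<cdot> (r \<cdot> k') = 0" using assoc[OF k'(2) r(1) k(2)] r(2) k'(3) by simp
  then have rk1: "r \<cdot> k' = 0" using k(5)[OF k'(1) cmp_ar[OF k'(2) r(1)]] by simp
  have "k' \<cdot> (r' \<cdot> k) = 0" using assoc[OF k(2) r'(1) k'(2)] r'(2) k(3) by simp
  then have rk2: "r' \<cdot> k = 0" using k'(5)[OF k(1) cmp_ar[OF k(2) r'(1)]] by simp
  have "k \<cdot> r + k' \<cdot> r' = \<iota> X" using r(2) r'(2) by (metis diff_add_cancel)
  then have "biprod X A A' k k' r r'" unfolding biprod_def using k k' r r' rk rk' rk1 rk2 by auto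
  then have "is_biproduct C X A A'" by (rule biprod_is_biproduct)
  then have "zero_object C A \<or> zero_object C A'"
    using ind arD(1)[OF k(2)] arD(1)[OF k'(2)] unfolding indecomposable_def by blast
  then show ?thesis
  proof
    assume "zero_object C A"
    then have "r = 0" using ar_eq_0_if_target_0[OF r(1)] by (simp add: zero_object_def)
    then have "?f = 0" using r(2) cmp_zero_right[OF oX k(2)] by simp
    then show ?thesis by simp
  next
    assume "zero_object C A'"
    then have "r' = 0" using ar_eq_0_if_target_0[OF r'(1)] by (simp add: zero_object_def)
    then show ?thesis using r'(2) cmp_zero_right[OF oX k'(2)] by simp
  qed
qed

lemma loc_indecomposable: assumes "indecomposable C X" shows "loc X"
proof -
  have X: "X \<in> obj C" "\<iota> X \<noteq> 0" using assms by (auto simp: indecomposable_def zero_object_def)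
  obtain b where b: "V.independent b" "V.span b = hom C X X" using basis_hom[OF X(1) X(1)] by metis
  have "finite b" by (rule finite_basis_hom[OF X(1) X(1) b])
  then show ?thesis using loc_if_no_idempotents[OF X, of b] b(2) indecomposable_idempotent[OF assms] by blast
qed

text \<open>A Serre functor commutes with every automorphism, because \<open>T\<close> identifies
  Hom(X, Y) with Hom(T X, T Y) and duals have unique representing objects. Applied to
  \<open>N\<close>, which is \<open>T\<close> after \<open>S\<close>, this gives the claim after
  removing one \<open>T\<close>.\<close>

lemma S_T_commute:
  assumes X: "X \<in> obj C"
  shows "isom (fobj T (fobj S X)) (fobj S (fobj T X))"
proof -
  interpret Ti: lauto C Ti T by (rule T.swap)
  let ?Y = "fobj S (fobj T X)" and ?N = "fobj T (fobj S X)" and ?X = "fobj T X"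
  have obj: "?X \<in> obj C" "?Y \<in> obj C" "?N \<in> obj C" "fobj T ?Y \<in> obj C" "fobj T ?N \<in> obj C"
    using X S.F_obj T.F_obj by auto
  have NX: "fobj N X = ?N" "fobj N ?X = fobj T ?Y" by (simp_all add: functor_comp_def)
  note 1 = id_ar[OF obj(4)] and 2 = id_ar[OF obj(3)]
  \<comment> \<open>\<open>\<kappa>\<close> represents pairing with the identity of the Serre image
    of \<open>?X\<close>, pulled back along \<open>T\<close>; \<open>g\<close> represents the
    corresponding functional for \<open>X\<close>, pushed forward. Nondegeneracy shows that
    \<open>\<kappa>\<close> and \<open>fmor Ti g\<close> are mutually inverse.\<close>
  obtain \<kappa> where \<kappa>: "ar \<kappa> ?Y ?N" "\<And>f. ar f X ?Y \<Longrightarrow> B X ?Y f \<kappa> = B ?X (fobj T ?Y) (fmor T f) (\<iota> (fobj T ?Y))"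
    using B_represent[OF X obj(2), of "\<lambda>f. B ?X (fobj T ?Y) (fmor T f) (\<iota> (fobj T ?Y))"]
      T.F_lin[of _ X ?Y] B_lin_left[OF T.F_ar T.F_ar, of _ X ?Y _ "\<iota> (fobj T ?Y)"] 1 NX by auto
  obtain g where g: "ar g (fobj T ?N) (fobj T ?Y)" "\<And>h. ar h ?X (fobj T ?N) \<Longrightarrow> B ?X (fobj T ?N) h g = B X ?N (fmor Ti h) (\<iota> ?N)"
  proof -
    have G: "ar (fmor Ti h) X ?N" if "ar h ?X (fobj T ?N)" for h by (rule T.G_ar'[OF that X obj(3)])
    have "\<exists>g. ar g (fobj T ?N) (fobj N ?X) \<and> (\<forall>h. ar h ?X (fobj T ?N) \<longrightarrow> B ?X (fobj T ?N) h g = B X ?N (fmor Ti h) (\<iota> ?N))"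
      using Ti.F_lin[of _ ?X "fobj T ?N"] B_lin_left[OF G G, of _ _ "\<iota> ?N"] 2 NX
      by (intro B_represent[OF obj(1,5)]) auto
    then show thesis using that NX by auto
  qed
  let ?\<kappa> = "fmor Ti g"
  have k': "ar ?\<kappa> ?N ?Y" by (rule T.G_ar'[OF g(1) obj(3,2)])
  have Tk': "fmor T ?\<kappa> = g" using T.FG[OF g(1)] .
  have "\<kappa> \<cdot> ?\<kappa> = \<iota> ?N"
  proof (rule B_nondegenerate_eq[of _ ?N X])
    show "ar (\<kappa> \<cdot> ?\<kappa>) ?N (fobj N X)" "ar (\<iota> ?N) ?N (fobj N X)" "X \<in> obj C"
      using cmp_ar[OF k' \<kappa>(1)] 2 NX X by auto
    fix f assume f: "ar f X ?N"
    have "B X ?N f (\<kappa> \<cdot> ?\<kappa>) = B X ?Y (?\<kappa> \<cdot> f) \<kappa>" using B_nat_right[OF k' f, of \<kappa>] \<kappa>(1) NX by simp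
    also have "\<dots> = B ?X (fobj T ?Y) (g \<cdot> fmor T f) (\<iota> (fobj T ?Y))"
      using \<kappa>(2)[OF cmp_ar[OF f k']] T.F_cmp[OF f k'] Tk' by simp
    also have "\<dots> = B ?X (fobj T ?N) (fmor T f) g"
      using B_nat_right[OF g(1) T.F_ar[OF f], of "\<iota> (fobj T ?Y)"] 1 NX id_left[OF g(1)] by simp
    also have "\<dots> = B X ?N f (\<iota> ?N)" using g(2)[OF T.F_ar[OF f]] T.GF[OF f] by simp
    finally show "B X ?N f (\<kappa> \<cdot> ?\<kappa>) = B X ?N f (\<iota> ?N)" .
  qed
  moreover have "?\<kappa> \<cdot> \<kappa> = \<iota> ?Y"
  proof -
    have Tk: "ar (fmor T \<kappa>) (fobj T ?Y) (fobj T ?N)" using T.F_ar[OF \<kappa>(1)] .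
    have "g \<cdot> fmor T \<kappa> = \<iota> (fobj T ?Y)"
    proof (rule B_nondegenerate_eq[of _ "fobj T ?Y" ?X])
      show "ar (g \<cdot> fmor T \<kappa>) (fobj T ?Y) (fobj N ?X)" "ar (\<iota> (fobj T ?Y)) (fobj T ?Y) (fobj N ?X)" "?X \<in> obj C"
        using cmp_ar[OF Tk g(1)] 1 NX obj by auto
      fix h assume h: "ar h ?X (fobj T ?Y)"
      note f = T.G_ar'[OF h X obj(2)]
      have "B ?X (fobj T ?Y) h (g \<cdot> fmor T \<kappa>) = B ?X (fobj T ?N) (fmor T \<kappa> \<cdot> h) g"
        using B_nat_right[OF Tk h, of g] g(1) NX by simp
      also have "\<dots> = B X ?N (fmor Ti (fmor T \<kappa> \<cdot> h)) (\<iota> ?N)" using g(2)[OF cmp_ar[OF h Tk]] by simp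
      also have "\<dots> = B X ?N (\<kappa> \<cdot> fmor Ti h) (\<iota> ?N)" using Ti.F_cmp[OF h Tk] T.GF[OF \<kappa>(1)] by simp
      also have "\<dots> = B X ?Y (fmor Ti h) \<kappa>" using B_nat_right[OF \<kappa>(1) f, of "\<iota> ?N"] 2 NX id_left[OF \<kappa>(1)] by simp
      also have "\<dots> = B ?X (fobj T ?Y) h (\<iota> (fobj T ?Y))" using \<kappa>(2)[OF f] T.FG[OF h] by simp
      finally show "B ?X (fobj T ?Y) h (g \<cdot> fmor T \<kappa>) = B ?X (fobj T ?Y) h (\<iota> (fobj T ?Y))" .
    qed
    then have "fmor Ti (g \<cdot> fmor T \<kappa>) = \<iota> ?Y" using Ti.F_id[OF obj(4)] T.GF_obj[OF obj(2)] by simp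
    then show ?thesis using Ti.F_cmp[OF Tk g(1)] T.GF[OF \<kappa>(1)] by simp
  qed
  ultimately show ?thesis using isoI[OF k' \<kappa>(1)] unfolding isom_def by blast
qed

text \<open>A functional \<open>\<phi>\<close> on End(X) that kills all nonunits but not the
  identity is represented by a map \<open>w\<close> from \<open>X\<close> to \<open>N X\<close>.
  Pairing with \<open>w\<close> cannot see maps that do not split, so these compose to 0 with
  \<open>w\<close> and lift along the triangle on \<open>fmor Si w\<close>. The properties on the
  side of \<open>A\<close> need \<open>weak_cokernel\<close>.\<close>

lemma almost_split:
  assumes X: "loc X" and A: "A = fobj Si (fobj N X)"
  obtains E u v where "ar u A E" "ar v E X"
    "\<forall>W g. ar g W X \<longrightarrow> (\<forall>s. ar s X W \<longrightarrow> g \<cdot> s \<noteq> \<iota> X) \<longrightarrow> (\<exists>t. ar t W E \<and> g = v \<cdot> t)"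
    "\<forall>s. ar s X E \<longrightarrow> v \<cdot> s \<noteq> \<iota> X"
    "\<forall>W h. ar h A W \<longrightarrow> (\<forall>s. ar s W A \<longrightarrow> s \<cdot> h \<noteq> \<iota> A) \<longrightarrow> (\<exists>s. ar s E W \<and> h = s \<cdot> u)"
    "\<forall>s. ar s E A \<longrightarrow> s \<cdot> u \<noteq> \<iota> A"
    "\<forall>W h. ar h E W \<longrightarrow> h \<cdot> u = 0 \<longrightarrow> (\<exists>s. ar s X W \<and> h = s \<cdot> v)"
proof -
  interpret Si: lauto C Si S by (rule S.swap)
  interpret Ni: lauto C Ni N by (rule N.swap)
  have oX: "X \<in> obj C" using X by (simp add: loc_def)
  note 1 = id_ar[OF oX]
  define J where "J = {f. ar f X X \<and> \<not> iso f X X}"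
  have "V.subspace J"
    unfolding V.subspace_def J_def using zero_ar[OF oX oX] loc_zero_nonunit[OF X] add_ar loc_nonunit_add[OF X]
      scl_ar loc_nonunit_scl[OF X] by auto
  obtain b where b: "b \<subseteq> J" "V.independent b" "J \<subseteq> V.span b" using V.basis_exists[of J] by metis
  have sp: "V.span b = J" using b V.span_minimal[OF b(1) \<open>V.subspace J\<close>] by auto
  have "\<iota> X \<notin> J" using iso_id[OF oX] by (simp add: J_def)
  then have "V.independent (insert (\<iota> X) b)" using b(2) sp by (simp add: V.independent_insertI)
  then obtain \<phi> where \<phi>: "Vector_Spaces.linear (scl C) ((*) :: 'k \<Rightarrow> 'k \<Rightarrow> 'k) \<phi>"
    "\<forall>x\<in>insert (\<iota> X) b. \<phi> x = of_bool (x = \<iota> X)"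
    using V.exists_scalar_extension[of _ "\<lambda>x. of_bool (x = \<iota> X)"] by blast
  interpret \<phi>: Vector_Spaces.linear "scl C" "(*) :: 'k \<Rightarrow> 'k \<Rightarrow> 'k" \<phi> by (rule \<phi>(1))
  have \<phi>J: "\<phi> f = 0" if "f \<in> J" for f
  proof -
    have "f \<in> V.span b" using that sp by simp
    then show ?thesis
    proof (induct rule: V.span_induct_alt)
      case (step c x y)
      then have "x \<noteq> \<iota> X" using b(1) \<open>\<iota> X \<notin> J\<close> by auto
      then show ?case using step \<phi>(2) by (simp add: \<phi>.add \<phi>.scale)
    qed (simp add: \<phi>.zero)
  qed
  obtain w where w: "ar w X (fobj N X)" "\<And>f. ar f X X \<Longrightarrow> B X X f w = \<phi> f"
    using B_represent[OF oX oX, of \<phi>] by (auto simp: \<phi>.add \<phi>.scale)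
  have w0: "w \<noteq> 0" using w(2)[OF 1] \<phi>(2) B_zero_right[OF 1] by auto
  have oN: "fobj N X \<in> obj C" and oA: "A \<in> obj C" and SA: "fobj S A = fobj N X"
    using N.F_obj[OF oX] S.G_obj S.FG_obj A by auto
  let ?u0 = "fmor Si w"
  have u0: "ar ?u0 (fobj Si X) A" using Si.F_ar[OF w(1)] A by simp
  have Su0: "fmor S ?u0 = w" using S.FG[OF w(1)] .
  obtain E u v where "S.tri (fobj Si X) A E ?u0 u v" using tri_ex[OF u0] by blast
  then have u: "ar u A E" and v: "ar v E X" and uu0: "u \<cdot> ?u0 = 0" and wv: "w \<cdot> v = 0"
    and exA: "\<And>W g. ar g W A \<Longrightarrow> u \<cdot> g = 0 \<Longrightarrow> \<exists>t. ar t W (fobj Si X) \<and> g = ?u0 \<cdot> t"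
    and exE: "\<And>W g. ar g W E \<Longrightarrow> v \<cdot> g = 0 \<Longrightarrow> \<exists>t. ar t W A \<and> g = u \<cdot> t"
    and exX: "\<And>W g. ar g W X \<Longrightarrow> w \<cdot> g = 0 \<Longrightarrow> \<exists>t. ar t W E \<and> g = v \<cdot> t"
    unfolding S.tri_def Su0 S.FG_obj[OF oX] by blast+
  show thesis
  proof (rule that[OF u v]; intro allI impI)
    fix W g assume g: "ar g W X" and "\<forall>s. ar s X W \<longrightarrow> g \<cdot> s \<noteq> \<iota> X"
    note ns = this(2)[rule_format]
    have "w \<cdot> g = 0"
    proof (rule B_nondegenerate[OF cmp_ar[OF g w(1)] oX])
      fix f assume f: "ar f X W"
      have "\<not> iso (g \<cdot> f) X X"
      proof
        assume "iso (g \<cdot> f) X X"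
        then obtain z where z: "ar z X X" "g \<cdot> f \<cdot> z = \<iota> X" by (auto simp: iso_def)
        then show False using ns[OF cmp_ar[OF z(1) f]] assoc[OF z(1) f g] by simp
      qed
      then have "\<phi> (g \<cdot> f) = 0" using \<phi>J cmp_ar[OF f g] by (simp add: J_def)
      then show "B X W f (w \<cdot> g) = 0" using B_nat_right[OF g f w(1)] w(2)[OF cmp_ar[OF f g]] by simp
    qed
    then show "\<exists>t. ar t W E \<and> g = v \<cdot> t" by (rule exX[OF g])
  next
    fix s assume s: "ar s X E"
    show "v \<cdot> s \<noteq> \<iota> X"
    proof
      assume "v \<cdot> s = \<iota> X"
      then have "w = w \<cdot> v \<cdot> s" using assoc[OF s v w(1)] id_right[OF w(1)] by simp
      then show False using wv cmp_zero_left[OF oN s] w0 by simp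
    qed
  next
    fix W h assume h: "ar h A W" and "\<forall>s. ar s W A \<longrightarrow> s \<cdot> h \<noteq> \<iota> A"
    note ns = this(2)[rule_format]
    note oW = arD(2)[OF h]
    \<comment> \<open>Chosen so that \<open>N\<close> maps \<open>?h\<close> to
      \<open>fmor S h\<close>; naturality of the pairing in its first argument then turns a map out
      of \<open>A\<close> into an endomorphism of \<open>X\<close>.\<close>
    let ?M = "fobj Ni (fobj S W)" and ?h = "fmor Ni (fmor S h)"
    have Sh: "ar (fmor S h) (fobj N X) (fobj S W)" using S.F_ar[OF h] SA by simp
    have h': "ar ?h X ?M" using Ni.F_ar[OF Sh] N.GF_obj[OF oX] by simp
    have Nh: "fmor N ?h = fmor S h" using N.FG[OF Sh] .
    have NM: "fobj N ?M = fobj S W" using N.FG_obj[OF S.F_obj[OF oW]] .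
    have "fmor S h \<cdot> w = 0"
    proof (rule B_nondegenerate[of _ X ?M])
      show "ar (fmor S h \<cdot> w) X (fobj N ?M)" using cmp_ar[OF w(1) Sh] NM by simp
      show "?M \<in> obj C" using arD(2)[OF h'] .
      fix f assume f: "ar f ?M X"
      have "\<not> iso (f \<cdot> ?h) X X"
      proof
        assume "iso (f \<cdot> ?h) X X"
        then obtain z where z: "ar z X X" "z \<cdot> (f \<cdot> ?h) = \<iota> X" by (auto simp: iso_def)
        note zf = cmp_ar[OF f z(1)]
        have "fmor N (z \<cdot> f) \<cdot> fmor S h = \<iota> (fobj N X)"
          using N.F_cmp[OF h' zf] Nh assoc[OF h' f z(1)] z(2) N.F_id[OF oX] by simp
        moreover have q: "ar (fmor N (z \<cdot> f)) (fobj S W) (fobj N X)" using N.F_ar[OF zf] NM by simp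
        ultimately have "fmor Si (fmor N (z \<cdot> f)) \<cdot> h = \<iota> A"
          using Si.F_cmp[OF Sh q] S.GF[OF h] Si.F_id[OF oN] A by simp
        moreover have "ar (fmor Si (fmor N (z \<cdot> f))) W A" using Si.F_ar[OF q] S.GF_obj[OF oW] A by simp
        ultimately show False using ns by blast
      qed
      then have "\<phi> (f \<cdot> ?h) = 0" using \<phi>J cmp_ar[OF h' f] by (simp add: J_def)
      then show "B ?M X f (fmor S h \<cdot> w) = 0"
        using B_nat_left[OF h' f w(1)] Nh w(2)[OF cmp_ar[OF h' f]] by simp
    qed
    then have "fmor S (h \<cdot> ?u0) = 0" using S.F_cmp[OF u0 h] Su0 by simp
    then have "h \<cdot> ?u0 = 0" by (rule S.F_eq_0[OF cmp_ar[OF u0 h]])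
    then show "\<exists>s. ar s E W \<and> h = s \<cdot> u" by (rule weak_cokernel[OF u0 u h _ exA])
  next
    fix s assume s: "ar s E A"
    show "s \<cdot> u \<noteq> \<iota> A"
    proof
      assume "s \<cdot> u = \<iota> A"
      then have "?u0 = s \<cdot> (u \<cdot> ?u0)" using assoc[OF u0 u s] id_left[OF u0] by simp
      then have "?u0 = 0" using uu0 cmp_zero_right[OF arD(1)[OF u0] s] by simp
      then show False using Su0 w0 S.F_zero[OF oX] by simp
    qed
  next
    fix W h assume h: "ar h E W" "h \<cdot> u = 0"
    show "\<exists>s. ar s X W \<and> h = s \<cdot> v" by (rule weak_cokernel[OF u v h exE])
  qed
qed

end

section \<open>Orbit categories\<close>

context lauto begin

abbreviation "P i \<equiv> fpow F G i"

lemma fpow_0: "fobj (P 0) X = X" "fmor (P 0) f = f" by (simp_all add: fpow_def)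

lemma funpow_G: "X \<in> obj C \<Longrightarrow> (fobj G ^^ n) X \<in> obj C"
  by (induct n) (auto simp: G_obj)

lemma funpow_G_ar: "ar f X Y \<Longrightarrow> ar ((fmor G ^^ n) f) ((fobj G ^^ n) X) ((fobj G ^^ n) Y)"
  by (induct n) (auto simp: G_ar)

text \<open>\<open>fpow\<close> branches on the sign of the exponent; this recursion is uniform
  across 0, where one \<open>F\<close> cancels one \<open>G\<close>.\<close>

lemma fpow_Suc:
  "X \<in> obj C \<Longrightarrow> fobj (P (i + 1)) X = fobj F (fobj (P i) X)"
  "ar f X Y \<Longrightarrow> fmor (P (i + 1)) f = fmor F (fmor (P i) f)"
proof -
  consider "0 \<le> i" | n where "i = - int (Suc n)" by (metis int_cases negative_zle_0 nonneg_int_cases of_nat_0_le_iff)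
  then have "(X \<in> obj C \<longrightarrow> fobj (P (i + 1)) X = fobj F (fobj (P i) X)) \<and>
    (ar f X Y \<longrightarrow> fmor (P (i + 1)) f = fmor F (fmor (P i) f))"
  proof cases
    case 1
    then have "nat (i + 1) = Suc (nat i)" by simp
    with 1 show ?thesis by (simp add: fpow_def)
  next
    case (2 n)
    have ni: "nat (- i) = Suc n" "i < 0" using 2 by auto
    have i: "fobj (P i) = fobj G ^^ Suc n" "fmor (P i) = fmor G ^^ Suc n"
      using ni(2) unfolding fpow_def ni(1) by auto
    have i1: "fobj (P (i + 1)) = fobj G ^^ n" "fmor (P (i + 1)) = fmor G ^^ n"
      using 2 by (auto simp: fpow_def)
    show ?thesis
      unfolding i i1 using FG_obj[OF funpow_G, of X n] FG[OF funpow_G_ar, of f X Y n] by simp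
  qed
  then show "X \<in> obj C \<Longrightarrow> fobj (P (i + 1)) X = fobj F (fobj (P i) X)"
    "ar f X Y \<Longrightarrow> fmor (P (i + 1)) f = fmor F (fmor (P i) f)" by blast+
qed

lemma fpow_automorphism:
  "(X \<in> obj C \<longrightarrow> fobj (P i) X \<in> obj C \<and> fmor (P i) (\<iota> X) = \<iota> (fobj (P i) X)) \<and>
   (ar f X Y \<longrightarrow> ar (fmor (P i) f) (fobj (P i) X) (fobj (P i) Y) \<and>
      (ar f' X Y \<longrightarrow> fmor (P i) (scl C c f + f') = scl C c (fmor (P i) f) + fmor (P i) f') \<and>
      (ar g Y Z \<longrightarrow> fmor (P i) (g \<cdot> f) = fmor (P i) g \<cdot> fmor (P i) f))"
proof (induct i arbitrary: X Y Z f f' g c rule: int_induct[where k = 0])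
  case base
  then show ?case by (simp add: fpow_0)
next
  case (step1 i)
  note IH = step1(2)
  show ?case
  proof (intro conjI impI)
    assume X: "X \<in> obj C"
    show "fobj (P (i + 1)) X \<in> obj C" "fmor (P (i + 1)) (\<iota> X) = \<iota> (fobj (P (i + 1)) X)"
      using X IH[of X] fpow_Suc(1)[OF X, of i] fpow_Suc(2)[OF id_ar[OF X], of i] F_obj F_id by auto
  next
    assume f: "ar f X Y"
    have a: "ar (fmor (P i) f) (fobj (P i) X) (fobj (P i) Y)" using IH[where f = f and X = X and Y = Y] f by blast
    show "ar (fmor (P (i + 1)) f) (fobj (P (i + 1)) X) (fobj (P (i + 1)) Y)"
      using F_ar[OF a] fpow_Suc(1)[OF arD(1)[OF f]] fpow_Suc(1)[OF arD(2)[OF f]] fpow_Suc(2)[OF f] by simp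
    show "fmor (P (i + 1)) (scl C c f + f') = scl C c (fmor (P (i + 1)) f) + fmor (P (i + 1)) f'" if f': "ar f' X Y"
    proof -
      have a': "ar (fmor (P i) f') (fobj (P i) X) (fobj (P i) Y)" using IH[where f = f' and X = X and Y = Y] f' by blast
      have "fmor (P i) (scl C c f + f') = scl C c (fmor (P i) f) + fmor (P i) f'"
        using IH[where f = f and f' = f' and X = X and Y = Y] f f' by blast
      then show ?thesis using fpow_Suc(2)[OF f] fpow_Suc(2)[OF f'] fpow_Suc(2)[OF add_ar[OF scl_ar[OF f] f']] F_lin[OF a a'] by simp
    qed
    show "fmor (P (i + 1)) (g \<cdot> f) = fmor (P (i + 1)) g \<cdot> fmor (P (i + 1)) f" if g: "ar g Y Z"
    proof -
      have b: "ar (fmor (P i) g) (fobj (P i) Y) (fobj (P i) Z)" using IH[where f = g and X = Y and Y = Z] g by blast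
      have "fmor (P i) (g \<cdot> f) = fmor (P i) g \<cdot> fmor (P i) f"
        using IH[where f = f and g = g and X = X and Y = Y and Z = Z] f g by blast
      then show ?thesis using fpow_Suc(2)[OF f] fpow_Suc(2)[OF g] fpow_Suc(2)[OF cmp_ar[OF f g]] F_cmp[OF a b] by simp
    qed
  qed
next
  case (step2 i)
  note IH = step2(2)
  interpret G: lauto C G F by (rule swap)
  have X1: "fobj (P (i - 1)) X = fobj G (fobj (P i) X)" if "X \<in> obj C" for X
  proof -
    have "fobj (P (i - 1)) X \<in> obj C"
    proof -
      have "fobj (P (i - 1)) X = (fobj G ^^ nat (- (i - 1))) X" using step2(1) by (simp add: fpow_def)
      then show ?thesis using funpow_G[OF that] by simp
    qed
    then show ?thesis using fpow_Suc(1)[OF that, of "i - 1"] GF_obj by simp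
  qed
  have f1: "fmor (P (i - 1)) f = fmor G (fmor (P i) f)" if "ar f X Y" for f X Y
  proof -
    have "fmor (P (i - 1)) f = (fmor G ^^ nat (- (i - 1))) f" using step2(1) by (simp add: fpow_def)
    then show ?thesis using fpow_Suc(2)[OF that, of "i - 1"] GF[OF funpow_G_ar[OF that]] by simp
  qed
  show ?case
  proof (intro conjI impI)
    assume X: "X \<in> obj C"
    show "fobj (P (i - 1)) X \<in> obj C" "fmor (P (i - 1)) (\<iota> X) = \<iota> (fobj (P (i - 1)) X)"
      using X IH[of X] X1[OF X] f1[OF id_ar[OF X]] G.F_obj G.F_id by auto
  next
    assume f: "ar f X Y"
    have a: "ar (fmor (P i) f) (fobj (P i) X) (fobj (P i) Y)" using IH[where f = f and X = X and Y = Y] f by blast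
    show "ar (fmor (P (i - 1)) f) (fobj (P (i - 1)) X) (fobj (P (i - 1)) Y)"
      using G.F_ar[OF a] X1[OF arD(1)[OF f]] X1[OF arD(2)[OF f]] f1[OF f] by simp
    show "fmor (P (i - 1)) (scl C c f + f') = scl C c (fmor (P (i - 1)) f) + fmor (P (i - 1)) f'" if f': "ar f' X Y"
    proof -
      have a': "ar (fmor (P i) f') (fobj (P i) X) (fobj (P i) Y)" using IH[where f = f' and X = X and Y = Y] f' by blast
      have "fmor (P i) (scl C c f + f') = scl C c (fmor (P i) f) + fmor (P i) f'"
        using IH[where f = f and f' = f' and X = X and Y = Y] f f' by blast
      then show ?thesis using f1[OF f] f1[OF f'] f1[OF add_ar[OF scl_ar[OF f] f']] G.F_lin[OF a a'] by simp
    qed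
    show "fmor (P (i - 1)) (g \<cdot> f) = fmor (P (i - 1)) g \<cdot> fmor (P (i - 1)) f" if g: "ar g Y Z"
    proof -
      have b: "ar (fmor (P i) g) (fobj (P i) Y) (fobj (P i) Z)" using IH[where f = g and X = Y and Y = Z] g by blast
      have "fmor (P i) (g \<cdot> f) = fmor (P i) g \<cdot> fmor (P i) f"
        using IH[where f = f and g = g and X = X and Y = Y and Z = Z] f g by blast
      then show ?thesis using f1[OF f] f1[OF g] f1[OF cmp_ar[OF f g]] G.F_cmp[OF a b] by simp
    qed
  qed
qed

lemma fpow_obj: "X \<in> obj C \<Longrightarrow> fobj (P i) X \<in> obj C" using fpow_automorphism by blast
lemma fpow_ar: "ar f X Y \<Longrightarrow> ar (fmor (P i) f) (fobj (P i) X) (fobj (P i) Y)" using fpow_automorphism by blast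

lemma fpow_Pred:
  "X \<in> obj C \<Longrightarrow> fobj (P (i - 1)) X = fobj G (fobj (P i) X)"
  "ar f X Y \<Longrightarrow> fmor (P (i - 1)) f = fmor G (fmor (P i) f)"
  using fpow_Suc(1)[of X "i - 1"] GF_obj[OF fpow_obj, of X "i - 1"] fpow_Suc(2)[of f X Y "i - 1"] GF[OF fpow_ar, of f X Y "i - 1"] by auto

lemma fpow_add:
  "(X \<in> obj C \<longrightarrow> fobj (P (i + j)) X = fobj (P i) (fobj (P j) X)) \<and>
   (ar f X Y \<longrightarrow> fmor (P (i + j)) f = fmor (P i) (fmor (P j) f))"
proof (induct i rule: int_induct[where k = 0])
  case base
  then show ?case by (simp add: fpow_0)
next
  case (step1 i)
  have "i + 1 + j = (i + j) + 1" by simp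
  then show ?case using step1(2) fpow_Suc fpow_obj fpow_ar by metis
next
  case (step2 i)
  have "i - 1 + j = (i + j) - 1" by simp
  then show ?case using step2(2) fpow_Pred fpow_obj fpow_ar by metis
qed

lemma lauto_fpow: "lauto C (P i) (P (- i))"
proof -
  have "linear_endofunctor C (P i)" for i
    unfolding linear_endofunctor_def
  proof (intro conjI ballI allI)
    fix X assume X: "X \<in> obj C"
    show "fobj (P i) X \<in> obj C" "fmor (P i) (\<iota> X) = \<iota> (fobj (P i) X)" using X fpow_automorphism by blast+
    fix Y f assume Y: "Y \<in> obj C" and "f \<in> hom C X Y"
    then have f: "ar f X Y" using X by (simp add: ar_def)
    show "fmor (P i) f \<in> hom C (fobj (P i) X) (fobj (P i) Y)" using fpow_ar[OF f] by (simp add: ar_def)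
    show "fmor (P i) (scl C c f + f') = scl C c (fmor (P i) f) + fmor (P i) f'" if "f' \<in> hom C X Y" for c f'
      using fpow_automorphism[where f = f and f' = f' and X = X and Y = Y] f that by (auto simp: ar_def)
    show "fmor (P i) (g \<cdot> f) = fmor (P i) g \<cdot> fmor (P i) f" if "Z \<in> obj C" "g \<in> hom C Y Z" for Z g
      using fpow_automorphism[where f = f and g = g and X = X and Y = Y and Z = Z] f that by (auto simp: ar_def)
  qed
  moreover have "fobj (P (- i)) (fobj (P i) X) = X \<and> fobj (P i) (fobj (P (- i)) X) = X" if "X \<in> obj C" for X
    using fpow_add[of X "- i" i] fpow_add[of X i "- i"] that by (simp add: fpow_0)
  moreover have "fmor (P (- i)) (fmor (P i) f) = f \<and> fmor (P i) (fmor (P (- i)) f) = f" if "ar f X Y" for f X Y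
    using fpow_add[of X "- i" i f Y] fpow_add[of X i "- i" f Y] that by (simp add: fpow_0)
  ultimately show ?thesis using lcat_axioms
    unfolding lauto_def lauto_axioms_def inverse_automorphisms_def by (auto simp: ar_def)
qed

abbreviation "\<O> \<equiv> orbit_category C F G"

lemma orbit_simps:
  "obj \<O> = obj C" "scl \<O> = (\<lambda>c f i. scl C c (f i))" "ident \<O> X = (\<lambda>i. if i = 0 then \<iota> X else 0)"
  by (auto simp: orbit_category_def)

definition oar :: "(int \<Rightarrow> 'm) \<Rightarrow> 'o \<Rightarrow> 'o \<Rightarrow> bool" where
  "oar f X Y \<longleftrightarrow> X \<in> obj C \<and> Y \<in> obj C \<and> finite {i. f i \<noteq> 0} \<and> (\<forall>i. ar (f i) X (fobj (P i) Y))"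

lemma oar_hom: "X \<in> obj C \<Longrightarrow> Y \<in> obj C \<Longrightarrow> f \<in> hom \<O> X Y \<longleftrightarrow> oar f X Y"
  using fpow_obj by (auto simp: orbit_category_def oar_def ar_def)

lemma oarD: "oar f X Y \<Longrightarrow> ar (f i) X (fobj (P i) Y)" by (simp add: oar_def)

lemma fpow_oar: "oar g Y Z \<Longrightarrow> ar (fmor (P i) (g (l - i))) (fobj (P i) Y) (fobj (P l) Z)"
  using fpow_ar[OF oarD, of g Y Z i "l - i"] fpow_add[of Z i "l - i"] by (auto simp: oar_def)

lemma orbit_comp_ar:
  assumes "oar f X Y" "oar g Y Z"
  shows "ar (fmor (P i) (g (l - i)) \<cdot> f i) X (fobj (P l) Z)"
  by (rule cmp_ar[OF oarD[OF assms(1)] fpow_oar[OF assms(2)]])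

text \<open>Freedom in the choice of the index set lets composites with different supports be summed
  over a common range.\<close>

lemma orbit_comp:
  assumes "oar f X Y" "oar g Y Z" "finite I" "{i. f i \<noteq> 0} \<subseteq> I"
  shows "comp \<O> g f l = (\<Sum>i\<in>I. fmor (P i) (g (l - i)) \<cdot> f i)"
proof -
  have "fmor (P i) (g (l - i)) \<cdot> f i = 0" if "f i = 0" for i
    using cmp_zero_right[OF _ fpow_oar[OF assms(2)], of X i l] assms(1) that by (simp add: oar_def)
  then show ?thesis
    unfolding orbit_category_def lincat.simps using assms(3,4) by (intro sum.mono_neutral_left) auto
qed

lemma orbit_comp_oar:
  assumes f: "oar f X Y" and g: "oar g Y Z"
  shows "oar (comp \<O> g f) X Z"
proof -
  have fin: "finite {i. f i \<noteq> 0}" "finite {i. g i \<noteq> 0}" and obj: "X \<in> obj C" "Z \<in> obj C"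
    using f g by (auto simp: oar_def)
  note eq = orbit_comp[OF f g fin(1) subset_refl]
  have "{l. comp \<O> g f l \<noteq> 0} \<subseteq> (\<lambda>(i, j). i + j) ` ({i. f i \<noteq> 0} \<times> {i. g i \<noteq> 0})"
  proof
    fix l assume "l \<in> {l. comp \<O> g f l \<noteq> 0}"
    then obtain i where i: "f i \<noteq> 0" "fmor (P i) (g (l - i)) \<cdot> f i \<noteq> 0" unfolding eq
      by (auto elim: sum.not_neutral_contains_not_neutral)
    have "g (l - i) \<noteq> 0"
    proof
      assume "g (l - i) = 0"
      then have "fmor (P i) (g (l - i)) = 0" using lauto.F_zero[OF lauto_fpow obj(1)] by simp
      then show False using i(2) cmp_zero_left[OF fpow_obj[OF obj(2), of l] oarD[OF f]] by simp
    qed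
    with i(1) show "l \<in> (\<lambda>(i, j). i + j) ` ({i. f i \<noteq> 0} \<times> {i. g i \<noteq> 0})"
      by (intro image_eqI[of _ _ "(i, l - i)"]) auto
  qed
  moreover have "ar (comp \<O> g f l) X (fobj (P l) Z)" for l
    unfolding eq by (intro sum_ar obj fpow_obj orbit_comp_ar[OF f g])
  ultimately show ?thesis
    unfolding oar_def using obj fin by (auto intro: finite_subset)
qed

lemma id_oar: "X \<in> obj C \<Longrightarrow> oar (ident \<O> X) X X"
  using id_ar zero_ar fpow_obj by (auto simp: oar_def orbit_simps fpow_0)

text \<open>Both sides are sums over the degrees \<open>j\<close> of \<open>f\<close> and
  \<open>k\<close> of \<open>g\<close>, compared by the substitution \<open>i = j + k\<close> and
  the additivity of powers of \<open>F\<close>.\<close>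

lemma orbit_assoc:
  assumes f: "oar f W X" and g: "oar g X Y" and h: "oar h Y Z"
  shows "comp \<O> h (comp \<O> g f) = comp \<O> (comp \<O> h g) f"
proof
  fix l
  note gf = orbit_comp_oar[OF f g] and hg = orbit_comp_oar[OF g h]
  let ?f = "{i. f i \<noteq> 0}" and ?g = "{i. g i \<noteq> 0}"
  \<comment> \<open>The support of the composite is what \<open>orbit_comp\<close> requires; the
    sums of degrees are what the reindexing requires.\<close>
  define I where "I = {i. comp \<O> g f i \<noteq> 0} \<union> (\<lambda>(i, j). i + j) ` (?f \<times> ?g)"
  have fin: "finite ?f" "finite ?g" "finite I" using f g gf by (auto simp: oar_def I_def)
  have obj: "W \<in> obj C" "X \<in> obj C" "Y \<in> obj C" "Z \<in> obj C" using f g h by (auto simp: oar_def)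
  let ?t = "\<lambda>i j. fmor (P i) (h (l - i)) \<cdot> (fmor (P j) (g (i - j)) \<cdot> f j)"
  have "comp \<O> h (comp \<O> g f) l = (\<Sum>i\<in>I. fmor (P i) (h (l - i)) \<cdot> comp \<O> g f i)"
    by (rule orbit_comp[OF gf h fin(3)]) (simp add: I_def)
  also have "\<dots> = (\<Sum>i\<in>I. \<Sum>j\<in>?f. ?t i j)"
    unfolding orbit_comp[OF f g fin(1) subset_refl]
    by (intro sum.cong refl cmp_sum_right[OF obj(1) fpow_oar[OF h]] orbit_comp_ar[OF f g])
  also have "\<dots> = (\<Sum>j\<in>?f. \<Sum>i\<in>I. ?t i j)" by (rule sum.swap)
  also have "\<dots> = (\<Sum>j\<in>?f. fmor (P j) (comp \<O> h g (l - j)) \<cdot> f j)"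
  proof (rule sum.cong[OF refl])
    fix j assume j: "j \<in> ?f"
    have z: "?t i j = 0" if "g (i - j) = 0" for i
    proof -
      have "fmor (P j) (g (i - j)) = 0" using that lauto.F_zero[OF lauto_fpow obj(1)] by simp
      then have "fmor (P j) (g (i - j)) \<cdot> f j = 0"
        using cmp_zero_left[OF fpow_obj[OF obj(3), of i] oarD[OF f, of j]] by simp
      then show ?thesis using cmp_zero_right[OF obj(1) fpow_oar[OF h, of i l]] by simp
    qed
    have "(\<Sum>i\<in>I. ?t i j) = (\<Sum>i\<in>(\<lambda>k. j + k) ` ?g. ?t i j)"
    proof (rule sum.mono_neutral_right[OF fin(3)])
      show "(\<lambda>k. j + k) ` ?g \<subseteq> I" using j by (auto simp: I_def)
      show "\<forall>i\<in>I - (\<lambda>k. j + k) ` ?g. ?t i j = 0"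
      proof
        fix i assume "i \<in> I - (\<lambda>k. j + k) ` ?g"
        then have "i - j \<notin> ?g" using image_eqI[of i "\<lambda>k. j + k" "i - j" ?g] by auto
        then show "?t i j = 0" using z by simp
      qed
    qed
    also have "\<dots> = (\<Sum>k\<in>?g. ?t (j + k) j)" by (subst sum.reindex) (auto simp: inj_on_def)
    also have "\<dots> = (\<Sum>k\<in>?g. fmor (P j) (fmor (P k) (h (l - j - k)) \<cdot> g k) \<cdot> f j)"
    proof (rule sum.cong[OF refl])
      fix k
      note gk = oarD[OF g, of k]
      note hk = fpow_oar[OF h, of k "l - j"]
      note gj = fpow_ar[OF gk, of j] and hj = fpow_ar[OF hk, of j]
      have hh: "fmor (P (j + k)) (h (l - (j + k))) = fmor (P j) (fmor (P k) (h (l - j - k)))"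
        using fpow_add[where i = j and j = k and f = "h (l - (j + k))" and X = Y and Y = "fobj (P (l - (j + k))) Z"] oarD[OF h]
        by (simp add: algebra_simps)
      have "fmor (P j) (fmor (P k) (h (l - j - k)) \<cdot> g k) = fmor (P j) (fmor (P k) (h (l - j - k))) \<cdot> fmor (P j) (g k)"
        by (rule lauto.F_cmp[OF lauto_fpow gk hk])
      then show "?t (j + k) j = fmor (P j) (fmor (P k) (h (l - j - k)) \<cdot> g k) \<cdot> f j"
        using assoc[OF oarD[OF f, of j] gj hj] hh by simp
    qed
    also have "\<dots> = fmor (P j) (comp \<O> h g (l - j)) \<cdot> f j"
    proof -
      have "fmor (P j) (comp \<O> h g (l - j)) = (\<Sum>k\<in>?g. fmor (P j) (fmor (P k) (h (l - j - k)) \<cdot> g k))"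
        unfolding orbit_comp[OF g h fin(2) subset_refl]
        by (rule lauto.F_sum[OF lauto_fpow obj(2) fpow_obj[OF obj(4)] orbit_comp_ar[OF g h]])
      moreover have "(\<Sum>k\<in>?g. fmor (P j) (fmor (P k) (h (l - j - k)) \<cdot> g k)) \<cdot> f j =
          (\<Sum>k\<in>?g. fmor (P j) (fmor (P k) (h (l - j - k)) \<cdot> g k) \<cdot> f j)"
        by (rule cmp_sum_left[OF fpow_obj[OF fpow_obj[OF obj(4)]] oarD[OF f] fpow_ar[OF orbit_comp_ar[OF g h]]])
      ultimately show ?thesis by simp
    qed
    finally show "(\<Sum>i\<in>I. ?t i j) = fmor (P j) (comp \<O> h g (l - j)) \<cdot> f j" .
  qed
  also have "\<dots> = comp \<O> (comp \<O> h g) f l" by (rule orbit_comp[OF f hg fin(1) subset_refl, symmetric])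
  finally show "comp \<O> h (comp \<O> g f) l = comp \<O> (comp \<O> h g) f l" .
qed

lemma linear_orbit_category: "linear_category \<O>"
proof -
  have vs: "vector_space (scl \<O>)"
    unfolding orbit_simps
    by unfold_locales (auto simp: V.scale_right_distrib V.scale_left_distrib)
  interpret O: vector_space "scl \<O>" by (rule vs)
  have lin: "oar (\<lambda>i. scl C c (f i) + f' i) X Y" if "oar f X Y" "oar f' X Y" for c f f' X Y
  proof -
    have "{i. scl C c (f i) + f' i \<noteq> 0} \<subseteq> {i. f i \<noteq> 0} \<union> {i. f' i \<noteq> 0}" by auto
    then have "finite {i. scl C c (f i) + f' i \<noteq> 0}" using that finite_subset by (auto simp: oar_def)
    then show ?thesis using that add_ar[OF scl_ar] by (auto simp: oar_def)
  qed
  have zero: "oar 0 X Y" if "X \<in> obj C" "Y \<in> obj C" for X Y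
    using that zero_ar fpow_obj by (auto simp: oar_def)
  have sub: "O.subspace (hom \<O> X Y)" if "X \<in> obj C" "Y \<in> obj C" for X Y
  proof (rule O.subspaceI)
    show "0 \<in> hom \<O> X Y" using zero that oar_hom by simp
    show "f + g \<in> hom \<O> X Y" if "f \<in> hom \<O> X Y" "g \<in> hom \<O> X Y" for f g
      using lin[of f X Y g 1] that oar_hom \<open>X \<in> obj C\<close> \<open>Y \<in> obj C\<close> by (simp add: plus_fun_def)
    show "scl \<O> c f \<in> hom \<O> X Y" if "f \<in> hom \<O> X Y" for f c
      using lin[of f X Y 0 c] zero that oar_hom \<open>X \<in> obj C\<close> \<open>Y \<in> obj C\<close> by (simp add: orbit_simps)
  qed
  have idr: "comp \<O> f (ident \<O> X) = f" and idl: "comp \<O> (ident \<O> Y) f = f" if f: "oar f X Y" for f X Y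
  proof -
    have obj: "X \<in> obj C" "Y \<in> obj C" "finite {i. f i \<noteq> 0}" using f by (auto simp: oar_def)
    show "comp \<O> f (ident \<O> X) = f"
    proof
      fix l
      have "comp \<O> f (ident \<O> X) l = (\<Sum>i\<in>{0}. fmor (P i) (f (l - i)) \<cdot> ident \<O> X i)"
        by (rule orbit_comp[OF id_oar[OF obj(1)] f]) (auto simp: orbit_simps)
      then show "comp \<O> f (ident \<O> X) l = f l" using id_right[OF oarD[OF f, of l]] by (simp add: orbit_simps fpow_0)
    qed
    show "comp \<O> (ident \<O> Y) f = f"
    proof
      fix l
      have "comp \<O> (ident \<O> Y) f l = (\<Sum>i\<in>insert l {i. f i \<noteq> 0}. fmor (P i) (ident \<O> Y (l - i)) \<cdot> f i)"
        by (rule orbit_comp[OF f id_oar[OF obj(2)]]) (use obj in auto)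
      also have "\<dots> = (\<Sum>i\<in>insert l {i. f i \<noteq> 0}. if i = l then f l else 0)"
      proof (rule sum.cong[OF refl])
        fix i
        show "fmor (P i) (ident \<O> Y (l - i)) \<cdot> f i = (if i = l then f l else 0)"
          using id_left[OF oarD[OF f, of l]] lauto.F_id[OF lauto_fpow obj(2)] lauto.F_zero[OF lauto_fpow obj(1), of i]
            cmp_zero_left[OF fpow_obj[OF obj(2)] oarD[OF f, of i]] by (auto simp: orbit_simps)
      qed
      also have "\<dots> = f l" using obj(3) by simp
      finally show "comp \<O> (ident \<O> Y) f l = f l" .
    qed
  qed
  have linr: "comp \<O> g (scl \<O> c f + f') = scl \<O> c (comp \<O> g f) + comp \<O> g f'"
    if "oar f X Y" "oar f' X Y" "oar g Y Z" for f f' g c X Y Z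
  proof
    fix l
    define I where "I = {i. f i \<noteq> 0} \<union> {i. f' i \<noteq> 0}"
    have I: "finite I" using that by (auto simp: oar_def I_def)
    have eq: "scl \<O> c f + f' = (\<lambda>i. scl C c (f i) + f' i)" by (auto simp: orbit_simps)
    have "comp \<O> g (scl \<O> c f + f') l = (\<Sum>i\<in>I. fmor (P i) (g (l - i)) \<cdot> (scl C c (f i) + f' i))"
      unfolding eq by (rule orbit_comp[OF lin[OF that(1,2)] that(3) I]) (auto simp: I_def)
    also have "\<dots> = (\<Sum>i\<in>I. scl C c (fmor (P i) (g (l - i)) \<cdot> f i) + fmor (P i) (g (l - i)) \<cdot> f' i)"
      by (intro sum.cong refl cmp_lin_right[OF oarD[OF that(1)] oarD[OF that(2)] fpow_oar[OF that(3)]])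
    also have "\<dots> = scl C c (comp \<O> g f l) + comp \<O> g f' l"
      using orbit_comp[OF that(1,3) I] orbit_comp[OF that(2,3) I]
      by (simp add: I_def sum.distrib V.scale_sum_right)
    finally show "comp \<O> g (scl \<O> c f + f') l = (scl \<O> c (comp \<O> g f) + comp \<O> g f') l" by (simp add: orbit_simps)
  qed
  have linl: "comp \<O> (scl \<O> c g + g') f = scl \<O> c (comp \<O> g f) + comp \<O> g' f"
    if "oar f X Y" "oar g Y Z" "oar g' Y Z" for f g g' c X Y Z
  proof
    fix l
    define I where "I = {i. f i \<noteq> 0}"
    have I: "finite I" using that by (auto simp: oar_def I_def)
    have eq: "scl \<O> c g + g' = (\<lambda>i. scl C c (g i) + g' i)" by (auto simp: orbit_simps)
    have "comp \<O> (scl \<O> c g + g') f l = (\<Sum>i\<in>I. fmor (P i) (scl C c (g (l - i)) + g' (l - i)) \<cdot> f i)"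
      unfolding eq by (rule orbit_comp[OF that(1) lin[OF that(2,3)] I]) (auto simp: I_def)
    also have "\<dots> = (\<Sum>i\<in>I. scl C c (fmor (P i) (g (l - i)) \<cdot> f i) + fmor (P i) (g' (l - i)) \<cdot> f i)"
      by (intro sum.cong refl)
        (simp only: lauto.F_lin[OF lauto_fpow oarD[OF that(2)] oarD[OF that(3)]]
          cmp_lin_left[OF oarD[OF that(1)] fpow_oar[OF that(2)] fpow_oar[OF that(3)]])
    also have "\<dots> = scl C c (comp \<O> g f l) + comp \<O> g' f l"
      using orbit_comp[OF that(1,2) I] orbit_comp[OF that(1,3) I]
      by (simp add: I_def sum.distrib V.scale_sum_right)
    finally show "comp \<O> (scl \<O> c g + g') f l = (scl \<O> c (comp \<O> g f) + comp \<O> g' f) l" by (simp add: orbit_simps)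
  qed
  show ?thesis
    unfolding linear_category_def orbit_simps(1)
  proof (intro conjI ballI allI)
    show "vector_space (scl \<O>)" by (rule vs)
  qed (use sub id_oar idr idl orbit_comp_oar linr linl orbit_assoc in \<open>simp_all add: oar_hom\<close>)
qed

sublocale O: lcat \<O> by unfold_locales (rule linear_orbit_category)

lemma O_ar: "O.ar f X Y \<longleftrightarrow> oar f X Y"
  unfolding O.ar_def orbit_simps(1) using oar_hom by (auto simp: oar_def)

end

section \<open>Irreducible morphisms\<close>

context lcat begin

text \<open>Existence of an irreducible map without reference to dimensions; it matches a nonzero
  \<open>irr_dim\<close> only where Hom-spaces are finite-dimensional.\<close>

definition irr :: "'o \<Rightarrow> 'o \<Rightarrow> bool" where
  "irr X Y \<longleftrightarrow> X \<in> obj C \<and> Y \<in> obj C \<and> \<not> radical C X Y \<subseteq> radical_sq C X Y"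

lemma radical_iff:
  "X \<in> obj C \<Longrightarrow> Y \<in> obj C \<Longrightarrow>
    f \<in> radical C X Y \<longleftrightarrow> ar f X Y \<and> (\<forall>g. ar g Y X \<longrightarrow> iso (\<iota> X - g \<cdot> f) X X)"
  by (auto simp: radical_def ar_def iso_mor_iff)

lemma radical_transport:
  assumes f: "f \<in> radical C X Y" and a: "iso a X' X" and b: "iso b Y Y'" and o: "X \<in> obj C" "Y \<in> obj C"
  shows "b \<cdot> f \<cdot> a \<in> radical C X' Y'"
proof -
  have a1: "ar a X' X" and b1: "ar b Y Y'" and f1: "ar f X Y" using a b f o by (auto simp: iso_def radical_iff)
  note o' = arD(1)[OF a1] arD(2)[OF b1]
  have "iso (\<iota> X' - g \<cdot> (b \<cdot> f \<cdot> a)) X' X'" if g: "ar g Y' X'" for g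
  proof -
    note bf = cmp_ar[OF f1 b1]
    note gbf = cmp_ar[OF bf g]
    have "a \<cdot> (g \<cdot> (b \<cdot> f)) = a \<cdot> g \<cdot> b \<cdot> f"
      using assoc[OF bf g a1] assoc[OF f1 b1 cmp_ar[OF g a1]] by simp
    then have "iso (\<iota> X - a \<cdot> (g \<cdot> (b \<cdot> f))) X X"
      using f cmp_ar[OF b1 cmp_ar[OF g a1]] o by (simp add: radical_iff)
    then have "iso (\<iota> X' - g \<cdot> (b \<cdot> f) \<cdot> a) X' X'" by (rule iso_one_minus_swap[OF a1 gbf])
    then show ?thesis using assoc[OF a1 bf g] by simp
  qed
  then show ?thesis using radical_iff[OF o'] cmp_ar[OF a1 cmp_ar[OF f1 b1]] by blast
qed

lemma subspace_radical_sq: "V.subspace (radical_sq C X Y)"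
  unfolding radical_sq_def by (rule V.subspace_span)

lemma comp_radical_sq:
  "Z \<in> obj C \<Longrightarrow> f \<in> radical C X Z \<Longrightarrow> g \<in> radical C Z Y \<Longrightarrow> g \<cdot> f \<in> radical_sq C X Y"
  unfolding radical_sq_def by (rule V.span_base) blast

lemma radical_sq_induct [consumes 3, case_names zero step]:
  assumes "x \<in> radical_sq C X Y" "X \<in> obj C" "Y \<in> obj C"
    and "Q 0"
    and "\<And>c f g Z y. Z \<in> obj C \<Longrightarrow> f \<in> radical C X Z \<Longrightarrow> g \<in> radical C Z Y \<Longrightarrow> ar y X Y \<Longrightarrow> Q y \<Longrightarrow> Q (scl C c (g \<cdot> f) + y)"
  shows "Q x" "ar x X Y"
proof -
  have "ar x X Y \<and> Q x"
    using assms(1) unfolding radical_sq_def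
  proof (induct rule: V.span_induct_alt)
    case base
    then show ?case using assms zero_ar by simp
  next
    case (step c x y)
    then obtain f g Z where *: "x = g \<cdot> f" "Z \<in> obj C" "f \<in> radical C X Z" "g \<in> radical C Z Y" by blast
    then have "ar f X Z" "ar g Z Y" using assms(2,3) by (auto simp: radical_iff)
    then show ?case using * step assms(5) add_ar[OF scl_ar[OF cmp_ar]] by auto
  qed
  then show "Q x" "ar x X Y" by auto
qed

lemma radical_sq_transport:
  assumes f: "f \<in> radical_sq C X Y" and a: "iso a X' X" and b: "iso b Y Y'" and o: "X \<in> obj C" "Y \<in> obj C"
  shows "b \<cdot> f \<cdot> a \<in> radical_sq C X' Y'"
proof -
  have a1: "ar a X' X" and b1: "ar b Y Y'" using a b by (auto simp: iso_def)
  note o' = arD(1)[OF a1] arD(2)[OF b1]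
  from f o show ?thesis
  proof (induct rule: radical_sq_induct(1))
    case zero
    then show ?case using cmp_zero_right[OF o(1) b1] cmp_zero_left[OF o'(2) a1] V.subspace_0[OF subspace_radical_sq] by simp
  next
    case (step c f g Z y)
    have f: "ar f X Z" and g: "ar g Z Y" using step o by (auto simp: radical_iff)
    note gf = cmp_ar[OF f g]
    have lin: "b \<cdot> (scl C c (g \<cdot> f) + y) \<cdot> a = scl C c (b \<cdot> (g \<cdot> f) \<cdot> a) + b \<cdot> y \<cdot> a"
      using cmp_lin_right[OF gf step(4) b1] cmp_lin_left[OF a1 cmp_ar[OF gf b1] cmp_ar[OF step(4) b1]] by simp
    have "b \<cdot> (g \<cdot> f) \<cdot> a = b \<cdot> g \<cdot> \<iota> Z \<cdot> (\<iota> Z \<cdot> f \<cdot> a)"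
      using assoc[OF f g b1] assoc[OF a1 f cmp_ar[OF g b1]] id_left[OF f] id_right[OF cmp_ar[OF g b1]] by simp
    also have "\<dots> \<in> radical_sq C X' Y'"
      by (rule comp_radical_sq[OF step(1) radical_transport[OF step(2) a iso_id[OF step(1)] o(1) step(1)]
        radical_transport[OF step(3) iso_id[OF step(1)] b step(1) o(2)]])
    finally show ?case
      unfolding lin using step(5) V.subspace_add[OF subspace_radical_sq V.subspace_scale[OF subspace_radical_sq]] by blast
  qed
qed

lemma irr_isom:
  assumes "irr X Y" "isom X X'" "isom Y Y'"
  shows "irr X' Y'"
proof -
  obtain a where a: "iso a X' X" using isom_sym[OF assms(2)] by (auto simp: isom_def)
  then obtain a' where a': "ar a X' X" "ar a' X X'" "a' \<cdot> a = \<iota> X'" "a \<cdot> a' = \<iota> X" "iso a' X X'" by (rule isoE)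
  obtain b where b: "iso b Y Y'" using assms(3) by (auto simp: isom_def)
  then obtain b' where b': "ar b Y Y'" "ar b' Y' Y" "b' \<cdot> b = \<iota> Y" "b \<cdot> b' = \<iota> Y'" "iso b' Y' Y" by (rule isoE)
  obtain f where f: "f \<in> radical C X Y" "f \<notin> radical_sq C X Y" and o: "X \<in> obj C" "Y \<in> obj C"
    using assms(1) by (auto simp: irr_def)
  have f1: "ar f X Y" using f o by (simp add: radical_iff)
  note bf = cmp_ar[OF f1 b'(1)]
  note bfa = cmp_ar[OF a'(1) bf]
  have "b' \<cdot> (b \<cdot> f \<cdot> a) \<cdot> a' = f"
  proof -
    have "b' \<cdot> (b \<cdot> f \<cdot> a) \<cdot> a' = b' \<cdot> (b \<cdot> f \<cdot> (a \<cdot> a'))"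
      using assoc[OF a'(2) bfa b'(2)] assoc[OF a'(2,1) bf] by simp
    then show ?thesis using a'(4) id_right[OF bf] assoc[OF f1 b'(1,2)] b'(3) id_left[OF f1] by simp
  qed
  then have "b \<cdot> f \<cdot> a \<notin> radical_sq C X' Y'"
    using radical_sq_transport[OF _ a'(5) b'(5) arD(1)[OF a'(1)] arD(2)[OF b'(1)]] f(2) by metis
  then show ?thesis
    using radical_transport[OF f(1) a b o] arD(1)[OF a'(1)] arD(2)[OF b'(1)] by (auto simp: irr_def)
qed

text \<open>A decomposition yields the idempotent \<open>i \<cdot> p\<close>; if it is 0 then
  \<open>A\<close> is zero, and if it is the identity then \<open>W\<close> is zero.\<close>

lemma loc_indecomposable': assumes "loc X" shows "indecomposable C X"
proof -
  have "zero_object C A \<or> zero_object C W" if "A \<in> obj C" "W \<in> obj C" "is_biproduct C X A W" for A W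
  proof -
    note AW = that
    obtain i j p q where *: "ar i A X" "ar j W X" "ar p X A" "ar q X W" "p \<cdot> i = \<iota> A" "q \<cdot> j = \<iota> W"
      "p \<cdot> j = 0" "q \<cdot> i = 0"
      using AW assms unfolding is_biproduct_def loc_def ar_def by blast
    have z: "\<iota> A = 0" if "i \<cdot> p = 0" "ar i A X" "ar p X A" "p \<cdot> i = \<iota> A" for i p A
    proof -
      have "i = i \<cdot> p \<cdot> i" using assoc[OF that(2,3,2)] that(4) id_right[OF that(2)] by simp
      then have "i = 0" using that(1) cmp_zero_left[OF arD(2)[OF that(2)] that(2)] by simp
      then show ?thesis using that(4) cmp_zero_right[OF arD(1)[OF that(2)] that(3)] by simp
    qed
    note ip = cmp_ar[OF *(3,1)]
    have "i \<cdot> p \<cdot> (i \<cdot> p) = i \<cdot> p" using assoc[OF ip *(3,1)] assoc[OF *(3,1,3)] *(5) id_left[OF *(3)] by simp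
    then consider "i \<cdot> p = 0" | "i \<cdot> p = \<iota> X" using loc_idempotent[OF assms ip] by blast
    then show ?thesis
    proof cases
      case 1
      then show ?thesis using z[OF _ *(1,3,5)] by (simp add: zero_object_def)
    next
      case 2
      then have "j = i \<cdot> p \<cdot> j" using id_left[OF *(2)] by simp
      then have "j = 0" using assoc[OF *(2,3,1)] *(7) cmp_zero_right[OF arD(1)[OF *(2)] *(1)] by simp
      then show ?thesis using *(6) cmp_zero_right[OF arD(1)[OF *(2)] *(4)] by (simp add: zero_object_def)
    qed
  qed
  then show ?thesis using assms by (auto simp: indecomposable_def loc_def zero_object_def)
qed

end

section \<open>The cluster category\<close>

context hered begin

lemma FG_inverse: "inverse_automorphisms C F G"
  using lauto.inv[OF T.swap] S.inv by (rule inverse_automorphisms_comp)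

sublocale FG: lauto C F G by unfold_locales (rule FG_inverse)

abbreviation K where "K \<equiv> orbit_category C F G"
abbreviation P where "P i \<equiv> fpow F G i"
abbreviation kcmp (infixl "\<star>" 70) where "g \<star> f \<equiv> comp K g f"
abbreviation oar where "oar \<equiv> FG.oar"

lemma LE_P: "X \<in> obj C \<Longrightarrow> LE a X \<Longrightarrow> LE (a - int n) (fobj (P (int n)) X)"
proof (induct n)
  case (Suc n)
  then show ?case
    using LE_F[where X = "fobj (P (int n)) X" and a = "a - int n", OF FG.fpow_obj] FG.fpow_Suc(1)[of X "int n"] by (simp add: algebra_simps)
qed (simp add: FG.fpow_0)

lemma GE_P: "X \<in> obj C \<Longrightarrow> GE a X \<Longrightarrow> GE (a + int n) (fobj (P (- int n)) X)"
proof (induct n)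
  case (Suc n)
  then show ?case
    using GE_G[where X = "fobj (P (- int n)) X" and a = "a + int n", OF FG.fpow_obj] FG.fpow_Pred(1)[of X "- int n"]
    by (simp add: algebra_simps minus_diff_commute)
qed (simp add: FG.fpow_0)

lemma hom_P_high:
  assumes "GE a X" "LE b Y" "0 \<le> i" "b - a + 2 \<le> i" "ar f X (fobj (P i) Y)" "Y \<in> obj C"
  shows "f = 0"
proof -
  have "LE (b - i) (fobj (P i) Y)" using LE_P[OF assms(6,2), of "nat i"] assms(3) by simp
  then show ?thesis using hereditary[OF assms(1) _ _ assms(5)] assms(4) by simp
qed

lemma hom_P_low:
  assumes "LE a X" "GE b Y" "i \<le> 0" "a < b - i" "ar f X (fobj (P i) Y)" "Y \<in> obj C"
  shows "f = 0"
proof -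
  have "GE (b - i) (fobj (P i) Y)" using GE_P[OF assms(6,2), of "nat (- i)"] assms(3) by simp
  then show ?thesis using orth[OF assms(1) _ _ assms(5)] assms(4) by simp
qed

text \<open>Makes each Hom-space of the orbit category a finite sum of Hom-spaces of
  \<open>C\<close>.\<close>

lemma hom_P_bounded:
  assumes "X \<in> obj C" "Y \<in> obj C"
  obtains n where "\<forall>i f. ar f X (fobj (P i) Y) \<longrightarrow> i \<notin> {-n..n} \<longrightarrow> f = 0"
proof -
  obtain a b a' b' where *: "GE a X" "LE b X" "GE a' Y" "LE b' Y" using bounded[OF assms(1)] bounded[OF assms(2)] by blast
  define n where "n = max 0 (max (b' - a + 2) (b - a' + 1))"
  show thesis
  proof (rule that[of n], intro allI impI)
    fix i f assume f: "ar f X (fobj (P i) Y)" and "i \<notin> {-n..n}"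
    then consider "n < i" | "i < - n" by force
    then show "f = 0"
    proof cases
      case 1
      then show ?thesis using hom_P_high[OF *(1,4) _ _ f assms(2)] by (simp add: n_def)
    next
      case 2
      then show ?thesis using hom_P_low[OF *(2,3) _ _ f assms(2)] by (simp add: n_def)
    qed
  qed
qed

text \<open>\<open>X\<close> sits in a single degree and its i-th translate at least
  \<open>i\<close> degrees lower, so \<open>hereditary\<close> excludes \<open>i \<ge> 2\<close> and
  orthogonality excludes \<open>i < 0\<close>. Degree 1 may survive.\<close>

lemma end_degrees:
  assumes "indecomposable C X" "oar f X X" "i \<noteq> 0" "i \<noteq> 1"
  shows "f i = 0"
proof -
  have X: "X \<in> obj C" using assms(1) by (simp add: indecomposable_def)
  obtain a where a: "LE a X" "GE a X" using pure_degree[OF assms(1)] .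
  show ?thesis
    using hom_P_high[OF a(2,1) _ _ FG.oarD[OF assms(2), of i] X] hom_P_low[OF a _ _ FG.oarD[OF assms(2), of i] X] assms(3,4)
    by (cases "i \<le> 0") auto
qed

definition deg :: "int \<Rightarrow> 'm \<Rightarrow> int \<Rightarrow> 'm" where "deg n f = (\<lambda>i. if i = n then f else 0)"

lemma deg_oar: "ar f X (fobj (P n) Y) \<Longrightarrow> Y \<in> obj C \<Longrightarrow> oar (deg n f) X Y"
  using zero_ar FG.fpow_obj arD(1)[of f X "fobj (P n) Y"] by (auto simp: FG.oar_def deg_def)

lemma deg0_oar: "ar f X Y \<Longrightarrow> oar (deg 0 f) X Y"
  using deg_oar[of f X 0 Y] arD[of f X Y] by (simp add: FG.fpow_0)

lemma comp_deg: "oar g Y Z \<Longrightarrow> ar f X (fobj (P n) Y) \<Longrightarrow> (g \<star> deg n f) l = fmor (P n) (g (l - n)) \<cdot> f"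
  using FG.orbit_comp[OF deg_oar[of f X n Y], of g Z "{n}" l] by (simp add: deg_def FG.oar_def Collect_conv_if)

lemma comp_deg0_deg0: assumes "ar f X Y" "ar g Y Z" shows "deg 0 g \<star> deg 0 f = deg 0 (g \<cdot> f)"
proof
  fix l
  have "(deg 0 g \<star> deg 0 f) l = fmor (P 0) (deg 0 g (l - 0)) \<cdot> f"
    by (rule comp_deg[OF deg0_oar[OF assms(2)]]) (use assms(1) FG.fpow_0 in simp)
  then show "(deg 0 g \<star> deg 0 f) l = deg 0 (g \<cdot> f) l"
    using cmp_zero_left[OF arD(2)[OF assms(2)] assms(1)] by (simp add: deg_def FG.fpow_0)
qed

lemma ident_K: "ident K X = deg 0 (\<iota> X)" by (simp add: FG.orbit_simps deg_def)

lemma deg_eq_0: "deg n f = 0 \<longleftrightarrow> f = 0" by (auto simp: deg_def fun_eq_iff)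

text \<open>Placing morphisms in degree 0 preserves biproducts and detects zero objects, so a
  decomposition in \<open>C\<close> is one in \<open>K\<close>.\<close>

lemma indecomposable_K_imp: assumes "indecomposable K X" shows "indecomposable C X"
proof -
  have z: "zero_object K A \<longleftrightarrow> zero_object C A" for A by (simp add: zero_object_def ident_K deg_eq_0)
  have "is_biproduct K X A W" if AW: "is_biproduct C X A W" "A \<in> obj C" "W \<in> obj C" for A W
  proof -
    have X: "X \<in> obj C" using assms by (simp add: indecomposable_def FG.orbit_simps)
    obtain i j p q where *: "ar i A X" "ar j W X" "ar p X A" "ar q X W" "p \<cdot> i = \<iota> A" "q \<cdot> j = \<iota> W"
      "p \<cdot> j = 0" "q \<cdot> i = 0" "i \<cdot> p + j \<cdot> q = \<iota> X"
      using AW X unfolding is_biproduct_def ar_def by blast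
    have "deg 0 (i \<cdot> p) + deg 0 (j \<cdot> q) = deg 0 (\<iota> X)" using *(9) by (auto simp: deg_def)
    then have "deg 0 i \<star> deg 0 p + deg 0 j \<star> deg 0 q = ident K X"
      using comp_deg0_deg0[OF *(3,1)] comp_deg0_deg0[OF *(4,2)] by (simp add: ident_K)
    moreover have "deg 0 p \<star> deg 0 i = ident K A" "deg 0 q \<star> deg 0 j = ident K W" "deg 0 p \<star> deg 0 j = 0" "deg 0 q \<star> deg 0 i = 0"
      using comp_deg0_deg0[OF *(1,3)] comp_deg0_deg0[OF *(2,4)] comp_deg0_deg0[OF *(2,3)] comp_deg0_deg0[OF *(1,4)] *
      by (auto simp: ident_K deg_eq_0)
    moreover have "deg 0 i \<in> hom K A X" "deg 0 j \<in> hom K W X" "deg 0 p \<in> hom K X A" "deg 0 q \<in> hom K X W"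
      using deg0_oar * FG.oar_hom X AW by auto
    ultimately show ?thesis unfolding is_biproduct_def by blast
  qed
  then show ?thesis using assms unfolding indecomposable_def z FG.orbit_simps by blast
qed

text \<open>The only other contribution to degree 0 combines degree 1 of \<open>f\<close> with
  degree -1 of \<open>g\<close>, and the latter vanishes.\<close>

lemma comp_0: assumes "indecomposable C X" "oar f X X" "oar g X X" shows "(g \<star> f) 0 = g 0 \<cdot> f 0"
proof -
  have X: "X \<in> obj C" using assms(1) by (simp add: indecomposable_def)
  have "(g \<star> f) 0 = (\<Sum>i\<in>{0, 1}. fmor (P i) (g (0 - i)) \<cdot> f i)"
    by (rule FG.orbit_comp[OF assms(2,3)]) (use end_degrees[OF assms(1,2)] in auto)
  moreover have "g (- 1) = 0" using end_degrees[OF assms(1,3), of "-1"] by simp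
  moreover have "0 \<cdot> f 1 = 0" using cmp_zero_left[OF X FG.oarD[OF assms(2), of 1]] .
  ultimately show ?thesis using lauto.F_zero[OF FG.lauto_fpow X, of 1] by (simp add: FG.fpow_0)
qed

lemma iso_deg0: assumes "iso f X Y" shows "FG.O.iso (deg 0 f) X Y"
proof -
  obtain g where g: "ar f X Y" "ar g Y X" "g \<cdot> f = \<iota> X" "f \<cdot> g = \<iota> Y" using assms by (rule isoE)
  then show ?thesis
    using FG.O.isoI[of "deg 0 f" X Y "deg 0 g"] deg0_oar comp_deg0_deg0[OF g(1,2)] comp_deg0_deg0[OF g(2,1)]
    by (simp add: FG.O_ar ident_K)
qed

lemma isom_imp_isom_K: "isom X Y \<Longrightarrow> FG.O.isom X Y"
  using iso_deg0 by (auto simp: isom_def FG.O.isom_def)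

text \<open>The endomorphisms of \<open>X\<close> of degree 1 form an ideal of square zero, and
  units lift along such an ideal.\<close>

lemma unit_K:
  assumes X: "indecomposable C X" and f: "oar f X X"
  shows "FG.O.iso f X X \<longleftrightarrow> iso (f 0) X X"
proof
  have oX: "X \<in> obj C" using X by (simp add: indecomposable_def)
  have f0: "ar (f 0) X X" using FG.oarD[OF f, of 0] by (simp add: FG.fpow_0)
  {
    assume "FG.O.iso f X X"
    then obtain g where g: "oar g X X" "g \<star> f = ident K X" "f \<star> g = ident K X" by (auto simp: FG.O.iso_def FG.O_ar)
    have g0: "ar (g 0) X X" using FG.oarD[OF g(1), of 0] by (simp add: FG.fpow_0)
    have "g 0 \<cdot> f 0 = \<iota> X" "f 0 \<cdot> g 0 = \<iota> X"
      using comp_0[OF X f g(1)] comp_0[OF X g(1) f] g by (simp_all add: ident_K deg_def)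
    then show "iso (f 0) X X" by (rule isoI[OF f0 g0])
  next
    assume "iso (f 0) X X"
    then obtain g where g: "ar g X X" "g \<cdot> f 0 = \<iota> X" "iso g X X" by (rule isoE)
    \<comment> \<open>The error left after inverting the degree 0 part lies in degree 1; its square
      lies in degree 2 and is therefore 0.\<close>
    define e where "e = ident K X - deg 0 g \<star> f"
    have g': "oar (deg 0 g) X X" by (rule deg0_oar[OF g(1)])
    have gf: "oar (deg 0 g \<star> f) X X" by (rule FG.orbit_comp_oar[OF f g'])
    have e: "oar e X X" unfolding e_def
      using FG.O.diff_ar[of "ident K X" X X "deg 0 g \<star> f"] FG.id_oar[OF oX] gf by (simp add: FG.O_ar)
    have e0: "e 0 = 0" unfolding e_def using comp_0[OF X f g'] g(2) by (simp add: ident_K deg_def)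
    have e1: "e i = 0" if "i \<noteq> 1" for i using end_degrees[OF X e, of i] e0 that by (cases "i = 0") auto
    have ee: "oar (e \<star> e) X X" by (rule FG.orbit_comp_oar[OF e e])
    have "e \<star> e = 0"
    proof
      fix l
      have "(e \<star> e) l = (\<Sum>i\<in>{1}. fmor (P i) (e (l - i)) \<cdot> e i)"
        by (rule FG.orbit_comp[OF e e]) (use e1 in auto)
      then have "(e \<star> e) l = fmor (P 1) (e (l - 1)) \<cdot> e 1" by simp
      moreover have "fmor (P 1) 0 \<cdot> e 1 = 0"
        using lauto.F_zero[OF FG.lauto_fpow oX, of 1] cmp_zero_left[OF oX FG.oarD[OF e, of 1]] by simp
      ultimately show "(e \<star> e) l = 0 l" using e1[of "l - 1"] end_degrees[OF X ee, of l] by (cases "l = 2") auto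
    qed
    then have "FG.O.pw X e 2 = 0"
      using FG.O.id_right[of e X X] e by (simp add: numeral_2_eq_2 FG.O_ar)
    then have "FG.O.iso (ident K X - e) X X" using FG.O.nilpotent_iso e by (simp add: FG.O_ar)
    then have "FG.O.iso (deg 0 g \<star> f) X X" by (simp add: e_def)
    then show "FG.O.iso f X X" using FG.O.iso_cancel_left[OF iso_deg0[OF g(3)]] f by (simp add: FG.O_ar)
  }
qed

lemma loc_K: assumes X: "indecomposable C X" shows "FG.O.loc X"
proof -
  have oX: "X \<in> obj C" "\<iota> X \<noteq> 0" using X by (auto simp: indecomposable_def zero_object_def)
  have "FG.O.iso f X X \<or> FG.O.iso (ident K X - f) X X" if f: "oar f X X" for f
  proof -
    have "oar (ident K X - f) X X" using FG.O.diff_ar[of "ident K X" X X f] FG.id_oar[OF oX(1)] f by (simp add: FG.O_ar)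
    moreover have "ar (f 0) X X" using FG.oarD[OF f, of 0] by (simp add: FG.fpow_0)
    ultimately show ?thesis using unit_K[OF X f] unit_K[OF X, of "ident K X - f"] loc_indecomposable[OF X]
      by (auto simp: loc_def ident_K deg_def)
  qed
  then show ?thesis using oX by (auto simp: FG.O.loc_def FG.O_ar FG.orbit_simps(1) ident_K deg_eq_0)
qed

lemma indecomposable_K_iff: "indecomposable K X \<longleftrightarrow> indecomposable C X"
  using indecomposable_K_imp FG.O.loc_indecomposable'[OF loc_K] by blast

lemma indecomposable_P: assumes "indecomposable C X" shows "indecomposable C (fobj (P i) X)"
  by (rule loc_indecomposable'[OF lauto.loc_F[OF FG.lauto_fpow loc_indecomposable[OF assms]]])

text \<open>The inverse is the identity of \<open>X\<close> placed in degree
  \<open>- i\<close>.\<close>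

lemma iso_shift_K:
  assumes X: "X \<in> obj C"
  shows "FG.O.iso (deg i (\<iota> (fobj (P i) X))) (fobj (P i) X) X"
proof -
  let ?X = "fobj (P i) X"
  have oX: "?X \<in> obj C" using FG.fpow_obj[OF X] .
  have bk: "fobj (P (- i)) ?X = X" using FG.fpow_add[of X "- i" i] X by (simp add: FG.fpow_0)
  have a: "ar (\<iota> ?X) ?X (fobj (P i) X)" using id_ar[OF oX] .
  have b: "ar (\<iota> X) X (fobj (P (- i)) ?X)" using id_ar[OF X] bk by simp
  note a' = deg_oar[OF a X] and b' = deg_oar[OF b oX]
  have "deg (- i) (\<iota> X) \<star> deg i (\<iota> ?X) = ident K ?X"
  proof
    fix l
    show "(deg (- i) (\<iota> X) \<star> deg i (\<iota> ?X)) l = ident K ?X l"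
      using comp_deg[OF b' a, of l] id_left[OF a] lauto.F_id[OF FG.lauto_fpow X, of i] lauto.F_zero[OF FG.lauto_fpow X, of i]
        cmp_zero_left[OF X a] by (auto simp: deg_def ident_K)
  qed
  moreover have "deg i (\<iota> ?X) \<star> deg (- i) (\<iota> X) = ident K X"
  proof
    fix l
    show "(deg i (\<iota> ?X) \<star> deg (- i) (\<iota> X)) l = ident K X l"
      using comp_deg[OF a' b, of l] id_left[OF b] lauto.F_id[OF FG.lauto_fpow oX, of "- i"] lauto.F_zero[OF FG.lauto_fpow X, of "- i"]
        cmp_zero_left[OF X b] bk by (auto simp: deg_def ident_K)
  qed
  ultimately show ?thesis using FG.O.isoI[of "deg i (\<iota> ?X)" ?X X "deg (- i) (\<iota> X)"] a' b' by (simp add: FG.O_ar)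
qed

lemma isom_shift_K: "X \<in> obj C \<Longrightarrow> FG.O.isom (fobj (P i) X) X"
  using iso_shift_K by (auto simp: FG.O.isom_def)

text \<open>The degree 0 component of \<open>g \<star> f\<close> is a sum of endomorphisms of
  \<open>X\<close> equal to the identity, so by locality one summand is a unit, and its factor
  \<open>f i\<close> is an isomorphism.\<close>

lemma isom_K_imp:
  assumes X: "indecomposable C X" and Y: "indecomposable C Y" and iso: "FG.O.isom X Y"
  shows "\<exists>i. isom X (fobj (P i) Y)"
proof -
  note lX = loc_indecomposable[OF X]
  have oX: "X \<in> obj C" using X by (simp add: indecomposable_def)
  obtain f g where f: "oar f X Y" and g: "oar g Y X" and gf: "g \<star> f = ident K X"
    using iso by (auto simp: FG.O.isom_def FG.O.iso_def FG.O_ar)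
  let ?t = "\<lambda>i. fmor (P i) (g (0 - i)) \<cdot> f i"
  have ar: "ar (?t i) X X" for i using FG.orbit_comp_ar[OF f g, of i 0] by (simp add: FG.fpow_0)
  have "(g \<star> f) 0 = (\<Sum>i\<in>{i. f i \<noteq> 0}. ?t i)"
    by (rule FG.orbit_comp[OF f g _ subset_refl]) (use f in \<open>simp add: FG.oar_def\<close>)
  then have "(\<Sum>i\<in>{i. f i \<noteq> 0}. ?t i) = \<iota> X" using gf by (simp add: ident_K deg_def)
  then have "\<exists>i. iso (?t i) X X" using loc_nonunit_sum[OF lX, of "{i. f i \<noteq> 0}" ?t] ar iso_id[OF oX] by auto
  then obtain i where i: "iso (?t i) X X" by blast
  have "ar (fmor (P i) (g (0 - i))) (fobj (P i) Y) X" using FG.fpow_oar[OF g, of i 0] by (simp add: FG.fpow_0)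
  then have "iso (f i) X (fobj (P i) Y)"
    using loc_unit_factor[OF lauto.loc_F[OF FG.lauto_fpow loc_indecomposable[OF Y]] lX FG.oarD[OF f] _ i] by blast
  then show ?thesis by (auto simp: isom_def)
qed

text \<open>The almost split triangle produces \<open>fobj Si (fobj N Z)\<close> at its left end; it
  has to be recognized as the translate. In \<open>K\<close> it is also identified with
  \<open>fobj S Z\<close>, being its image under the inverse of \<open>F\<close>.\<close>

lemma isom_S_T_K: assumes Z: "Z \<in> obj C" shows "FG.O.isom (fobj Si (fobj N Z)) (fobj T Z)" "FG.O.isom (fobj S Z) (fobj T Z)"
proof -
  have obj: "fobj S Z \<in> obj C" "fobj T Z \<in> obj C" using Z S.F_obj T.F_obj by auto
  have "isom (fobj Si (fobj T (fobj S Z))) (fobj Si (fobj S (fobj T Z)))"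
    by (rule lauto.F_isom[OF S.swap S_T_commute[OF Z]])
  then have 1: "isom (fobj Si (fobj N Z)) (fobj T Z)" using S.GF_obj[OF obj(2)] by (simp add: functor_comp_def)
  then show "FG.O.isom (fobj Si (fobj N Z)) (fobj T Z)" by (rule isom_imp_isom_K)
  have "fobj (P (0 - 1)) (fobj S Z) = fobj Si (fobj N Z)"
    using FG.fpow_Pred(1)[OF obj(1), of 0] unfolding FG.fpow_0 by (simp add: functor_comp_def)
  then have "FG.O.isom (fobj Si (fobj N Z)) (fobj S Z)" using isom_shift_K[OF obj(1), of "0 - 1"] by simp
  then show "FG.O.isom (fobj S Z) (fobj T Z)" using isom_imp_isom_K[OF 1] FG.O.isom_sym FG.O.isom_trans by blast
qed

lemma isom_T_P: assumes Z: "Z \<in> obj C" shows "FG.O.isom (fobj T (fobj (P i) Z)) (fobj T Z)"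
proof -
  have step: "FG.O.isom (fobj T (fobj F W)) (fobj T W)" if "W \<in> obj C" for W
    using isom_S_T_K(2)[OF that] T.FG_obj[OF S.F_obj[OF that]] by (simp add: functor_comp_def)
  show ?thesis
  proof (induct i rule: int_induct[where k = 0])
    case base
    then show ?case using FG.O.isom_refl T.F_obj[OF Z] by (simp add: FG.fpow_0 FG.orbit_simps)
  next
    case (step1 i)
    then show ?case using step[OF FG.fpow_obj[OF Z, of i]] FG.fpow_Suc(1)[OF Z, of i] FG.O.isom_trans by metis
  next
    case (step2 i)
    then show ?case using step[OF FG.fpow_obj[OF Z, of "i - 1"]] FG.fpow_Suc(1)[OF Z, of "i - 1"] FG.O.isom_trans FG.O.isom_sym
      by (metis diff_add_cancel)
  qed
qed

lemma isom_T_K: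
  assumes "indecomposable C X" "indecomposable C Y" "FG.O.isom X Y"
  shows "FG.O.isom (fobj T X) (fobj T Y)"
proof -
  obtain i where "isom X (fobj (P i) Y)" using isom_K_imp[OF assms] by blast
  then have "FG.O.isom (fobj T X) (fobj T (fobj (P i) Y))" by (intro isom_imp_isom_K T.F_isom)
  then show ?thesis using isom_T_P[of Y i] assms(2) FG.O.isom_trans by (auto simp: indecomposable_def)
qed

end

lemma sum_apply_fun: "(\<Sum>i\<in>I. f i) x = (\<Sum>i\<in>I. f i x)" for f :: "'i \<Rightarrow> 'a \<Rightarrow> 'b::comm_monoid_add"
  by (induct I rule: infinite_finite_induct) auto

lemma (in lcat) loc_isom:
  assumes lX: "loc X" and iso: "isom X Z"
  shows "loc Z"
proof -
  obtain f where "iso f X Z" using iso by (auto simp: isom_def)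
  then obtain g where g: "ar f X Z" "ar g Z X" "g \<cdot> f = \<iota> X" "f \<cdot> g = \<iota> Z" by (rule isoE)
  have isof: "iso f X Z" "iso g Z X" using g by (auto intro: isoI)
  note 1 = id_ar[OF arD(2)[OF g(1)]]
  have "\<iota> Z \<noteq> 0"
  proof
    assume "\<iota> Z = 0"
    then have "f = 0" using ar_eq_0_if_target_0[OF g(1)] by simp
    then show False using g(3) cmp_zero_right[OF arD(1)[OF g(1)] g(2)] lX by (simp add: loc_def)
  qed
  moreover have "iso k Z Z \<or> iso (\<iota> Z - k) Z Z" if k: "ar k Z Z" for k
  proof -
    note kf = cmp_ar[OF g(1) k]
    note gkf = cmp_ar[OF kf g(2)]
    have isoX: "iso m Z Z" if m: "ar m Z Z" "iso (g \<cdot> (m \<cdot> f)) X X" for m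
    proof -
      have "iso (m \<cdot> f) X Z" by (rule iso_cancel_left[OF isof(2) cmp_ar[OF g(1) m(1)] m(2)])
      then have "iso (m \<cdot> f \<cdot> g) Z Z" using iso_cmp[OF isof(2)] by blast
      then show ?thesis using assoc[OF g(2,1) m(1)] g(4) id_right[OF m(1)] by simp
    qed
    have "iso (g \<cdot> (k \<cdot> f)) X X \<or> iso (\<iota> X - g \<cdot> (k \<cdot> f)) X X" using lX gkf by (simp add: loc_def)
    moreover have "g \<cdot> ((\<iota> Z - k) \<cdot> f) = \<iota> X - g \<cdot> (k \<cdot> f)"
      using cmp_diff_left[OF g(1) 1 k] cmp_diff_right[OF g(1) kf g(2)] id_left[OF g(1)] g(3) by simp
    ultimately show ?thesis using isoX[OF k] isoX[OF diff_ar[OF 1 k]] by auto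
  qed
  ultimately show ?thesis using arD[OF g(1)] by (simp add: loc_def)
qed

section \<open>Radical and irreducible morphisms of the cluster category\<close>

context hered begin

lemma comp_at_0:
  assumes "oar f X Y" "oar g Y X"
  shows "(g \<star> f) 0 = (\<Sum>i\<in>{i. f i \<noteq> 0}. fmor (P i) (g (- i)) \<cdot> f i)"
    "ar (fmor (P i) (g (- i))) (fobj (P i) Y) X" "ar ((g \<star> f) 0) X X"
  using FG.orbit_comp[OF assms _ subset_refl, of 0] FG.fpow_oar[OF assms(2), of i 0] assms(1)
    FG.oarD[OF FG.orbit_comp_oar[OF assms], of 0]
  by (simp_all add: FG.oar_def FG.fpow_0)

lemma unit_K_diff:
  assumes X: "indecomposable C X" and h: "oar h X X"
  shows "FG.O.iso (ident K X - h) X X \<longleftrightarrow> iso (\<iota> X - h 0) X X"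
proof -
  have oX: "X \<in> obj C" using X by (simp add: indecomposable_def)
  have "oar (ident K X - h) X X" using FG.O.diff_ar[of "ident K X" X X h] FG.id_oar[OF oX] h by (simp add: FG.O_ar)
  then show ?thesis using unit_K[OF X] by (simp add: ident_K deg_def)
qed

text \<open>Units of the endomorphism ring of \<open>X\<close> are detected in degree 0, and in a
  local ring a map stays away from the identity exactly when its multiples are nonunits.\<close>

lemma radical_K_iff_0:
  assumes X: "indecomposable C X" and Z: "Z \<in> obj C"
  shows "f \<in> radical K X Z \<longleftrightarrow> oar f X Z \<and> (\<forall>g. oar g Z X \<longrightarrow> \<not> iso ((g \<star> f) 0) X X)"
proof -
  have oX: "X \<in> obj C" using X by (simp add: indecomposable_def)
  note lX = loc_indecomposable[OF X]
  have r: "f \<in> radical K X Z \<longleftrightarrow> oar f X Z \<and> (\<forall>g. oar g Z X \<longrightarrow> FG.O.iso (ident K X - g \<star> f) X X)"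
    using FG.O.radical_iff[of X Z f] oX Z by (simp add: FG.O_ar FG.orbit_simps(1))
  show ?thesis
  proof
    assume f: "f \<in> radical K X Z"
    then have f1: "oar f X Z" using r by simp
    have "\<not> iso ((g \<star> f) 0) X X" if g: "oar g Z X" for g
    proof
      assume "iso ((g \<star> f) 0) X X"
      then obtain u where u: "ar u X X" "u \<cdot> (g \<star> f) 0 = \<iota> X" by (auto simp: iso_def)
      note u' = deg0_oar[OF u(1)]
      have "(deg 0 u \<star> g \<star> f) 0 = (deg 0 u \<star> (g \<star> f)) 0" using FG.orbit_assoc[OF f1 g u'] by simp
      also have "\<dots> = \<iota> X" using comp_0[OF X FG.orbit_comp_oar[OF f1 g] u'] u(2) by (simp add: deg_def)
      finally have "FG.O.iso (ident K X - deg 0 u \<star> g \<star> f) X X \<longleftrightarrow> iso 0 X X"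
        using unit_K_diff[OF X FG.orbit_comp_oar[OF f1 FG.orbit_comp_oar[OF g u']]] by simp
      then show False using f r FG.orbit_comp_oar[OF g u'] loc_zero_nonunit[OF lX] by blast
    qed
    with f1 show "oar f X Z \<and> (\<forall>g. oar g Z X \<longrightarrow> \<not> iso ((g \<star> f) 0) X X)" by blast
  next
    assume f: "oar f X Z \<and> (\<forall>g. oar g Z X \<longrightarrow> \<not> iso ((g \<star> f) 0) X X)"
    have "FG.O.iso (ident K X - g \<star> f) X X" if g: "oar g Z X" for g
      using loc_one_nonunit[OF lX comp_at_0(3)] f g unit_K_diff[OF X FG.orbit_comp_oar] by blast
    then show "f \<in> radical K X Z" using r f by blast
  qed
qed

text \<open>A sum of nonunits of a local ring is a nonunit, so the criterion of
  \<open>radical_K_iff_0\<close> can be tested on each degree separately: no component may be a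
  split monomorphism.\<close>

lemma radical_K_iff:
  assumes X: "indecomposable C X" and Z: "Z \<in> obj C"
  shows "f \<in> radical K X Z \<longleftrightarrow> oar f X Z \<and> (\<forall>i s. ar s (fobj (P i) Z) X \<longrightarrow> s \<cdot> f i \<noteq> \<iota> X)"
proof -
  have oX: "X \<in> obj C" using X by (simp add: indecomposable_def)
  note lX = loc_indecomposable[OF X]
  have "(\<exists>g. oar g Z X \<and> iso ((g \<star> f) 0) X X) \<longleftrightarrow> (\<exists>i s. ar s (fobj (P i) Z) X \<and> s \<cdot> f i = \<iota> X)" if f: "oar f X Z"
  proof
    assume "\<exists>g. oar g Z X \<and> iso ((g \<star> f) 0) X X"
    then obtain g where g: "oar g Z X" and iso: "iso ((g \<star> f) 0) X X" by blast
    note ar = comp_at_0(2)[OF f g]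
    have "\<exists>i. iso (fmor (P i) (g (- i)) \<cdot> f i) X X"
      using iso loc_nonunit_sum[OF lX, of "{i. f i \<noteq> 0}" "\<lambda>i. fmor (P i) (g (- i)) \<cdot> f i"] cmp_ar[OF FG.oarD[OF f] ar]
      unfolding comp_at_0(1)[OF f g] by blast
    then obtain i u where u: "ar u X X" "u \<cdot> (fmor (P i) (g (- i)) \<cdot> f i) = \<iota> X" by (auto simp: iso_def)
    then have "u \<cdot> fmor (P i) (g (- i)) \<cdot> f i = \<iota> X" using assoc[OF FG.oarD[OF f] ar u(1)] by simp
    then show "\<exists>i s. ar s (fobj (P i) Z) X \<and> s \<cdot> f i = \<iota> X" using cmp_ar[OF ar u(1)] by blast
  next
    assume "\<exists>i s. ar s (fobj (P i) Z) X \<and> s \<cdot> f i = \<iota> X"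
    then obtain i s where s: "ar s (fobj (P i) Z) X" "s \<cdot> f i = \<iota> X" by blast
    let ?g = "deg (- i) (fmor (P (- i)) s)"
    have "ar (fmor (P (- i)) s) Z (fobj (P (- i)) X)"
      using FG.fpow_ar[OF s(1), of "- i"] FG.fpow_add[of Z "- i" i] Z by (simp add: FG.fpow_0)
    then have g: "oar ?g Z X" by (rule deg_oar[OF _ oX])
    have fin: "finite {i. f i \<noteq> 0}" using f by (simp add: FG.oar_def)
    have bck: "fmor (P i) (fmor (P (- i)) s) = s"
      using FG.fpow_add[of _ i "- i" s] s(1) by (simp add: FG.fpow_0)
    have "fmor (P j) (?g (- j)) \<cdot> f j = (if j = i then \<iota> X else 0)" for j
      using s(2) bck lauto.F_zero[OF FG.lauto_fpow oX, of j] cmp_zero_left[OF oX FG.oarD[OF f, of j]] by (auto simp: deg_def)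
    then have "(?g \<star> f) 0 = (\<Sum>j\<in>{i. f i \<noteq> 0}. if j = i then \<iota> X else 0)" using comp_at_0(1)[OF f g] by simp
    also have "\<dots> = \<iota> X"
    proof -
      have "f i \<noteq> 0" using s(2) cmp_zero_right[OF oX s(1)] X by (auto simp: indecomposable_def zero_object_def)
      then show ?thesis using fin by simp
    qed
    finally show "\<exists>g. oar g Z X \<and> iso ((g \<star> f) 0) X X" using g iso_id[OF oX] by auto
  qed
  then show ?thesis unfolding radical_K_iff_0[OF X Z] by blast
qed

text \<open>The counterpart at the target. Here only \<open>Y\<close> has a local endomorphism ring,
  so the unit condition, which \<open>radical\<close> states at the source, is moved to
  \<open>Y\<close> by Jacobson's identity.\<close>

lemma radical_K_no_section:
  assumes Y: "indecomposable C Y" and Z: "Z \<in> obj C" and g: "g \<in> radical K Z Y" and s: "ar s (fobj (P i) Y) Z"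
  shows "fmor (P (- i)) (g i) \<cdot> fmor (P (- i)) s \<noteq> \<iota> Y"
proof
  have oY: "Y \<in> obj C" using Y by (simp add: indecomposable_def)
  have r: "oar g Z Y" "\<And>f. oar f Y Z \<Longrightarrow> FG.O.iso (ident K Z - f \<star> g) Z Z"
    using FG.O.radical_iff[of Z Y g] oY Z g by (auto simp: FG.O_ar FG.orbit_simps(1))
  assume eq: "fmor (P (- i)) (g i) \<cdot> fmor (P (- i)) s = \<iota> Y"
  let ?f = "deg (- i) (fmor (P (- i)) s)"
  have a: "ar (fmor (P (- i)) s) Y (fobj (P (- i)) Z)"
    using FG.fpow_ar[OF s, of "- i"] FG.fpow_add[of Y "- i" i] oY by (simp add: FG.fpow_0)
  note f = deg_oar[OF a Z]
  have "(g \<star> ?f) 0 = \<iota> Y" using comp_deg[OF r(1) a, of 0] eq by simp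
  moreover have "FG.O.iso (ident K Y - g \<star> ?f) Y Y"
    using FG.O.iso_one_minus_swap[of ?f Y Z g] f r by (simp add: FG.O_ar)
  ultimately have "iso 0 Y Y" using unit_K_diff[OF Y FG.orbit_comp_oar[OF f r(1)]] by simp
  then show False using loc_zero_nonunit[OF loc_indecomposable[OF Y]] by blast
qed

lemma radical_K_deg0_target:
  assumes X: "indecomposable C X" and v: "ar v E X" and ns: "\<And>s. ar s X E \<Longrightarrow> v \<cdot> s \<noteq> \<iota> X"
  shows "deg 0 v \<in> radical K E X"
proof -
  have oX: "X \<in> obj C" using X by (simp add: indecomposable_def)
  note oE = arD(1)[OF v] and v' = deg0_oar[OF v]
  have "FG.O.iso (ident K E - g \<star> deg 0 v) E E" if g: "oar g X E" for g
  proof -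
    have g0: "ar (g 0) X E" using FG.oarD[OF g, of 0] by (simp add: FG.fpow_0)
    have fin: "finite {i. g i \<noteq> 0}" using g by (simp add: FG.oar_def)
    have "(deg 0 v \<star> g) 0 = (\<Sum>i\<in>insert 0 {i. g i \<noteq> 0}. fmor (P i) (deg 0 v (0 - i)) \<cdot> g i)"
      by (rule FG.orbit_comp[OF g v']) (use fin in auto)
    also have "\<dots> = (\<Sum>i\<in>insert 0 {i. g i \<noteq> 0}. if i = 0 then v \<cdot> g 0 else 0)"
      using lauto.F_zero[OF FG.lauto_fpow oX] cmp_zero_left[OF oX FG.oarD[OF g]]
      by (intro sum.cong refl) (auto simp: deg_def FG.fpow_0)
    also have "\<dots> = v \<cdot> g 0" using fin by simp
    finally have eq: "(deg 0 v \<star> g) 0 = v \<cdot> g 0" .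
    have "\<not> iso (v \<cdot> g 0) X X"
    proof
      assume "iso (v \<cdot> g 0) X X"
      then obtain u where u: "ar u X X" "v \<cdot> g 0 \<cdot> u = \<iota> X" by (auto simp: iso_def)
      then show False using ns[OF cmp_ar[OF u(1) g0]] assoc[OF u(1) g0 v] by simp
    qed
    then have "iso (\<iota> X - v \<cdot> g 0) X X" using loc_one_nonunit[OF loc_indecomposable[OF X] cmp_ar[OF g0 v]] by blast
    then have "FG.O.iso (ident K X - deg 0 v \<star> g) X X" using unit_K_diff[OF X FG.orbit_comp_oar[OF g v']] eq by simp
    then show ?thesis using FG.O.iso_one_minus_swap[of "deg 0 v" E X g] g v' by (simp add: FG.O_ar)
  qed
  then show ?thesis using FG.O.radical_iff[of E X "deg 0 v"] oX oE v' by (simp add: FG.O_ar FG.orbit_simps(1))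
qed

lemma deg_in_radical:
  assumes X: "indecomposable C X" and f: "ar f X (fobj (P n) Z)" and Z: "Z \<in> obj C"
    and ns: "\<And>s. ar s (fobj (P n) Z) X \<Longrightarrow> s \<cdot> f \<noteq> \<iota> X"
  shows "deg n f \<in> radical K X Z"
proof -
  have "X \<in> obj C" "\<iota> X \<noteq> 0" using X by (auto simp: indecomposable_def zero_object_def)
  then show ?thesis unfolding radical_K_iff[OF X Z] using deg_oar[OF f Z] ns cmp_zero_right[of X] by (auto simp: deg_def)
qed

text \<open>The square of the radical is a subspace, so some homogeneous component of an irreducible
  map lies outside it. Replacing \<open>Y\<close> by a translate moves this component to degree 0,
  where the almost split triangle of \<open>C\<close> applies.\<close>

lemma irr_K_homogeneous:
  assumes X: "indecomposable C X" and Y: "indecomposable C Y" and irr: "FG.O.irr Y X"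
  obtains i h where "ar h (fobj (P (- i)) Y) X" "\<forall>s. ar s X (fobj (P (- i)) Y) \<longrightarrow> s \<cdot> h \<noteq> \<iota> (fobj (P (- i)) Y)"
    "deg 0 h \<notin> radical_sq K (fobj (P (- i)) Y) X"
proof -
  have oX: "X \<in> obj C" and oY: "Y \<in> obj C" using X Y by (auto simp: indecomposable_def)
  obtain h where h: "h \<in> radical K Y X" "h \<notin> radical_sq K Y X" using irr by (auto simp: FG.O.irr_def)
  have h1: "oar h Y X" and h2: "\<And>i s. ar s (fobj (P i) X) Y \<Longrightarrow> s \<cdot> h i \<noteq> \<iota> Y"
    using h(1) radical_K_iff[OF Y oX] by auto
  have fin: "finite {i. h i \<noteq> 0}" using h1 by (simp add: FG.oar_def)
  have "(\<Sum>i\<in>{i. h i \<noteq> 0}. deg i (h i)) = h"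
  proof
    fix l
    have "(\<Sum>i\<in>{i. h i \<noteq> 0}. deg i (h i)) l = (\<Sum>i\<in>{i. h i \<noteq> 0}. if i = l then h l else 0)"
      unfolding sum_apply_fun by (intro sum.cong) (auto simp: deg_def)
    also have "\<dots> = h l" using fin by simp
    finally show "(\<Sum>i\<in>{i. h i \<noteq> 0}. deg i (h i)) l = h l" .
  qed
  then have "\<exists>i. deg i (h i) \<notin> radical_sq K Y X"
    using FG.O.V.subspace_sum[OF FG.O.subspace_radical_sq, of "{i. h i \<noteq> 0}" "\<lambda>i. deg i (h i)" Y X] h(2) by auto
  then obtain i where i: "deg i (h i) \<notin> radical_sq K Y X" by blast
  let ?Y = "fobj (P (- i)) Y" and ?h = "fmor (P (- i)) (h i)"
  have bck: "fobj (P i) ?Y = Y" "fobj (P (- i)) (fobj (P i) X) = X" "fmor (P i) ?h = h i"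
    using FG.fpow_add[of Y i "- i"] FG.fpow_add[of X "- i" i] FG.fpow_add[of Y i "- i" "h i" "fobj (P i) X"] oX oY FG.oarD[OF h1, of i]
    by (simp_all add: FG.fpow_0)
  have h': "ar ?h ?Y X" using FG.fpow_ar[OF FG.oarD[OF h1, of i], of "- i"] bck by simp
  show thesis
  proof (rule that[OF h'], intro allI impI)
    fix s assume s: "ar s X ?Y"
    show "s \<cdot> ?h \<noteq> \<iota> ?Y"
    proof
      assume "s \<cdot> ?h = \<iota> ?Y"
      then have "fmor (P i) s \<cdot> h i = \<iota> Y"
        using lauto.F_cmp[OF FG.lauto_fpow h' s, of i] bck lauto.F_id[OF FG.lauto_fpow FG.fpow_obj[OF oY], of i "- i"] by simp
      moreover have "ar (fmor (P i) s) (fobj (P i) X) Y" using FG.fpow_ar[OF s, of i] bck by simp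
      ultimately show False using h2 by blast
    qed
  next
    show "deg 0 ?h \<notin> radical_sq K ?Y X"
    proof
      assume sq: "deg 0 ?h \<in> radical_sq K ?Y X"
      have oY': "?Y \<in> obj C" using FG.fpow_obj[OF oY] .
      have iso: "FG.O.iso (deg i (\<iota> Y)) Y ?Y" using iso_shift_K[OF oY', of i] bck by simp
      have a: "ar (\<iota> Y) Y (fobj (P i) ?Y)" using id_ar[OF oY] bck by simp
      note h0 = deg0_oar[OF h']
      have "deg 0 ?h \<star> deg i (\<iota> Y) = deg i (h i)"
      proof
        fix l
        show "(deg 0 ?h \<star> deg i (\<iota> Y)) l = deg i (h i) l"
          using comp_deg[OF h0 a, of l] bck id_right[OF FG.oarD[OF h1, of i]] lauto.F_zero[OF FG.lauto_fpow oX, of i]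
            cmp_zero_left[OF oX a] by (auto simp: deg_def)
      qed
      moreover have "ident K X \<star> deg 0 ?h \<star> deg i (\<iota> Y) \<in> radical_sq K Y X"
        by (rule FG.O.radical_sq_transport[OF sq iso FG.O.iso_id]) (use oX oY' in \<open>simp_all add: FG.orbit_simps\<close>)
      moreover have "ident K X \<star> deg 0 ?h = deg 0 ?h" using FG.O.id_left[of "deg 0 ?h" ?Y X] h0 by (simp add: FG.O_ar)
      ultimately show False using i by simp
    qed
  qed
qed

text \<open>If \<open>h\<close> factors as \<open>v t\<close> through the almost split morphism \<open>v\<close>, irreducibility makes \<open>t\<close> split by
  some \<open>r\<close>, and then \<open>r u\<close> is irreducible.\<close>

lemma irr_K_tau:
  assumes X: "indecomposable C X" and Y: "indecomposable C Y" and irr: "FG.O.irr Y X"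
  shows "FG.O.irr (fobj T X) Y"
proof -
  have oX: "X \<in> obj C" and oY: "Y \<in> obj C" using X Y by (auto simp: indecomposable_def)
  obtain h i where h0: "ar h (fobj (P (- i)) Y) X" "\<forall>s. ar s X (fobj (P (- i)) Y) \<longrightarrow> s \<cdot> h \<noteq> \<iota> (fobj (P (- i)) Y)"
    "deg 0 h \<notin> radical_sq K (fobj (P (- i)) Y) X"
    by (rule irr_K_homogeneous[OF X Y irr])
  define Y' where "Y' = fobj (P (- i)) Y"
  note h = h0(1)[folded Y'_def] h0(2)[folded Y'_def, rule_format] h0(3)[folded Y'_def]
  have Y': "indecomposable C Y'" unfolding Y'_def by (rule indecomposable_P[OF Y])
  note lX = loc_indecomposable[OF X] and lY = loc_indecomposable[OF Y']
  have oY': "Y' \<in> obj C" using Y' by (simp add: indecomposable_def)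
  note 1 = id_ar[OF oY']
  define A where "A = fobj Si (fobj N X)"
  have "loc A" unfolding A_def by (rule lauto.loc_F[OF S.swap N.loc_F[OF lX]])
  then have A: "indecomposable C A" by (rule loc_indecomposable')
  then have oA: "A \<in> obj C" by (simp add: indecomposable_def)
  obtain E u v where u: "ar u A E" and v: "ar v E X"
    and a0: "\<forall>W g. ar g W X \<longrightarrow> (\<forall>s. ar s X W \<longrightarrow> g \<cdot> s \<noteq> \<iota> X) \<longrightarrow> (\<exists>t. ar t W E \<and> g = v \<cdot> t)"
    and b0: "\<forall>s. ar s X E \<longrightarrow> v \<cdot> s \<noteq> \<iota> X"
    and c0: "\<forall>W h. ar h A W \<longrightarrow> (\<forall>s. ar s W A \<longrightarrow> s \<cdot> h \<noteq> \<iota> A) \<longrightarrow> (\<exists>s. ar s E W \<and> h = s \<cdot> u)"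
    and d0: "\<forall>s. ar s E A \<longrightarrow> s \<cdot> u \<noteq> \<iota> A"
    and e0: "\<forall>W h. ar h E W \<longrightarrow> h \<cdot> u = 0 \<longrightarrow> (\<exists>s. ar s X W \<and> h = s \<cdot> v)"
    by (rule almost_split[OF lX A_def])
  note a = a0[rule_format] and b = b0[rule_format] and c = c0[rule_format] and d = d0[rule_format] and e = e0[rule_format]
  note oE = arD(2)[OF u]
  \<comment> \<open>Between objects with local endomorphism rings a split epimorphism would be an
    isomorphism, hence also a split monomorphism.\<close>
  have "h \<cdot> s \<noteq> \<iota> X" if s: "ar s X Y'" for s
  proof
    assume hs: "h \<cdot> s = \<iota> X"
    have "iso s X Y'" using loc_retract_iso[OF lY oX _ s h(1) hs] lX by (simp add: loc_def)
    then obtain z where z: "ar z Y' X" "s \<cdot> z = \<iota> Y'" by (auto simp: iso_def)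
    have "h = h \<cdot> s \<cdot> z" using assoc[OF z(1) s h(1)] z(2) id_right[OF h(1)] by simp
    then have "h = z" using hs id_left[OF z(1)] by simp
    then show False using h(2)[OF s] z(2) by simp
  qed
  then obtain t where t: "ar t Y' E" "h = v \<cdot> t" using a[OF h(1)] by blast
  \<comment> \<open>Otherwise \<open>h\<close> would be a product of two radical maps.\<close>
  have "deg 0 t \<notin> radical K Y' E"
  proof
    assume "deg 0 t \<in> radical K Y' E"
    then have "deg 0 v \<star> deg 0 t \<in> radical_sq K Y' X"
      using FG.O.comp_radical_sq[OF _ _ radical_K_deg0_target[OF X v b]] oE by (simp add: FG.orbit_simps)
    then show False using h(3) comp_deg0_deg0[OF t(1) v] t(2) by simp
  qed
  then obtain r where r: "ar r E Y'" "r \<cdot> t = \<iota> Y'"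
    using deg_in_radical[OF Y', of t 0 E] t(1) oE by (auto simp: FG.fpow_0)
  let ?y = "r \<cdot> u"
  note y = cmp_ar[OF u r(1)]
  have "deg 0 ?y \<in> radical K A Y'"
  proof (rule deg_in_radical[OF A _ oY'])
    show "ar ?y A (fobj (P 0) Y')" using y by (simp add: FG.fpow_0)
    show "s \<cdot> ?y \<noteq> \<iota> A" if "ar s (fobj (P 0) Y') A" for s
      using that d[OF cmp_ar[OF r(1)], of s] assoc[OF u r(1), of s A] by (simp add: FG.fpow_0)
  qed
  moreover have "deg 0 ?y \<notin> radical_sq K A Y'"
  proof
    \<comment> \<open>The invariant separating \<open>?y\<close> from the square of the radical: in
      degree 0 a product of radical maps out of \<open>A\<close> factors as
      \<open>c \<cdot> u\<close> with \<open>c \<cdot> t\<close> a nonunit. The components of the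
      first factor extend along \<open>u\<close> because they do not split; those of the second
      admit no section, which makes \<open>c \<cdot> t\<close> a nonunit.\<close>
    let ?Q = "\<lambda>x. \<exists>c. ar c E Y' \<and> x (0::int) = c \<cdot> u \<and> \<not> iso (c \<cdot> t) Y' Y'"
    assume "deg 0 ?y \<in> radical_sq K A Y'"
    moreover have "A \<in> obj K" "Y' \<in> obj K" using oA oY' by (simp_all add: FG.orbit_simps)
    ultimately have "?Q (deg 0 ?y)"
    proof (induct rule: FG.O.radical_sq_induct(1))
      case zero
      then show ?case using zero_ar[OF oE oY'] cmp_zero_left[OF oY' u] cmp_zero_left[OF oY' t(1)] loc_zero_nonunit[OF lY]
        by (intro exI[of _ 0]) simp
    next
      case (step k f g Z x)
      have oZ: "Z \<in> obj C" using step(1) by (simp add: FG.orbit_simps)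
      have f: "oar f A Z" "\<And>i s. ar s (fobj (P i) Z) A \<Longrightarrow> s \<cdot> f i \<noteq> \<iota> A"
        using step(2) radical_K_iff[OF A oZ] by auto
      have g: "oar g Z Y'" using step(3) FG.O.radical_iff[of Z Y' g] oZ oY' by (simp add: FG.O_ar FG.orbit_simps(1))
      obtain \<alpha> where \<alpha>: "\<And>i. ar (\<alpha> i) E (fobj (P i) Z)" "\<And>i. f i = \<alpha> i \<cdot> u"
        using c[OF FG.oarD[OF f(1)] f(2)] by metis
      let ?b = "\<lambda>i. fmor (P i) (g (0 - i))"
      have b: "ar (?b i) (fobj (P i) Z) Y'" for i using FG.fpow_oar[OF g, of i 0] by (simp add: FG.fpow_0)
      note ba = cmp_ar[OF \<alpha>(1) b]
      have fin: "finite {i. f i \<noteq> 0}" using f(1) by (simp add: FG.oar_def)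
      define c1 where "c1 = (\<Sum>i\<in>{i. f i \<noteq> 0}. ?b i \<cdot> \<alpha> i)"
      have c1: "ar c1 E Y'" unfolding c1_def by (intro sum_ar oE oY' ba)
      have "(g \<star> f) 0 = (\<Sum>i\<in>{i. f i \<noteq> 0}. ?b i \<cdot> f i)" by (rule FG.orbit_comp[OF f(1) g fin subset_refl])
      also have "\<dots> = (\<Sum>i\<in>{i. f i \<noteq> 0}. ?b i \<cdot> \<alpha> i \<cdot> u)"
        using assoc[OF u \<alpha>(1) b] \<alpha>(2) by (intro sum.cong) auto
      also have "\<dots> = c1 \<cdot> u" unfolding c1_def by (rule cmp_sum_left[OF oY' u ba, symmetric])
      finally have gf: "(g \<star> f) 0 = c1 \<cdot> u" .
      have "\<not> iso (?b i \<cdot> \<alpha> i \<cdot> t) Y' Y'" for i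
      proof
        assume "iso (?b i \<cdot> \<alpha> i \<cdot> t) Y' Y'"
        then obtain z where z: "ar z Y' Y'" "?b i \<cdot> \<alpha> i \<cdot> t \<cdot> z = \<iota> Y'" by (auto simp: iso_def)
        let ?s = "\<alpha> i \<cdot> (t \<cdot> z)"
        note s = cmp_ar[OF cmp_ar[OF z(1) t(1)] \<alpha>(1)[of i]]
        have bs: "?b i \<cdot> ?s = \<iota> Y'"
          using z(2) assoc[OF z(1) t(1) ba] assoc[OF cmp_ar[OF z(1) t(1)] \<alpha>(1) b] by simp
        have s': "ar (fmor (P (- i)) ?s) (fobj (P (- i)) Y') Z"
          using FG.fpow_ar[OF s, of "- i"] FG.fpow_add[of Z "- i" i] oZ by (simp add: FG.fpow_0)
        have "fmor (P i) (fmor (P (- i)) ?s) = ?s" using FG.fpow_add[of Y' i "- i" ?s] s by (simp add: FG.fpow_0)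
        then show False using radical_K_no_section[OF Y' oZ step(3) s'] bs by simp
      qed
      then have n1: "\<not> iso (c1 \<cdot> t) Y' Y'"
        unfolding c1_def cmp_sum_left[OF oY' t(1) ba] by (intro loc_nonunit_sum[OF lY]) (use cmp_ar[OF t(1) ba] in auto)
      obtain c2 where c2: "ar c2 E Y'" "x 0 = c2 \<cdot> u" "\<not> iso (c2 \<cdot> t) Y' Y'" using step(5) by blast
      let ?c = "scl C k c1 + c2"
      have "(scl K k (g \<star> f) + x) 0 = ?c \<cdot> u"
        using gf c2(2) cmp_lin_left[OF u c1 c2(1)] by (simp add: FG.orbit_simps)
      moreover have "\<not> iso (?c \<cdot> t) Y' Y'"
        unfolding cmp_lin_left[OF t(1) c1 c2(1)]
        by (rule loc_nonunit_add[OF lY scl_ar[OF cmp_ar[OF t(1) c1]] cmp_ar[OF t(1) c2(1)] loc_nonunit_scl[OF lY cmp_ar[OF t(1) c1] n1] c2(3)])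
      ultimately show ?case using add_ar[OF scl_ar[OF c1] c2(1)] by blast
    qed
    then obtain c where c: "ar c E Y'" "?y = c \<cdot> u" "\<not> iso (c \<cdot> t) Y' Y'" by (auto simp: deg_def)
    \<comment> \<open>The factor through \<open>u\<close> is not unique, but the ambiguity factors
      through \<open>v\<close>. It changes the composite with \<open>t\<close> only by
      \<open>z \<cdot> h\<close>, a nonunit as \<open>h\<close> does not split, so the identity
      would be a sum of two nonunits.\<close>
    have "(r - c) \<cdot> u = 0" using cmp_diff_left[OF u r(1) c(1)] c(2) by simp
    then obtain z where z: "ar z X Y'" "r - c = z \<cdot> v" using e[OF diff_ar[OF r(1) c(1)]] by blast
    have "z \<cdot> h = r \<cdot> t - c \<cdot> t" using z(2) assoc[OF t(1) v z(1)] cmp_diff_left[OF t(1) r(1) c(1)] t(2) by simp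
    then have sum: "c \<cdot> t + z \<cdot> h = \<iota> Y'" using r(2) by simp
    have "\<not> iso (z \<cdot> h) Y' Y'"
    proof
      assume "iso (z \<cdot> h) Y' Y'"
      then obtain w where w: "ar w Y' Y'" "w \<cdot> (z \<cdot> h) = \<iota> Y'" by (auto simp: iso_def)
      then show False using h(2)[OF cmp_ar[OF z(1) w(1)]] assoc[OF h(1) z(1) w(1)] by simp
    qed
    then show False
      using loc_nonunit_add[OF lY cmp_ar[OF t(1) c(1)] cmp_ar[OF h(1) z(1)] c(3)] sum iso_id[OF oY'] by simp
  qed
  ultimately have "FG.O.irr A Y'" using oA oY' by (auto simp: FG.O.irr_def FG.orbit_simps)
  then show ?thesis
    using FG.O.irr_isom isom_S_T_K(1)[OF oX, folded A_def] isom_shift_K[OF oY, of "- i", folded Y'_def] by blast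
qed

section \<open>Arrows, translation and components of the Auslander-Reiten quiver\<close>

lemma finite_dim_hom_K:
  assumes X: "X \<in> obj C" and Y: "Y \<in> obj C"
  shows "\<exists>b. finite b \<and> hom K X Y \<subseteq> FG.O.V.span b"
proof -
  obtain n where n0: "\<forall>i f. ar f X (fobj (P i) Y) \<longrightarrow> i \<notin> {-n..n} \<longrightarrow> f = 0" by (rule hom_P_bounded[OF X Y])
  note n = n0[rule_format]
  have "\<exists>b. finite b \<and> V.span b = hom C X (fobj (P i) Y)" for i
    using basis_hom[OF X FG.fpow_obj[OF Y, of i]] finite_basis_hom[OF X FG.fpow_obj[OF Y, of i]] by metis
  then obtain b where b: "\<And>i. finite (b i)" "\<And>i. V.span (b i) = hom C X (fobj (P i) Y)" by metis
  define bb where "bb = (\<Union>i\<in>{-n..n}. deg i ` b i)"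
  have sp: "deg i x \<in> FG.O.V.span bb" if "x \<in> V.span (b i)" "i \<in> {-n..n}" for i x
    using that(1)
  proof (induct rule: V.span_induct_alt)
    case base
    have "deg i 0 = 0" by (simp add: deg_eq_0)
    then show ?case using FG.O.V.span_zero[of bb] by (simp only:)
  next
    case (step c x y)
    have "deg i (scl C c x + y) = scl K c (deg i x) + deg i y" by (auto simp: deg_def FG.orbit_simps)
    moreover have "deg i x \<in> bb" using step(1) that(2) by (auto simp: bb_def)
    ultimately show ?case using FG.O.V.span_add[OF FG.O.V.span_scale[OF FG.O.V.span_base] step(2)] by (simp only:)
  qed
  have "f \<in> FG.O.V.span bb" if "f \<in> hom K X Y" for f
  proof -
    have f: "oar f X Y" using that FG.oar_hom[OF X Y] by simp
    have z: "f i = 0" if "i \<notin> {-n..n}" for i using n[OF FG.oarD[OF f] that] .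
    have "(\<Sum>i\<in>{-n..n}. deg i (f i)) = f"
    proof
      fix l
      have "(\<Sum>i\<in>{-n..n}. deg i (f i)) l = (\<Sum>i\<in>{-n..n}. if i = l then f l else 0)"
        unfolding sum_apply_fun by (intro sum.cong) (auto simp: deg_def)
      also have "\<dots> = f l" using z[of l] by simp
      finally show "(\<Sum>i\<in>{-n..n}. deg i (f i)) l = f l" .
    qed
    moreover have "deg i (f i) \<in> FG.O.V.span bb" if "i \<in> {-n..n}" for i
      using sp[OF _ that] b(2)[of i] FG.oarD[OF f, of i] by (simp add: ar_def)
    ultimately show ?thesis using FG.O.V.span_sum[of "{-n..n}" "\<lambda>i. deg i (f i)" bb] by metis
  qed
  then show ?thesis using b(1) by (intro exI[of _ bb]) (auto simp: bb_def)
qed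

text \<open>\<open>irr_dim\<close> is a truncated difference of dimensions; it detects a proper
  inclusion because both spaces are finite-dimensional and the square of the radical is contained in
  the radical.\<close>

lemma irr_dim_K_iff:
  assumes X: "indecomposable C X" and Y: "indecomposable C Y"
  shows "irr_dim K X Y \<noteq> 0 \<longleftrightarrow> FG.O.irr X Y"
proof -
  have oX: "X \<in> obj C" and oY: "Y \<in> obj C" using X Y by (auto simp: indecomposable_def)
  note lX = loc_indecomposable[OF X]
  let ?R = "radical K X Y" and ?R2 = "radical_sq K X Y"
  obtain s where s: "finite s" "hom K X Y \<subseteq> FG.O.V.span s" using finite_dim_hom_K[OF oX oY] by blast
  note R = radical_K_iff_0[OF X oY]
  have Rsub: "FG.O.V.subspace ?R"
  proof (rule FG.O.V.subspaceI)
    have lin: "scl K c f + f' \<in> ?R" if f: "f \<in> ?R" "f' \<in> ?R" for c f f'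
    proof -
      have o: "oar f X Y" "oar f' X Y" using f R by auto
      have "\<not> iso ((g \<star> (scl K c f + f')) 0) X X" if g: "oar g Y X" for g
      proof -
        have "(g \<star> (scl K c f + f')) 0 = scl C c ((g \<star> f) 0) + (g \<star> f') 0"
          using FG.O.cmp_lin_right[of f X Y f' g X c] o g by (simp add: FG.O_ar FG.orbit_simps)
        moreover have "\<not> iso ((g \<star> f) 0) X X" "\<not> iso ((g \<star> f') 0) X X" using f g R by auto
        ultimately show ?thesis
          using loc_nonunit_add[OF lX scl_ar[OF comp_at_0(3)[OF o(1) g]] comp_at_0(3)[OF o(2) g]]
            loc_nonunit_scl[OF lX comp_at_0(3)[OF o(1) g]] by simp
      qed
      moreover have "oar (scl K c f + f') X Y"
        using FG.O.add_ar[OF FG.O.scl_ar, of f X Y f' c] o by (simp add: FG.O_ar)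
      ultimately show ?thesis using R by blast
    qed
    show 0: "0 \<in> ?R"
    proof -
      have "(g \<star> 0) 0 = 0" if "oar g Y X" for g
        using FG.O.cmp_zero_right[of X g Y X] that oX by (simp add: FG.O_ar FG.orbit_simps(1))
      moreover have "oar 0 X Y" using FG.O.zero_ar[of X Y] oX oY by (simp add: FG.O_ar FG.orbit_simps(1))
      ultimately show ?thesis using R loc_zero_nonunit[OF lX] by simp
    qed
    show "f + f' \<in> ?R" if "f \<in> ?R" "f' \<in> ?R" for f f' using lin[OF that, of 1] by simp
    show "scl K c f \<in> ?R" if "f \<in> ?R" for c f using lin[OF that 0, of c] by simp
  qed
  have R2: "?R2 \<subseteq> ?R"
    unfolding radical_sq_def
  proof (rule FG.O.V.span_minimal[OF _ Rsub], clarify)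
    fix f g Z assume Z: "Z \<in> obj K" and f: "f \<in> radical K X Z" and g: "g \<in> radical K Z Y"
    have oZ: "Z \<in> obj C" using Z by (simp add: FG.orbit_simps)
    have f1: "oar f X Z" using f radical_K_iff_0[OF X oZ] by simp
    have g1: "oar g Z Y" using g FG.O.radical_iff[of Z Y g] oZ oY by (simp add: FG.O_ar FG.orbit_simps(1))
    have "\<not> iso ((k \<star> (g \<star> f)) 0) X X" if k: "oar k Y X" for k
      using f radical_K_iff_0[OF X oZ] FG.orbit_comp_oar[OF g1 k] FG.orbit_assoc[OF f1 g1 k] by auto
    then show "g \<star> f \<in> ?R" using R FG.orbit_comp_oar[OF f1 g1] by blast
  qed
  have Rhom: "?R \<subseteq> hom K X Y" by (auto simp: radical_def)
  obtain b2 where b2: "b2 \<subseteq> ?R2" "FG.O.V.independent b2" "?R2 \<subseteq> FG.O.V.span b2" "card b2 = FG.O.V.dim ?R2"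
    using FG.O.V.basis_exists[of ?R2] by metis
  obtain b1 where b1: "b1 \<subseteq> ?R" "FG.O.V.independent b1" "?R \<subseteq> FG.O.V.span b1" "card b1 = FG.O.V.dim ?R"
    using FG.O.V.basis_exists[of ?R] by metis
  have fin: "finite b1" "finite b2"
    using FG.O.V.independent_span_bound[OF s(1) b1(2)] FG.O.V.independent_span_bound[OF s(1) b2(2)] b1(1) b2(1) R2 Rhom s(2) by blast+
  show ?thesis
  proof
    assume "irr_dim K X Y \<noteq> 0"
    then have lt: "FG.O.V.dim ?R2 < FG.O.V.dim ?R" by (simp add: irr_dim_def)
    have "\<not> ?R \<subseteq> ?R2"
    proof
      assume "?R \<subseteq> ?R2"
      then have "FG.O.V.dim ?R \<le> card b2" using b2(3) fin(2) by (intro FG.O.V.dim_le_card) auto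
      then show False using lt b2(4) by simp
    qed
    then show "FG.O.irr X Y" using oX oY by (simp add: FG.O.irr_def FG.orbit_simps)
  next
    assume "FG.O.irr X Y"
    then obtain f where f: "f \<in> ?R" "f \<notin> ?R2" by (auto simp: FG.O.irr_def)
    have "FG.O.V.span b2 = ?R2" using FG.O.V.span_minimal[OF b2(1) FG.O.subspace_radical_sq] b2(3) by auto
    then have "FG.O.V.independent (insert f b2)" "f \<notin> b2"
      using f FG.O.V.independent_insertI[of f b2] b2(1,2) by auto
    moreover have "insert f b2 \<subseteq> FG.O.V.span b1" using f(1) b1(3) b2(1) R2 by blast
    ultimately have "card (insert f b2) \<le> card b1" using FG.O.V.independent_span_bound[OF fin(1)] by blast
    then show "irr_dim K X Y \<noteq> 0" using fin \<open>f \<notin> b2\<close> b1(4) b2(4) by (simp add: irr_dim_def)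
  qed
qed

lemma indecomposable_isom_K: "indecomposable C X \<Longrightarrow> FG.O.isom X Z \<Longrightarrow> indecomposable C Z"
  using FG.O.loc_indecomposable'[OF FG.O.loc_isom[OF loc_K]] indecomposable_K_imp by blast

lemma AR_trans:
  assumes X: "indecomposable C X"
  shows "trans (AR_quiver K T) (iso_class K X) = iso_class K (fobj T X)"
proof -
  have oX: "X \<in> obj C" using X by (simp add: indecomposable_def)
  have oK: "Z \<in> obj K \<longleftrightarrow> Z \<in> obj C" for Z by (simp add: FG.orbit_simps)
  have "iso_class K (fobj T Z) = iso_class K (fobj T X)" if "Z \<in> iso_class K X" for Z
  proof -
    have iso: "FG.O.isom X Z" using that FG.O.iso_class_eq[of X] oX oK by simp
    then have oZ: "Z \<in> obj C" using FG.O.isom_obj oK by blast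
    have "indecomposable C Z" by (rule indecomposable_isom_K[OF X iso])
    then have "FG.O.isom (fobj T Z) (fobj T X)" using isom_T_K[OF _ X] FG.O.isom_sym[OF iso] by blast
    then show ?thesis using FG.O.iso_class_eq_iff[of "fobj T Z" "fobj T X"] T.F_obj oX oZ oK by simp
  qed
  moreover have "X \<in> iso_class K X" using FG.O.iso_class_eq[of X] FG.O.isom_refl oX oK by simp
  ultimately have "(\<Union>Z\<in>iso_class K X. iso_class K (fobj T Z)) = iso_class K (fobj T X)" by blast
  then show ?thesis by (simp only: AR_quiver_def tquiver.simps)
qed

text \<open>The arrow from \<open>W\<close> to \<open>U\<close> yields by \<open>irr_K_tau\<close>
  an arrow from the translate of \<open>U\<close> to \<open>W\<close>, which makes the translate a
  neighbour of \<open>W\<close>.\<close>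

lemma AR_component_trans:
  assumes T0: "T0 \<in> tq_components (AR_quiver K T)" and U: "U \<in> T0" and W: "W \<in> T0" "arr (AR_quiver K T) W U \<noteq> 0"
  shows "trans (AR_quiver K T) U \<in> T0"
proof -
  let ?AR = "AR_quiver K T"
  have oK: "Z \<in> obj K \<longleftrightarrow> Z \<in> obj C" for Z by (simp add: FG.orbit_simps)
  obtain x where x: "T0 = {y. (tq_adj ?AR)\<^sup>*\<^sup>* x y}" "x \<in> verts ?AR" using T0 unfolding tq_components_def by blast
  have vs: "y \<in> verts ?AR" if "y \<in> T0" for y
  proof -
    have "(tq_adj ?AR)\<^sup>*\<^sup>* x y" using that x(1) by simp
    then show ?thesis by (cases rule: rtranclp.cases) (use x(2) in \<open>auto simp: tq_adj_def\<close>)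
  qed
  have oC: "X \<in> obj C" if "indecomposable C X" for X using that by (simp add: indecomposable_def)
  have vK: "iso_class K X \<in> verts ?AR" if "indecomposable C X" for X
    using that indecomposable_K_iff[of X] unfolding AR_quiver_def tquiver.simps by blast
  have rep: "\<exists>X. indecomposable C X \<and> U' = iso_class K X" if "U' \<in> verts ?AR" for U'
    using that indecomposable_K_iff unfolding AR_quiver_def tquiver.simps by blast
  have arr: "arr ?AR (iso_class K X) (iso_class K Y) \<noteq> 0 \<longleftrightarrow> FG.O.irr X Y"
    if X: "indecomposable C X" and Y: "indecomposable C Y" for X Y
  proof -
    define X' where "X' = (SOME Z. Z \<in> iso_class K X)"
    define Y' where "Y' = (SOME Z. Z \<in> iso_class K Y)"
    have some: "FG.O.isom Z (SOME Z'. Z' \<in> iso_class K Z)" if "indecomposable C Z" for Z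
    proof -
      have "Z \<in> obj K" using oC[OF that] oK by simp
      note eq = FG.O.iso_class_eq[OF this] and r = FG.O.isom_refl[OF this]
      have "(SOME Z'. Z' \<in> iso_class K Z) \<in> iso_class K Z" by (rule someI[of _ Z]) (use eq r in simp)
      then show ?thesis using eq by simp
    qed
    have X': "FG.O.isom X X'" and Y': "FG.O.isom Y Y'" unfolding X'_def Y'_def using some[OF X] some[OF Y] .
    have "arr ?AR (iso_class K X) (iso_class K Y) = irr_dim K X' Y'" by (simp add: AR_quiver_def X'_def Y'_def)
    then have "arr ?AR (iso_class K X) (iso_class K Y) \<noteq> 0 \<longleftrightarrow> FG.O.irr X' Y'"
      using irr_dim_K_iff[OF indecomposable_isom_K[OF X X'] indecomposable_isom_K[OF Y Y']] by simp
    also have "\<dots> \<longleftrightarrow> FG.O.irr X Y"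
      using FG.O.irr_isom[OF _ X' Y'] FG.O.irr_isom[OF _ FG.O.isom_sym[OF X'] FG.O.isom_sym[OF Y']] by blast
    finally show ?thesis .
  qed
  obtain X where X: "indecomposable C X" "U = iso_class K X" using rep[OF vs[OF U]] by blast
  obtain Y where Y: "indecomposable C Y" "W = iso_class K Y" using rep[OF vs[OF W(1)]] by blast
  have "FG.O.irr Y X" using W(2) arr[OF Y(1) X(1)] X(2) Y(2) by simp
  then have irr: "FG.O.irr (fobj T X) Y" by (rule irr_K_tau[OF X(1) Y(1)])
  have TX: "indecomposable C (fobj T X)" by (rule loc_indecomposable'[OF T.loc_F[OF loc_indecomposable[OF X(1)]]])
  have tr: "trans ?AR U = iso_class K (fobj T X)" using AR_trans[OF X(1)] X(2) by simp
  have "arr ?AR (trans ?AR U) W \<noteq> 0" using arr[OF TX Y(1)] irr tr Y(2) by simp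
  then have "tq_adj ?AR W (trans ?AR U)" using vs[OF W(1)] vK[OF TX] tr by (simp add: tq_adj_def)
  moreover have "(tq_adj ?AR)\<^sup>*\<^sup>* x W" using W(1) x(1) by simp
  ultimately have "(tq_adj ?AR)\<^sup>*\<^sup>* x (trans ?AR U)" by (rule rtranclp.rtrancl_into_rtrancl[rotated])
  then show ?thesis using x(1) by simp
qed

end

section \<open>Matrices as operators\<close>

text \<open>Matrices of all formats are embedded into the ring of linear endomorphisms of the space of
  sequences, where the format side conditions of matrix algebra disappear.\<close>

typedef (overloaded) 'k linop =
  "{T :: (nat \<Rightarrow> 'k::field) \<Rightarrow> nat \<Rightarrow> 'k. \<forall>c x y. T (\<lambda>i. c * x i + y i) = (\<lambda>i. c * T x i + T y i)}"
  by (rule exI[of _ "\<lambda>x. x"]) simp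

setup_lifting type_definition_linop

instantiation linop :: (field) ring_1
begin

lift_definition zero_linop :: "'a linop" is "\<lambda>_ _. 0" by simp
lift_definition one_linop :: "'a linop" is "\<lambda>x. x" by simp
lift_definition plus_linop :: "'a linop \<Rightarrow> 'a linop \<Rightarrow> 'a linop" is "\<lambda>S T x i. S x i + T x i"
  by (auto simp: algebra_simps)
lift_definition minus_linop :: "'a linop \<Rightarrow> 'a linop \<Rightarrow> 'a linop" is "\<lambda>S T x i. S x i - T x i"
  by (auto simp: algebra_simps)
lift_definition uminus_linop :: "'a linop \<Rightarrow> 'a linop" is "\<lambda>S x i. - S x i"
  by (auto simp: algebra_simps)
lift_definition times_linop :: "'a linop \<Rightarrow> 'a linop \<Rightarrow> 'a linop" is "\<lambda>S T x. S (T x)"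
  by simp

instance
proof
  fix a b c :: "'a linop"
  show "a * (b + c) = a * b + a * c"
  proof transfer
    fix a b c :: "(nat \<Rightarrow> 'a) \<Rightarrow> nat \<Rightarrow> 'a"
    assume "\<forall>c x y. a (\<lambda>i. c * x i + y i) = (\<lambda>i. c * a x i + a y i)"
    from this[rule_format, of 1] show "(\<lambda>x. a (\<lambda>i. b x i + c x i)) = (\<lambda>x i. a (b x) i + a (c x) i)" by simp
  qed
  show "(0 :: 'a linop) \<noteq> 1"
  proof transfer
    have "(\<lambda>_ _. 0 :: 'a) (\<lambda>_. 1) 0 \<noteq> (\<lambda>x. x) (\<lambda>_. 1) (0::nat)" by simp
    then show "(\<lambda>_ _. 0) \<noteq> (\<lambda>x :: nat \<Rightarrow> 'a. x)" by metis
  qed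
qed (transfer; auto simp: algebra_simps fun_eq_iff)+

end

abbreviation app :: "'k::field linop \<Rightarrow> (nat \<Rightarrow> 'k) \<Rightarrow> nat \<Rightarrow> 'k" where "app \<equiv> Rep_linop"

lift_definition sc :: "'k::field \<Rightarrow> 'k linop" is "\<lambda>c x i. c * x i" by (auto simp: algebra_simps)
text \<open>The stand-in for the identity matrix: an operator \<open>T\<close> has format m by n
  when \<open>e m * T = T\<close> and \<open>T * e n = T\<close>.\<close>

lift_definition e :: "nat \<Rightarrow> 'k::field linop" is "\<lambda>n x i. if i < n then x i else 0" by auto
lift_definition sh :: "nat \<Rightarrow> 'k::field linop" is "\<lambda>m x i. if i < m then 0 else x (i - m)" by auto
lift_definition us :: "nat \<Rightarrow> 'k::field linop" is "\<lambda>m x i. x (i + m)" by auto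
lift_definition E :: "nat \<Rightarrow> nat \<Rightarrow> 'k::field linop" is "\<lambda>a b x i. if i = a then x b else 0" by auto
lift_definition op :: "'k::field mat \<Rightarrow> 'k linop" is
  "\<lambda>A x i. if i < dim_row A then \<Sum>j<dim_col A. A $$ (i, j) * x j else 0"
  by (auto simp: fun_eq_iff algebra_simps sum.distrib sum_distrib_left)

lemma linop_eqI: "(\<And>x. app S x = app T x) \<Longrightarrow> S = T"
  using Rep_linop_inject by blast

lemma app_simps:
  "app (S + T) x = (\<lambda>i. app S x i + app T x i)" "app (S - T) x = (\<lambda>i. app S x i - app T x i)"
  "app (S * T) x = app S (app T x)" "app 0 x = (\<lambda>_. 0)" "app 1 x = x" "app (- S) x = (\<lambda>i. - app S x i)"
  "app (sc c) x = (\<lambda>i. c * x i)"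
  by (transfer; simp)+

lemma app_lin: "app T (\<lambda>i. c * x i + y i) = (\<lambda>i. c * app T x i + app T y i)"
  by transfer simp

lemma app_zero [simp]: "app T (\<lambda>_. 0) = (\<lambda>_. 0)"
  using app_lin[of T "-1" "\<lambda>_. 0" "\<lambda>_. 0"] by simp

lemma app_neg: "app T (\<lambda>i. - x i) = (\<lambda>i. - app T x i)"
  using app_lin[of T "-1" x "\<lambda>_. 0"] by simp

lemma app_sum: "finite I \<Longrightarrow> app T (\<lambda>i. \<Sum>j\<in>I. c j * x j i) = (\<lambda>i. \<Sum>j\<in>I. c j * app T (x j) i)"
proof (induct I rule: finite_induct)
  case (insert k I)
  then show ?case using app_lin[of T "c k" "x k" "\<lambda>i. \<Sum>j\<in>I. c j * x j i"] by simp
qed simp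

lemma sc_commute: "T * sc c = sc c * T"
  by (rule linop_eqI) (use app_lin[of T c _ "\<lambda>_. 0"] in \<open>simp add: app_simps\<close>)

lemma sc_simps: "sc (c + d) = sc c + sc d" "sc (c * d) = sc c * sc d" "sc 1 = 1" "sc 0 = 0"
  by (transfer; auto simp: algebra_simps)+

lemma sc_sum: "sc (\<Sum>i\<in>I. c i) = (\<Sum>i\<in>I. sc (c i))"
  by (induct I rule: infinite_finite_induct) (auto simp: sc_simps)

lemma app_e: "app (e n) x = (\<lambda>i. if i < n then x i else 0)" by (simp only: e.rep_eq)
lemma app_sh: "app (sh m) x = (\<lambda>i. if i < m then 0 else x (i - m))" by (simp only: sh.rep_eq)
lemma app_us: "app (us m) x = (\<lambda>i. x (i + m))" by (simp only: us.rep_eq)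
lemma app_E: "app (E a b) x = (\<lambda>i. if i = a then x b else 0)" by (simp only: E.rep_eq)
lemma app_op: "app (op A) x = (\<lambda>i. if i < dim_row A then \<Sum>j<dim_col A. A $$ (i, j) * x j else 0)"
  by (simp only: op.rep_eq)

lemma e_0 [simp]: "e 0 = 0" by (rule linop_eqI) (simp add: app_simps app_e)
lemma e_mult: "e m * e n = e (min m n)" by (rule linop_eqI) (simp add: app_simps app_e fun_eq_iff)
lemma e_idem [simp]: "e n * e n = e n" by (simp add: e_mult)
lemma us_sh: "us m * sh m = 1" by (rule linop_eqI) (simp add: app_simps app_us app_sh)
lemma e_sh: "e m * sh m = 0" by (rule linop_eqI) (simp add: app_simps app_e app_sh fun_eq_iff)
lemma us_e: "us m * e m = 0" by (rule linop_eqI) (simp add: app_simps app_us app_e)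
lemma e_split: "e (m + n) = e m + sh m * e n * us m"
  by (rule linop_eqI) (auto simp: app_simps app_us app_sh app_e fun_eq_iff)

lemma E_mult: "E a b * E c d = (if b = c then E a d else 0)"
  by (rule linop_eqI) (auto simp: app_simps app_E fun_eq_iff)
lemma e_E: "e n * E a b = (if a < n then E a b else 0)"
  by (rule linop_eqI) (auto simp: app_simps app_e app_E fun_eq_iff)
lemma E_e: "E a b * e n = (if b < n then E a b else 0)"
  by (rule linop_eqI) (auto simp: app_simps app_e app_E fun_eq_iff)
lemma e_Suc: "e (Suc n) = e n + E n n"
  by (rule linop_eqI) (auto simp: app_simps app_e app_E fun_eq_iff)

definition unit :: "nat \<Rightarrow> nat \<Rightarrow> 'k::field" where "unit j = (\<lambda>i. if i = j then 1 else 0)"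

lemma e_units: "app (e n) x = (\<lambda>i. \<Sum>j<n. x j * unit j i)"
  by (auto simp: app_e unit_def fun_eq_iff if_distrib[of "\<lambda>z. _ * z"] cong: if_cong)

definition mo :: "nat \<Rightarrow> nat \<Rightarrow> 'k::field linop \<Rightarrow> 'k mat" where
  "mo m n T = mat m n (\<lambda>(i, j). app T (unit j) i)"

lemma mo_dim [simp]: "mo m n T \<in> carrier_mat m n" "dim_row (mo m n T) = m" "dim_col (mo m n T) = n"
  by (simp_all add: mo_def)

lemma op_mo: "op (mo m n T) = e m * T * e n"
proof (rule linop_eqI)
  fix x
  have "app T (app (e n) x) = (\<lambda>i. \<Sum>j<n. x j * app T (unit j) i)"
    unfolding e_units by (rule app_sum) simp
  then show "app (op (mo m n T)) x = app (e m * T * e n) x"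
    by (auto simp: app_simps app_e[of m] app_op mo_def fun_eq_iff mult.commute)
qed

lemma op_inj:
  assumes "dim_row A = dim_row B" "dim_col A = dim_col B" "op A = op B"
  shows "A = B"
proof (rule eq_matI)
  fix i j assume ij: "i < dim_row B" "j < dim_col B"
  have "app (op M) (unit j) i = M $$ (i, j)" if "i < dim_row M" "j < dim_col M" for M :: "'a mat"
    using that by (simp add: app_op unit_def if_distrib[of "\<lambda>z. _ * z"] cong: if_cong)
  then show "A $$ (i, j) = B $$ (i, j)" using ij assms by metis
qed (use assms in auto)

lemma op_mult: "dim_col A = dim_row B \<Longrightarrow> op (A * B) = op A * op B"
proof (rule linop_eqI)
  fix x assume AB: "dim_col A = dim_row B"
  show "app (op (A * B)) x = app (op A * op B) x"
  proof
    fix i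
    have "(\<Sum>j<dim_col B. (\<Sum>k<dim_row B. A $$ (i, k) * B $$ (k, j)) * x j) =
        (\<Sum>k<dim_row B. A $$ (i, k) * (\<Sum>j<dim_col B. B $$ (k, j) * x j))"
      by (simp add: sum_distrib_left sum_distrib_right mult.assoc) (rule sum.swap)
    then show "app (op (A * B)) x i = app (op A * op B) x i"
      using AB by (simp add: app_simps app_op scalar_prod_def atLeast0LessThan)
  qed
qed

lemma op_add: "dim_row A = dim_row B \<Longrightarrow> dim_col A = dim_col B \<Longrightarrow> op (A + B) = op A + op B"
  by (rule linop_eqI) (auto simp: app_simps app_op fun_eq_iff algebra_simps sum.distrib)

lemma op_minus: "dim_row A = dim_row B \<Longrightarrow> dim_col A = dim_col B \<Longrightarrow> op (A - B) = op A - op B"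
  by (rule linop_eqI) (auto simp: app_simps app_op fun_eq_iff algebra_simps sum_subtractf)

lemma op_uminus: "op (- A) = - op A"
  by (rule linop_eqI) (auto simp: app_simps app_op fun_eq_iff sum_negf)

lemma op_smult: "op (c \<cdot>\<^sub>m A) = sc c * op A"
  by (rule linop_eqI) (auto simp: app_simps app_op fun_eq_iff sum_distrib_left mult.assoc)

lemma op_zero: "op (0\<^sub>m m n) = 0"
  by (rule linop_eqI) (auto simp: app_simps app_op fun_eq_iff)

lemma op_one: "op (1\<^sub>m n) = e n"
  by (rule linop_eqI) (auto simp: app_e app_op fun_eq_iff if_distrib[of "\<lambda>z. z * _"] cong: if_cong)

lemma e_op: "e (dim_row A) * op A = op A" and op_e: "op A * e (dim_col A) = op A"
  by (rule linop_eqI, auto simp: app_simps app_e app_op fun_eq_iff)+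

lemma mo_op: "A \<in> carrier_mat m n \<Longrightarrow> mo m n (op A) = A"
  by (rule op_inj) (use e_op[of A] op_e[of A] in \<open>auto simp: op_mo mult.assoc\<close>)

text \<open>Vectors of length \<open>n\<close> are the sequences vanishing from \<open>n\<close> on.\<close>

definition seq :: "'k::field vec \<Rightarrow> nat \<Rightarrow> 'k" where "seq v = (\<lambda>i. if i < dim_vec v then v $ i else 0)"

lemma seq_inj: "dim_vec v = dim_vec w \<Longrightarrow> seq v = seq w \<Longrightarrow> v = w"
  by (rule eq_vecI) (auto simp: seq_def fun_eq_iff split: if_splits dest: spec)

lemma seq_mult: "dim_vec v = dim_col A \<Longrightarrow> seq (A *\<^sub>v v) = app (op A) (seq v)"
  by (auto simp: seq_def app_op fun_eq_iff scalar_prod_def atLeast0LessThan)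

lemma seq_vec: "seq (vec n x) = app (e n) x"
  by (auto simp: seq_def app_e)

lemma e_seq: "app (e (dim_vec v)) (seq v) = seq v"
  by (auto simp: seq_def app_e)

lemma seq_zero: "seq (0\<^sub>v n) = (\<lambda>_. 0)" by (auto simp: seq_def)

lemma seq_diff: "dim_vec v = dim_vec w \<Longrightarrow> seq (v - w) = (\<lambda>i. seq v i - seq w i)"
  by (auto simp: seq_def)

subsection \<open>Rank factorization\<close>

lemma E_compress: "E 0 i * T * E j 0 = sc (app T (unit j) i) * E 0 0" for T :: "'k::field linop"
proof (rule linop_eqI)
  fix x :: "nat \<Rightarrow> 'k"
  have "app (E j 0) x = (\<lambda>k. x 0 * unit j k + 0)" by (auto simp: app_E unit_def)
  then have "app T (app (E j 0) x) = (\<lambda>k. x 0 * app T (unit j) k)"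
    using app_lin[of T "x 0" "unit j" "\<lambda>_. 0"] by simp
  then show "app (E 0 i * T * E j 0) x = app (sc (app T (unit j) i) * E 0 0) x"
    by (auto simp: app_simps app_E)
qed

lemma nonzero_entry:
  assumes "T \<noteq> 0" "e m * T = T" "T * e n = T"
  obtains i j where "i < m" "j < n" "app T (unit j) i \<noteq> 0"
proof -
  have "\<exists>j<n. app T (unit j) \<noteq> (\<lambda>_. 0)"
  proof (rule ccontr)
    assume *: "\<not> ?thesis"
    have "app T x = app 0 x" for x
    proof -
      have "app T x = app T (app (e n) x)" using assms(3) app_simps(3)[of T "e n" x] by simp
      also have "\<dots> = (\<lambda>i. \<Sum>j<n. x j * app T (unit j) i)" unfolding e_units by (rule app_sum) simp
      also have "\<dots> = app 0 x" using * by (auto simp: app_simps)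
      finally show ?thesis .
    qed
    then show False using assms(1) linop_eqI by blast
  qed
  then obtain i j where ij: "j < n" "app T (unit j) i \<noteq> 0" by (auto simp: fun_eq_iff)
  have "app T (unit j) i = app (e m) (app T (unit j)) i" using assms(2) app_simps(3)[of "e m" T] by simp
  then have "i < m" using ij(2) by (auto simp: app_e split: if_splits)
  with ij that show thesis by blast
qed

text \<open>Rank-one reduction at a nonzero entry \<open>a\<close>: subtracting the product of the
  pivot column and the scaled pivot row clears both, so the number of nonzero rows drops
  (\<open>E 0 k * T\<close> is row \<open>k\<close> moved to the top). The one-sided inverses
  \<open>K'\<close> and \<open>L'\<close> are kept so that \<open>K\<close> and \<open>L\<close> can
  be cancelled later.\<close>

lemma rank_factorization:
  fixes T :: "'a::field linop"
  assumes "e m * T = T" "T * e n = T"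
  shows "\<exists>r K L K' L'. T = K * L \<and> K' * K = e r \<and> L * L' = e r \<and>
    e m * K = K \<and> K * e r = K \<and> e r * L = L \<and> L * e n = L \<and> e r * K' = K' \<and> K' * e m = K' \<and> e n * L' = L' \<and> L' * e r = L'"
  using assms
proof (induct "card {k. k < m \<and> E 0 k * T \<noteq> 0}" arbitrary: T rule: less_induct)
  case less
  show ?case
  proof (cases "T = 0")
    case True
    then show ?thesis by (intro exI[of _ 0]) simp
  next
    case False
    then obtain i j where ij: "i < m" "j < n" "app T (unit j) i \<noteq> 0" using nonzero_entry less.prems by blast
    define a where "a = app T (unit j) i"
    have a: "a \<noteq> 0" "sc (1 / a) * sc a = 1" "sc a * sc (1 / a) = 1"
      using ij by (simp_all add: a_def flip: sc_simps)
    define c where "c = T * E j 0"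
    define \<sigma> where "\<sigma> = sc (1 / a) * E 0 i"
    define \<rho> where "\<rho> = \<sigma> * T"
    have cc: "E 0 i * T * E j 0 = sc a * E 0 0" unfolding a_def by (rule E_compress)
    have \<sigma>c: "\<sigma> * c = E 0 0" using cc a by (simp add: \<sigma>_def c_def mult.assoc) (simp flip: mult.assoc)
    define T' where "T' = T - c * \<rho>"
    have eT: "e m * T = T" "T * e n = T" using less.prems by auto
    have "E 0 0 * \<sigma> = sc (1 / a) * (E 0 0 * E 0 i)" unfolding \<sigma>_def by (metis mult.assoc sc_commute)
    then have \<sigma>0: "E 0 0 * \<sigma> = \<sigma>" by (simp add: E_mult \<sigma>_def)
    have fm: "e m * c = c" "\<rho> * e n = \<rho>" "\<sigma> * e m = \<sigma>" "c * E 0 0 = c" "E 0 0 * \<rho> = \<rho>" "E 0 0 * \<sigma> = \<sigma>"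
    proof -
      show "e m * c = c" by (simp add: c_def eT flip: mult.assoc)
      show "\<rho> * e n = \<rho>" by (simp add: \<rho>_def eT mult.assoc)
      show "\<sigma> * e m = \<sigma>" using ij(1) by (simp add: \<sigma>_def mult.assoc E_e)
      show "c * E 0 0 = c" by (simp add: c_def mult.assoc E_mult)
      show "E 0 0 * \<rho> = \<rho>" by (simp add: \<rho>_def \<sigma>0 flip: mult.assoc)
      show "E 0 0 * \<sigma> = \<sigma>" by (rule \<sigma>0)
    qed
    have T': "e m * T' = T'" "T' * e n = T'" 
      unfolding T'_def right_diff_distrib left_diff_distrib by (simp_all add: eT fm flip: mult.assoc) (simp_all add: fm mult.assoc)
    have iT': "E 0 i * T' = 0"
    proof -
      have "E 0 i * c = sc a * E 0 0" using cc by (simp add: c_def mult.assoc)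
      then have "E 0 i * (c * \<rho>) = sc a * \<rho>" using fm(5) by (simp flip: mult.assoc) (simp add: mult.assoc fm(5))
      also have "\<dots> = E 0 i * T" unfolding \<rho>_def \<sigma>_def using a by (simp flip: mult.assoc)
      finally show ?thesis by (simp add: T'_def right_diff_distrib)
    qed
    have jT': "T' * E j 0 = 0"
    proof -
      have "\<rho> * E j 0 = E 0 0" using \<sigma>c by (simp add: \<rho>_def c_def mult.assoc)
      then show ?thesis using fm(4) by (simp add: T'_def left_diff_distrib mult.assoc c_def[symmetric])
    qed
    have "{k. k < m \<and> E 0 k * T' \<noteq> 0} \<subset> {k. k < m \<and> E 0 k * T \<noteq> 0}"
    proof (rule psubsetI)
      have "E 0 k * T' = 0" if "E 0 k * T = 0" for k
        using that by (simp add: T'_def right_diff_distrib c_def flip: mult.assoc)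
      then show "{k. k < m \<and> E 0 k * T' \<noteq> 0} \<subseteq> {k. k < m \<and> E 0 k * T \<noteq> 0}" by auto
      have "E 0 i * T \<noteq> 0"
      proof
        assume "E 0 i * T = 0"
        then have "sc a * E 0 0 = 0" using cc by simp
        then have "app (sc a * E 0 0) (\<lambda>_. 1) 0 = (0::'a)" by (simp add: app_simps)
        then show False using a(1) by (simp add: app_simps app_E)
      qed
      then show "{k. k < m \<and> E 0 k * T' \<noteq> 0} \<noteq> {k. k < m \<and> E 0 k * T \<noteq> 0}" using ij(1) iT' by auto
    qed
    then have "card {k. k < m \<and> E 0 k * T' \<noteq> 0} < card {k. k < m \<and> E 0 k * T \<noteq> 0}" by (intro psubset_card_mono) auto
    from less.hyps[OF this T'] obtain r K L K' L' where
      F: "T' = K * L" "K' * K = e r" "L * L' = e r" "e m * K = K" "K * e r = K" "e r * L = L" "L * e n = L"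
      "e r * K' = K'" "K' * e m = K'" "e n * L' = L'" "L' * e r = L'" by blast
    have \<sigma>K: "\<sigma> * K = 0"
    proof -
      have "K = T' * L'" using F by (simp add: mult.assoc)
      then show ?thesis using iT' by (simp add: \<sigma>_def mult.assoc) (simp flip: mult.assoc)
    qed
    have LE: "L * E j 0 = 0"
    proof -
      have "L = K' * T'" using F by (simp flip: mult.assoc)
      then show ?thesis using jT' by (simp add: mult.assoc)
    qed
    have Er: "K * E r 0 = 0" "E 0 r * L = 0" "E 0 r * K' = 0" "L' * E r 0 = 0"
    proof -
      have "K * E r 0 = K * (e r * E r 0)" "L' * E r 0 = L' * (e r * E r 0)" using F by (simp_all flip: mult.assoc)
      then show "K * E r 0 = 0" "L' * E r 0 = 0" by (simp_all add: e_E)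
      have "E 0 r * L = E 0 r * e r * L" "E 0 r * K' = E 0 r * e r * K'" using F by (simp_all add: mult.assoc)
      then show "E 0 r * L = 0" "E 0 r * K' = 0" by (simp_all add: E_e)
    qed
    \<comment> \<open>Pivot column and pivot row are appended at position \<open>r\<close>. The
      subtracted terms in \<open>K2'\<close> and \<open>L2'\<close> make the old parts annihilate
      the new column and row.\<close>
    define K2 where "K2 = K + c * E 0 r"
    define L2 where "L2 = L + E r 0 * \<rho>"
    define K2' where "K2' = K' - K' * c * \<sigma> + E r 0 * \<sigma>"
    define L2' where "L2' = L' - E j 0 * \<rho> * L' + E j 0 * E 0 r"
    have \<rho>E: "\<rho> * E j 0 = E 0 0" using \<sigma>c by (simp add: \<rho>_def c_def mult.assoc)
    note as = mult.assoc
    have z: "\<sigma> * (K * x) = 0" "L * (E j 0 * x) = 0" "K * (E r 0 * x) = 0" "E 0 r * (L * x) = 0" "E 0 r * (K' * x) = 0" "L' * (E r 0 * x) = 0"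
      "\<sigma> * (c * x) = E 0 0 * x" "\<rho> * (E j 0 * x) = E 0 0 * x" "E 0 r * (E r 0 * x) = E 0 0 * x" "c * (E 0 0 * x) = c * x" "E 0 0 * (\<rho> * x) = \<rho> * x"
      "E 0 0 * (E 0 r * x) = E 0 r * x" "E r 0 * (E 0 0 * x) = E r 0 * x" "E r 0 * (E 0 r * x) = E r r * x" "E 0 0 * (\<sigma> * x) = \<sigma> * x"
      "K' * (K * x) = e r * x" "L * (L' * x) = e r * x" for x
      by (simp_all add: \<sigma>K LE Er \<sigma>c \<rho>E fm E_mult F flip: mult.assoc)
    have "K2 * L2 = K * L + c * \<rho>" by (simp add: K2_def L2_def algebra_simps z Er fm)
    then have 1: "T = K2 * L2" using F(1) unfolding T'_def by (metis diff_add_cancel)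
    have 2: "K2' * K2 = e (Suc r)" by (simp add: K2_def K2'_def algebra_simps z Er fm \<sigma>K \<sigma>c F E_mult e_Suc)
    have 3: "L2 * L2' = e (Suc r)" 
      by (simp add: L2_def L2'_def algebra_simps z Er fm LE \<rho>E F E_mult[of 0 0 0 r] E_mult[of r 0 0 r] e_Suc)
    have er: "e (Suc r) * X = X" if "e r * X = X" for X :: "'a linop" 
      by (metis that e_mult lessI less_imp_le_nat min.absorb2 mult.assoc)
    have er': "X * e (Suc r) = X" if "X * e r = X" for X :: "'a linop" 
      by (metis that e_mult lessI less_imp_le_nat min.absorb1 mult.assoc)
    have 4: "e m * K2 = K2" "K2 * e (Suc r) = K2" "e (Suc r) * L2 = L2" "L2 * e n = L2"
      "e (Suc r) * K2' = K2'" "K2' * e m = K2'" "e n * L2' = L2'" "L2' * e (Suc r) = L2'"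
    proof -
      show "e m * K2 = K2" unfolding K2_def distrib_left by (simp add: F fm flip: mult.assoc)
      show "K2 * e (Suc r) = K2" unfolding K2_def distrib_right by (simp add: er' F mult.assoc E_e)
      show "e (Suc r) * L2 = L2" unfolding L2_def distrib_left by (simp add: er F e_E flip: mult.assoc)
      show "L2 * e n = L2" unfolding L2_def distrib_right by (simp add: F fm mult.assoc)
      show "e (Suc r) * K2' = K2'" unfolding K2'_def distrib_left right_diff_distrib by (simp add: er F e_E flip: mult.assoc)
      show "K2' * e m = K2'" unfolding K2'_def distrib_right left_diff_distrib by (simp add: F fm mult.assoc)
      show "e n * L2' = L2'" unfolding L2'_def distrib_left right_diff_distrib using ij(2) by (simp add: F e_E flip: mult.assoc)
      show "L2' * e (Suc r) = L2'" unfolding L2'_def distrib_right left_diff_distrib by (simp add: er' F E_e mult.assoc)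
    qed
    show ?thesis using 1 2 3 4 by blast
  qed
qed

lemma sc_left: "T * (sc c * S) = sc c * (T * S)"
  by (simp add: sc_commute flip: mult.assoc)

lemma generalized_inverse:
  assumes "e m * T = T" "T * e n = T"
  obtains G where "T * G * T = T" "e n * G = G" "G * e m = G"
proof -
  obtain r K L K' L' where F: "T = K * L" "K' * K = e r" "L * L' = e r" "e r * L = L" "K * e r = K" "K' * e m = K'" "e n * L' = L'"
    using rank_factorization[OF assms] by blast
  have "T * (L' * K') * T = K * (L * L') * (K' * K) * L" by (simp add: F(1) mult.assoc)
  also have "\<dots> = T" unfolding F(2,3) by (simp add: F(4) mult.assoc F(1))
  finally show thesis using that[of "L' * K'"] F by (simp add: mult.assoc) (simp flip: mult.assoc)
qed

text \<open>Cancelling \<open>K\<close> and \<open>L\<close> in \<open>P * P = P\<close> by their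
  one-sided inverses leaves \<open>L * K = e r\<close>.\<close>

lemma idempotent_splitting:
  assumes "e n * P = P" "P * e n = P" "P * P = P"
  obtains r K L where "P = K * L" "L * K = e r" "e n * K = K" "K * e r = K" "e r * L = L" "L * e n = L"
proof -
  obtain r K L K' L' where F: "P = K * L" "K' * K = e r" "L * L' = e r" "e n * K = K" "K * e r = K" "e r * L = L" "L * e n = L"
    "e r * K' = K'" "L' * e r = L'"
    using rank_factorization[OF assms(1,2)] by blast
  have "K' * (P * P) * L' = K' * K * (L * K) * (L * L')" by (simp add: F(1) mult.assoc)
  also have "\<dots> = e r * (L * K) * e r" unfolding F(2,3) ..
  also have "\<dots> = L * K" by (simp add: F mult.assoc) (simp add: F flip: mult.assoc)
  finally have "L * K = K' * P * L'" unfolding assms(3) by simp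
  also have "\<dots> = (K' * K) * (L * L')" by (simp add: F(1) mult.assoc)
  also have "\<dots> = e r" unfolding F(2,3) by simp
  finally show thesis using that F by blast
qed

text \<open>With a generalized inverse \<open>G\<close>, the operator \<open>e n - G * T\<close>
  maps into the kernel of \<open>T\<close>, where \<open>C\<close> vanishes; hence
  \<open>C * G\<close> serves as \<open>H\<close>.\<close>

lemma factor_through:
  fixes C :: "'k::field linop"
  assumes "e m * T = T" "T * e n = T"
    and ker: "\<And>x. app (e n) x = x \<Longrightarrow> app T x = (\<lambda>_. 0) \<Longrightarrow> app C x = (\<lambda>_. 0)"
  shows "\<exists>H. C * e n = H * T"
proof -
  obtain G where G: "T * G * T = T" "e n * G = G" "G * e m = G" using generalized_inverse[OF assms(1,2)] .
  have "C * (e n - G * T) = 0"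
  proof (rule linop_eqI)
    fix x
    let ?y = "app (e n - G * T) x"
    have "app (e n) ?y = app (e n * (e n - G * T)) x" by (simp add: app_simps)
    also have "e n * (e n - G * T) = e n - G * T" by (simp add: right_diff_distrib G(2) flip: mult.assoc)
    finally have 1: "app (e n) ?y = ?y" .
    have "app T ?y = app (T * (e n - G * T)) x" by (simp add: app_simps)
    also have "T * (e n - G * T) = 0" using G(1) assms(2) by (simp add: right_diff_distrib flip: mult.assoc)
    finally have "app T ?y = (\<lambda>_. 0)" by (simp add: app_simps)
    from ker[OF 1 this] show "app (C * (e n - G * T)) x = app 0 x" by (simp add: app_simps)
  qed
  then have "C * e n = (C * G) * T" by (simp add: right_diff_distrib mult.assoc)
  then show ?thesis by blast
qed

section \<open>Modules and complexes in operator form\<close>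

abbreviation rho :: "('a, 'k::field) fdmod \<Rightarrow> 'a \<Rightarrow> 'k linop" where "rho M a \<equiv> op (mact M a)"
abbreviation eM :: "('a, 'k::field) fdmod \<Rightarrow> 'k linop" where "eM M \<equiv> e (mdim M)"

text \<open>The prefix \<open>r\<close> marks the operator versions of modules, homomorphisms, chain maps and
  quasi-isomorphisms.\<close>

definition rmod :: "('k::field, 'a) module \<Rightarrow> nat \<Rightarrow> ('a \<Rightarrow> 'k linop) \<Rightarrow> bool" where
  "rmod \<Lambda> n \<rho> \<longleftrightarrow> (\<forall>a\<in>carrier \<Lambda>. e n * \<rho> a = \<rho> a \<and> \<rho> a * e n = \<rho> a) \<and>
     (\<forall>a\<in>carrier \<Lambda>. \<forall>b\<in>carrier \<Lambda>. \<rho> (a \<oplus>\<^bsub>\<Lambda>\<^esub> b) = \<rho> a + \<rho> b) \<and>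
     (\<forall>c. \<forall>a\<in>carrier \<Lambda>. \<rho> (c \<odot>\<^bsub>\<Lambda>\<^esub> a) = sc c * \<rho> a) \<and>
     (\<forall>a\<in>carrier \<Lambda>. \<forall>b\<in>carrier \<Lambda>. \<rho> (a \<otimes>\<^bsub>\<Lambda>\<^esub> b) = \<rho> a * \<rho> b) \<and> \<rho> \<one>\<^bsub>\<Lambda>\<^esub> = e n"

definition mkmod :: "nat \<Rightarrow> ('a \<Rightarrow> 'k::field linop) \<Rightarrow> ('a, 'k) fdmod" where
  "mkmod n \<rho> = \<lparr>mdim = n, mact = (\<lambda>a. mo n n (\<rho> a))\<rparr>"

lemma mdim_mkmod [simp]: "mdim (mkmod n \<rho>) = n" by (simp add: mkmod_def)

lemma rho_mkmod: "rmod \<Lambda> n \<rho> \<Longrightarrow> a \<in> carrier \<Lambda> \<Longrightarrow> rho (mkmod n \<rho>) a = \<rho> a"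
  by (simp add: mkmod_def op_mo rmod_def)

lemma is_fdmod_mkmod:
  assumes r: "rmod \<Lambda> n \<rho>"
  shows "is_fdmod \<Lambda> (mkmod n \<rho>)"
proof -
  have e: "e n * \<rho> a * e n = \<rho> a" if "a \<in> carrier \<Lambda>" for a using r that by (simp add: rmod_def)
  have s: "e n * (sc c * \<rho> a) * e n = sc c * \<rho> a" if "a \<in> carrier \<Lambda>" for a c
    using e[OF that] by (simp add: sc_left mult.assoc)
  have p: "e n * (\<rho> a * \<rho> b) * e n = \<rho> a * \<rho> b" if "a \<in> carrier \<Lambda>" "b \<in> carrier \<Lambda>" for a b
    using r that by (simp add: rmod_def flip: mult.assoc) (simp add: mult.assoc)
  show ?thesis
    unfolding is_fdmod_def mkmod_def fdmod.simps
  proof (intro conjI ballI allI; (intro op_inj)?)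
    fix a b assume a: "a \<in> carrier \<Lambda>" and b: "b \<in> carrier \<Lambda>"
    show "op (mo n n (\<rho> (a \<oplus>\<^bsub>\<Lambda>\<^esub> b))) = op (mo n n (\<rho> a) + mo n n (\<rho> b))"
      using r a b e[OF a] e[OF b] by (simp add: op_add op_mo rmod_def distrib_left distrib_right)
    show "op (mo n n (\<rho> (a \<otimes>\<^bsub>\<Lambda>\<^esub> b))) = op (mo n n (\<rho> a) * mo n n (\<rho> b))"
      using r a b e[OF a] e[OF b] p[OF a b] by (simp add: op_mult op_mo rmod_def)
  next
    fix c a assume a: "a \<in> carrier \<Lambda>"
    show "op (mo n n (\<rho> (c \<odot>\<^bsub>\<Lambda>\<^esub> a))) = op (c \<cdot>\<^sub>m mo n n (\<rho> a))"
      using r a e[OF a] s[OF a] by (simp add: op_smult op_mo rmod_def)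
  next
    show "op (mo n n (\<rho> \<one>\<^bsub>\<Lambda>\<^esub>)) = op (1\<^sub>m n)" using r by (simp add: op_mo op_one rmod_def)
  qed simp_all
qed

lemma rmod_rho: assumes "is_fdmod \<Lambda> M" shows "rmod \<Lambda> (mdim M) (rho M)"
proof -
  have d: "dim_row (mact M a) = mdim M" "dim_col (mact M a) = mdim M" if "a \<in> carrier \<Lambda>" for a
    using assms that by (auto simp: is_fdmod_def)
  show ?thesis
    unfolding rmod_def
  proof (intro conjI ballI allI)
    fix a assume a: "a \<in> carrier \<Lambda>"
    show "eM M * rho M a = rho M a" "rho M a * eM M = rho M a" using e_op[of "mact M a"] op_e[of "mact M a"] d[OF a] by auto
    show "rho M (c \<odot>\<^bsub>\<Lambda>\<^esub> a) = sc c * rho M a" for c using assms a by (simp add: is_fdmod_def op_smult)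
    fix b assume b: "b \<in> carrier \<Lambda>"
    show "rho M (a \<oplus>\<^bsub>\<Lambda>\<^esub> b) = rho M a + rho M b" using assms a b d[OF a] d[OF b] by (simp add: is_fdmod_def op_add)
    show "rho M (a \<otimes>\<^bsub>\<Lambda>\<^esub> b) = rho M a * rho M b" using assms a b d[OF a] d[OF b] by (simp add: is_fdmod_def op_mult)
  qed (use assms in \<open>simp add: is_fdmod_def op_one\<close>)
qed

definition rhom :: "('k::field, 'a) module \<Rightarrow> ('a, 'k) fdmod \<Rightarrow> ('a, 'k) fdmod \<Rightarrow> 'k linop \<Rightarrow> bool" where
  "rhom \<Lambda> M N T \<longleftrightarrow> eM N * T = T \<and> T * eM M = T \<and> (\<forall>a\<in>carrier \<Lambda>. T * rho M a = rho N a * T)"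

lemma rhom_op:
  assumes "is_fdmod \<Lambda> M" "is_fdmod \<Lambda> N" "f \<in> mod_hom \<Lambda> M N"
  shows "rhom \<Lambda> M N (op f)"
proof -
  have d: "dim_row f = mdim N" "dim_col f = mdim M" using assms(3) by (auto simp: mod_hom_def)
  have "op f * rho M a = rho N a * op f" if a: "a \<in> carrier \<Lambda>" for a
  proof -
    have "dim_row (mact M a) = mdim M" "dim_col (mact N a) = mdim N" using assms(1,2) a by (auto simp: is_fdmod_def)
    moreover have "f * mact M a = mact N a * f" using assms(3) a by (simp add: mod_hom_def)
    ultimately show ?thesis using op_mult[of f "mact M a"] op_mult[of "mact N a" f] d by simp
  qed
  then show ?thesis using e_op[of f] op_e[of f] d by (simp add: rhom_def)
qed

lemma mo_mod_hom:
  assumes M: "is_fdmod \<Lambda> M" and N: "is_fdmod \<Lambda> N" and T: "rhom \<Lambda> M N T"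
  shows "mo (mdim N) (mdim M) T \<in> mod_hom \<Lambda> M N" "op (mo (mdim N) (mdim M) T) = T"
proof -
  show op: "op (mo (mdim N) (mdim M) T) = T" using T by (simp add: op_mo rhom_def)
  have "mo (mdim N) (mdim M) T * mact M a = mact N a * mo (mdim N) (mdim M) T" if a: "a \<in> carrier \<Lambda>" for a
  proof (rule op_inj)
    have d: "mact M a \<in> carrier_mat (mdim M) (mdim M)" "mact N a \<in> carrier_mat (mdim N) (mdim N)"
      using M N a by (auto simp: is_fdmod_def)
    then show "dim_row (mo (mdim N) (mdim M) T * mact M a) = dim_row (mact N a * mo (mdim N) (mdim M) T)"
      "dim_col (mo (mdim N) (mdim M) T * mact M a) = dim_col (mact N a * mo (mdim N) (mdim M) T)" by auto
    show "op (mo (mdim N) (mdim M) T * mact M a) = op (mact N a * mo (mdim N) (mdim M) T)"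
      using T a d by (simp add: op_mult op rhom_def)
  qed
  then show "mo (mdim N) (mdim M) T \<in> mod_hom \<Lambda> M N" by (simp add: mod_hom_def)
qed

lemma rhom_add: "rhom \<Lambda> M N S \<Longrightarrow> rhom \<Lambda> M N T \<Longrightarrow> rhom \<Lambda> M N (S + T)"
  and rhom_diff: "rhom \<Lambda> M N S \<Longrightarrow> rhom \<Lambda> M N T \<Longrightarrow> rhom \<Lambda> M N (S - T)"
  and rhom_neg: "rhom \<Lambda> M N S \<Longrightarrow> rhom \<Lambda> M N (- S)"
  and rhom_zero: "rhom \<Lambda> M N 0"
  by (auto simp: rhom_def algebra_simps)

lemma rhom_sc: "rhom \<Lambda> M N S \<Longrightarrow> rhom \<Lambda> M N (sc c * S)"
  by (simp add: rhom_def sc_left mult.assoc)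

lemma rhom_mult: assumes "rhom \<Lambda> M N S" "rhom \<Lambda> N K T" shows "rhom \<Lambda> M K (T * S)"
proof -
  have "eM K * (T * S) = (eM K * T) * S" "T * S * eM M = T * (S * eM M)" by (simp_all add: mult.assoc)
  moreover have "T * S * rho M a = rho K a * (T * S)" if a: "a \<in> carrier \<Lambda>" for a
  proof -
    have "T * S * rho M a = T * (S * rho M a)" by (simp add: mult.assoc)
    also have "\<dots> = T * rho N a * S" using assms(1) a by (simp add: rhom_def mult.assoc)
    also have "\<dots> = rho K a * (T * S)" using assms(2) a by (simp add: rhom_def mult.assoc)
    finally show ?thesis .
  qed
  ultimately show ?thesis using assms by (simp add: rhom_def)
qed

lemma rhom_id: "is_fdmod \<Lambda> M \<Longrightarrow> rhom \<Lambda> M M (eM M)"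
  using rmod_rho[of \<Lambda> M] by (simp add: rhom_def rmod_def)

abbreviation d :: "('a, 'k::field) cplx \<Rightarrow> int \<Rightarrow> 'k linop" where "d X i \<equiv> op (diff X i)"
abbreviation eX :: "('a, 'k::field) cplx \<Rightarrow> int \<Rightarrow> 'k linop" where "eX X i \<equiv> eM (cobj X i)"

lemma complexD:
  assumes "X \<in> bounded_complexes \<Lambda>"
  shows "is_fdmod \<Lambda> (cobj X i)" "rhom \<Lambda> (cobj X i) (cobj X (i + 1)) (d X i)" "d X (i + 1) * d X i = 0"
    "finite {i. mdim (cobj X i) \<noteq> 0}" "diff X i \<in> carrier_mat (mdim (cobj X (i + 1))) (mdim (cobj X i))"
proof -
  show m: "is_fdmod \<Lambda> (cobj X i)" for i using assms by (simp add: bounded_complexes_def)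
  have h: "diff X i \<in> mod_hom \<Lambda> (cobj X i) (cobj X (i + 1))" for i using assms by (simp add: bounded_complexes_def)
  show "rhom \<Lambda> (cobj X i) (cobj X (i + 1)) (d X i)" by (rule rhom_op[OF m m h])
  show c: "diff X i \<in> carrier_mat (mdim (cobj X (i + 1))) (mdim (cobj X i))" for i using h[of i] by (simp add: mod_hom_def)
  have "diff X (i + 1) * diff X i = 0\<^sub>m (mdim (cobj X (i + 2))) (mdim (cobj X i))" using assms by (simp add: bounded_complexes_def)
  moreover have "d X (i + 1) * d X i = op (diff X (i + 1) * diff X i)"
    by (rule op_mult[symmetric]) (use c[of i] c[of "i + 1"] in auto)
  ultimately show "d X (i + 1) * d X i = 0" by (simp add: op_zero)
  show "finite {i. mdim (cobj X i) \<noteq> 0}" using assms by (simp add: bounded_complexes_def)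
qed

definition mkc :: "(int \<Rightarrow> nat) \<Rightarrow> (int \<Rightarrow> 'a \<Rightarrow> 'k::field linop) \<Rightarrow> (int \<Rightarrow> 'k linop) \<Rightarrow> ('a, 'k) cplx" where
  "mkc m \<rho> D = \<lparr>cobj = (\<lambda>i. mkmod (m i) (\<rho> i)), diff = (\<lambda>i. mo (m (i + 1)) (m i) (D i))\<rparr>"

lemma mkc_complex:
  assumes r: "\<And>i. rmod \<Lambda> (m i) (\<rho> i)"
    and D: "\<And>i. e (m (i + 1)) * D i = D i" "\<And>i. D i * e (m i) = D i"
      "\<And>i a. a \<in> carrier \<Lambda> \<Longrightarrow> D i * \<rho> i a = \<rho> (i + 1) a * D i" "\<And>i. D (i + 1) * D i = 0"
    and fin: "finite {i. m i \<noteq> 0}"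
  shows "mkc m \<rho> D \<in> bounded_complexes \<Lambda>" "d (mkc m \<rho> D) i = D i" "mdim (cobj (mkc m \<rho> D) i) = m i"
    "a \<in> carrier \<Lambda> \<Longrightarrow> rho (cobj (mkc m \<rho> D) i) a = \<rho> i a"
proof -
  show rh: "rho (cobj (mkc m \<rho> D) i) a = \<rho> i a" if "a \<in> carrier \<Lambda>" for i a using rho_mkmod[OF r that] by (simp add: mkc_def)
  show dim: "mdim (cobj (mkc m \<rho> D) i) = m i" for i by (simp add: mkc_def)
  show op: "d (mkc m \<rho> D) i = D i" for i using D by (simp add: mkc_def op_mo)
  have fm: "is_fdmod \<Lambda> (cobj (mkc m \<rho> D) i)" for i using is_fdmod_mkmod[OF r] by (simp add: mkc_def)
  have "rhom \<Lambda> (cobj (mkc m \<rho> D) i) (cobj (mkc m \<rho> D) (i + 1)) (D i)" for i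
    using D rh dim by (simp add: rhom_def)
  from mo_mod_hom(1)[OF fm fm this] have "diff (mkc m \<rho> D) i \<in> mod_hom \<Lambda> (cobj (mkc m \<rho> D) i) (cobj (mkc m \<rho> D) (i + 1))" for i
    by (simp add: dim) (simp add: mkc_def)
  moreover have "diff (mkc m \<rho> D) (i + 1) * diff (mkc m \<rho> D) i = 0\<^sub>m (mdim (cobj (mkc m \<rho> D) (i + 2))) (mdim (cobj (mkc m \<rho> D) i))" for i
  proof (rule op_inj)
    have "op (diff (mkc m \<rho> D) (i + 1) * diff (mkc m \<rho> D) i) = d (mkc m \<rho> D) (i + 1) * d (mkc m \<rho> D) i"
      by (rule op_mult) (simp add: mkc_def)
    then show "op (diff (mkc m \<rho> D) (i + 1) * diff (mkc m \<rho> D) i) = op (0\<^sub>m (mdim (cobj (mkc m \<rho> D) (i + 2))) (mdim (cobj (mkc m \<rho> D) i)))"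
      using D(4) by (simp add: op op_zero)
  qed (simp_all add: mkc_def add.commute)
  ultimately show "mkc m \<rho> D \<in> bounded_complexes \<Lambda>"
    using fm fin unfolding bounded_complexes_def by (simp add: dim)
qed

definition rch :: "('k::field, 'a) module \<Rightarrow> ('a, 'k) cplx \<Rightarrow> ('a, 'k) cplx \<Rightarrow> (int \<Rightarrow> 'k linop) \<Rightarrow> bool" where
  "rch \<Lambda> X Y T \<longleftrightarrow> (\<forall>i. rhom \<Lambda> (cobj X i) (cobj Y i) (T i) \<and> T (i + 1) * d X i = d Y i * T i)"

definition mkf :: "('a, 'k::field) cplx \<Rightarrow> ('a, 'k) cplx \<Rightarrow> (int \<Rightarrow> 'k linop) \<Rightarrow> int \<Rightarrow> 'k mat" where
  "mkf X Y T i = mo (mdim (cobj Y i)) (mdim (cobj X i)) (T i)"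

lemma mkf_dim [simp]: "dim_row (mkf X Y T i) = mdim (cobj Y i)" "dim_col (mkf X Y T i) = mdim (cobj X i)"
  by (simp_all add: mkf_def)

lemma mkf_chain:
  assumes X: "X \<in> bounded_complexes \<Lambda>" and Y: "Y \<in> bounded_complexes \<Lambda>" and T: "rch \<Lambda> X Y T"
  shows "mkf X Y T \<in> chain_maps \<Lambda> X Y" "op (mkf X Y T i) = T i"
proof -
  note m = mo_mod_hom[OF complexD(1)[OF X] complexD(1)[OF Y]]
  have h: "rhom \<Lambda> (cobj X i) (cobj Y i) (T i)" for i using T by (simp add: rch_def)
  show op: "op (mkf X Y T i) = T i" for i using m(2)[OF h] by (simp add: mkf_def)
  have "mkf X Y T (i + 1) * diff X i = diff Y i * mkf X Y T i" for i
  proof (rule op_inj)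
    show "op (mkf X Y T (i + 1) * diff X i) = op (diff Y i * mkf X Y T i)"
      using complexD(5)[OF X, of i] complexD(5)[OF Y, of i] T by (simp add: op_mult op rch_def)
  qed (use complexD(5)[OF X, of i] complexD(5)[OF Y, of i] in auto)
  then show "mkf X Y T \<in> chain_maps \<Lambda> X Y" using m(1)[OF h] by (simp add: chain_maps_def mkf_def)
qed

lemma rch_op:
  assumes X: "X \<in> bounded_complexes \<Lambda>" and Y: "Y \<in> bounded_complexes \<Lambda>" and f: "f \<in> chain_maps \<Lambda> X Y"
  shows "rch \<Lambda> X Y (\<lambda>i. op (f i))" "mkf X Y (\<lambda>i. op (f i)) = f" "f i \<in> carrier_mat (mdim (cobj Y i)) (mdim (cobj X i))"
proof -
  have h: "f i \<in> mod_hom \<Lambda> (cobj X i) (cobj Y i)" "f (i + 1) * diff X i = diff Y i * f i" for i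
    using f by (auto simp: chain_maps_def)
  show c: "f i \<in> carrier_mat (mdim (cobj Y i)) (mdim (cobj X i))" for i using h(1) by (simp add: mod_hom_def)
  have "op (f (i + 1)) * d X i = d Y i * op (f i)" for i
    using h(2)[of i] op_mult[of "f (i + 1)" "diff X i"] op_mult[of "diff Y i" "f i"] c[of i] c[of "i + 1"]
      complexD(5)[OF X, of i] complexD(5)[OF Y, of i] by simp
  then show "rch \<Lambda> X Y (\<lambda>i. op (f i))"
    unfolding rch_def using rhom_op[OF complexD(1)[OF X] complexD(1)[OF Y] h(1)] by simp
  show "mkf X Y (\<lambda>i. op (f i)) = f" using mo_op[OF c] by (auto simp: mkf_def)
qed

lemma rch_id: "X \<in> bounded_complexes \<Lambda> \<Longrightarrow> rch \<Lambda> X X (\<lambda>i. eX X i)"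
  using rhom_id[OF complexD(1)[of X \<Lambda>]] complexD(2)[of X \<Lambda>] by (simp add: rch_def rhom_def)

lemma rch_comp: "rch \<Lambda> X Y T \<Longrightarrow> rch \<Lambda> Y Z U \<Longrightarrow> rch \<Lambda> X Z (\<lambda>i. U i * T i)"
proof -
  assume T: "rch \<Lambda> X Y T" and U: "rch \<Lambda> Y Z U"
  have "U (i + 1) * T (i + 1) * d X i = d Z i * (U i * T i)" for i
  proof -
    have "U (i + 1) * T (i + 1) * d X i = U (i + 1) * d Y i * T i" using T by (simp add: rch_def mult.assoc)
    also have "\<dots> = d Z i * (U i * T i)" using U by (simp add: rch_def mult.assoc)
    finally show ?thesis .
  qed
  then show ?thesis using T U rhom_mult unfolding rch_def by blast
qed

lemma rch_lin: "rch \<Lambda> X Y T \<Longrightarrow> rch \<Lambda> X Y U \<Longrightarrow> rch \<Lambda> X Y (\<lambda>i. sc c * T i + U i)"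
  unfolding rch_def by (simp add: rhom_add rhom_sc distrib_left distrib_right sc_left mult.assoc)

lemma rch_zero: "rch \<Lambda> X Y (\<lambda>_. 0)" by (simp add: rch_def rhom_zero)

definition exact_at :: "('a, 'k::field) cplx \<Rightarrow> int \<Rightarrow> bool" where
  "exact_at X i \<longleftrightarrow> (\<forall>x. app (eX X i) x = x \<longrightarrow> app (d X i) x = (\<lambda>_. 0) \<longrightarrow> (\<exists>u. x = app (d X (i - 1)) u))"

text \<open>Turns exactness at one place into an operator identity, with a contraction that is only
  linear over the field. A generalized inverse of the incoming differential removes the boundaries
  from the identity; what is left kills the cycles and so factors through the outgoing
  differential.\<close>

lemma exact_at_contraction:
  assumes X: "X \<in> bounded_complexes \<Lambda>"
  shows "exact_at X i \<longleftrightarrow> (\<exists>h0 h1. eX X i = d X (i - 1) * h0 + h1 * d X i)"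
proof
  assume ex: "exact_at X i"
  have D: "eX X i * d X (i - 1) = d X (i - 1)" "d X (i - 1) * eX X (i - 1) = d X (i - 1)"
    "eX X (i + 1) * d X i = d X i" "d X i * eX X i = d X i"
    using complexD(2)[OF X, of "i - 1"] complexD(2)[OF X, of i] by (auto simp: rhom_def)
  obtain G where G: "d X (i - 1) * G * d X (i - 1) = d X (i - 1)" "eX X (i - 1) * G = G" "G * eX X i = G"
    using generalized_inverse[OF D(1,2)] .
  let ?C = "eX X i - d X (i - 1) * G"
  have C0: "?C * d X (i - 1) = 0" using G(1) D(1) by (simp add: left_diff_distrib mult.assoc)
  have "\<exists>H. ?C * eX X i = H * d X i"
  proof (rule factor_through[OF D(3,4)])
    fix x assume "app (eX X i) x = x" "app (d X i) x = (\<lambda>_. 0)"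
    then obtain u where "x = app (d X (i - 1)) u" using ex by (auto simp: exact_at_def)
    then have "app ?C x = app (?C * d X (i - 1)) u" by (simp add: app_simps(3))
    then show "app ?C x = (\<lambda>_. 0)" unfolding C0 by (simp add: app_simps)
  qed
  then obtain H where "?C * eX X i = H * d X i" by blast
  then have "eX X i = d X (i - 1) * G + H * d X i" using G(3) by (simp add: left_diff_distrib mult.assoc algebra_simps)
  then show "\<exists>h0 h1. eX X i = d X (i - 1) * h0 + h1 * d X i" by blast
next
  assume "\<exists>h0 h1. eX X i = d X (i - 1) * h0 + h1 * d X i"
  then obtain h0 h1 where h: "eX X i = d X (i - 1) * h0 + h1 * d X i" by blast
  show "exact_at X i" unfolding exact_at_def
  proof (intro allI impI)
    fix x assume x: "app (eX X i) x = x" "app (d X i) x = (\<lambda>_. 0)"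
    have "x = app (d X (i - 1) * h0 + h1 * d X i) x" using x(1) unfolding h by simp
    also have "\<dots> = app (d X (i - 1)) (app h0 x)" using x(2) by (simp add: app_simps)
    finally show "\<exists>u. x = app (d X (i - 1)) u" by blast
  qed
qed

lemma cycles_iff:
  assumes X: "X \<in> bounded_complexes \<Lambda>" and v: "v \<in> carrier_vec (mdim (cobj X i))"
  shows "v \<in> cycles X i \<longleftrightarrow> app (d X i) (seq v) = (\<lambda>_. 0)"
proof -
  note c = complexD(5)[OF X, of i]
  have "diff X i *\<^sub>v v = 0\<^sub>v (mdim (cobj X (i + 1))) \<longleftrightarrow> seq (diff X i *\<^sub>v v) = seq (0\<^sub>v (mdim (cobj X (i + 1))))"
    using seq_inj[of "diff X i *\<^sub>v v" "0\<^sub>v (mdim (cobj X (i + 1)))"] c by auto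
  also have "\<dots> \<longleftrightarrow> app (d X i) (seq v) = (\<lambda>_. 0)" using seq_mult[of v "diff X i"] c v by (simp add: seq_zero)
  finally show ?thesis using v by (simp add: cycles_def)
qed

lemma boundaries_iff: assumes X: "X \<in> bounded_complexes \<Lambda>" and v: "v \<in> carrier_vec (mdim (cobj X i))"
  shows "v \<in> boundaries X i \<longleftrightarrow> (\<exists>u. seq v = app (d X (i - 1)) u)"
proof
  have c: "diff X (i - 1) \<in> carrier_mat (mdim (cobj X i)) (mdim (cobj X (i - 1)))" using complexD(5)[OF X, of "i - 1"] by simp
  show "\<exists>u. seq v = app (d X (i - 1)) u" if "v \<in> boundaries X i"
    using that c seq_mult[of _ "diff X (i - 1)"] by (auto simp: boundaries_def)
  show "v \<in> boundaries X i" if ex: "\<exists>u. seq v = app (d X (i - 1)) u"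
  proof -
    obtain u where u: "seq v = app (d X (i - 1)) u" using ex by blast
    let ?w = "vec (mdim (cobj X (i - 1))) u"
    have "seq (diff X (i - 1) *\<^sub>v ?w) = app (d X (i - 1)) (app (eX X (i - 1)) u)" using c by (simp add: seq_mult seq_vec)
    also have "\<dots> = app (d X (i - 1) * eX X (i - 1)) u" by (simp add: app_simps)
    also have "d X (i - 1) * eX X (i - 1) = d X (i - 1)" using op_e[of "diff X (i - 1)"] c by simp
    finally have "v = diff X (i - 1) *\<^sub>v ?w" using u c v seq_inj[of v "diff X (i - 1) *\<^sub>v ?w"] by auto
    then show ?thesis unfolding boundaries_def by (intro image_eqI[of _ _ ?w]) auto
  qed
qed

definition rq :: "('k::field, 'a) module \<Rightarrow> ('a, 'k) cplx \<Rightarrow> ('a, 'k) cplx \<Rightarrow> (int \<Rightarrow> 'k linop) \<Rightarrow> bool" where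
  "rq \<Lambda> Z X s \<longleftrightarrow> rch \<Lambda> Z X s \<and> (\<forall>i.
     (\<forall>x. app (eX Z i) x = x \<longrightarrow> app (d Z i) x = (\<lambda>_. 0) \<longrightarrow> (\<exists>u. app (s i) x = app (d X (i - 1)) u) \<longrightarrow>
        (\<exists>u. x = app (d Z (i - 1)) u)) \<and>
     (\<forall>y. app (eX X i) y = y \<longrightarrow> app (d X i) y = (\<lambda>_. 0) \<longrightarrow>
        (\<exists>x u. app (eX Z i) x = x \<and> app (d Z i) x = (\<lambda>_. 0) \<and> app (s i) x = (\<lambda>j. y j + app (d X (i - 1)) u j))))"

lemma seq_surj: "app (e n) x = x \<Longrightarrow> \<exists>v\<in>carrier_vec n. seq v = x"
  by (rule bexI[of _ "vec n x"]) (simp_all add: seq_vec)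

lemma quasi_iso_iff:
  fixes \<Lambda> :: "('k::field, 'a) module"
  assumes Z: "Z \<in> bounded_complexes \<Lambda>" and X: "X \<in> bounded_complexes \<Lambda>" and s: "s \<in> chain_maps \<Lambda> Z X"
  shows "s \<in> quasi_isos \<Lambda> Z X \<longleftrightarrow> rq \<Lambda> Z X (\<lambda>i. op (s i))"
proof -
  note c = rch_op(3)[OF Z X s]
  have sv: "seq (s i *\<^sub>v v) = app (op (s i)) (seq v)" "s i *\<^sub>v v \<in> carrier_vec (mdim (cobj X i))"
    if "v \<in> carrier_vec (mdim (cobj Z i))" for v i
    using that c[of i] by (auto simp: seq_mult)
  have ex: "app (eX Y i) (seq v) = seq v" if "v \<in> carrier_vec (mdim (cobj Y i))" for v i and Y :: "('a, 'k) cplx"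
    using e_seq[of v] that by simp
  have cyc: "v \<in> carrier_vec (mdim (cobj Y i))" if "v \<in> cycles Y i" for v i and Y :: "('a, 'k) cplx" using that by (simp add: cycles_def)
  have A: "(\<forall>v\<in>cycles Z i. s i *\<^sub>v v \<in> boundaries X i \<longrightarrow> v \<in> boundaries Z i) \<longleftrightarrow>
    (\<forall>x. app (eX Z i) x = x \<longrightarrow> app (d Z i) x = (\<lambda>_. 0) \<longrightarrow> (\<exists>u. app (op (s i)) x = app (d X (i - 1)) u) \<longrightarrow>
        (\<exists>u. x = app (d Z (i - 1)) u))" (is "?l = ?r") for i
  proof
    assume l: ?l
    show ?r
    proof (intro allI impI)
      fix x assume x: "app (eX Z i) x = x" "app (d Z i) x = (\<lambda>_. 0)" "\<exists>u. app (op (s i)) x = app (d X (i - 1)) u"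
      obtain v where v: "v \<in> carrier_vec (mdim (cobj Z i))" "seq v = x" using seq_surj[OF x(1)] by blast
      have "v \<in> cycles Z i" using cycles_iff[OF Z v(1)] v(2) x(2) by simp
      moreover have "s i *\<^sub>v v \<in> boundaries X i" using boundaries_iff[OF X sv(2)[OF v(1)]] sv(1)[OF v(1)] v(2) x(3) by simp
      ultimately have "v \<in> boundaries Z i" using l by blast
      then show "\<exists>u. x = app (d Z (i - 1)) u" using boundaries_iff[OF Z v(1)] v(2) by simp
    qed
  next
    assume r: ?r
    show ?l
    proof (intro ballI impI)
      fix v assume v: "v \<in> cycles Z i" "s i *\<^sub>v v \<in> boundaries X i"
      note vc = cyc[OF v(1)]
      show "v \<in> boundaries Z i"
        using r[rule_format, of "seq v"] ex[OF vc] cycles_iff[OF Z vc] v boundaries_iff[OF X sv(2)[OF vc]] sv(1)[OF vc] boundaries_iff[OF Z vc] by simp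
    qed
  qed
  have B: "(\<forall>w\<in>cycles X i. \<exists>v\<in>cycles Z i. s i *\<^sub>v v - w \<in> boundaries X i) \<longleftrightarrow>
    (\<forall>y. app (eX X i) y = y \<longrightarrow> app (d X i) y = (\<lambda>_. 0) \<longrightarrow>
        (\<exists>x u. app (eX Z i) x = x \<and> app (d Z i) x = (\<lambda>_. 0) \<and> app (op (s i)) x = (\<lambda>j. y j + app (d X (i - 1)) u j)))" (is "?l = ?r") for i
  proof -
    have bd: "s i *\<^sub>v v - w \<in> boundaries X i \<longleftrightarrow> (\<exists>u. app (op (s i)) (seq v) = (\<lambda>j. seq w j + app (d X (i - 1)) u j))"
      if "v \<in> carrier_vec (mdim (cobj Z i))" "w \<in> carrier_vec (mdim (cobj X i))" for v w
    proof -
      have cv: "s i *\<^sub>v v - w \<in> carrier_vec (mdim (cobj X i))" using sv(2)[OF that(1)] that(2) by simp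
      have sd: "seq (s i *\<^sub>v v - w) = (\<lambda>j. app (op (s i)) (seq v) j - seq w j)"
        using seq_diff[of "s i *\<^sub>v v" w] sv[OF that(1)] that(2) c[of i] by auto
      show ?thesis unfolding boundaries_iff[OF X cv] sd by (simp add: fun_eq_iff algebra_simps)
    qed
    show ?thesis
    proof
      assume l: ?l
      show ?r
      proof (intro allI impI)
        fix y assume y: "app (eX X i) y = y" "app (d X i) y = (\<lambda>_. 0)"
        obtain w where w: "w \<in> carrier_vec (mdim (cobj X i))" "seq w = y" using seq_surj[OF y(1)] by blast
        have "w \<in> cycles X i" using cycles_iff[OF X w(1)] w(2) y(2) by simp
        then obtain v where v: "v \<in> cycles Z i" "s i *\<^sub>v v - w \<in> boundaries X i" using l by blast
        note vc = cyc[OF v(1)]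
        obtain u where "app (op (s i)) (seq v) = (\<lambda>j. y j + app (d X (i - 1)) u j)" using bd[OF vc w(1)] v(2) w(2) by auto
        then show "\<exists>x u. app (eX Z i) x = x \<and> app (d Z i) x = (\<lambda>_. 0) \<and> app (op (s i)) x = (\<lambda>j. y j + app (d X (i - 1)) u j)"
          using ex[OF vc] cycles_iff[OF Z vc] v(1) by blast
      qed
    next
      assume r: ?r
      show ?l
      proof
        fix w assume w: "w \<in> cycles X i"
        note wc = cyc[OF w]
        obtain x u where x: "app (eX Z i) x = x" "app (d Z i) x = (\<lambda>_. 0)" "app (op (s i)) x = (\<lambda>j. seq w j + app (d X (i - 1)) u j)"
          using r ex[OF wc] cycles_iff[OF X wc] w by blast
        obtain v where v: "v \<in> carrier_vec (mdim (cobj Z i))" "seq v = x" using seq_surj[OF x(1)] by blast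
        have "v \<in> cycles Z i" using cycles_iff[OF Z v(1)] v(2) x(2) by simp
        moreover have "s i *\<^sub>v v - w \<in> boundaries X i" using bd[OF v(1) wc] v(2) x(3) by blast
        ultimately show "\<exists>v\<in>cycles Z i. s i *\<^sub>v v - w \<in> boundaries X i" by blast
      qed
    qed
  qed
  show ?thesis unfolding quasi_isos_def rq_def A[symmetric] B[symmetric] using s rch_op(1)[OF Z X s] by simp
qed

lemma exact_at_quasi_iso:
  assumes q: "rq \<Lambda> Z X s" and ex: "exact_at X i"
  shows "exact_at Z i"
  unfolding exact_at_def
proof (intro allI impI)
  fix x assume x: "app (eX Z i) x = x" "app (d Z i) x = (\<lambda>_. 0)"
  have s: "eX X i * s i = s i" "s (i + 1) * d Z i = d X i * s i" using q by (auto simp: rq_def rch_def rhom_def)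
  have "app (d X i) (app (s i) x) = app (s (i + 1) * d Z i) x" unfolding s(2) by (simp add: app_simps)
  then have "app (d X i) (app (s i) x) = (\<lambda>_. 0)" using x(2) by (simp add: app_simps)
  moreover have "app (eX X i) (app (s i) x) = app (s i) x" using s(1) app_simps(3)[of "eX X i" "s i" x] by simp
  ultimately obtain u where "app (s i) x = app (d X (i - 1)) u" using ex unfolding exact_at_def by blast
  then show "\<exists>u. x = app (d Z (i - 1)) u" using q x unfolding rq_def by blast
qed

section \<open>Mapping cones\<close>

text \<open>Block embeddings and projections: in a sum of formats \<open>m\<close> and
  \<open>n\<close> the left summand occupies the first \<open>m\<close> coordinates. All four maps
  take both formats for uniformity.\<close>

definition inl :: "nat \<Rightarrow> nat \<Rightarrow> 'k::field linop" where "inl m n = e m"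
definition inr :: "nat \<Rightarrow> nat \<Rightarrow> 'k::field linop" where "inr m n = sh m * e n"
definition prl :: "nat \<Rightarrow> nat \<Rightarrow> 'k::field linop" where "prl m n = e m"
definition prr :: "nat \<Rightarrow> nat \<Rightarrow> 'k::field linop" where "prr m n = e n * us m"

text \<open>Products are kept associated to the right; this lets a rule for \<open>a * b\<close>
  fire inside a longer product.\<close>

lemma mult_l: "a * b = c \<Longrightarrow> a * (b * x) = c * (x :: 'k::field linop)"
  by (simp flip: mult.assoc)

lemmas ring_norm = mult.assoc distrib_left distrib_right left_diff_distrib right_diff_distrib mult_zero_left mult_zero_right
  add_0_left add_0_right diff_0_right diff_self diff_0 mult_minus_left mult_minus_right minus_minus

lemma sum_ops:
  "prl m n * inl m n = e m" "prr m n * inr m n = e n" "prl m n * inr m n = 0" "prr m n * inl m n = 0"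
  "inl m n * prl m n + inr m n * prr m n = e (m + n)"
  "e (m + n) * inl m n = inl m n" "inl m n * e m = inl m n" "e (m + n) * inr m n = inr m n" "inr m n * e n = inr m n"
  "e m * prl m n = prl m n" "prl m n * e (m + n) = prl m n" "e n * prr m n = prr m n" "prr m n * e (m + n) = prr m n"
proof -
  note [simp] = inl_def inr_def prl_def prr_def mult.assoc us_sh us_sh[THEN mult_l] e_sh e_sh[THEN mult_l] us_e us_e[THEN mult_l]
    e_idem[THEN mult_l] e_split distrib_left distrib_right
  show "prl m n * inl m n = e m" "prr m n * inr m n = e n" "prl m n * inr m n = 0" "prr m n * inl m n = 0"
    "inl m n * prl m n + inr m n * prr m n = e (m + n)"
    "e (m + n) * inl m n = inl m n" "inl m n * e m = inl m n" "e (m + n) * inr m n = inr m n" "inr m n * e n = inr m n"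
    "e m * prl m n = prl m n" "prl m n * e (m + n) = prl m n" "e n * prr m n = prr m n" "prr m n * e (m + n) = prr m n"
    by simp_all
qed

lemma rmod_sum:
  assumes \<rho>: "rmod \<Lambda> m \<rho>" and \<sigma>: "rmod \<Lambda> n \<sigma>"
  shows "rmod \<Lambda> (m + n) (\<lambda>a. inl m n * \<rho> a * prl m n + inr m n * \<sigma> a * prr m n)"
proof -
  note [simp] = sum_ops sum_ops(1-4,6-13)[THEN mult_l] mult.assoc distrib_left distrib_right
  have r: "e m * \<rho> a = \<rho> a" "\<rho> a * e m = \<rho> a" "e n * \<sigma> a = \<sigma> a" "\<sigma> a * e n = \<sigma> a" if "a \<in> carrier \<Lambda>" for a
    using \<rho> \<sigma> that by (auto simp: rmod_def)
  note rr = r r[THEN mult_l]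
  have 5: "inl m n * prl m n + inr m n * prr m n = e (m + n)" by (rule sum_ops)
  show ?thesis
    unfolding rmod_def
    using \<rho> \<sigma> by (auto simp: rmod_def rr sc_left algebra_simps)
qed

lemma finite_shift: "finite {i. P i} \<Longrightarrow> finite {i :: int. P (i + 1)}"
  using finite_vimageI[of "{i. P i}" "\<lambda>i. i + 1"] by (simp add: vimage_def inj_def)

text \<open>The usual mapping cone: degree \<open>i\<close> is the sum of degree
  \<open>i + 1\<close> of \<open>X\<close> and degree \<open>i\<close> of \<open>Y\<close>, and the
  differential sends (x, y) to (-dx, fx + dy).\<close>

definition cone :: "('a, 'k::field) cplx \<Rightarrow> ('a, 'k) cplx \<Rightarrow> (int \<Rightarrow> 'k linop) \<Rightarrow> ('a, 'k) cplx" where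
  "cone X Y f = (let x = (\<lambda>i. mdim (cobj X (i + 1))); y = (\<lambda>i. mdim (cobj Y i)) in
     mkc (\<lambda>i. x i + y i)
       (\<lambda>i a. inl (x i) (y i) * rho (cobj X (i + 1)) a * prl (x i) (y i) + inr (x i) (y i) * rho (cobj Y i) a * prr (x i) (y i))
       (\<lambda>i. inr (x (i + 1)) (y (i + 1)) * f (i + 1) * prl (x i) (y i) + inr (x (i + 1)) (y (i + 1)) * d Y i * prr (x i) (y i)
          - inl (x (i + 1)) (y (i + 1)) * d X (i + 1) * prl (x i) (y i)))"

locale cone_data =
  fixes \<Lambda> :: "('k::field, 'a) module" and X Y :: "('a, 'k) cplx" and f :: "int \<Rightarrow> 'k linop"
  assumes X: "X \<in> bounded_complexes \<Lambda>" and Y: "Y \<in> bounded_complexes \<Lambda>" and f: "rch \<Lambda> X Y f"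
begin

definition il where "il i = (inl (mdim (cobj X (i + 1))) (mdim (cobj Y i)) :: 'k linop)"
definition ir where "ir i = (inr (mdim (cobj X (i + 1))) (mdim (cobj Y i)) :: 'k linop)"
definition pl where "pl i = (prl (mdim (cobj X (i + 1))) (mdim (cobj Y i)) :: 'k linop)"
definition pr where "pr i = (prr (mdim (cobj X (i + 1))) (mdim (cobj Y i)) :: 'k linop)"

abbreviation "Z \<equiv> cone X Y f"

lemma ops:
  "pl i * il i = eX X (i + 1)" "pr i * ir i = eX Y i" "pl i * ir i = 0" "pr i * il i = 0"
  "il i * eX X (i + 1) = il i" "ir i * eX Y i = ir i" "eX X (i + 1) * pl i = pl i" "eX Y i * pr i = pr i"
  unfolding il_def ir_def pl_def pr_def by (rule sum_ops)+

lemma X_ops: "eX X (i + 1) * d X i = d X i" "d X i * eX X i = d X i" "d X (i + 1) * d X i = 0"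
  and Y_ops: "eX Y (i + 1) * d Y i = d Y i" "d Y i * eX Y i = d Y i" "d Y (i + 1) * d Y i = 0"
  and f_ops: "eX Y i * f i = f i" "f i * eX X i = f i" "f (i + 1) * d X i = d Y i * f i"
  using complexD(2,3)[OF X, of i] complexD(2,3)[OF Y, of i] f by (auto simp: rhom_def rch_def)

lemma act_ops: assumes "a \<in> carrier \<Lambda>"
  shows "eX X i * rho (cobj X i) a = rho (cobj X i) a" "rho (cobj X i) a * eX X i = rho (cobj X i) a"
    "eX Y i * rho (cobj Y i) a = rho (cobj Y i) a" "rho (cobj Y i) a * eX Y i = rho (cobj Y i) a"
    "d X i * rho (cobj X i) a = rho (cobj X (i + 1)) a * d X i" "d Y i * rho (cobj Y i) a = rho (cobj Y (i + 1)) a * d Y i"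
    "f i * rho (cobj X i) a = rho (cobj Y i) a * f i"
  using rmod_rho[OF complexD(1)[OF X, of i]] rmod_rho[OF complexD(1)[OF Y, of i]] complexD(2)[OF X, of i] complexD(2)[OF Y, of i] f assms
  by (auto simp: rmod_def rhom_def rch_def)

lemma cone_complex: "Z \<in> bounded_complexes \<Lambda>"
  and cone_d: "d Z i = ir (i + 1) * f (i + 1) * pl i + ir (i + 1) * d Y i * pr i - il (i + 1) * d X (i + 1) * pl i"
  and cone_dim: "mdim (cobj Z i) = mdim (cobj X (i + 1)) + mdim (cobj Y i)"
  and cone_rho: "a \<in> carrier \<Lambda> \<Longrightarrow> rho (cobj Z i) a = il i * rho (cobj X (i + 1)) a * pl i + ir i * rho (cobj Y i) a * pr i"
proof -
  let ?m = "\<lambda>i. mdim (cobj X (i + 1)) + mdim (cobj Y i)"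
  let ?r = "\<lambda>i a. il i * rho (cobj X (i + 1)) a * pl i + ir i * rho (cobj Y i) a * pr i"
  let ?D = "\<lambda>i. ir (i + 1) * f (i + 1) * pl i + ir (i + 1) * d Y i * pr i - il (i + 1) * d X (i + 1) * pl i"
  have Z: "Z = mkc ?m ?r ?D" by (simp add: cone_def Let_def il_def ir_def pl_def pr_def)
  have em: "e (?m i) * il i = il i" "e (?m i) * ir i = ir i" "pl i * e (?m i) = pl i" "pr i * e (?m i) = pr i" for i
    unfolding il_def ir_def pl_def pr_def by (rule sum_ops)+
  note R = ops ops[THEN mult_l] X_ops X_ops[THEN mult_l] Y_ops Y_ops[THEN mult_l] f_ops f_ops[THEN mult_l]
    em em[THEN mult_l] ring_norm
  have 1: "rmod \<Lambda> (?m i) (?r i)" for i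
    unfolding il_def ir_def pl_def pr_def by (rule rmod_sum[OF rmod_rho[OF complexD(1)[OF X]] rmod_rho[OF complexD(1)[OF Y]]])
  have 2: "e (?m (i + 1)) * ?D i = ?D i" "?D i * e (?m i) = ?D i" for i by (simp_all only: R)
  have 3: "?D i * ?r i a = ?r (i + 1) a * ?D i" if a: "a \<in> carrier \<Lambda>" for i a
    by (simp only: R act_ops[OF a] act_ops[OF a, THEN mult_l] diff_add_eq)
  have 4: "?D (i + 1) * ?D i = 0" for i by (simp only: R)
  have "{i. ?m i \<noteq> 0} = {i. mdim (cobj X (i + 1)) \<noteq> 0} \<union> {i. mdim (cobj Y i) \<noteq> 0}" by auto
  then have 5: "finite {i. ?m i \<noteq> 0}" using finite_shift[OF complexD(4)[OF X]] complexD(4)[OF Y] by simp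
  show "Z \<in> bounded_complexes \<Lambda>" "d Z i = ?D i" "mdim (cobj Z i) = ?m i" "a \<in> carrier \<Lambda> \<Longrightarrow> rho (cobj Z i) a = ?r i a"
    unfolding Z by (rule mkc_complex[OF 1 2 3 4 5]; assumption)+
qed

lemma cone_e: "eX Z i = il i * pl i + ir i * pr i"
  unfolding cone_dim il_def ir_def pl_def pr_def by (rule sum_ops(5)[symmetric])

lemma cone_e_ops: "eX Z i * il i = il i" "eX Z i * ir i = ir i" "pl i * eX Z i = pl i" "pr i * eX Z i = pr i"
  unfolding cone_dim il_def ir_def pl_def pr_def by (rule sum_ops)+

lemma ir_rhom: "rhom \<Lambda> (cobj Y i) (cobj Z i) (ir i)"
  unfolding rhom_def using ops ops[THEN mult_l] cone_e_ops act_ops cone_rho by (auto simp: mult.assoc distrib_left distrib_right)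

lemma il_rhom: "rhom \<Lambda> (cobj X (i + 1)) (cobj Z i) (il i)"
  unfolding rhom_def using ops ops[THEN mult_l] cone_e_ops act_ops cone_rho by (auto simp: mult.assoc distrib_left distrib_right)

lemma pr_rhom: "rhom \<Lambda> (cobj Z i) (cobj Y i) (pr i)"
  unfolding rhom_def using ops ops[THEN mult_l] cone_e_ops act_ops act_ops[THEN mult_l] cone_rho by (auto simp: mult.assoc distrib_left distrib_right)

lemma pl_rhom: "rhom \<Lambda> (cobj Z i) (cobj X (i + 1)) (pl i)"
  unfolding rhom_def using ops ops[THEN mult_l] cone_e_ops act_ops act_ops[THEN mult_l] cone_rho by (auto simp: mult.assoc distrib_left distrib_right)

lemma ir_chain: "rch \<Lambda> Y Z ir"
  unfolding rch_def using ir_rhom cone_d ops ops[THEN mult_l] Y_ops by (auto simp: mult.assoc left_diff_distrib distrib_right)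

end

lemma shift_complex:
  assumes X: "X \<in> bounded_complexes \<Lambda>"
  shows "cplx_shift X \<in> bounded_complexes \<Lambda>" "cobj (cplx_shift X) i = cobj X (i + 1)" "d (cplx_shift X) i = - d X (i + 1)"
proof -
  show c: "cobj (cplx_shift X) i = cobj X (i + 1)" for i by (simp add: cplx_shift_def)
  show "d (cplx_shift X) i = - d X (i + 1)" by (simp add: cplx_shift_def op_uminus)
  have "- diff X (i + 1) \<in> mod_hom \<Lambda> (cobj X (i + 1)) (cobj X (i + 1 + 1))" for i
  proof -
    have "- diff X (i + 1) \<in> carrier_mat (mdim (cobj X (i + 1 + 1))) (mdim (cobj X (i + 1)))" using complexD(5)[OF X, of "i + 1"] by simp
    then show ?thesis
      using mo_mod_hom(1)[OF complexD(1)[OF X] complexD(1)[OF X] rhom_neg[OF complexD(2)[OF X, of "i + 1"]]] mo_op op_uminus by metis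
  qed
  moreover have "- diff X (i + 1 + 1) * - diff X (i + 1) = 0\<^sub>m (mdim (cobj X (i + 2 + 1))) (mdim (cobj X (i + 1)))" for i
  proof -
    have c: "diff X (i + 1) \<in> carrier_mat (mdim (cobj X (i + 1 + 1))) (mdim (cobj X (i + 1)))"
      "diff X (i + 1 + 1) \<in> carrier_mat (mdim (cobj X (i + 2 + 1))) (mdim (cobj X (i + 1 + 1)))"
      using complexD(5)[OF X, of "i + 1"] complexD(5)[OF X, of "i + 1 + 1"] by (simp_all add: add.commute add.left_commute)
    show ?thesis
    proof (rule op_inj)
      have "op (- diff X (i + 1 + 1) * - diff X (i + 1)) = d X (i + 1 + 1) * d X (i + 1)"
        using c by (simp add: op_mult op_uminus)
      then show "op (- diff X (i + 1 + 1) * - diff X (i + 1)) = op (0\<^sub>m (mdim (cobj X (i + 2 + 1))) (mdim (cobj X (i + 1))))"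
        using complexD(3)[OF X, of "i + 1"] by (simp add: op_zero)
    qed (use c in auto)
  qed
  moreover have "finite {i. mdim (cobj X (i + 1)) \<noteq> 0}" by (rule finite_shift[OF complexD(4)[OF X]])
  ultimately show "cplx_shift X \<in> bounded_complexes \<Lambda>"
    using complexD(1)[OF X] unfolding bounded_complexes_def cplx_shift_def by simp
qed

section \<open>The derived category\<close>

definition null :: "('k::field, 'a) module \<Rightarrow> ('a, 'k) cplx \<Rightarrow> ('a, 'k) cplx \<Rightarrow> (int \<Rightarrow> 'k linop) \<Rightarrow> bool" where
  "null \<Lambda> X Y T \<longleftrightarrow> (\<exists>h. (\<forall>i. rhom \<Lambda> (cobj X i) (cobj Y (i - 1)) (h i)) \<and>
     (\<forall>i. T i = d Y (i - 1) * h i + h (i + 1) * d X i))"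

text \<open>Objects of the derived category are only isomorphic to images of complexes, so triangles
  built from cones have to be moved along isomorphisms of their first two objects.\<close>

lemma (in lauto) tri_transport:
  assumes t: "tri X Y Z u v w" and \<sigma>: "iso \<sigma> X X'" and \<beta>: "iso \<beta> Y Y'" and u': "ar u' X' Y'" "u' \<cdot> \<sigma> = \<beta> \<cdot> u"
  shows "\<exists>v' w'. tri X' Y' Z u' v' w'"
proof -
  have u: "ar u X Y" and v: "ar v Y Z" and w: "ar w Z (fobj F X)" using t by (auto simp: tri_def)
  obtain s where s: "ar \<sigma> X X'" "ar s X' X" "s \<cdot> \<sigma> = \<iota> X" "\<sigma> \<cdot> s = \<iota> X'" using \<sigma> by (rule isoE)
  obtain b where b: "ar \<beta> Y Y'" "ar b Y' Y" "b \<cdot> \<beta> = \<iota> Y" "\<beta> \<cdot> b = \<iota> Y'" using \<beta> by (rule isoE)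
  note Fs = F_ar[OF s(1)] F_ar[OF s(2)]
  have us: "u \<cdot> s = b \<cdot> u'"
  proof -
    have "b \<cdot> u' = b \<cdot> (u' \<cdot> \<sigma> \<cdot> s)" using assoc[OF s(2,1) u'(1)] s(4) id_right[OF u'(1)] by simp
    also have "\<dots> = b \<cdot> (\<beta> \<cdot> (u \<cdot> s))" using u'(2) assoc[OF s(2) u b(1)] by simp
    also have "\<dots> = u \<cdot> s" using assoc[OF cmp_ar[OF s(2) u] b(1,2)] b(3) id_left[OF cmp_ar[OF s(2) u]] by simp
    finally show ?thesis by simp
  qed
  let ?v = "v \<cdot> b" and ?w = "fmor F \<sigma> \<cdot> w"
  note v' = cmp_ar[OF b(2) v] and w' = cmp_ar[OF w Fs(1)]
  have Fsig: "fmor F s \<cdot> fmor F \<sigma> = \<iota> (fobj F X)" "fmor F \<sigma> \<cdot> fmor F s = \<iota> (fobj F X')"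
    using F_cmp[OF s(1,2)] F_cmp[OF s(2,1)] s F_id arD(1)[OF s(1)] arD(2)[OF s(1)] by simp_all
  have sw: "fmor F s \<cdot> ?w = w" using assoc[OF w Fs] Fsig id_left[OF w] by simp
  have 1: "?v \<cdot> u' = 0"
  proof -
    have "?v \<cdot> u' = v \<cdot> (u \<cdot> s)" using assoc[OF u'(1) b(2) v] us by simp
    also have "\<dots> = 0" using assoc[OF s(2) u v] t cmp_zero_left[OF arD(2)[OF v] s(2)] by (simp add: tri_def)
    finally show ?thesis .
  qed
  have 2: "?w \<cdot> ?v = 0"
  proof -
    have "?w \<cdot> ?v = fmor F \<sigma> \<cdot> (w \<cdot> v \<cdot> b)" using assoc[OF v' w Fs(1)] assoc[OF b(2) v w] by simp
    also have "\<dots> = 0" using t cmp_zero_left[OF arD(2)[OF w] b(2)] cmp_zero_right[OF arD(1)[OF b(2)] Fs(1)] by (simp add: tri_def)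
    finally show ?thesis .
  qed
  have u\<sigma>: "fmor F u' \<cdot> fmor F \<sigma> = fmor F \<beta> \<cdot> fmor F u"
    using F_cmp[OF s(1) u'(1)] F_cmp[OF u b(1)] u'(2) by simp
  have 3: "fmor F u' \<cdot> ?w = 0"
  proof -
    have "fmor F u' \<cdot> ?w = fmor F \<beta> \<cdot> (fmor F u \<cdot> w)"
      using assoc[OF w Fs(1) F_ar[OF u'(1)]] u\<sigma> assoc[OF w F_ar[OF u] F_ar[OF b(1)]] by simp
    also have "\<dots> = 0" using t cmp_zero_right[OF arD(1)[OF w] F_ar[OF b(1)]] by (simp add: tri_def)
    finally show ?thesis .
  qed
  have 4: "\<exists>t. ar t W X' \<and> g = u' \<cdot> t" if g: "ar g W Y'" "?v \<cdot> g = 0" for W g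
  proof -
    have "v \<cdot> (b \<cdot> g) = 0" using assoc[OF g(1) b(2) v] g(2) by simp
    then obtain k where k: "ar k W X" "b \<cdot> g = u \<cdot> k" using t cmp_ar[OF g(1) b(2)] unfolding tri_def by blast
    have "g = \<beta> \<cdot> (b \<cdot> g)" using assoc[OF g(1) b(2,1)] b(4) id_left[OF g(1)] by simp
    also have "\<dots> = u' \<cdot> (\<sigma> \<cdot> k)" using k(2) assoc[OF k(1) u b(1)] u'(2) assoc[OF k(1) s(1) u'(1)] by simp
    finally show ?thesis using cmp_ar[OF k(1) s(1)] by blast
  qed
  have 5: "\<exists>t. ar t W Y' \<and> g = ?v \<cdot> t" if g: "ar g W Z" "?w \<cdot> g = 0" for W g
  proof -
    have "w \<cdot> g = fmor F s \<cdot> (?w \<cdot> g)" using assoc[OF g(1) w' Fs(2)] sw by simp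
    then have "w \<cdot> g = 0" using g(2) cmp_zero_right[OF arD(1)[OF g(1)] Fs(2)] by simp
    then obtain k where k: "ar k W Y" "g = v \<cdot> k" using t g(1) unfolding tri_def by blast
    have "?v \<cdot> (\<beta> \<cdot> k) = v \<cdot> (b \<cdot> \<beta> \<cdot> k)" using assoc[OF cmp_ar[OF k(1) b(1)] b(2) v] assoc[OF k(1) b(1,2)] by simp
    then have "g = ?v \<cdot> (\<beta> \<cdot> k)" using k(2) b(3) id_left[OF k(1)] by simp
    then show ?thesis using cmp_ar[OF k(1) b(1)] by blast
  qed
  have 6: "\<exists>t. ar t W Z \<and> g = ?w \<cdot> t" if g: "ar g W (fobj F X')" "fmor F u' \<cdot> g = 0" for W g
  proof -
    have "fmor F u \<cdot> fmor F s = fmor F b \<cdot> fmor F u'" using F_cmp[OF s(2) u] F_cmp[OF u'(1) b(2)] us by simp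
    then have "fmor F u \<cdot> (fmor F s \<cdot> g) = fmor F b \<cdot> (fmor F u' \<cdot> g)"
      using assoc[OF g(1) Fs(2) F_ar[OF u]] assoc[OF g(1) F_ar[OF u'(1)] F_ar[OF b(2)]] by simp
    also have "\<dots> = 0" using g(2) cmp_zero_right[OF arD(1)[OF g(1)] F_ar[OF b(2)]] by simp
    finally obtain k where k: "ar k W Z" "fmor F s \<cdot> g = w \<cdot> k" using t cmp_ar[OF g(1) Fs(2)] unfolding tri_def by blast
    have "g = fmor F \<sigma> \<cdot> (fmor F s \<cdot> g)" using assoc[OF g(1) Fs(2,1)] Fsig(2) id_left[OF g(1)] by simp
    then have "g = ?w \<cdot> k" using k(2) assoc[OF k(1) w Fs(1)] by simp
    then show ?thesis using k(1) by blast
  qed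
  show ?thesis
    by (rule exI[of _ ?v], rule exI[of _ ?w]) (use u' v' w' 1 2 3 4 5 6 in \<open>auto simp: tri_def\<close>)
qed

locale derived = lcat C + S: lauto C S Si
  for C :: "('o, 'm::ab_group_add, 'k::field) lincat" and S Si :: "('o, 'm) lfunctor" +
  fixes \<Lambda> :: "('k, 'a) module" and Lo :: "('a, 'k) cplx \<Rightarrow> 'o"
    and Lm :: "('a, 'k) cplx \<Rightarrow> ('a, 'k) cplx \<Rightarrow> (int \<Rightarrow> 'k mat) \<Rightarrow> 'm" and \<theta> :: "('a, 'k) cplx \<Rightarrow> 'm"
  assumes dc: "is_derived_category \<Lambda> C Lo Lm"
    and th_iso0: "X \<in> bounded_complexes \<Lambda> \<Longrightarrow> iso_mor C (fobj S (Lo X)) (Lo (cplx_shift X)) (\<theta> X)"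
    and th_nat0: "X \<in> bounded_complexes \<Lambda> \<Longrightarrow> Y \<in> bounded_complexes \<Lambda> \<Longrightarrow> f \<in> chain_maps \<Lambda> X Y \<Longrightarrow>
      \<theta> Y \<cdot> fmor S (Lm X Y f) = Lm (cplx_shift X) (cplx_shift Y) (\<lambda>i. f (i + 1)) \<cdot> \<theta> X"
begin

abbreviation "bc \<equiv> bounded_complexes \<Lambda>"

definition LM where "LM X Y T = Lm X Y (mkf X Y T)"

lemma Lo_obj: "X \<in> bc \<Longrightarrow> Lo X \<in> obj C"
  using dc by (simp add: is_derived_category_def)

lemma Lm_linear: "\<forall>X\<in>bc. \<forall>Y\<in>bc. \<forall>f\<in>chain_maps \<Lambda> X Y. Lm X Y f \<in> hom C (Lo X) (Lo Y) \<and>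
    (\<forall>c. \<forall>g\<in>chain_maps \<Lambda> X Y. Lm X Y (\<lambda>i. c \<cdot>\<^sub>m f i + g i) = scl C c (Lm X Y f) + Lm X Y g)"
  using dc unfolding is_derived_category_def by (elim conjE)

lemma LM_ar: assumes "X \<in> bc" "Y \<in> bc" "rch \<Lambda> X Y T" shows "ar (LM X Y T) (Lo X) (Lo Y)"
  using Lm_linear mkf_chain(1)[OF assms] assms Lo_obj by (simp add: LM_def ar_def)

lemma LM_lin:
  assumes X: "X \<in> bc" and Y: "Y \<in> bc" and T: "rch \<Lambda> X Y T" and U: "rch \<Lambda> X Y U"
  shows "LM X Y (\<lambda>i. sc c * T i + U i) = scl C c (LM X Y T) + LM X Y U"
proof -
  have "mkf X Y (\<lambda>i. sc c * T i + U i) = (\<lambda>i. c \<cdot>\<^sub>m mkf X Y T i + mkf X Y U i)"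
  proof
    fix i show "mkf X Y (\<lambda>i. sc c * T i + U i) i = c \<cdot>\<^sub>m mkf X Y T i + mkf X Y U i"
      by (rule op_inj) (simp_all add: op_add op_smult mkf_chain(2)[OF X Y T] mkf_chain(2)[OF X Y U] mkf_chain(2)[OF X Y rch_lin[OF T U]])
  qed
  then show ?thesis unfolding LM_def using Lm_linear X Y mkf_chain(1)[OF X Y T] mkf_chain(1)[OF X Y U] by simp
qed

lemma LM_comp:
  assumes X: "X \<in> bc" and Y: "Y \<in> bc" and Z: "Z \<in> bc" and T: "rch \<Lambda> X Y T" and U: "rch \<Lambda> Y Z U"
  shows "LM X Z (\<lambda>i. U i * T i) = LM Y Z U \<cdot> LM X Y T"
proof -
  have "\<forall>X\<in>bc. \<forall>Y\<in>bc. \<forall>Z\<in>bc. \<forall>f\<in>chain_maps \<Lambda> X Y. \<forall>g\<in>chain_maps \<Lambda> Y Z. Lm X Z (\<lambda>i. g i * f i) = Lm Y Z g \<cdot> Lm X Y f"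
    using dc unfolding is_derived_category_def by (elim conjE)
  moreover have "mkf X Z (\<lambda>i. U i * T i) = (\<lambda>i. mkf Y Z U i * mkf X Y T i)"
  proof
    fix i show "mkf X Z (\<lambda>i. U i * T i) i = mkf Y Z U i * mkf X Y T i"
      by (rule op_inj) (simp_all add: op_mult mkf_chain(2)[OF X Y T] mkf_chain(2)[OF Y Z U] mkf_chain(2)[OF X Z rch_comp[OF T U]])
  qed
  ultimately show ?thesis unfolding LM_def using X Y Z mkf_chain(1)[OF X Y T] mkf_chain(1)[OF Y Z U] by simp
qed

lemma LM_zero: "X \<in> bc \<Longrightarrow> Y \<in> bc \<Longrightarrow> LM X Y (\<lambda>_. 0) = 0"
  using LM_lin[OF _ _ rch_zero rch_zero, of X Y "-1"] by simp

lemma LM_quasi_iso: assumes Z: "Z \<in> bc" and X: "X \<in> bc" and q: "rq \<Lambda> Z X s" shows "iso (LM Z X s) (Lo Z) (Lo X)"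
proof -
  have c: "rch \<Lambda> Z X s" using q by (simp add: rq_def)
  have "\<forall>X\<in>bc. \<forall>Y\<in>bc. \<forall>s\<in>quasi_isos \<Lambda> X Y. iso_mor C (Lo X) (Lo Y) (Lm X Y s)"
    using dc unfolding is_derived_category_def by (elim conjE)
  moreover have "mkf Z X s \<in> quasi_isos \<Lambda> Z X"
    unfolding quasi_iso_iff[OF Z X mkf_chain(1)[OF Z X c]] using q by (simp add: mkf_chain(2)[OF Z X c])
  ultimately show ?thesis unfolding LM_def using Z X iso_mor_iff[OF Lo_obj Lo_obj] by blast
qed

lemma LM_eq_0_iff:
  assumes X: "X \<in> bc" and Y: "Y \<in> bc" and T: "rch \<Lambda> X Y T"
  shows "LM X Y T = 0 \<longleftrightarrow> (\<exists>Z\<in>bc. \<exists>s. rq \<Lambda> Z X s \<and> null \<Lambda> Z Y (\<lambda>i. T i * s i))"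
proof -
  have ax: "\<forall>X\<in>bc. \<forall>Y\<in>bc. \<forall>f\<in>chain_maps \<Lambda> X Y. \<forall>g\<in>chain_maps \<Lambda> X Y. Lm X Y f = Lm X Y g \<longleftrightarrow>
        (\<exists>Z\<in>bc. \<exists>s\<in>quasi_isos \<Lambda> Z X. chain_homotopic \<Lambda> Z Y (\<lambda>i. f i * s i) (\<lambda>i. g i * s i))"
    using dc unfolding is_derived_category_def by (elim conjE)
  note T' = mkf_chain[OF X Y T] and Z' = mkf_chain[OF X Y rch_zero]
  have "LM X Y T = 0 \<longleftrightarrow> Lm X Y (mkf X Y T) = Lm X Y (mkf X Y (\<lambda>_. 0))" using LM_zero[OF X Y] by (simp add: LM_def)
  also have "\<dots> \<longleftrightarrow> (\<exists>Z\<in>bc. \<exists>s\<in>quasi_isos \<Lambda> Z X. chain_homotopic \<Lambda> Z Y (\<lambda>i. mkf X Y T i * s i) (\<lambda>i. mkf X Y (\<lambda>_. 0) i * s i))"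
    using ax X Y T'(1) Z'(1) by blast
  also have "\<dots> \<longleftrightarrow> (\<exists>Z\<in>bc. \<exists>s. rq \<Lambda> Z X s \<and> null \<Lambda> Z Y (\<lambda>i. T i * s i))"
  proof -
    have hom: "chain_homotopic \<Lambda> Z Y (\<lambda>i. mkf X Y T i * s i) (\<lambda>i. mkf X Y (\<lambda>_. 0) i * s i) \<longleftrightarrow> null \<Lambda> Z Y (\<lambda>i. T i * op (s i))"
      if Z: "Z \<in> bc" and s: "s \<in> chain_maps \<Lambda> Z X" for Z s
    proof
      have opl: "op (mkf X Y T i * s i - mkf X Y (\<lambda>_. 0) i * s i) = T i * op (s i)" for i
        using rch_op(3)[OF Z X s, of i] by (simp add: op_minus op_mult T'(2) Z'(2))
      have cY: "diff Y (i - 1) \<in> carrier_mat (mdim (cobj Y i)) (mdim (cobj Y (i - 1)))" for i using complexD(5)[OF Y, of "i - 1"] by simp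
      have cZ: "diff Z i \<in> carrier_mat (mdim (cobj Z (i + 1))) (mdim (cobj Z i))" for i using complexD(5)[OF Z, of i] .
      have opr: "op (diff Y (i - 1) * h i + h (i + 1) * diff Z i) = d Y (i - 1) * op (h i) + op (h (i + 1)) * d Z i"
        if "\<And>i. h i \<in> carrier_mat (mdim (cobj Y (i - 1))) (mdim (cobj Z i))" for h i
        using that[of i] that[of "i + 1"] cY[of i] cZ[of i] by (simp add: op_add op_mult)
      {
        assume "chain_homotopic \<Lambda> Z Y (\<lambda>i. mkf X Y T i * s i) (\<lambda>i. mkf X Y (\<lambda>_. 0) i * s i)"
        then obtain h where h: "\<And>i. h i \<in> mod_hom \<Lambda> (cobj Z i) (cobj Y (i - 1))"
          "\<And>i. mkf X Y T i * s i - mkf X Y (\<lambda>_. 0) i * s i = diff Y (i - 1) * h i + h (i + 1) * diff Z i"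
          unfolding chain_homotopic_def by blast
        have c: "h i \<in> carrier_mat (mdim (cobj Y (i - 1))) (mdim (cobj Z i))" for i using h(1) by (simp add: mod_hom_def)
        have "T i * op (s i) = d Y (i - 1) * op (h i) + op (h (i + 1)) * d Z i" for i
          unfolding opl[symmetric] h(2) by (rule opr[OF c])
        then show "null \<Lambda> Z Y (\<lambda>i. T i * op (s i))"
          unfolding null_def using rhom_op[OF complexD(1)[OF Z] complexD(1)[OF Y] h(1)] by (intro exI[of _ "\<lambda>i. op (h i)"]) blast
      next
        assume "null \<Lambda> Z Y (\<lambda>i. T i * op (s i))"
        then obtain h where h: "\<And>i. rhom \<Lambda> (cobj Z i) (cobj Y (i - 1)) (h i)"
          "\<And>i. T i * op (s i) = d Y (i - 1) * h i + h (i + 1) * d Z i" unfolding null_def by blast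
        define k where "k i = mo (mdim (cobj Y (i - 1))) (mdim (cobj Z i)) (h i)" for i
        note m = mo_mod_hom[OF complexD(1)[OF Z] complexD(1)[OF Y] h(1)]
        have c: "k i \<in> carrier_mat (mdim (cobj Y (i - 1))) (mdim (cobj Z i))" for i by (simp add: k_def)
        have kop: "op (k i) = h i" for i using m(2) by (simp add: k_def)
        have "mkf X Y T i * s i - mkf X Y (\<lambda>_. 0) i * s i = diff Y (i - 1) * k i + k (i + 1) * diff Z i" for i
        proof (rule op_inj)
          show "op (mkf X Y T i * s i - mkf X Y (\<lambda>_. 0) i * s i) = op (diff Y (i - 1) * k i + k (i + 1) * diff Z i)"
            unfolding opl opr[OF c] kop h(2) ..
        qed (use rch_op(3)[OF Z X s, of i] cY[of i] cZ[of i] c[of i] c[of "i + 1"] in auto)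
        then show "chain_homotopic \<Lambda> Z Y (\<lambda>i. mkf X Y T i * s i) (\<lambda>i. mkf X Y (\<lambda>_. 0) i * s i)"
          unfolding chain_homotopic_def using m(1) k_def by (intro exI[of _ k]) (simp add: k_def)
      }
    qed
    show ?thesis
    proof
      assume "\<exists>Z\<in>bc. \<exists>s\<in>quasi_isos \<Lambda> Z X. chain_homotopic \<Lambda> Z Y (\<lambda>i. mkf X Y T i * s i) (\<lambda>i. mkf X Y (\<lambda>_. 0) i * s i)"
      then obtain Z s where Z: "Z \<in> bc" and s: "s \<in> quasi_isos \<Lambda> Z X"
        and h: "chain_homotopic \<Lambda> Z Y (\<lambda>i. mkf X Y T i * s i) (\<lambda>i. mkf X Y (\<lambda>_. 0) i * s i)" by blast
      have s': "s \<in> chain_maps \<Lambda> Z X" using s by (simp add: quasi_isos_def)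
      show "\<exists>Z\<in>bc. \<exists>s. rq \<Lambda> Z X s \<and> null \<Lambda> Z Y (\<lambda>i. T i * s i)"
        using Z quasi_iso_iff[OF Z X s'] s hom[OF Z s'] h by (intro bexI[OF _ Z] exI[of _ "\<lambda>i. op (s i)"]) simp
    next
      assume "\<exists>Z\<in>bc. \<exists>s. rq \<Lambda> Z X s \<and> null \<Lambda> Z Y (\<lambda>i. T i * s i)"
      then obtain Z s where Z: "Z \<in> bc" and q: "rq \<Lambda> Z X s" and n: "null \<Lambda> Z Y (\<lambda>i. T i * s i)" by blast
      have c: "rch \<Lambda> Z X s" using q by (simp add: rq_def)
      note m = mkf_chain[OF Z X c]
      show "\<exists>Z\<in>bc. \<exists>s\<in>quasi_isos \<Lambda> Z X. chain_homotopic \<Lambda> Z Y (\<lambda>i. mkf X Y T i * s i) (\<lambda>i. mkf X Y (\<lambda>_. 0) i * s i)"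
        using quasi_iso_iff[OF Z X m(1)] q n hom[OF Z m(1)] m(2) by (intro bexI[OF _ Z] bexI[of _ "mkf Z X s"]) simp_all
    qed
  qed
  finally show ?thesis .
qed

lemma rq_id: "X \<in> bc \<Longrightarrow> rq \<Lambda> X X (\<lambda>i. eX X i)"
  unfolding rq_def
proof (intro conjI allI impI)
  assume X: "X \<in> bc"
  show "rch \<Lambda> X X (\<lambda>i. eX X i)" by (rule rch_id[OF X])
  fix i x assume x: "app (eX X i) x = x" "app (d X i) x = (\<lambda>_. 0)"
  show "\<exists>u. x = app (d X (i - 1)) u" if "\<exists>u. app (eX X i) x = app (d X (i - 1)) u" using that x by simp
  show "\<exists>y u. app (eX X i) y = y \<and> app (d X i) y = (\<lambda>_. 0) \<and> app (eX X i) y = (\<lambda>j. x j + app (d X (i - 1)) u j)"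
    using x by (intro exI[of _ x] exI[of _ "\<lambda>_. 0"]) simp
qed

lemma LM_null: assumes "X \<in> bc" "Y \<in> bc" "rch \<Lambda> X Y T" "null \<Lambda> X Y T" shows "LM X Y T = 0"
proof -
  have "(\<lambda>i. T i * eX X i) = T" using assms(3) by (auto simp: rch_def rhom_def)
  then show ?thesis using LM_eq_0_iff[OF assms(1-3)] assms(1,4) rq_id by metis
qed

lemma fraction:
  assumes X: "X \<in> bc" and Y: "Y \<in> bc" and h: "ar h (Lo X) (Lo Y)"
  obtains Z s T where "Z \<in> bc" "rq \<Lambda> Z X s" "rch \<Lambda> Z Y T" "h \<cdot> LM Z X s = LM Z Y T"
proof -
  have "\<forall>X\<in>bc. \<forall>Y\<in>bc. \<forall>h\<in>hom C (Lo X) (Lo Y). \<exists>Z\<in>bc. \<exists>s\<in>quasi_isos \<Lambda> Z X. \<exists>f\<in>chain_maps \<Lambda> Z Y. h \<cdot> Lm Z X s = Lm Z Y f"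
    using dc unfolding is_derived_category_def by (elim conjE)
  then obtain Z s f where Z: "Z \<in> bc" and s: "s \<in> quasi_isos \<Lambda> Z X" and f: "f \<in> chain_maps \<Lambda> Z Y" "h \<cdot> Lm Z X s = Lm Z Y f"
    using X Y arD(3)[OF h] by blast
  have s': "s \<in> chain_maps \<Lambda> Z X" using s by (simp add: quasi_isos_def)
  show thesis
    by (rule that[OF Z _ rch_op(1)[OF Z Y f(1)], of "\<lambda>i. op (s i)"])
      (use quasi_iso_iff[OF Z X s'] s f rch_op(2)[OF Z X s'] rch_op(2)[OF Z Y f(1)] in \<open>simp_all add: LM_def\<close>)
qed

lemma object_iso: assumes "U \<in> obj C" obtains X \<sigma> where "X \<in> bc" "iso \<sigma> (Lo X) U"
proof -
  have "\<forall>U\<in>obj C. \<exists>X\<in>bc. U \<in> iso_class C (Lo X)" using dc unfolding is_derived_category_def by (elim conjE)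
  then obtain X where X: "X \<in> bc" "U \<in> iso_class C (Lo X)" using assms by blast
  then show thesis using that iso_class_eq[OF Lo_obj[OF X(1)]] by (auto simp: isom_def)
qed

lemma represent:
  assumes Y: "Y \<in> bc" and g: "ar g W (Lo Y)"
  obtains Z \<sigma> T where "Z \<in> bc" "iso \<sigma> (Lo Z) W" "rch \<Lambda> Z Y T" "g \<cdot> \<sigma> = LM Z Y T"
proof -
  obtain X \<tau> where X: "X \<in> bc" "iso \<tau> (Lo X) W" using object_iso[OF arD(1)[OF g]] .
  then have \<tau>: "ar \<tau> (Lo X) W" by (simp add: iso_def)
  obtain Z s T where Z: "Z \<in> bc" "rq \<Lambda> Z X s" "rch \<Lambda> Z Y T" "g \<cdot> \<tau> \<cdot> LM Z X s = LM Z Y T"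
    using fraction[OF X(1) Y cmp_ar[OF \<tau> g]] .
  have s: "iso (LM Z X s) (Lo Z) (Lo X)" by (rule LM_quasi_iso[OF Z(1) X(1) Z(2)])
  then have "ar (LM Z X s) (Lo Z) (Lo X)" by (simp add: iso_def)
  then have "g \<cdot> (\<tau> \<cdot> LM Z X s) = LM Z Y T" using Z(4) assoc[OF _ \<tau> g] by simp
  then show thesis using that[OF Z(1) iso_cmp[OF s X(2)] Z(3)] by blast
qed

text \<open>Replacing the source by a quasi-isomorphic complex makes \<open>g\<close> a chain map
  and the vanishing of the composite an explicit null-homotopy, so that exactness becomes a
  computation with homotopies.\<close>

lemma represent_null:
  assumes Y: "Y \<in> bc" and g: "ar g W (Lo Y)" and U: "U \<in> bc" and V: "rch \<Lambda> Y U V" and 0: "LM Y U V \<cdot> g = 0"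
  obtains Z \<sigma> T where "Z \<in> bc" "iso \<sigma> (Lo Z) W" "rch \<Lambda> Z Y T" "g \<cdot> \<sigma> = LM Z Y T" "null \<Lambda> Z U (\<lambda>i. V i * T i)"
proof -
  obtain Z \<sigma> T where Z: "Z \<in> bc" "iso \<sigma> (Lo Z) W" "rch \<Lambda> Z Y T" "g \<cdot> \<sigma> = LM Z Y T" using represent[OF Y g] .
  have \<sigma>: "ar \<sigma> (Lo Z) W" using Z(2) by (simp add: iso_def)
  have "LM Z U (\<lambda>i. V i * T i) = LM Y U V \<cdot> g \<cdot> \<sigma>"
    using LM_comp[OF Z(1) Y U Z(3) V] Z(4) assoc[OF \<sigma> g LM_ar[OF Y U V]] by simp
  also have "\<dots> = 0" unfolding 0 by (rule cmp_zero_left[OF Lo_obj[OF U] \<sigma>])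
  finally obtain Z' s where s: "Z' \<in> bc" "rq \<Lambda> Z' Z s" "null \<Lambda> Z' U (\<lambda>i. V i * T i * s i)"
    using LM_eq_0_iff[OF Z(1) U rch_comp[OF Z(3) V]] by blast
  have s1: "rch \<Lambda> Z' Z s" using s(2) by (simp add: rq_def)
  have si: "iso (LM Z' Z s) (Lo Z') (Lo Z)" by (rule LM_quasi_iso[OF s(1) Z(1) s(2)])
  show thesis
  proof (rule that[OF s(1) iso_cmp[OF si Z(2)] rch_comp[OF s1 Z(3)]])
    show "g \<cdot> (\<sigma> \<cdot> LM Z' Z s) = LM Z' Y (\<lambda>i. T i * s i)"
      using assoc[OF LM_ar[OF s(1) Z(1) s1] \<sigma> g] Z(4) LM_comp[OF s(1) Z(1) Y s1 Z(3)] by simp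
    show "null \<Lambda> Z' U (\<lambda>i. V i * (T i * s i))" using s(3) by (simp add: mult.assoc)
  qed
qed

lemma LM_factor:
  assumes X: "X \<in> bc" and Y: "Y \<in> bc" and Z: "Z \<in> bc" and f: "rch \<Lambda> X Y f" and t: "rch \<Lambda> Z X t" and T: "rch \<Lambda> Z Y T"
    and h: "null \<Lambda> Z Y (\<lambda>i. T i - f i * t i)" and g: "ar g W (Lo Y)" "iso \<sigma> (Lo Z) W" "g \<cdot> \<sigma> = LM Z Y T"
  shows "\<exists>t. ar t W (Lo X) \<and> g = LM X Y f \<cdot> t"
proof -
  obtain s where s: "ar \<sigma> (Lo Z) W" "ar s W (Lo Z)" "\<sigma> \<cdot> s = \<iota> W" using g(2) by (rule isoE)
  note ft = rch_comp[OF t f]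
  have eq: "(\<lambda>i. sc (- 1) * (f i * t i) + T i) = (\<lambda>i. T i - f i * t i)"
  proof
    fix i
    have "sc (- 1 :: 'k) = - 1" by (rule linop_eqI) (simp add: app_simps)
    then show "sc (- 1) * (f i * t i) + T i = T i - f i * t i" by simp
  qed
  have "LM Z Y (\<lambda>i. T i - f i * t i) = 0" using LM_null[OF Z Y rch_lin[OF ft T, of "-1"]] h unfolding eq .
  moreover have "LM Z Y (\<lambda>i. T i - f i * t i) = LM Z Y T - LM Z Y (\<lambda>i. f i * t i)"
    using LM_lin[OF Z Y ft T, of "-1"] unfolding eq by simp
  ultimately have "LM Z Y T = LM X Y f \<cdot> LM Z X t" using LM_comp[OF Z X Y t f] by simp
  then have "g \<cdot> \<sigma> \<cdot> s = LM X Y f \<cdot> (LM Z X t \<cdot> s)"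
    using g(3) assoc[OF s(2) LM_ar[OF Z X t] LM_ar[OF X Y f]] by simp
  moreover have "g \<cdot> \<sigma> \<cdot> s = g" using assoc[OF s(2,1) g(1)] s(3) id_right[OF g(1)] by simp
  ultimately show ?thesis using cmp_ar[OF s(2) LM_ar[OF Z X t]] by auto
qed

end

context lcat begin

lemma iso_epi0: "iso s X Y \<Longrightarrow> ar f Y Z \<Longrightarrow> f \<cdot> s = 0 \<Longrightarrow> f = 0"
proof -
  assume s: "iso s X Y" and f: "ar f Y Z" and 0: "f \<cdot> s = 0"
  obtain r where r: "ar s X Y" "ar r Y X" "s \<cdot> r = \<iota> Y" using s by (rule isoE)
  have "f = f \<cdot> s \<cdot> r" using assoc[OF r(2,1) f] r(3) id_right[OF f] by simp
  then show ?thesis using 0 cmp_zero_left[OF arD(2)[OF f] r(2)] by simp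
qed

lemma iso_mono0: "iso s Y Z \<Longrightarrow> ar f X Y \<Longrightarrow> s \<cdot> f = 0 \<Longrightarrow> f = 0"
proof -
  assume s: "iso s Y Z" and f: "ar f X Y" and 0: "s \<cdot> f = 0"
  obtain r where r: "ar s Y Z" "ar r Z Y" "r \<cdot> s = \<iota> Y" using s by (rule isoE)
  have "f = r \<cdot> (s \<cdot> f)" using assoc[OF f r(1,2)] r(3) id_left[OF f] by simp
  then show ?thesis using 0 cmp_zero_right[OF arD(1)[OF f] r(2)] by simp
qed

end

context cone_data begin

lemma cone_d': "d Z (i - 1) = ir i * f i * pl (i - 1) + ir i * d Y (i - 1) * pr (i - 1) - il i * d X i * pl (i - 1)"
  using cone_d[of "i - 1"] by simp

lemma ops': "pl (i - 1) * il (i - 1) = eX X i" "il (i - 1) * eX X i = il (i - 1)" "eX X i * pl (i - 1) = pl (i - 1)"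
  using ops(1,5,7)[of "i - 1"] by simp_all

lemma pl_chain: "rch \<Lambda> Z (cplx_shift X) pl"
  unfolding rch_def
proof (intro allI conjI)
  fix i
  show "rhom \<Lambda> (cobj Z i) (cobj (cplx_shift X) i) (pl i)" using pl_rhom shift_complex(2)[OF X] by simp
  show "pl (i + 1) * d Z i = d (cplx_shift X) i * pl i"
    unfolding cone_d shift_complex(3)[OF X]
    by (simp only: ops ops[THEN mult_l] X_ops X_ops[THEN mult_l] ring_norm)
qed

lemma f_shift_chain: "rch \<Lambda> (cplx_shift X) (cplx_shift Y) (\<lambda>i. f (i + 1))"
  unfolding rch_def shift_complex(2,3)[OF X] shift_complex(2,3)[OF Y]
proof (intro allI conjI)
  fix i
  show "rhom \<Lambda> (cobj X (i + 1)) (cobj Y (i + 1)) (f (i + 1))" using f by (simp add: rch_def)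
  show "f (i + 1 + 1) * - d X (i + 1) = - d Y (i + 1) * f (i + 1)" by (simp only: f_ops mult_minus_right mult_minus_left)
qed

lemma null_ir_f: "null \<Lambda> X Z (\<lambda>i. ir i * f i)"
  unfolding null_def
proof (intro exI[of _ "\<lambda>i. il (i - 1)"] conjI allI)
  fix i
  show "rhom \<Lambda> (cobj X i) (cobj Z (i - 1)) (il (i - 1))" using il_rhom[of "i - 1"] by simp
  have "d Z (i - 1) * il (i - 1) = ir i * f i - il i * d X i"
    unfolding cone_d' by (simp only: ops ops[THEN mult_l] ops' ops'[THEN mult_l] X_ops f_ops ring_norm diff_add_cancel)
  then show "ir i * f i = d Z (i - 1) * il (i - 1) + il (i + 1 - 1) * d X i" by simp
qed

lemma null_f_pl: "null \<Lambda> Z (cplx_shift Y) (\<lambda>i. f (i + 1) * pl i)"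
  unfolding null_def
proof (intro exI[of _ pr] conjI allI)
  fix i
  show "rhom \<Lambda> (cobj Z i) (cobj (cplx_shift Y) (i - 1)) (pr i)" using pr_rhom shift_complex(2)[OF Y] by simp
  have "pr (i + 1) * d Z i = f (i + 1) * pl i + d Y i * pr i"
    unfolding cone_d by (simp only: ops ops[THEN mult_l] Y_ops Y_ops[THEN mult_l] f_ops f_ops[THEN mult_l] ring_norm)
  then show "f (i + 1) * pl i = d (cplx_shift Y) (i - 1) * pr i + pr (i + 1) * d Z i" using shift_complex(3)[OF Y, of "i - 1"] by simp
qed

end

context derived begin

lemma th_iso: "X \<in> bc \<Longrightarrow> iso (\<theta> X) (fobj S (Lo X)) (Lo (cplx_shift X))"
  using th_iso0 iso_mor_iff[OF S.F_obj[OF Lo_obj] Lo_obj] shift_complex(1) by blast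

lemma th_nat:
  assumes X: "X \<in> bc" and Y: "Y \<in> bc" and f: "rch \<Lambda> X Y f"
  shows "\<theta> Y \<cdot> fmor S (LM X Y f) = LM (cplx_shift X) (cplx_shift Y) (\<lambda>i. f (i + 1)) \<cdot> \<theta> X"
proof -
  have "mkf (cplx_shift X) (cplx_shift Y) (\<lambda>i. f (i + 1)) = (\<lambda>i. mkf X Y f (i + 1))"
    by (auto simp: mkf_def shift_complex(2)[OF X] shift_complex(2)[OF Y])
  then show ?thesis using th_nat0[OF X Y mkf_chain(1)[OF X Y f]] by (simp add: LM_def)
qed

text \<open>The connecting map is the projection to the shifted complex followed by the inverse of
  \<open>\<theta> X\<close>. At each place the block components of a null-homotopy furnish both the
  lift and the homotopy certifying it.\<close>

lemma cone_tri:
  assumes X: "X \<in> bc" and Y: "Y \<in> bc" and f: "rch \<Lambda> X Y f"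
  shows "\<exists>v w. S.tri (Lo X) (Lo Y) (Lo (cone X Y f)) (LM X Y f) v w"
proof -
  interpret cone_data \<Lambda> X Y f using assms by unfold_locales
  let ?SX = "cplx_shift X" and ?SY = "cplx_shift Y"
  note Z = cone_complex and SX = shift_complex[OF X] and SY = shift_complex[OF Y]
  note u = LM_ar[OF X Y f] and v = LM_ar[OF Y Z ir_chain] and p = LM_ar[OF Z SX(1) pl_chain]
    and fs = LM_ar[OF SX(1) SY(1) f_shift_chain]
  obtain \<theta>' where th: "ar (\<theta> X) (fobj S (Lo X)) (Lo ?SX)" "ar \<theta>' (Lo ?SX) (fobj S (Lo X))"
    "\<theta>' \<cdot> \<theta> X = \<iota> (fobj S (Lo X))" "\<theta> X \<cdot> \<theta>' = \<iota> (Lo ?SX)" "iso \<theta>' (Lo ?SX) (fobj S (Lo X))"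
    using th_iso[OF X] by (rule isoE)
  have thY: "ar (\<theta> Y) (fobj S (Lo Y)) (Lo ?SY)" using th_iso[OF Y] by (simp add: iso_def)
  let ?v = "LM Y Z ir" and ?p = "LM Z ?SX pl"
  let ?w = "\<theta>' \<cdot> ?p"
  note w = cmp_ar[OF p th(2)]
  have \<theta>w: "\<theta> X \<cdot> ?w = ?p" using assoc[OF p th(2,1)] th(4) id_left[OF p] by simp
  have nat: "\<theta> Y \<cdot> (fmor S (LM X Y f) \<cdot> g) = LM ?SX ?SY (\<lambda>i. f (i + 1)) \<cdot> (\<theta> X \<cdot> g)" if g: "ar g W (fobj S (Lo X))" for g W
    using th_nat[OF X Y f] assoc[OF g S.F_ar[OF u] thY] assoc[OF g th(1) fs] by simp
  have 1: "?v \<cdot> LM X Y f = 0"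
    using LM_null[OF X Z rch_comp[OF f ir_chain] null_ir_f] LM_comp[OF X Y Z f ir_chain] by simp
  have 2: "?w \<cdot> ?v = 0"
  proof -
    have "(\<lambda>i. pl i * ir i) = (\<lambda>_. 0)" using ops by simp
    then have "?p \<cdot> ?v = 0" using LM_comp[OF Y Z SX(1) ir_chain pl_chain] LM_zero[OF Y SX(1)] by simp
    then show ?thesis using assoc[OF v p th(2)] cmp_zero_right[OF Lo_obj[OF Y] th(2)] by simp
  qed
  have 3: "fmor S (LM X Y f) \<cdot> ?w = 0"
  proof -
    have "\<theta> Y \<cdot> (fmor S (LM X Y f) \<cdot> ?w) = LM ?SX ?SY (\<lambda>i. f (i + 1)) \<cdot> ?p" using nat[OF w] \<theta>w by simp
    also have "\<dots> = 0"
      using LM_comp[OF Z SX(1) SY(1) pl_chain f_shift_chain] LM_null[OF Z SY(1) rch_comp[OF pl_chain f_shift_chain] null_f_pl] by simp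
    finally show ?thesis using iso_mono0[OF th_iso[OF Y] cmp_ar[OF w S.F_ar[OF u]]] by blast
  qed
  have 4: "\<exists>t. ar t W (Lo X) \<and> g = LM X Y f \<cdot> t" if g: "ar g W (Lo Y)" "?v \<cdot> g = 0" for W g
  proof -
    obtain A \<sigma> T where A: "A \<in> bc" "iso \<sigma> (Lo A) W" "rch \<Lambda> A Y T" "g \<cdot> \<sigma> = LM A Y T" "null \<Lambda> A Z (\<lambda>i. ir i * T i)"
      using represent_null[OF Y g(1) Z ir_chain g(2)] .
    obtain h where h: "\<And>i. rhom \<Lambda> (cobj A i) (cobj Z (i - 1)) (h i)" "\<And>i. ir i * T i = d Z (i - 1) * h i + h (i + 1) * d A i"
      using A(5) unfolding null_def by blast
    \<comment> \<open>The \<open>X\<close> block of the homotopy is a chain map; its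
      \<open>Y\<close> block \<open>k\<close> is a homotopy between \<open>T\<close> and the
      composite of \<open>f\<close> with \<open>t\<close>.\<close>
    define t where "t i = pl (i - 1) * h i" for i
    define k where "k i = pr (i - 1) * h i" for i
    have t1: "rhom \<Lambda> (cobj A i) (cobj X i) (t i)" for i using rhom_mult[OF h(1) pl_rhom, of i] by (simp add: t_def)
    have k1: "rhom \<Lambda> (cobj A i) (cobj Y (i - 1)) (k i)" for i using rhom_mult[OF h(1) pr_rhom, of i] by (simp add: k_def)
    have t2: "t (i + 1) * d A i = d X i * t i" for i
    proof -
      have "0 = pl i * (ir i * T i)" by (simp only: ops[THEN mult_l] ring_norm)
      also have "\<dots> = t (i + 1) * d A i - d X i * t i"
        unfolding h(2) cone_d' t_def by (simp only: ops[THEN mult_l] X_ops[THEN mult_l] ring_norm add_diff_cancel_right') (simp add: mult.assoc)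
      finally show ?thesis by simp
    qed
    have t: "rch \<Lambda> A X t" unfolding rch_def using t1 t2 by simp
    have "T i - f i * t i = d Y (i - 1) * k i + k (i + 1) * d A i" for i
    proof -
      have eT: "eX Y i * T i = T i" using A(3) by (simp add: rch_def rhom_def)
      have Y1: "eX Y i * d Y (i - 1) = d Y (i - 1)" using Y_ops(1)[of "i - 1"] by simp
      have "T i = pr i * (ir i * T i)" using eT by (simp only: ops[THEN mult_l])
      also have "\<dots> = f i * t i + d Y (i - 1) * k i + k (i + 1) * d A i"
        unfolding h(2) cone_d' t_def k_def
        by (simp only: ops[THEN mult_l] f_ops[THEN mult_l] Y1[THEN mult_l] ring_norm) (simp add: mult.assoc)
      finally show ?thesis by simp
    qed
    then have "null \<Lambda> A Y (\<lambda>i. T i - f i * t i)" unfolding null_def using k1 by blast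
    then show ?thesis by (rule LM_factor[OF X Y A(1) f t A(3) _ g(1) A(2) A(4)])
  qed
  have 5: "\<exists>t. ar t W (Lo Y) \<and> g = ?v \<cdot> t" if g: "ar g W (Lo Z)" "?w \<cdot> g = 0" for W g
  proof -
    have pg: "?p \<cdot> g = 0"
    proof (rule iso_mono0[OF th(5) cmp_ar[OF g(1) p]])
      show "\<theta>' \<cdot> (?p \<cdot> g) = 0" using assoc[OF g(1) p th(2)] g(2) by simp
    qed
    obtain A \<sigma> T where A: "A \<in> bc" "iso \<sigma> (Lo A) W" "rch \<Lambda> A Z T" "g \<cdot> \<sigma> = LM A Z T" "null \<Lambda> A ?SX (\<lambda>i. pl i * T i)"
      using represent_null[OF Z g(1) SX(1) pl_chain pg] .
    obtain h where h: "\<And>i. rhom \<Lambda> (cobj A i) (cobj ?SX (i - 1)) (h i)" "\<And>i. pl i * T i = d ?SX (i - 1) * h i + h (i + 1) * d A i"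
      using A(5) unfolding null_def by blast
    have h1: "rhom \<Lambda> (cobj A i) (cobj X i) (h i)" for i using h(1)[of i] SX(2)[of "i - 1"] by simp
    have h2: "h (i + 1) * d A i = pl i * T i + d X i * h i" for i using h(2)[of i] SX(3)[of "i - 1"] by (simp add: algebra_simps)
    have T: "T (i + 1) * d A i = d Z i * T i" "eX Z i * T i = T i" for i using A(3) by (auto simp: rch_def rhom_def)
    \<comment> \<open>The \<open>Y\<close> block of \<open>T\<close> is not a chain map by itself;
      the homotopy that kills its \<open>X\<close> block supplies the correction, and the same
      \<open>h\<close>, placed in the \<open>X\<close> block, relates \<open>T\<close> to the
      lift.\<close>
    define t where "t i = pr i * T i - f i * h i" for i
    have "rhom \<Lambda> (cobj A i) (cobj Y i) (t i)" for i
      unfolding t_def using A(3) f rhom_diff[OF rhom_mult[OF _ pr_rhom] rhom_mult[OF h1]] unfolding rch_def by blast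
    moreover have "t (i + 1) * d A i = d Y i * t i" for i
    proof -
      have "t (i + 1) * d A i = pr (i + 1) * (d Z i * T i) - f (i + 1) * (pl i * T i + d X i * h i)"
        unfolding t_def h2[symmetric] T(1)[symmetric] by (simp add: left_diff_distrib mult.assoc)
      also have "\<dots> = d Y i * t i"
        unfolding cone_d t_def
        by (simp only: ops[THEN mult_l] Y_ops[THEN mult_l] f_ops[THEN mult_l] ring_norm) (simp add: algebra_simps)
      finally show ?thesis .
    qed
    ultimately have t: "rch \<Lambda> A Y t" by (simp add: rch_def)
    have "null \<Lambda> A Z (\<lambda>i. T i - ir i * t i)"
      unfolding null_def
    proof (intro exI[of _ "\<lambda>i. il (i - 1) * h i"] conjI allI)
      fix i
      show "rhom \<Lambda> (cobj A i) (cobj Z (i - 1)) (il (i - 1) * h i)" using rhom_mult[OF h1 , of i "cobj Z (i - 1)" "il (i - 1)"] il_rhom[of "i - 1"] by simp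
      have "d Z (i - 1) * (il (i - 1) * h i) + il (i + 1 - 1) * h (i + 1) * d A i =
          ir i * (f i * h i) - il i * (d X i * h i) + il i * (h (i + 1) * d A i)"
        using h1[of i] unfolding cone_d' rhom_def by (simp only: ops ops[THEN mult_l] ops' ops'[THEN mult_l] X_ops[THEN mult_l] f_ops[THEN mult_l] ring_norm) (simp add: mult.assoc)
      also have "\<dots> = ir i * (f i * h i) + il i * (pl i * T i)" unfolding h2 by (simp add: distrib_left)
      also have "\<dots> = T i - ir i * t i"
      proof -
        have "T i = il i * (pl i * T i) + ir i * (pr i * T i)" using T(2)[of i] unfolding cone_e by (simp add: distrib_right mult.assoc)
        then show ?thesis unfolding t_def by (simp add: right_diff_distrib algebra_simps)
      qed
      finally show "T i - ir i * t i = d Z (i - 1) * (il (i - 1) * h i) + il (i + 1 - 1) * h (i + 1) * d A i" by simp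
    qed
    then show ?thesis by (rule LM_factor[OF Y Z A(1) ir_chain t A(3) _ g(1) A(2) A(4)])
  qed
  have 6: "\<exists>t. ar t W (Lo Z) \<and> g = ?w \<cdot> t" if g: "ar g W (fobj S (Lo X))" "fmor S (LM X Y f) \<cdot> g = 0" for W g
  proof -
    let ?g = "\<theta> X \<cdot> g"
    note g1 = cmp_ar[OF g(1) th(1)]
    have "LM ?SX ?SY (\<lambda>i. f (i + 1)) \<cdot> ?g = 0" using nat[OF g(1)] g(2) cmp_zero_right[OF arD(1)[OF g(1)] thY] by simp
    then obtain A \<sigma> T where A: "A \<in> bc" "iso \<sigma> (Lo A) W" "rch \<Lambda> A ?SX T" "?g \<cdot> \<sigma> = LM A ?SX T" "null \<Lambda> A ?SY (\<lambda>i. f (i + 1) * T i)"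
      by (rule represent_null[OF SX(1) g1 SY(1) f_shift_chain])
    obtain h where h: "\<And>i. rhom \<Lambda> (cobj A i) (cobj ?SY (i - 1)) (h i)" "\<And>i. f (i + 1) * T i = d ?SY (i - 1) * h i + h (i + 1) * d A i"
      using A(5) unfolding null_def by blast
    have h1: "rhom \<Lambda> (cobj A i) (cobj Y i) (h i)" for i using h(1)[of i] SY(2)[of "i - 1"] by simp
    have h2: "h (i + 1) * d A i = f (i + 1) * T i + d Y i * h i" for i using h(2)[of i] SY(3)[of "i - 1"] by (simp add: algebra_simps)
    have T: "T (i + 1) * d A i = - (d X (i + 1) * T i)" "eX X (i + 1) * T i = T i" "rhom \<Lambda> (cobj A i) (cobj X (i + 1)) (T i)" for i
      using A(3) SX(2,3) by (auto simp: rch_def rhom_def)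
    \<comment> \<open>A map to the cone is a map to the shifted \<open>X\<close> together with a
      null-homotopy of its image in the shifted \<open>Y\<close>.\<close>
    define t where "t i = il i * T i + ir i * h i" for i
    have "rhom \<Lambda> (cobj A i) (cobj Z i) (t i)" for i
      unfolding t_def using rhom_add[OF rhom_mult[OF T(3) il_rhom] rhom_mult[OF h1 ir_rhom]] by blast
    moreover have "t (i + 1) * d A i = d Z i * t i" for i
    proof -
      have "t (i + 1) * d A i = ir (i + 1) * (f (i + 1) * T i + d Y i * h i) - il (i + 1) * (d X (i + 1) * T i)"
        unfolding t_def h2[symmetric] using T(1)[of i] by (simp add: distrib_right mult.assoc)
      also have "\<dots> = d Z i * t i"
        unfolding cone_d t_def
        by (simp only: ops[THEN mult_l] X_ops[THEN mult_l] Y_ops[THEN mult_l] f_ops[THEN mult_l] ring_norm) (simp add: algebra_simps)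
      finally show ?thesis .
    qed
    ultimately have t: "rch \<Lambda> A Z t" by (simp add: rch_def)
    have "T i - pl i * t i = 0" for i unfolding t_def using T(2)[of i] by (simp add: distrib_left ops[THEN mult_l])
    then have "null \<Lambda> A ?SX (\<lambda>i. T i - pl i * t i)" unfolding null_def by (intro exI[of _ "\<lambda>_. 0"]) (simp add: rhom_zero)
    then obtain t' where t': "ar t' W (Lo Z)" "?g = ?p \<cdot> t'"
      using LM_factor[OF Z SX(1) A(1) pl_chain t A(3) _ g1 A(2) A(4)] by blast
    have "g = \<theta>' \<cdot> ?g" using assoc[OF g(1) th(1,2)] th(3) id_left[OF g(1)] by simp
    then have "g = ?w \<cdot> t'" using t' assoc[OF t'(1) p th(2)] by simp
    then show ?thesis using t'(1) by blast
  qed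
  show ?thesis
    by (rule exI[of _ ?v], rule exI[of _ ?w]) (use u v w 1 2 3 4 5 6 in \<open>auto simp: S.tri_def\<close>)
qed

lemma tri_exists:
  assumes u: "ar u U V"
  shows "\<exists>W v w. S.tri U V W u v w"
proof -
  obtain Y \<beta> where Y: "Y \<in> bc" "iso \<beta> (Lo Y) V" using object_iso[OF arD(2)[OF u]] .
  obtain b where b: "ar \<beta> (Lo Y) V" "ar b V (Lo Y)" "\<beta> \<cdot> b = \<iota> V" using Y(2) by (rule isoE)
  obtain X \<sigma> T where X: "X \<in> bc" "iso \<sigma> (Lo X) U" "rch \<Lambda> X Y T" "b \<cdot> u \<cdot> \<sigma> = LM X Y T"
    using represent[OF Y(1) cmp_ar[OF u b(2)]] .
  have \<sigma>: "ar \<sigma> (Lo X) U" using X(2) by (simp add: iso_def)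
  obtain v w where t: "S.tri (Lo X) (Lo Y) (Lo (cone X Y T)) (LM X Y T) v w" using cone_tri[OF X(1) Y(1) X(3)] by blast
  have "u \<cdot> \<sigma> = \<beta> \<cdot> LM X Y T"
  proof -
    have "\<beta> \<cdot> (b \<cdot> u \<cdot> \<sigma>) = \<beta> \<cdot> b \<cdot> (u \<cdot> \<sigma>)" using assoc[OF \<sigma> u b(2)] assoc[OF cmp_ar[OF \<sigma> u] b(2,1)] by simp
    then show ?thesis using X(4) b(3) id_left[OF cmp_ar[OF \<sigma> u]] by simp
  qed
  then show ?thesis using S.tri_transport[OF t X(2) Y(2) u] by blast
qed

end

section \<open>Truncation\<close>

text \<open>The retractions \<open>r\<close> are merely linear; stability of the images of
  \<open>s\<close> under the action and the differential is what makes compression by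
  \<open>r\<close> and \<open>s\<close> multiplicative.\<close>

lemma subcomplex:
  fixes X :: "('a, 'k::field) cplx"
  assumes X: "X \<in> bounded_complexes \<Lambda>"
    and s: "\<And>i. r i * s i = e (m i)" "\<And>i. eX X i * s i = s i" "\<And>i. s i * e (m i) = s i" "\<And>i. e (m i) * r i = r i" "\<And>i. r i * eX X i = r i"
    and inv: "\<And>i a. a \<in> carrier \<Lambda> \<Longrightarrow> s i * r i * (rho (cobj X i) a * s i) = rho (cobj X i) a * s i"
      "\<And>i. s (i + 1) * r (i + 1) * (d X i * s i) = d X i * s i"
    and m0: "\<And>i. mdim (cobj X i) = 0 \<Longrightarrow> m i = 0"
  shows "\<exists>A\<in>bounded_complexes \<Lambda>. rch \<Lambda> A X s \<and> (\<forall>i. mdim (cobj A i) = m i) \<and> (\<forall>i. d A i = r (i + 1) * d X i * s i)"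
proof -
  let ?rho = "\<lambda>i a. r i * (rho (cobj X i) a * s i)"
  let ?D = "\<lambda>i. r (i + 1) * (d X i * s i)"
  note inv' = inv[unfolded mult.assoc]
  note [simp] = s s[THEN mult_l] mult.assoc inv' sc_left
  have mX: "rmod \<Lambda> (mdim (cobj X i)) (rho (cobj X i))" for i by (rule rmod_rho[OF complexD(1)[OF X]])
  have 1: "rmod \<Lambda> (m i) (?rho i)" for i
    using mX[of i] unfolding rmod_def by (auto simp: distrib_left distrib_right)
  have dX: "d X i * rho (cobj X i) a = rho (cobj X (i + 1)) a * d X i" if "a \<in> carrier \<Lambda>" for a i
    using complexD(2)[OF X, of i] that by (simp add: rhom_def)
  have 2: "?D i * ?rho i a = ?rho (i + 1) a * ?D i" if a: "a \<in> carrier \<Lambda>" for i a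
    using a dX[OF a, of i] dX[OF a, of i, THEN mult_l] by simp
  have 3: "?D (i + 1) * ?D i = 0" for i
  proof -
    have "?D (i + 1) * ?D i = r (i + 1 + 1) * (d X (i + 1) * (s (i + 1) * (r (i + 1) * (d X i * s i))))" by (simp only: mult.assoc)
    also have "\<dots> = r (i + 1 + 1) * (d X (i + 1) * d X i * s i)" by (simp only: inv' mult.assoc)
    finally show ?thesis using complexD(3)[OF X, of i] by simp
  qed
  have 4: "finite {i. m i \<noteq> 0}" by (rule finite_subset[OF _ complexD(4)[OF X]], rule subsetI, rule CollectI, rule notI, drule m0, simp)
  note A = mkc_complex[of \<Lambda> m ?rho ?D, OF 1 _ _ 2 3 4]
  let ?A = "mkc m ?rho ?D"
  have "?A \<in> bounded_complexes \<Lambda>" by (rule A(1)) simp_all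
  moreover have dA: "d ?A i = ?D i" for i by (rule A(2)) simp_all
  moreover have mA: "mdim (cobj ?A i) = m i" for i by (rule A(3)) simp_all
  moreover have rA: "rho (cobj ?A i) a = ?rho i a" if "a \<in> carrier \<Lambda>" for i a by (rule A(4)) (use that in simp_all)
  moreover have "rch \<Lambda> ?A X s" unfolding rch_def rhom_def by (simp add: dA mA rA)
  ultimately show ?thesis by (intro bexI[of _ ?A]) simp_all
qed

text \<open>The truncation that keeps everything below \<open>a\<close> and the cycles in degree
  \<open>a\<close>. With a generalized inverse \<open>G\<close> of the differential,
  \<open>eX X a - G * d X a\<close> is an idempotent onto the cycles, and splitting it gives them a
  basis.\<close>

lemma truncation:
  fixes X :: "('a, 'k::field) cplx"
  assumes X: "X \<in> bounded_complexes \<Lambda>"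
  obtains A s r H where "A \<in> bounded_complexes \<Lambda>" "rch \<Lambda> A X s" "\<forall>i. i > a \<longrightarrow> mdim (cobj A i) = 0"
    "\<forall>i. mdim (cobj X i) = 0 \<longrightarrow> mdim (cobj A i) = 0" "\<forall>i. r i * s i = eX A i"
    "\<forall>i. eX A i * r i = r i \<and> r i * eX X i = r i" "\<forall>i. i < a \<longrightarrow> s i * r i = eX X i" "eX X a = s a * r a + H * d X a"
    "\<forall>i. d A i = r (i + 1) * d X i * s i"
proof -
  have D: "eX X (a + 1) * d X a = d X a" "d X a * eX X a = d X a" using complexD(2)[OF X, of a] by (auto simp: rhom_def)
  obtain G where G: "d X a * G * d X a = d X a" "eX X a * G = G" "G * eX X (a + 1) = G" using generalized_inverse[OF D] .
  let ?P = "eX X a - G * d X a"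
  have DP: "d X a * ?P = 0" using G(1) D(2) by (simp add: right_diff_distrib mult.assoc)
  have P: "eX X a * ?P = ?P" "?P * eX X a = ?P"
    using G(2) D(2) by (simp_all add: right_diff_distrib left_diff_distrib G(2)[THEN mult_l] mult.assoc)
  have "?P * ?P = eX X a * ?P - G * (d X a * ?P)" by (simp only: left_diff_distrib mult.assoc)
  then have PP: "?P * ?P = ?P" unfolding DP P by simp
  obtain n K L where K: "?P = K * L" "L * K = e n" "eX X a * K = K" "K * e n = K" "e n * L = L" "L * eX X a = L"
    using idempotent_splitting[OF P PP] .
  have DK: "d X a * K = 0"
  proof -
    have "d X a * K = d X a * (K * (L * K))" using K(2,4) by simp
    also have "\<dots> = d X a * ?P * K" unfolding K(1) by (simp add: mult.assoc)
    finally show ?thesis using DP by simp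
  qed
  \<comment> \<open>The clause for a zero space in degree \<open>a\<close> makes \<open>m\<close>
    vanish wherever \<open>X\<close> does, without inferring \<open>n = 0\<close> from the equation
    \<open>e n = 0\<close>.\<close>
  define m where "m i = (if i < a then mdim (cobj X i) else if i = a \<and> mdim (cobj X a) \<noteq> 0 then n else 0)" for i
  define s where "s i = (if i < a then eX X i else if i = a then K else 0)" for i
  define r where "r i = (if i < a then eX X i else if i = a then L else 0)" for i
  have n0: "K = 0 \<and> L = 0 \<and> e n = (0 :: 'k linop)" if "mdim (cobj X a) = 0"
  proof -
    have "K = 0" "L = 0" using K(3,6) that by auto
    then show ?thesis using K(2) by simp
  qed
  have ops: "r i * s i = e (m i)" "eX X i * s i = s i" "s i * e (m i) = s i" "e (m i) * r i = r i" "r i * eX X i = r i" for i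
    using K n0 by (auto simp: s_def r_def m_def)
  have inv1: "s i * r i * (rho (cobj X i) x * s i) = rho (cobj X i) x * s i" if x: "x \<in> carrier \<Lambda>" for i x
  proof -
    have rX: "eX X i * rho (cobj X i) x = rho (cobj X i) x" for i using rmod_rho[OF complexD(1)[OF X, of i]] x by (simp add: rmod_def)
    have "K * L * (rho (cobj X a) x * K) = rho (cobj X a) x * K"
    proof -
      have "d X a * (rho (cobj X a) x * K) = rho (cobj X (a + 1)) x * (d X a * K)"
        using complexD(2)[OF X, of a] x by (simp add: rhom_def flip: mult.assoc)
      then have z: "d X a * (rho (cobj X a) x * K) = 0" using DK by simp
      have "K * L * (rho (cobj X a) x * K) = eX X a * (rho (cobj X a) x * K) - G * (d X a * (rho (cobj X a) x * K))"
        unfolding K(1)[symmetric] by (simp only: left_diff_distrib mult.assoc)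
      then show ?thesis unfolding z using rX by (simp flip: mult.assoc)
    qed
    then show ?thesis using rX[of i] by (auto simp: s_def r_def rX[THEN mult_l] mult.assoc)
  qed
  have inv2: "s (i + 1) * r (i + 1) * (d X i * s i) = d X i * s i" for i
  proof -
    consider "i + 1 < a" | "i + 1 = a" | "i = a" | "i > a" by linarith
    then show ?thesis
    proof cases
      case 1
      then show ?thesis using complexD(2)[OF X, of i] by (simp add: s_def r_def rhom_def mult.assoc; simp flip: mult.assoc)
    next
      case 2
      then have i: "i < a" "\<not> i + 1 < a" by auto
      have dd: "d X a * (d X i * x) = 0" "eX X a * (d X i * x) = d X i * x" for x
        using complexD(2,3)[OF X, of i] 2 by (simp_all add: rhom_def flip: mult.assoc)
      have "K * L * (d X i * eX X i) = eX X a * (d X i * eX X i) - G * (d X a * (d X i * eX X i))"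
        unfolding K(1)[symmetric] by (simp only: left_diff_distrib mult.assoc)
      then show ?thesis using i 2 dd by (simp add: s_def r_def)
    next
      case 3
      then show ?thesis using DK by (simp add: s_def r_def)
    next
      case 4
      then show ?thesis by (simp add: s_def)
    qed
  qed
  have m0: "mdim (cobj X i) = 0 \<Longrightarrow> m i = 0" for i by (auto simp: m_def)
  obtain A where A: "A \<in> bounded_complexes \<Lambda>" "rch \<Lambda> A X s" "\<forall>i. mdim (cobj A i) = m i" "\<forall>i. d A i = r (i + 1) * d X i * s i"
    using subcomplex[of X \<Lambda> r s m, OF X ops inv1 inv2 m0] by blast
  show thesis
  proof (rule that[OF A(1,2), of r G])
    show "eX X a = s a * r a + G * d X a" using K(1) by (simp add: s_def r_def algebra_simps)
  qed (use A ops in \<open>auto simp: m_def s_def r_def\<close>)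
qed

lemma exact_at_zero: "mdim (cobj X i) = 0 \<Longrightarrow> exact_at X i"
  unfolding exact_at_def by (auto simp: app_simps intro: exI[of _ "\<lambda>_. 0"])

locale trunc =
  fixes \<Lambda> :: "('k::field, 'a) module" and X A :: "('a, 'k) cplx" and s r H a
  assumes X: "X \<in> bounded_complexes \<Lambda>" and A: "A \<in> bounded_complexes \<Lambda>" and s: "rch \<Lambda> A X s"
    and mA: "\<forall>i. i > a \<longrightarrow> mdim (cobj A i) = 0"
    and rs: "\<forall>i. r i * s i = eX A i" and er: "\<forall>i. eX A i * r i = r i \<and> r i * eX X i = r i"
    and sr: "\<forall>i. i < a \<longrightarrow> s i * r i = eX X i" and H: "eX X a = s a * r a + H * d X a"
    and dA: "\<forall>i. d A i = r (i + 1) * d X i * s i"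
begin

lemma eA0: "i > a \<Longrightarrow> eX A i = 0" using mA by simp
lemma s0: "i > a \<Longrightarrow> s i = 0" using s eA0 by (simp add: rch_def rhom_def) (metis mult_zero_right)
lemma r0: "i > a \<Longrightarrow> r i = 0" using er eA0 by (metis mult_zero_left)
lemma s_ops: "eX X i * s i = s i" "s i * eX A i = s i" "s (i + 1) * d A i = d X i * s i" using s by (auto simp: rch_def rhom_def)

lemma dX_ops: "eX X (i + 1) * d X i = d X i" "d X i * eX X i = d X i"
  using complexD(2)[OF X, of i] by (auto simp: rhom_def)

text \<open>Below \<open>a\<close> the retraction is inverse to the inclusion; from \<open>a\<close>
  on both sides are 0.\<close>

lemma r_chain: "r (i + 1) * d X i = d A i * r i"
proof -
  consider "i < a" | "i \<ge> a" by linarith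
  then show ?thesis
  proof cases
    case 1
    have "d A i * r i = r (i + 1) * (d X i * (s i * r i))" using dA by (simp add: mult.assoc)
    then show ?thesis using sr 1 dX_ops by simp
  next
    case 2
    then show ?thesis using r0[of "i + 1"] dA by simp
  qed
qed

lemma app_r_cycle:
  assumes "i \<le> a" "app (eX X i) x = x" "app (d X i) x = (\<lambda>_. 0)"
  shows "app (s i) (app (r i) x) = x"
proof (cases "i < a")
  case True
  then show ?thesis using sr assms(2) app_simps(3)[of "s i" "r i" x] by simp
next
  case False
  then have "i = a" using assms(1) by simp
  then have "x = app (s a * r a + H * d X a) x" using assms(2) unfolding H[symmetric] by simp
  also have "\<dots> = app (s a) (app (r a) x)" using assms(3) \<open>i = a\<close> by (simp add: app_simps)
  finally show ?thesis using \<open>i = a\<close> by simp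
qed

lemma app_mono: "app (eX A i) x = x \<Longrightarrow> app (r i) (app (s i) x) = x"
  using rs app_simps(3)[of "r i" "s i" x] by simp

lemma app_e0: "i > a \<Longrightarrow> app (eX A i) x = x \<Longrightarrow> x = (\<lambda>_. 0)" using eA0 by (simp add: app_simps)

lemma boundary:
  assumes x: "app (eX A i) x = x" and "app (s i) x = app (d X (i - 1)) u" and "i \<le> a"
  shows "x = app (d A (i - 1)) (app (r (i - 1)) u)"
proof -
  have "x = app (r i) (app (d X (i - 1)) u)" using app_mono[OF x] assms(2) by simp
  also have "\<dots> = app (d A (i - 1)) (app (r (i - 1)) u)"
    using r_chain[of "i - 1"] app_simps(3)[of "r i" "d X (i - 1)" u] app_simps(3)[of "d A (i - 1)" "r (i - 1)" u] by simp
  finally show ?thesis .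
qed

lemma quasi_iso: assumes ex: "\<And>i. i > a \<Longrightarrow> exact_at X i" shows "rq \<Lambda> A X s"
  unfolding rq_def
proof (intro conjI allI impI)
  show "rch \<Lambda> A X s" by (rule s)
next
  fix i x assume x: "app (eX A i) x = x" "app (d A i) x = (\<lambda>_. 0)" and "\<exists>u. app (s i) x = app (d X (i - 1)) u"
  then obtain u where u: "app (s i) x = app (d X (i - 1)) u" by blast
  show "\<exists>u. x = app (d A (i - 1)) u"
  proof (cases "i \<le> a")
    case True
    then show ?thesis using boundary[OF x(1) u] by blast
  next
    case False
    then show ?thesis using app_e0[OF _ x(1)] by (intro exI[of _ "\<lambda>_. 0"]) simp
  qed
next
  fix i y assume y: "app (eX X i) y = y" "app (d X i) y = (\<lambda>_. 0)"
  show "\<exists>x u. app (eX A i) x = x \<and> app (d A i) x = (\<lambda>_. 0) \<and> app (s i) x = (\<lambda>j. y j + app (d X (i - 1)) u j)"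
  proof (cases "i \<le> a")
    case True
    let ?x = "app (r i) y"
    have "app (eX A i) ?x = ?x" using er app_simps(3)[of "eX A i" "r i" y] by simp
    moreover have "app (d A i) ?x = (\<lambda>_. 0)"
      using r_chain[of i] app_simps(3)[of "d A i" "r i" y] app_simps(3)[of "r (i + 1)" "d X i" y] y(2) by simp
    ultimately show ?thesis using app_r_cycle[OF True y] by (intro exI[of _ ?x] exI[of _ "\<lambda>_. 0"]) simp
  next
    case False
    then obtain u where u: "y = app (d X (i - 1)) u" using ex[of i] y unfolding exact_at_def by auto
    have "app (d X (i - 1)) (\<lambda>j. - u j) = (\<lambda>j. - y j)" using app_neg[of "d X (i - 1)" u] u by simp
    then show ?thesis by (intro exI[of _ "\<lambda>_. 0"] exI[of _ "\<lambda>j. - u j"]) simp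
  qed
qed

lemma acyclic: assumes ex: "\<And>i. i \<le> a \<Longrightarrow> exact_at X i" shows "exact_at A i"
proof (cases "i \<le> a")
  case True
  show ?thesis
    unfolding exact_at_def
  proof (intro allI impI)
    fix x assume x: "app (eX A i) x = x" "app (d A i) x = (\<lambda>_. 0)"
    have "app (eX X i) (app (s i) x) = app (s i) x" using s_ops(1)[of i] app_simps(3)[of "eX X i" "s i" x] by simp
    moreover have "app (d X i) (app (s i) x) = (\<lambda>_. 0)"
      using s_ops(3)[of i] app_simps(3)[of "d X i" "s i" x] app_simps(3)[of "s (i + 1)" "d A i" x] x(2) by simp
    ultimately obtain u where "app (s i) x = app (d X (i - 1)) u" using ex[OF True] unfolding exact_at_def by blast
    then show "\<exists>u. x = app (d A (i - 1)) u" using boundary[OF x(1) _ True] by blast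
  qed
next
  case False
  show ?thesis by (rule exact_at_zero) (use False mA in auto)
qed

text \<open>\<open>T\<close> vanishes above \<open>a\<close>, so in degree \<open>a\<close> it takes
  values in cycles, where \<open>s a * r a\<close> acts as the identity.\<close>

lemma factor:
  assumes W: "\<forall>i. i > a \<longrightarrow> mdim (cobj W i) = 0" and T: "rch \<Lambda> W X T"
  shows "rch \<Lambda> W A (\<lambda>i. r i * T i)" "s i * (r i * T i) = T i"
proof -
  have T0: "T i = 0" if "i > a" for i
    using T W that by (simp add: rch_def rhom_def) (metis e_0 mult_zero_right)
  have Te: "eX X i * T i = T i" "T i * eX W i = T i" "T (i + 1) * d W i = d X i * T i" for i using T by (auto simp: rch_def rhom_def)
  show sT: "s i * (r i * T i) = T i" for i
  proof -
    consider "i < a" | "i = a" | "i > a" by linarith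
    then show ?thesis
    proof cases
      case 1
      then show ?thesis using sr Te(1)[of i] by (simp flip: mult.assoc)
    next
      case 2
      have "d X a * T a = 0" using Te(3)[of a] T0[of "a + 1"] by simp
      then have "(s a * r a + H * d X a) * T a = s a * (r a * T a)" by (simp add: distrib_right mult.assoc)
      then show ?thesis using 2 Te(1)[of a] unfolding H by simp
    next
      case 3
      then show ?thesis using T0 by simp
    qed
  qed
  have "r i * T i * rho (cobj W i) x = rho (cobj A i) x * (r i * T i)" if x: "x \<in> carrier \<Lambda>" for i x
  proof -
    have "s i * rho (cobj A i) x = rho (cobj X i) x * s i" using s x by (simp add: rch_def rhom_def)
    moreover have "eX A i * rho (cobj A i) x = rho (cobj A i) x" using rmod_rho[OF complexD(1)[OF A, of i]] x by (simp add: rmod_def)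
    ultimately have "rho (cobj A i) x = r i * (rho (cobj X i) x * s i)" using rs by (metis mult.assoc)
    then have "rho (cobj A i) x * (r i * T i) = r i * (rho (cobj X i) x * (s i * (r i * T i)))" by (simp only: mult.assoc)
    also have "\<dots> = r i * (T i * rho (cobj W i) x)" unfolding sT using T x by (simp add: rch_def rhom_def)
    finally show ?thesis by (simp add: mult.assoc)
  qed
  then have "rhom \<Lambda> (cobj W i) (cobj A i) (r i * T i)" for i
    unfolding rhom_def using er Te(2)[of i] by (simp add: mult.assoc) (simp flip: mult.assoc)
  moreover have "r (i + 1) * T (i + 1) * d W i = d A i * (r i * T i)" for i
  proof -
    have "r (i + 1) * T (i + 1) * d W i = r (i + 1) * d X i * T i" using Te(3)[of i] by (simp add: mult.assoc)
    then show ?thesis unfolding r_chain by (simp add: mult.assoc)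
  qed
  ultimately show "rch \<Lambda> W A (\<lambda>i. r i * T i)" by (simp add: rch_def)
qed

sublocale cone_data \<Lambda> A X s using X A s by unfold_locales

text \<open>Up to degree \<open>a\<close> the inclusion of the truncation is an isomorphism on
  cycles; the contraction of the cone combines the retraction \<open>r\<close> with the operator
  \<open>H\<close> that accounts for the non-cycles in degree \<open>a\<close>.\<close>

lemma cone_exact: assumes "i \<le> a" shows "exact_at (cone A X s) i"
proof -
  have A1: "eX A i * d A (i - 1) = d A (i - 1)" using X_ops(1)[of "i - 1"] by simp
  \<comment> \<open>Below \<open>a\<close> the value 0 works and at \<open>a\<close> the operator
    \<open>H\<close>; the second equation then holds because \<open>s\<close> vanishes in degree
    \<open>a + 1\<close>.\<close>
  obtain h where h: "eX X i = s i * r i + h * d X i" "h * s (i + 1) = 0"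
    using assms sr H s0[of "a + 1"] by (cases "i < a") (auto intro: that[of 0] that[of H])
  let ?h0 = "il (i - 1) * (r i * pr i)" and ?h1 = "il i * (r (i + 1) * pr (i + 1)) + ir i * (h * pr (i + 1))"
  have r1: "eX A (i - 1 + 1) * r i = r i" using er by simp
  have e1: "d Z (i - 1) * ?h0 = ir i * (s i * (r i * pr i)) - il i * (d A i * (r i * pr i))"
    unfolding cone_d' by (simp only: ops ops[THEN mult_l] ops' ops'[THEN mult_l] X_ops[THEN mult_l] f_ops[THEN mult_l] r1[THEN mult_l] ring_norm)
  have rs1: "r (i + 1) * s (i + 1) = eX A (i + 1)" using rs by simp
  have e2: "?h1 * d Z i = il i * pl i + il i * (d A i * (r i * pr i)) + ir i * (h * (d X i * pr i))"
  proof -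
    have "?h1 * d Z i = il i * (r (i + 1) * (s (i + 1) * pl i)) + il i * (r (i + 1) * (d X i * pr i)) + (ir i * (h * (s (i + 1) * pl i)) + ir i * (h * (d X i * pr i)))"
      unfolding cone_d by (simp only: ops ops[THEN mult_l] Y_ops[THEN mult_l] f_ops[THEN mult_l] ring_norm) (simp only: add_ac)
    also have "r (i + 1) * (s (i + 1) * pl i) = pl i" using ops(7)[of i] rs1 by (simp flip: mult.assoc)
    also have "r (i + 1) * (d X i * pr i) = d A i * (r i * pr i)" using r_chain[of i] by (simp flip: mult.assoc)
    also have "h * (s (i + 1) * pl i) = 0" using h(2) by (simp flip: mult.assoc)
    finally show ?thesis by simp
  qed
  have "pr i = eX X i * pr i" using ops(8) by simp
  also have "\<dots> = s i * (r i * pr i) + h * (d X i * pr i)" unfolding h(1) by (simp add: distrib_right mult.assoc)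
  finally have "ir i * pr i = ir i * (s i * (r i * pr i)) + ir i * (h * (d X i * pr i))" by (metis distrib_left)
  then have "eX Z i = d Z (i - 1) * ?h0 + ?h1 * d Z i" unfolding e1 e2 cone_e by simp
  then show ?thesis unfolding exact_at_contraction[OF cone_complex] by blast
qed

end

section \<open>Cohomological degree in the derived category\<close>

context derived begin

text \<open>On an acyclic complex the zero map is a quasi-isomorphism, hence an isomorphism.\<close>

lemma acyclic_zero: assumes A: "A \<in> bc" and ex: "\<And>i. exact_at A i" shows "\<iota> (Lo A) = 0"
proof -
  have "rq \<Lambda> A A (\<lambda>_. 0)"
    unfolding rq_def
  proof (intro conjI allI impI)
    fix i x assume x: "app (eX A i) x = x" "app (d A i) x = (\<lambda>_. 0)"
    then obtain u where u: "x = app (d A (i - 1)) u" using ex[of i] unfolding exact_at_def by blast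
    then show "\<exists>u. x = app (d A (i - 1)) u" by blast
    have "app (d A (i - 1)) (\<lambda>j. - u j) = (\<lambda>j. - x j)" using app_neg[of "d A (i - 1)" u] u by simp
    then show "\<exists>y u. app (eX A i) y = y \<and> app (d A i) y = (\<lambda>_. 0) \<and> app 0 y = (\<lambda>j. x j + app (d A (i - 1)) u j)"
      by (intro exI[of _ "\<lambda>_. 0"] exI[of _ "\<lambda>j. - u j"]) (simp add: app_simps)
  qed (rule rch_zero)
  then have "iso 0 (Lo A) (Lo A)" using LM_quasi_iso[OF A A] LM_zero[OF A A] by metis
  then obtain g where "ar g (Lo A) (Lo A)" "g \<cdot> 0 = \<iota> (Lo A)" by (auto simp: iso_def)
  then show ?thesis using cmp_zero_right[OF Lo_obj[OF A]] by metis
qed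

text \<open>Deliberately asymmetric to \<open>GE\<close>: truncation yields a complex without terms
  above \<open>a\<close>, whereas the complementary part arises as a cone, about which only
  exactness in low degrees is known.\<close>

definition LE :: "int \<Rightarrow> 'o \<Rightarrow> bool" where
  "LE a U \<longleftrightarrow> (\<exists>X\<in>bc. isom (Lo X) U \<and> (\<forall>i. i > a \<longrightarrow> mdim (cobj X i) = 0))"

definition GE :: "int \<Rightarrow> 'o \<Rightarrow> bool" where
  "GE a U \<longleftrightarrow> (\<exists>X\<in>bc. isom (Lo X) U \<and> (\<forall>i. i < a \<longrightarrow> exact_at X i))"

lemma LE_isom: "LE a U \<Longrightarrow> isom U V \<Longrightarrow> LE a V" and GE_isom: "GE a U \<Longrightarrow> isom U V \<Longrightarrow> GE a V"
  unfolding LE_def GE_def using isom_trans by blast+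

lemma zero_transport:
  assumes "isom X X'" "isom Y Y'" "ar f X' Y'" "\<And>g. ar g X Y \<Longrightarrow> g = 0"
  shows "f = 0"
proof -
  obtain a where a: "iso a X X'" using assms(1) by (auto simp: isom_def)
  obtain b where b: "iso b Y' Y" using isom_sym[OF assms(2)] by (auto simp: isom_def)
  have ar: "ar a X X'" "ar b Y' Y" using a b by (auto simp: iso_def)
  have "b \<cdot> (f \<cdot> a) = 0" using assms(4) cmp_ar[OF cmp_ar[OF ar(1) assms(3)] ar(2)] by blast
  then have "f \<cdot> a = 0" by (rule iso_mono0[OF b cmp_ar[OF ar(1) assms(3)]])
  then show ?thesis by (rule iso_epi0[OF a assms(3)])
qed

text \<open>The denominator of a fraction for \<open>f\<close> is exact above \<open>a\<close> and
  may be replaced by its truncation. From there the numerator factors through the truncation of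
  \<open>Y\<close>, which is acyclic.\<close>

lemma orth_complex:
  assumes X: "X \<in> bc" "\<forall>i. i > a \<longrightarrow> mdim (cobj X i) = 0" and Y: "Y \<in> bc" "\<forall>i. i \<le> a \<longrightarrow> exact_at Y i" and f: "ar f (Lo X) (Lo Y)"
  shows "f = 0"
proof -
  obtain Z s T where Z: "Z \<in> bc" "rq \<Lambda> Z X s" "rch \<Lambda> Z Y T" "f \<cdot> LM Z X s = LM Z Y T" using fraction[OF X(1) Y(1) f] .
  have exZ: "exact_at Z i" if "i > a" for i using exact_at_quasi_iso[OF Z(2)] exact_at_zero X(2) that by blast
  obtain A j r H where "A \<in> bc" "rch \<Lambda> A Z j" "\<forall>i. i > a \<longrightarrow> mdim (cobj A i) = 0" "\<forall>i. mdim (cobj Z i) = 0 \<longrightarrow> mdim (cobj A i) = 0"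
    "\<forall>i. r i * j i = eX A i" "\<forall>i. eX A i * r i = r i \<and> r i * eX Z i = r i" "\<forall>i. i < a \<longrightarrow> j i * r i = eX Z i"
    "eX Z a = j a * r a + H * d Z a" "\<forall>i. d A i = r (i + 1) * d Z i * j i"
    by (rule truncation[OF Z(1), of a])
  then interpret tZ: trunc \<Lambda> Z A j r H a using Z(1) by unfold_locales
  obtain A' j' r' H' where "A' \<in> bc" "rch \<Lambda> A' Y j'" "\<forall>i. i > a \<longrightarrow> mdim (cobj A' i) = 0" "\<forall>i. mdim (cobj Y i) = 0 \<longrightarrow> mdim (cobj A' i) = 0"
    "\<forall>i. r' i * j' i = eX A' i" "\<forall>i. eX A' i * r' i = r' i \<and> r' i * eX Y i = r' i" "\<forall>i. i < a \<longrightarrow> j' i * r' i = eX Y i"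
    "eX Y a = j' a * r' a + H' * d Y a" "\<forall>i. d A' i = r' (i + 1) * d Y i * j' i"
    by (rule truncation[OF Y(1), of a])
  then interpret tY: trunc \<Lambda> Y A' j' r' H' a using Y(1) by unfold_locales
  note Tj = rch_comp[OF tZ.s Z(3)]
  note fac = tY.factor[OF tZ.mA Tj]
  have "LM A Y (\<lambda>i. T i * j i) = LM A Y (\<lambda>i. j' i * (r' i * (T i * j i)))" using fac(2) by simp
  also have "\<dots> = LM A' Y j' \<cdot> LM A A' (\<lambda>i. r' i * (T i * j i))" by (rule LM_comp[OF tZ.A tY.A Y(1) fac(1) tY.s])
  also have "LM A' Y j' = 0"
    by (rule ar_eq_0_if_source_0[OF LM_ar[OF tY.A Y(1) tY.s] acyclic_zero[OF tY.A tY.acyclic]]) (use Y(2) in blast)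
  also have "0 \<cdot> LM A A' (\<lambda>i. r' i * (T i * j i)) = 0" by (rule cmp_zero_left[OF Lo_obj[OF Y(1)] LM_ar[OF tZ.A tY.A fac(1)]])
  finally have "LM Z Y T \<cdot> LM A Z j = 0" using LM_comp[OF tZ.A Z(1) Y(1) tZ.s Z(3)] by simp
  moreover have "iso (LM A Z j) (Lo A) (Lo Z)" by (rule LM_quasi_iso[OF tZ.A Z(1) tZ.quasi_iso[OF exZ]])
  ultimately have "LM Z Y T = 0" using iso_epi0 LM_ar[OF Z(1) Y(1) Z(3)] by blast
  then show ?thesis using iso_epi0[OF LM_quasi_iso[OF Z(1) X(1) Z(2)] f] Z(4) by simp
qed

lemma orth: assumes U: "LE a U" and V: "GE b V" and "a < b" and f: "ar f U V" shows "f = 0"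
proof -
  obtain X where X: "X \<in> bc" "isom (Lo X) U" "\<forall>i. i > a \<longrightarrow> mdim (cobj X i) = 0" using U by (auto simp: LE_def)
  obtain Y where Y: "Y \<in> bc" "isom (Lo Y) V" "\<forall>i. i < b \<longrightarrow> exact_at Y i" using V by (auto simp: GE_def)
  have "\<forall>i. i \<le> a \<longrightarrow> exact_at Y i" using Y(3) \<open>a < b\<close> by auto
  then show ?thesis using zero_transport[OF X(2) Y(2) f] orth_complex[OF X(1,3) Y(1)] by blast
qed

lemma trunc_tri:
  assumes U: "U \<in> obj C"
  shows "\<exists>A W u v w. S.tri A U W u v w \<and> LE a A \<and> GE (a + 1) W"
proof -
  obtain X \<beta> where X: "X \<in> bc" "iso \<beta> (Lo X) U" using object_iso[OF U] .
  obtain A j r H where "A \<in> bc" "rch \<Lambda> A X j" "\<forall>i. i > a \<longrightarrow> mdim (cobj A i) = 0" "\<forall>i. mdim (cobj X i) = 0 \<longrightarrow> mdim (cobj A i) = 0"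
    "\<forall>i. r i * j i = eX A i" "\<forall>i. eX A i * r i = r i \<and> r i * eX X i = r i" "\<forall>i. i < a \<longrightarrow> j i * r i = eX X i"
    "eX X a = j a * r a + H * d X a" "\<forall>i. d A i = r (i + 1) * d X i * j i"
    by (rule truncation[OF X(1), of a])
  then interpret t: trunc \<Lambda> X A j r H a using X(1) by unfold_locales
  obtain v w where tri: "S.tri (Lo A) (Lo X) (Lo (cone A X j)) (LM A X j) v w" using cone_tri[OF t.A X(1) t.s] by blast
  have \<beta>: "ar \<beta> (Lo X) U" using X(2) by (simp add: iso_def)
  note u = LM_ar[OF t.A X(1) t.s]
  note u' = cmp_ar[OF u \<beta>]
  have "\<beta> \<cdot> LM A X j \<cdot> \<iota> (Lo A) = \<beta> \<cdot> LM A X j" by (rule id_right[OF u'])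
  then obtain v' w' where "S.tri (Lo A) U (Lo (cone A X j)) (\<beta> \<cdot> LM A X j) v' w'"
    using S.tri_transport[OF tri iso_id[OF Lo_obj[OF t.A]] X(2) u'] by blast
  moreover have "LE a (Lo A)" unfolding LE_def using t.A t.mA isom_refl[OF Lo_obj[OF t.A]] by blast
  moreover have "GE (a + 1) (Lo (cone A X j))"
    unfolding GE_def using t.cone_complex t.cone_exact isom_refl[OF Lo_obj[OF t.cone_complex]] by auto
  ultimately show ?thesis by blast
qed

lemma bounded: assumes U: "U \<in> obj C" shows "\<exists>a b. GE a U \<and> LE b U"
proof -
  obtain X \<beta> where X: "X \<in> bc" "iso \<beta> (Lo X) U" using object_iso[OF U] .
  have iso: "isom (Lo X) U" using X(2) by (auto simp: isom_def)
  let ?I = "{i. mdim (cobj X i) \<noteq> 0}"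
  have fin: "finite ?I" by (rule complexD(4)[OF X(1)])
  obtain n where n: "\<forall>i\<in>?I. \<bar>i\<bar> \<le> n"
    using fin by (metis finite_imageI Max_ge imageI)
  have z: "mdim (cobj X i) = 0" if "i < - n \<or> i > n" for i
  proof (rule ccontr)
    assume "mdim (cobj X i) \<noteq> 0"
    then have "\<bar>i\<bar> \<le> n" using n by blast
    then show False using that by linarith
  qed
  have "GE (- n) U" unfolding GE_def using X(1) iso exact_at_zero z by blast
  moreover have "LE n U" unfolding LE_def using X(1) iso z by blast
  ultimately show ?thesis by blast
qed

lemma unshift:
  assumes X: "X \<in> bc"
  obtains Y where "Y \<in> bc" "cplx_shift Y = X" "\<forall>i. cobj Y i = cobj X (i - 1)" "\<forall>i. d Y i = - d X (i - 1)"
proof -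
  let ?Y = "\<lparr>cobj = (\<lambda>i. cobj X (i - 1)), diff = (\<lambda>i. - diff X (i - 1))\<rparr>"
  have "cplx_shift ?Y = X" by (simp add: cplx_shift_def)
  moreover have "?Y \<in> bc"
  proof -
    have mh: "- diff X (i - 1) \<in> mod_hom \<Lambda> (cobj X (i - 1)) (cobj X i)" for i
    proof -
      have "- diff X (i - 1) \<in> carrier_mat (mdim (cobj X i)) (mdim (cobj X (i - 1)))" using complexD(5)[OF X, of "i - 1"] by simp
      moreover have "rhom \<Lambda> (cobj X (i - 1)) (cobj X i) (op (- diff X (i - 1)))"
        using rhom_neg[OF complexD(2)[OF X, of "i - 1"]] by (simp add: op_uminus)
      ultimately show ?thesis using mo_mod_hom(1)[OF complexD(1)[OF X] complexD(1)[OF X]] mo_op by metis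
    qed
    have prod: "- diff X i * - diff X (i - 1) = 0\<^sub>m (mdim (cobj X (i + 1))) (mdim (cobj X (i - 1)))" for i
    proof (rule op_inj)
      have c: "diff X (i - 1) \<in> carrier_mat (mdim (cobj X i)) (mdim (cobj X (i - 1)))" using complexD(5)[OF X, of "i - 1"] by simp
      have "op (- diff X i * - diff X (i - 1)) = d X i * d X (i - 1)"
        using c complexD(5)[OF X, of i] by (simp add: op_mult op_uminus)
      then show "op (- diff X i * - diff X (i - 1)) = op (0\<^sub>m (mdim (cobj X (i + 1))) (mdim (cobj X (i - 1))))"
        using complexD(3)[OF X, of "i - 1"] by (simp add: op_zero)
    qed (use complexD(5)[OF X, of i] complexD(5)[OF X, of "i - 1"] in auto)
    have fin: "finite {i. mdim (cobj X (i - 1)) \<noteq> 0}"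
      using finite_vimageI[OF complexD(4)[OF X], of "\<lambda>i. i - 1"] by (simp add: vimage_def inj_def)
    show ?thesis
      unfolding bounded_complexes_def
    proof (intro CollectI conjI allI)
      fix i
      show "is_fdmod \<Lambda> (cobj ?Y i)" using complexD(1)[OF X] by simp
      show "diff ?Y i \<in> mod_hom \<Lambda> (cobj ?Y i) (cobj ?Y (i + 1))" using mh[of i] by simp
      show "diff ?Y (i + 1) * diff ?Y i = 0\<^sub>m (mdim (cobj ?Y (i + 2))) (mdim (cobj ?Y i))"
        using prod[of i] by (simp only: cplx.simps add_diff_cancel_right' add_diff_eq[symmetric]) simp
    qed (use fin in simp)
  qed
  ultimately show thesis by (intro that[of ?Y]) (simp_all add: op_uminus)
qed

lemma isom_shift: "X \<in> bc \<Longrightarrow> isom (Lo (cplx_shift X)) (fobj S (Lo X))"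
  by (rule isom_sym) (use th_iso in \<open>auto simp: isom_def\<close>)

lemma LE_S: assumes U: "U \<in> obj C" "LE a U" shows "LE (a - 1) (fobj S U)"
proof -
  obtain X where X: "X \<in> bc" "isom (Lo X) U" "\<forall>i. i > a \<longrightarrow> mdim (cobj X i) = 0" using U by (auto simp: LE_def)
  have "isom (Lo (cplx_shift X)) (fobj S U)" using isom_trans[OF isom_shift[OF X(1)] S.F_isom[OF X(2)]] .
  moreover have "\<forall>i. i > a - 1 \<longrightarrow> mdim (cobj (cplx_shift X) i) = 0" using X(3) shift_complex(2)[OF X(1)] by simp
  ultimately show ?thesis using shift_complex(1)[OF X(1)] by (auto simp: LE_def)
qed

lemma isom_unshift: assumes "Y \<in> bc" "cplx_shift Y = X" "isom (Lo X) U" shows "isom (Lo Y) (fobj Si U)"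
proof -
  have "isom (fobj S (Lo Y)) U" using isom_trans[OF isom_sym[OF isom_shift[OF assms(1)]]] assms(2,3) by simp
  from lauto.F_isom[OF S.swap this] show ?thesis using S.GF_obj[OF Lo_obj[OF assms(1)]] by simp
qed

lemma LE_Si: assumes U: "U \<in> obj C" "LE a U" shows "LE (a + 1) (fobj Si U)"
proof -
  obtain X where X: "X \<in> bc" "isom (Lo X) U" "\<forall>i. i > a \<longrightarrow> mdim (cobj X i) = 0" using U by (auto simp: LE_def)
  obtain Y where Y: "Y \<in> bc" "cplx_shift Y = X" "\<forall>i. cobj Y i = cobj X (i - 1)" "\<forall>i. d Y i = - d X (i - 1)" by (rule unshift[OF X(1)])
  show ?thesis unfolding LE_def using Y(1,3) X(3) isom_unshift[OF Y(1,2) X(2)] by (intro bexI[of _ Y]) auto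
qed

lemma GE_Si: assumes U: "U \<in> obj C" "GE a U" shows "GE (a + 1) (fobj Si U)"
proof -
  obtain X where X: "X \<in> bc" "isom (Lo X) U" "\<forall>i. i < a \<longrightarrow> exact_at X i" using U by (auto simp: GE_def)
  obtain Y where Y: "Y \<in> bc" "cplx_shift Y = X" "\<forall>i. cobj Y i = cobj X (i - 1)" "\<forall>i. d Y i = - d X (i - 1)" by (rule unshift[OF X(1)])
  have "exact_at Y i" if "i < a + 1" for i
    unfolding exact_at_def
  proof (intro allI impI)
    fix x assume "app (eX Y i) x = x" "app (d Y i) x = (\<lambda>_. 0)"
    then have "app (eX X (i - 1)) x = x" "app (d X (i - 1)) x = (\<lambda>_. 0)" using Y(3)[rule_format, of i] Y(4)[rule_format, of i] by (auto simp: app_simps fun_eq_iff)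
    moreover have "exact_at X (i - 1)" using X(3) that by simp
    ultimately obtain u where u: "x = app (d X (i - 1 - 1)) u" unfolding exact_at_def by blast
    have "x = app (d Y (i - 1)) (\<lambda>j. - u j)" unfolding Y(4)[rule_format] using app_neg[of "d X (i - 1 - 1)" u] u by (simp add: app_simps)
    then show "\<exists>u. x = app (d Y (i - 1)) u" by blast
  qed
  then show ?thesis unfolding GE_def using Y(1) isom_unshift[OF Y(1,2) X(2)] by blast
qed

end

section \<open>Modules over path algebras\<close>

definition pe :: "nat list \<Rightarrow> nat list \<Rightarrow> 'k::field" where "pe p = (\<lambda>q. if q = p then 1 else 0)"

lemma pe_carrier: assumes "p \<in> paths V A" shows "(pe p :: nat list \<Rightarrow> 'k::field) \<in> carrier (path_algebra V A)"
proof -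
  have "{q. pe p q \<noteq> (0 :: 'k)} = {p}" by (auto simp: pe_def)
  then show ?thesis using assms by (simp add: path_algebra_def)
qed

text \<open>The two pieces share the vertex at position \<open>i\<close>; therefore \<open>r\<close>
  has length \<open>i + 1\<close> and only the tail of \<open>q\<close> is appended.\<close>

lemma split_path_iff:
  assumes "i < length x" "q \<noteq> []" "r \<noteq> []"
  shows "drop i x = q \<and> take (Suc i) x = r \<longleftrightarrow> i = length r - 1 \<and> last r = hd q \<and> x = r @ tl q"
proof
  assume *: "drop i x = q \<and> take (Suc i) x = r"
  then have "length r = Suc i" "last r = x ! i" "hd q = x ! i" "tl q = drop (Suc i) x"
    using assms(1) by (auto simp: hd_drop_conv_nth drop_Suc tl_drop take_Suc_conv_app_nth)
  then show "i = length r - 1 \<and> last r = hd q \<and> x = r @ tl q" using * by auto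
next
  assume *: "i = length r - 1 \<and> last r = hd q \<and> x = r @ tl q"
  obtain r' a where r: "r = r' @ [a]" using assms(3) by (cases r rule: rev_cases) auto
  have "drop i x = last r # tl q" using * by (simp add: r)
  moreover have "take (Suc i) x = r" using * by (simp add: r)
  ultimately show "drop i x = q \<and> take (Suc i) x = r" using * assms(2) by simp
qed

lemma pe_mult:
  assumes "q \<noteq> []" "r \<noteq> []"
  shows "(\<Sum>i<length x. pe q (drop i x) * pe r (take (Suc i) x)) = (if last r = hd q then pe (r @ tl q) x else (0 :: 'k::field))"
proof -
  have "(\<Sum>i<length x. pe q (drop i x) * pe r (take (Suc i) x)) =
      (\<Sum>i<length x. if i = length r - 1 \<and> last r = hd q \<and> x = r @ tl q then 1 else (0 :: 'k))"
  proof (rule sum.cong[OF refl])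
    fix i assume i: "i \<in> {..<length x}"
    have "pe q (drop i x) * pe r (take (Suc i) x) = (if drop i x = q \<and> take (Suc i) x = r then 1 else (0 :: 'k))" by (simp add: pe_def)
    then show "pe q (drop i x) * pe r (take (Suc i) x) = (if i = length r - 1 \<and> last r = hd q \<and> x = r @ tl q then 1 else (0 :: 'k))"
      using split_path_iff[of i x, OF _ assms] i by simp
  qed
  also have "\<dots> = (if last r = hd q \<and> x = r @ tl q then \<Sum>i<length x. if i = length r - 1 then 1 else 0 else 0)" by auto
  also have "\<dots> = (if last r = hd q then pe (r @ tl q) x else 0)" using assms(2) by (cases r) (auto simp: pe_def)
  finally show ?thesis .
qed

locale quiver =
  fixes V :: "nat set" and A :: "(nat \<times> nat) set"
  assumes fin_V: "finite V"
begin

abbreviation PA :: "('k::field, nat list \<Rightarrow> 'k) module" where "PA \<equiv> path_algebra V A"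
abbreviation ev :: "(nat list \<Rightarrow> 'k::field, 'k) fdmod \<Rightarrow> nat \<Rightarrow> 'k linop" where "ev M v \<equiv> rho M (pe [v])"
abbreviation ac :: "(nat list \<Rightarrow> 'k::field, 'k) fdmod \<Rightarrow> nat \<Rightarrow> nat \<Rightarrow> 'k linop" where "ac M s t \<equiv> rho M (pe [s, t])"
definition Ar :: "(nat \<times> nat) set" where "Ar = A \<inter> V \<times> V"

lemma path1: "v \<in> V \<Longrightarrow> [v] \<in> paths V A" and path2: "(s, t) \<in> Ar \<Longrightarrow> [s, t] \<in> paths V A"
  and path3: "s # t # p \<in> paths V A \<longleftrightarrow> (s, t) \<in> Ar \<and> t # p \<in> paths V A"
  by (auto simp: paths_def Ar_def)

lemma path_induct [consumes 1, case_names single arrow]: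
  assumes "p \<in> paths V A" "\<And>v. v \<in> V \<Longrightarrow> P [v]" "\<And>s t p. (s, t) \<in> Ar \<Longrightarrow> t # p \<in> paths V A \<Longrightarrow> P (t # p) \<Longrightarrow> P (s # t # p)"
  shows "P p"
  using assms(1)
proof (induction p rule: induct_list012)
  case (2 x) then show ?case using assms(2) by (simp add: paths_def)
next
  case (3 x y zs) then show ?case using assms(3) by (simp add: path3)
qed (simp add: paths_def)

lemma PA_mult: "q \<noteq> [] \<Longrightarrow> r \<noteq> [] \<Longrightarrow> pe q \<otimes>\<^bsub>PA\<^esub> pe r = (if last r = hd q then pe (r @ tl q) else (\<lambda>_. 0 :: 'k::field))"
  by (rule ext) (simp add: path_algebra_def pe_mult)

lemma rmod_expand:
  assumes "rmod PA n \<rho>" "finite F" "F \<subseteq> paths V A" "{p. a p \<noteq> (0 :: 'k::field)} \<subseteq> F"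
  shows "\<rho> a = (\<Sum>p\<in>F. sc (a p) * \<rho> (pe p))"
  using assms(2-4)
proof (induction F arbitrary: a rule: finite_induct)
  case empty
  then have a: "a = (\<lambda>_. 0)" by auto
  have "a \<in> carrier PA" by (simp add: a path_algebra_def)
  moreover have "(0 :: 'k) \<odot>\<^bsub>PA\<^esub> a = a" by (simp add: a path_algebra_def)
  ultimately have "\<rho> a = sc 0 * \<rho> a" using assms(1) by (metis rmod_def)
  then show ?case by (simp add: sc_simps)
next
  case (insert p F)
  let ?b = "a(p := 0)"
  note R = assms(1)[unfolded rmod_def]
  have b: "{q. ?b q \<noteq> 0} \<subseteq> F" using insert.prems by auto
  have bc: "?b \<in> carrier PA" using order_trans[OF b, of "paths V A"] insert.prems(1) finite_subset[OF b insert.hyps(1)] by (simp add: path_algebra_def)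
  have pc: "pe p \<in> carrier PA" using insert.prems(1) by (intro pe_carrier) simp
  have sp: "{q. a p * pe p q \<noteq> 0} \<subseteq> {p}" by (auto simp: pe_def)
  have spc: "a p \<odot>\<^bsub>PA\<^esub> pe p \<in> carrier PA"
    using order_trans[OF sp, of "paths V A"] finite_subset[OF sp] insert.prems(1) by (simp add: path_algebra_def)
  have "a = ?b \<oplus>\<^bsub>PA\<^esub> (a p \<odot>\<^bsub>PA\<^esub> pe p)" by (auto simp: path_algebra_def pe_def)
  then have "\<rho> a = \<rho> (?b \<oplus>\<^bsub>PA\<^esub> (a p \<odot>\<^bsub>PA\<^esub> pe p))" by (rule arg_cong)
  also have "\<dots> = \<rho> ?b + sc (a p) * \<rho> (pe p)" 
    unfolding R[THEN conjunct2, THEN conjunct1, rule_format, OF bc spc] R[THEN conjunct2, THEN conjunct2, THEN conjunct1, rule_format, OF pc] ..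
  also have "\<rho> ?b = (\<Sum>q\<in>F. sc (?b q) * \<rho> (pe q))" by (rule insert.IH) (use b insert.prems in auto)
  also have "\<dots> = (\<Sum>q\<in>F. sc (a q) * \<rho> (pe q))" using insert.hyps(2) by (intro sum.cong) auto
  finally show ?case using insert.hyps by (simp add: add.commute)
qed

lemma rmod_ops:
  assumes r: "rmod PA n (\<rho> :: _ \<Rightarrow> 'k::field linop)"
  shows "v \<in> V \<Longrightarrow> w \<in> V \<Longrightarrow> \<rho> (pe [v]) * \<rho> (pe [w]) = (if v = w then \<rho> (pe [v]) else 0)"
    "(\<Sum>v\<in>V. \<rho> (pe [v])) = e n"
    "(s, t) \<in> Ar \<Longrightarrow> \<rho> (pe [t]) * \<rho> (pe [s, t]) = \<rho> (pe [s, t])"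
    "(s, t) \<in> Ar \<Longrightarrow> \<rho> (pe [s, t]) * \<rho> (pe [s]) = \<rho> (pe [s, t])"
    "s # t # p \<in> paths V A \<Longrightarrow> \<rho> (pe (s # t # p)) = \<rho> (pe (t # p)) * \<rho> (pe [s, t])"
proof -
  have m: "\<rho> (pe q \<otimes>\<^bsub>PA\<^esub> pe p) = \<rho> (pe q) * \<rho> (pe p)" if "q \<in> paths V A" "p \<in> paths V A" for p q
    using r pe_carrier[OF that(1), where 'k = 'k] pe_carrier[OF that(2), where 'k = 'k] by (simp add: rmod_def)
  have z: "\<rho> (\<lambda>_. 0) = 0" using rmod_expand[OF r, of "{}" "\<lambda>_. 0"] by simp
  show "\<rho> (pe [v]) * \<rho> (pe [w]) = (if v = w then \<rho> (pe [v]) else 0)" if "v \<in> V" "w \<in> V"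
    using m[of "[v]" "[w]"] that z by (auto simp: path1 PA_mult)
  have V: "t \<in> V" "s \<in> V" if "(s, t) \<in> Ar" for s t using that by (auto simp: Ar_def)
  show "\<rho> (pe [t]) * \<rho> (pe [s, t]) = \<rho> (pe [s, t])" "\<rho> (pe [s, t]) * \<rho> (pe [s]) = \<rho> (pe [s, t])" if "(s, t) \<in> Ar"
    using m[of "[t]" "[s, t]"] m[of "[s, t]" "[s]"] that V[OF that] by (auto simp: path1 path2 PA_mult)
  show "\<rho> (pe (s # t # p)) = \<rho> (pe (t # p)) * \<rho> (pe [s, t])" if "s # t # p \<in> paths V A"
    using m[of "t # p" "[s, t]"] that V(1)[of s t] path1[of t] by (auto simp: path3 path2 PA_mult)
  have "\<rho> \<one>\<^bsub>PA\<^esub> = (\<Sum>p\<in>(\<lambda>v. [v]) ` V. sc (\<one>\<^bsub>PA\<^esub> p) * \<rho> (pe p))"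
    by (rule rmod_expand[OF r]) (use fin_V path1 in \<open>auto simp: path_algebra_def\<close>)
  also have "\<dots> = (\<Sum>v\<in>V. \<rho> (pe [v]))"
    by (subst sum.reindex) (auto simp: inj_on_def path_algebra_def sc_simps intro!: sum.cong)
  finally show "(\<Sum>v\<in>V. \<rho> (pe [v])) = e n" using r by (simp add: rmod_def)
qed

lemma rmod_commute:
  assumes r: "rmod PA m (\<rho> :: _ \<Rightarrow> 'k::field linop)" and s: "rmod PA n \<sigma>"
    and T: "\<And>v. v \<in> V \<Longrightarrow> T * \<rho> (pe [v]) = \<sigma> (pe [v]) * T" "\<And>s t. (s, t) \<in> Ar \<Longrightarrow> T * \<rho> (pe [s, t]) = \<sigma> (pe [s, t]) * T"
    and a: "a \<in> carrier PA"
  shows "T * \<rho> a = \<sigma> a * T"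
proof -
  have p: "T * \<rho> (pe p) = \<sigma> (pe p) * T" if "p \<in> paths V A" for p
    using that
  proof (induction p rule: path_induct)
    case (arrow s t p)
    then have p: "s # t # p \<in> paths V A" by (simp add: path3)
    have "T * \<rho> (pe (s # t # p)) = \<sigma> (pe (t # p)) * (T * \<rho> (pe [s, t]))" using arrow.IH unfolding rmod_ops(5)[OF r p] by (simp flip: mult.assoc)
    also have "\<dots> = \<sigma> (pe (s # t # p)) * T" unfolding rmod_ops(5)[OF s p] T(2)[OF arrow.hyps(1)] by (simp add: mult.assoc)
    finally show ?case .
  qed (use T in simp)
  let ?F = "{p. a p \<noteq> 0}"
  have F: "finite ?F" "?F \<subseteq> paths V A" using a by (auto simp: path_algebra_def)
  show ?thesis
    unfolding rmod_expand[OF r F subset_refl] rmod_expand[OF s F subset_refl] sum_distrib_left sum_distrib_right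
    using F(2) p by (intro sum.cong refl) (auto simp: sc_left mult.assoc)
qed

text \<open>The action of a path as the product of its arrows, the starting arrow acting first and
  hence standing rightmost. The empty list is not a path and gets the default 0.\<close>

fun along :: "(nat \<Rightarrow> 'k::field linop) \<Rightarrow> (nat \<Rightarrow> nat \<Rightarrow> 'k linop) \<Rightarrow> nat list \<Rightarrow> 'k linop" where
  "along Ev Ac [] = 0" | "along Ev Ac [v] = Ev v" | "along Ev Ac (s # t # p) = along Ev Ac (t # p) * Ac s t"

text \<open>The absence of relations between paths enters here: composites along paths extend
  linearly, and multiplicativity holds because a path is determined by its arrows.\<close>

lemma representation:
  fixes Ev :: "nat \<Rightarrow> 'k::field linop"
  assumes Ev: "\<And>v w. v \<in> V \<Longrightarrow> w \<in> V \<Longrightarrow> Ev v * Ev w = (if v = w then Ev v else 0)" "(\<Sum>v\<in>V. Ev v) = e n"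
    and Ac: "\<And>s t. (s, t) \<in> Ar \<Longrightarrow> Ev t * Ac s t = Ac s t" "\<And>s t. (s, t) \<in> Ar \<Longrightarrow> Ac s t * Ev s = Ac s t"
  obtains \<rho> where "rmod PA n \<rho>" "\<forall>v\<in>V. \<rho> (pe [v]) = Ev v" "\<forall>s t. (s, t) \<in> Ar \<longrightarrow> \<rho> (pe [s, t]) = Ac s t"
proof -
  let ?M = "along Ev Ac"
  define \<rho> where "\<rho> a = (\<Sum>p\<in>{p. a p \<noteq> 0}. sc (a p) * ?M p)" for a
  have \<rho>: "\<rho> a = (\<Sum>p\<in>F. sc (a p) * ?M p)" if "finite F" "{p. a p \<noteq> 0} \<subseteq> F" for a F
    unfolding \<rho>_def by (rule sum.mono_neutral_left) (use that in \<open>auto simp: sc_simps\<close>)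
  have Vt: "s \<in> V" "t \<in> V" if "(s, t) \<in> Ar" for s t using that by (auto simp: Ar_def)
  have eEv: "e n * Ev v = Ev v" "Ev v * e n = Ev v" if "v \<in> V" for v
  proof -
    have "(\<Sum>w\<in>V. Ev w * Ev v) = (\<Sum>w\<in>V. if w = v then Ev v else 0)" "(\<Sum>w\<in>V. Ev v * Ev w) = (\<Sum>w\<in>V. if w = v then Ev v else 0)"
      using Ev(1) that by (auto intro!: sum.cong)
    then show "e n * Ev v = Ev v" "Ev v * e n = Ev v"
      unfolding Ev(2)[symmetric] using fin_V that by (simp_all add: sum_distrib_left sum_distrib_right)
  qed
  have M: "?M p * Ev (hd p) = ?M p \<and> e n * ?M p = ?M p \<and> ?M p * e n = ?M p" if "p \<in> paths V A" for p
    using that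
  proof (induction p rule: path_induct)
    case (single v) then show ?case using Ev(1) eEv by simp
  next
    case (arrow s t p)
    have "Ac s t * e n = Ac s t"
      using Ac(2)[OF arrow.hyps(1)] eEv(2)[OF Vt(1)[OF arrow.hyps(1)]] by (metis mult.assoc)
    then show ?case using arrow Ac by (simp add: mult.assoc) (simp flip: mult.assoc)
  qed
  have MM: "?M q * ?M r = (if last r = hd q then ?M (r @ tl q) else 0)" if r: "r \<in> paths V A" and q: "q \<in> paths V A" for q r
    using r
  proof (induction r rule: path_induct)
    case (single v)
    have hq: "hd q \<in> V" "q \<noteq> []" using q by (auto simp: paths_def)
    then have "?M q * Ev v = ?M q * (Ev (hd q) * Ev v)" using M[OF q] by (simp flip: mult.assoc)
    then show ?case using Ev(1)[OF hq(1) single] M[OF q] hq by (cases q) auto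
  next
    case (arrow s t r)
    then show ?case by (simp flip: mult.assoc)
  qed
  have mod: "rmod PA n \<rho>"
    unfolding rmod_def
  proof (intro conjI ballI allI)
    fix a :: "nat list \<Rightarrow> 'k" assume a: "a \<in> carrier PA"
    let ?F = "{p. a p \<noteq> 0}"
    have F: "finite ?F" "?F \<subseteq> paths V A" using a by (auto simp: path_algebra_def)
    have aF: "a x = (\<Sum>q\<in>?F. a q * pe q x)" for x using F(1) by (simp add: pe_def if_distrib cong: if_cong)
    show "e n * \<rho> a = \<rho> a" "\<rho> a * e n = \<rho> a"
      unfolding \<rho>_def sum_distrib_left sum_distrib_right
      using F(2) M by (auto intro!: sum.cong simp: sc_left mult.assoc)
    show "\<rho> (c \<odot>\<^bsub>PA\<^esub> a) = sc c * \<rho> a" for c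
    proof -
      have "\<rho> (c \<odot>\<^bsub>PA\<^esub> a) = (\<Sum>p\<in>?F. sc ((c \<odot>\<^bsub>PA\<^esub> a) p) * ?M p)" by (rule \<rho>[OF F(1)]) (auto simp: path_algebra_def)
      then show ?thesis unfolding \<rho>_def sum_distrib_left by (simp add: path_algebra_def sc_simps mult.assoc)
    qed
    fix b :: "nat list \<Rightarrow> 'k" assume b: "b \<in> carrier PA"
    let ?G = "{p. b p \<noteq> 0}"
    have G: "finite ?G" "?G \<subseteq> paths V A" using b by (auto simp: path_algebra_def)
    have bG: "b x = (\<Sum>q\<in>?G. b q * pe q x)" for x using G(1) by (simp add: pe_def if_distrib cong: if_cong)
    show "\<rho> (a \<oplus>\<^bsub>PA\<^esub> b) = \<rho> a + \<rho> b"
    proof -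
      have FG: "finite (?F \<union> ?G)" using F G by simp
      have "\<rho> (a \<oplus>\<^bsub>PA\<^esub> b) = (\<Sum>p\<in>?F \<union> ?G. sc ((a \<oplus>\<^bsub>PA\<^esub> b) p) * ?M p)" by (rule \<rho>[OF FG]) (auto simp: path_algebra_def)
      also have "\<dots> = \<rho> a + \<rho> b"
        unfolding \<rho>[OF FG Un_upper1] \<rho>[OF FG Un_upper2] by (simp add: path_algebra_def sc_simps distrib_right sum.distrib)
      finally show ?thesis .
    qed
    show "\<rho> (a \<otimes>\<^bsub>PA\<^esub> b) = \<rho> a * \<rho> b"
    proof -
      \<comment> \<open>All concatenations are collected, including those of pairs that do not
        compose; the coefficient \<open>?m\<close> is 0 for such pairs.\<close>
      let ?H = "(\<lambda>(q, r). r @ tl q) ` (?F \<times> ?G)"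
      let ?m = "\<lambda>q r x. if last r = hd q then pe (r @ tl q) x else (0 :: 'k)"
      have ne: "q \<noteq> []" if "q \<in> paths V A" for q using that by (simp add: paths_def)
      have ab: "(a \<otimes>\<^bsub>PA\<^esub> b) x = (\<Sum>q\<in>?F. \<Sum>r\<in>?G. a q * b r * ?m q r x)" for x
      proof -
        have "(a \<otimes>\<^bsub>PA\<^esub> b) x = (\<Sum>i<length x. (\<Sum>q\<in>?F. a q * pe q (drop i x)) * (\<Sum>r\<in>?G. b r * pe r (take (Suc i) x)))"
          unfolding aF[symmetric] bG[symmetric] by (simp add: path_algebra_def)
        also have "\<dots> = (\<Sum>i<length x. \<Sum>q\<in>?F. \<Sum>r\<in>?G. a q * b r * (pe q (drop i x) * pe r (take (Suc i) x)))"
          by (simp add: sum_product ac_simps)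
        also have "\<dots> = (\<Sum>q\<in>?F. \<Sum>i<length x. \<Sum>r\<in>?G. a q * b r * (pe q (drop i x) * pe r (take (Suc i) x)))" by (rule sum.swap)
        also have "\<dots> = (\<Sum>q\<in>?F. \<Sum>r\<in>?G. \<Sum>i<length x. a q * b r * (pe q (drop i x) * pe r (take (Suc i) x)))"
          by (intro sum.cong refl sum.swap)
        also have "\<dots> = (\<Sum>q\<in>?F. \<Sum>r\<in>?G. a q * b r * ?m q r x)"
        proof (intro sum.cong refl)
          fix q r assume "q \<in> ?F" "r \<in> ?G"
          then have qr: "q \<noteq> []" "r \<noteq> []" using ne subsetD[OF F(2)] subsetD[OF G(2)] by auto
          show "(\<Sum>i<length x. a q * b r * (pe q (drop i x) * pe r (take (Suc i) x))) = a q * b r * ?m q r x"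
            unfolding sum_distrib_left[symmetric] pe_mult[OF qr] ..
        qed
        finally show ?thesis .
      qed
      have fH: "finite ?H" using F G by simp
      have m: "(\<Sum>x\<in>?H. sc (?m q r x) * ?M x) = ?M q * ?M r" if "q \<in> ?F" "r \<in> ?G" for q r
      proof -
        have H: "r @ tl q \<in> ?H" using that by force
        have "(\<Sum>x\<in>?H. sc (?m q r x) * ?M x) = (\<Sum>x\<in>?H. if x = r @ tl q then (if last r = hd q then ?M (r @ tl q) else 0) else 0)"
          by (intro sum.cong refl) (simp add: pe_def sc_simps)
        also have "\<dots> = (if last r = hd q then ?M (r @ tl q) else 0)" using H fH by (simp only: sum.delta if_True)
        finally show ?thesis unfolding MM[OF subsetD[OF G(2) that(2)] subsetD[OF F(2) that(1)]] .
      qed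
      have "\<rho> (a \<otimes>\<^bsub>PA\<^esub> b) = (\<Sum>x\<in>?H. sc ((a \<otimes>\<^bsub>PA\<^esub> b) x) * ?M x)"
      proof (rule \<rho>[OF fH], rule subsetI, rule ccontr)
        fix x assume x: "x \<in> {p. (a \<otimes>\<^bsub>PA\<^esub> b) p \<noteq> 0}" "x \<notin> ?H"
        have "(\<Sum>q\<in>?F. \<Sum>r\<in>?G. a q * b r * ?m q r x) = 0"
        proof (intro sum.neutral ballI)
          fix q r assume "q \<in> ?F" "r \<in> ?G"
          then have "r @ tl q \<in> ?H" by force
          then show "a q * b r * ?m q r x = 0" using x(2) by (auto simp: pe_def)
        qed
        then show False using x(1) unfolding ab by simp
      qed
      also have "\<dots> = (\<Sum>x\<in>?H. \<Sum>q\<in>?F. \<Sum>r\<in>?G. sc (a q) * (sc (b r) * (sc (?m q r x) * ?M x)))"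
        unfolding ab sc_sum sum_distrib_right by (simp only: sc_simps(2) mult.assoc)
      also have "\<dots> = (\<Sum>q\<in>?F. \<Sum>x\<in>?H. \<Sum>r\<in>?G. sc (a q) * (sc (b r) * (sc (?m q r x) * ?M x)))" by (rule sum.swap)
      also have "\<dots> = (\<Sum>q\<in>?F. \<Sum>r\<in>?G. \<Sum>x\<in>?H. sc (a q) * (sc (b r) * (sc (?m q r x) * ?M x)))" by (intro sum.cong refl sum.swap)
      also have "\<dots> = (\<Sum>q\<in>?F. \<Sum>r\<in>?G. sc (a q) * (sc (b r) * (?M q * ?M r)))"
        unfolding sum_distrib_left[symmetric] by (simp only: m cong: sum.cong)
      also have "\<dots> = \<rho> a * \<rho> b" unfolding \<rho>_def sum_product by (simp only: mult.assoc sc_left[of "?M q" for q])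
      finally show ?thesis .
    qed
  next
    have "\<rho> \<one>\<^bsub>PA\<^esub> = (\<Sum>p\<in>(\<lambda>v. [v]) ` V. sc (\<one>\<^bsub>PA\<^esub> p) * ?M p)"
      by (rule \<rho>) (use fin_V in \<open>auto simp: path_algebra_def\<close>)
    also have "\<dots> = (\<Sum>v\<in>V. Ev v)"
      by (subst sum.reindex) (auto simp: inj_on_def path_algebra_def sc_simps intro!: sum.cong)
    finally show "\<rho> \<one>\<^bsub>PA\<^esub> = e n" using Ev(2) by simp
  qed
  have pe: "\<rho> (pe p) = ?M p" for p
    using \<rho>[of "{p}" "pe p"] by (auto simp: pe_def sc_simps)
  show thesis by (rule that[OF mod]) (use Ac(1) in \<open>auto simp: pe\<close>)
qed

text \<open>A representation of the quiver is given by arbitrary maps on the arrows. Hence the failure of a linear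
  lift \<open>g0\<close> of \<open>f\<close> to be a module homomorphism can be absorbed into the action of the arrows on \<open>N \<oplus> P\<close>.\<close>

lemma extension:
  fixes d0 d1 f g0 :: "'k::field linop"
  assumes mods: "is_fdmod PA N" "is_fdmod PA Z0" "is_fdmod PA Z1" "is_fdmod PA P"
    and d0: "rhom PA Z0 Z1 d0" and d1: "rhom PA Z1 P d1" and dd: "d1 * d0 = 0" and f: "rhom PA Z0 N f"
    and g0: "g0 * d0 = f" and h: "eM Z1 = d0 * h0 + h1 * d1"
  obtains E \<kappa> \<pi> g l \<mu> where "is_fdmod PA E" "rhom PA N E \<kappa>" "rhom PA E P \<pi>" "rhom PA Z1 E g" "g * d0 = \<kappa> * f" "\<pi> * g = d1"
    "\<pi> * \<kappa> = 0" "l * \<kappa> = eM N" "\<pi> * \<mu> = eM P" "\<kappa> * l + \<mu> * \<pi> = eM E"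
proof -
  note N = rmod_ops[OF rmod_rho[OF mods(1)]] and Z0 = rmod_ops[OF rmod_rho[OF mods(2)]]
    and Z1 = rmod_ops[OF rmod_rho[OF mods(3)]] and P = rmod_ops[OF rmod_rho[OF mods(4)]]
  have Vt: "s \<in> V" "t \<in> V" if "(s, t) \<in> Ar" for s t using that by (auto simp: Ar_def)
  have commV: "d0 * ev Z0 v = ev Z1 v * d0" "d1 * ev Z1 v = ev P v * d1" "f * ev Z0 v = ev N v * f" if "v \<in> V" for v
    using d0 d1 f pe_carrier[OF path1[OF that]] by (auto simp: rhom_def)
  have commA: "d0 * ac Z0 s t = ac Z1 s t * d0" "d1 * ac Z1 s t = ac P s t * d1" "f * ac Z0 s t = ac N s t * f"
    if "(s, t) \<in> Ar" for s t using d0 d1 f pe_carrier[OF path2[OF that]] by (auto simp: rhom_def)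
  have e_ops: "eM M * rho M a = rho M a" "rho M a * eM M = rho M a" if "is_fdmod PA M" "a \<in> carrier PA" for M and a :: "nat list \<Rightarrow> 'k"
    using rmod_rho[OF that(1)] that(2) by (auto simp: rmod_def)
  \<comment> \<open>Compressing by the vertex idempotents makes the lift respect the vertices; it
    still extends \<open>f\<close>, since \<open>f\<close> and \<open>d0\<close> respect them
    already.\<close>
  define g1 where "g1 = (\<Sum>v\<in>V. ev N v * g0 * ev Z1 v)"
  have g1l: "ev N w * g1 = ev N w * g0 * ev Z1 w" if "w \<in> V" for w
  proof -
    have "ev N w * g1 = (\<Sum>v\<in>V. if v = w then ev N w * g0 * ev Z1 w else 0)"
      unfolding g1_def sum_distrib_left by (intro sum.cong refl) (use N(1) that in \<open>auto simp flip: mult.assoc\<close>)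
    then show ?thesis using that fin_V by simp
  qed
  have g1r: "g1 * ev Z1 w = ev N w * g0 * ev Z1 w" if "w \<in> V" for w
  proof -
    have "g1 * ev Z1 w = (\<Sum>v\<in>V. if v = w then ev N w * g0 * ev Z1 w else 0)"
      unfolding g1_def sum_distrib_right by (intro sum.cong refl) (use Z1(1) that in \<open>auto simp: mult.assoc\<close>)
    then show ?thesis using that fin_V by simp
  qed
  have "(\<Sum>v\<in>V. ev N v * g1) = g1" "(\<Sum>v\<in>V. g1 * ev Z1 v) = g1"
    using sum.cong[OF refl g1l, of V] sum.cong[OF refl g1r, of V] by (simp_all add: g1_def[symmetric])
  then have g1e: "eM N * g1 = g1" "g1 * eM Z1 = g1"
    unfolding N(2)[symmetric] Z1(2)[symmetric] sum_distrib_left sum_distrib_right by simp_all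
  have g1d: "g1 * d0 = f"
  proof -
    have "g1 * d0 = (\<Sum>v\<in>V. f * ev Z0 v)"
      unfolding g1_def sum_distrib_right
    proof (intro sum.cong refl)
      fix v assume v: "v \<in> V"
      have "ev N v * g0 * ev Z1 v * d0 = ev N v * (g0 * d0) * ev Z0 v" using commV(1)[OF v] by (simp add: mult.assoc)
      also have "\<dots> = f * (ev Z0 v * ev Z0 v)" unfolding g0 commV(3)[OF v, symmetric] by (simp add: mult.assoc)
      finally show "ev N v * g0 * ev Z1 v * d0 = f * ev Z0 v" using Z0(1)[OF v v] by simp
    qed
    also have "\<dots> = f" unfolding sum_distrib_left[symmetric] Z0(2) using f by (simp add: rhom_def)
    finally show ?thesis .
  qed
  \<comment> \<open>The failure of \<open>g1\<close> to commute with an arrow. It vanishes on the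
    image of \<open>d0\<close>, so exactness at \<open>Z1\<close> lets it factor through
    \<open>d1\<close>; the factor \<open>c'\<close> becomes the off-diagonal part of the arrow on
    the extension.\<close>
  define c where "c = (\<lambda>s t. g1 * ac Z1 s t - ac N s t * g1)"
  define c' where "c' = (\<lambda>s t. ev N t * (c s t * h1) * ev P s)"
  have c_ops: "ev N t * c s t = c s t" "c s t * ev Z1 s = c s t" "c s t * d0 = 0" if st: "(s, t) \<in> Ar" for s t
  proof -
    have "ev N t * c s t = g1 * (ev Z1 t * ac Z1 s t) - ev N t * ac N s t * g1"
      unfolding c_def right_diff_distrib using g1l[OF Vt(2)[OF st]] g1r[OF Vt(2)[OF st]] by (simp flip: mult.assoc)
    then show "ev N t * c s t = c s t" using N(3)[OF st] Z1(3)[OF st] by (simp add: c_def)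
    have "c s t * ev Z1 s = g1 * (ac Z1 s t * ev Z1 s) - ac N s t * (ev N s * g1)"
      unfolding c_def left_diff_distrib using g1l[OF Vt(1)[OF st]] g1r[OF Vt(1)[OF st]] by (simp add: mult.assoc)
    then show "c s t * ev Z1 s = c s t" using N(4)[OF st] Z1(4)[OF st] by (simp add: c_def flip: mult.assoc)
    have "c s t * d0 = g1 * d0 * ac Z0 s t - ac N s t * (g1 * d0)"
      unfolding c_def left_diff_distrib using commA(1)[OF st] by (simp add: mult.assoc)
    then show "c s t * d0 = 0" unfolding g1d using commA(3)[OF st] by simp
  qed
  have c'd: "c' s t * d1 = c s t" if st: "(s, t) \<in> Ar" for s t
  proof -
    have "c' s t * d1 = ev N t * (c s t * (h1 * d1)) * ev Z1 s" using commV(2)[OF Vt(1)[OF st]] by (simp add: c'_def mult.assoc)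
    also have "h1 * d1 = eM Z1 - d0 * h0" unfolding h by simp
    also have "c s t * (eM Z1 - d0 * h0) = c s t * eM Z1"
      using c_ops(3)[OF st] by (simp add: right_diff_distrib flip: mult.assoc)
    also have "ev N t * (c s t * eM Z1) * ev Z1 s = ev N t * c s t * ev Z1 s"
      using e_ops(1)[OF mods(3) pe_carrier[OF path1[OF Vt(1)[OF st]]]] by (simp add: mult.assoc)
    finally show ?thesis using c_ops[OF st] by simp
  qed
  have c'_ops: "ev N t * c' s t = c' s t" "c' s t * ev P s = c' s t" if st: "(s, t) \<in> Ar" for s t
    using N(1)[OF Vt(2)[OF st] Vt(2)[OF st]] P(1)[OF Vt(1)[OF st] Vt(1)[OF st]]
    by (auto simp: c'_def mult.assoc) (simp flip: mult.assoc)
  let ?m = "mdim N" and ?n = "mdim P"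
  let ?il = "inl ?m ?n :: 'k linop" and ?ir = "inr ?m ?n :: 'k linop" and ?pl = "prl ?m ?n :: 'k linop" and ?pr = "prr ?m ?n :: 'k linop"
  note so' = sum_ops(1-4,6-13) sum_ops(1-4,6-13)[THEN mult_l]
  have eN: "eM N * ev N v = ev N v" "ev N v * eM N = ev N v" "eM P * ev P v = ev P v" "ev P v * eM P = ev P v" if "v \<in> V" for v
    using e_ops[OF mods(1) pe_carrier[OF path1[OF that]]] e_ops[OF mods(4) pe_carrier[OF path1[OF that]]] by auto
  have eA: "eM N * ac N s t = ac N s t" "ac N s t * eM N = ac N s t" "eM P * ac P s t = ac P s t" "ac P s t * eM P = ac P s t"
    if "(s, t) \<in> Ar" for s t
    using e_ops[OF mods(1) pe_carrier[OF path2[OF that]]] e_ops[OF mods(4) pe_carrier[OF path2[OF that]]] by auto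
  have c'_e: "eM N * c' s t = c' s t" "c' s t * eM P = c' s t" if st: "(s, t) \<in> Ar" for s t
    using eN(1)[OF Vt(2)[OF st]] eN(4)[OF Vt(1)[OF st]] by (auto simp: c'_def mult.assoc) (simp flip: mult.assoc)
  define Ev where "Ev v = ?il * (ev N v * ?pl) + ?ir * (ev P v * ?pr)" for v
  define Ac where "Ac s t = ?il * (ac N s t * ?pl) + ?ir * (ac P s t * ?pr) + ?il * (c' s t * ?pr)" for s t
  have 1: "Ev v * Ev w = (if v = w then Ev v else 0)" if "v \<in> V" "w \<in> V" for v w
    using N(1)[OF that, THEN mult_l] P(1)[OF that, THEN mult_l] eN[OF that(1), THEN mult_l] eN[OF that(2), THEN mult_l]
    by (simp add: Ev_def so' ring_norm)
  have 2: "(\<Sum>v\<in>V. Ev v) = e (?m + ?n)"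
  proof -
    have "(\<Sum>v\<in>V. Ev v) = ?il * ((\<Sum>v\<in>V. ev N v) * ?pl) + ?ir * ((\<Sum>v\<in>V. ev P v) * ?pr)"
      by (simp add: Ev_def sum.distrib sum_distrib_left sum_distrib_right)
    then show ?thesis unfolding N(2) P(2) using sum_ops(5)[of ?m ?n] by (simp add: so')
  qed
  have 3: "Ev t * Ac s t = Ac s t" "Ac s t * Ev s = Ac s t" if st: "(s, t) \<in> Ar" for s t
  proof -
    note rules = so' ring_norm N(3,4)[OF st, THEN mult_l] P(3,4)[OF st, THEN mult_l] c'_ops[OF st, THEN mult_l] c'_e[OF st, THEN mult_l]
      eN[OF Vt(1)[OF st], THEN mult_l] eN[OF Vt(2)[OF st], THEN mult_l] eA[OF st, THEN mult_l]
    show "Ev t * Ac s t = Ac s t" "Ac s t * Ev s = Ac s t" by (simp_all only: Ev_def Ac_def rules add.assoc)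
  qed
  obtain \<rho> where \<rho>: "rmod PA (?m + ?n) \<rho>" "\<forall>v\<in>V. \<rho> (pe [v]) = Ev v" "\<forall>s t. (s, t) \<in> Ar \<longrightarrow> \<rho> (pe [s, t]) = Ac s t"
    using representation[of Ev "?m + ?n" Ac, OF 1 2 3] .
  let ?E = "mkmod (?m + ?n) \<rho>"
  have E: "is_fdmod PA ?E" by (rule is_fdmod_mkmod[OF \<rho>(1)])
  have EV: "ev ?E v = Ev v" if "v \<in> V" for v using rho_mkmod[OF \<rho>(1) pe_carrier[OF path1[OF that]]] \<rho>(2) that by simp
  have EA: "rho ?E (pe [s, t]) = Ac s t" if "(s, t) \<in> Ar" for s t using rho_mkmod[OF \<rho>(1) pe_carrier[OF path2[OF that]]] \<rho>(3) that by force
  let ?g = "?il * g1 + ?ir * d1"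
  have homI: "rhom PA M M' T" if "is_fdmod PA M" "is_fdmod PA M'" "eM M' * T = T" "T * eM M = T" "\<And>v. v \<in> V \<Longrightarrow> T * ev M v = ev M' v * T"
     "\<And>s t. (s, t) \<in> Ar \<Longrightarrow> T * rho M (pe [s, t]) = rho M' (pe [s, t]) * T" for M M' and T :: "'k linop"
    unfolding rhom_def using rmod_commute[OF rmod_rho[OF that(1)] rmod_rho[OF that(2)] that(5,6)] that(3,4) by blast
  show thesis
  proof (rule that[OF E, of ?il ?pr ?g ?pl ?ir])
    show "rhom PA N ?E ?il"
      by (rule homI[OF mods(1) E]) (simp_all add: so' EV EA Ev_def Ac_def ring_norm eN eA)
    show "rhom PA ?E P ?pr"
      by (rule homI[OF E mods(4)]) (simp_all add: so' EV EA Ev_def Ac_def ring_norm eN[THEN mult_l] eA[THEN mult_l])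
    have gd: "eM P * d1 = d1" "d1 * eM Z1 = d1" using d1 by (auto simp: rhom_def)
    show "rhom PA Z1 ?E ?g"
    proof (rule homI[OF mods(3) E])
      show "eM ?E * ?g = ?g" "?g * eM Z1 = ?g" using g1e gd by (simp_all add: so' ring_norm)
      show "?g * ev Z1 v = ev ?E v * ?g" if v: "v \<in> V" for v
        unfolding EV[OF v] Ev_def using g1l[OF v] g1r[OF v] commV(2)[OF v] g1e gd by (simp add: so' ring_norm)
      show "?g * rho Z1 (pe [s, t]) = rho ?E (pe [s, t]) * ?g" if st: "(s, t) \<in> Ar" for s t
      proof -
        have "rho ?E (pe [s, t]) * ?g = ?il * (ac N s t * g1 + c' s t * d1) + ?ir * (ac P s t * d1)"
          unfolding EA[OF st] Ac_def using g1e gd by (simp only: so' ring_norm) (simp only: add_ac)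
        also have "\<dots> = ?g * ac Z1 s t" unfolding c'd[OF st] using commA(2)[OF st] by (simp add: c_def ring_norm)
        finally show ?thesis by simp
      qed
    qed
    show "?g * d0 = ?il * f" using g1d dd by (simp add: ring_norm)
    show "?pr * ?g = d1" using gd by (simp add: so' ring_norm)
    show "?il * ?pl + ?ir * ?pr = eM ?E" using sum_ops(5)[of ?m ?n] by simp
  qed (simp_all add: so')
qed

end

section \<open>Hereditary vanishing\<close>

locale derived_quiver = derived C S Si "path_algebra V A" Lo Lm \<theta> + quiver V A
  for C :: "('o, 'm::ab_group_add, 'k::field) lincat" and S Si :: "('o, 'm) lfunctor" and V A Lo Lm \<theta>
begin

text \<open>The module \<open>E\<close> of the extension lemma, placed in degree \<open>b\<close> over \<open>Z\<^sup>b\<^sup>+\<^sup>2\<close> in degree \<open>b + 1\<close>, gives a complex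
  quasi-isomorphic to \<open>Y\<close> in which the numerator of the fraction \<open>f\<close> becomes null-homotopic.\<close>

lemma single_degree_vanishing:
  assumes X: "X \<in> bc" "\<forall>i. i < a \<longrightarrow> exact_at X i" and Y: "Y \<in> bc" "\<forall>i. i \<noteq> b \<longrightarrow> mdim (cobj Y i) = 0"
    and "b + 2 \<le> a" and f: "ar f (Lo X) (Lo Y)"
  shows "f = 0"
proof -
  obtain Z s T where Z: "Z \<in> bc" "rq PA Z X s" "rch PA Z Y T" "f \<cdot> LM Z X s = LM Z Y T" using fraction[OF X(1) Y(1) f] .
  have exZ: "exact_at Z i" if "i < a" for i using exact_at_quasi_iso[OF Z(2)] X(2) that by blast
  have Tb: "rhom PA (cobj Z i) (cobj Y i) (T i)" "T (i + 1) * d Z i = d Y i * T i" for i using Z(3) by (auto simp: rch_def)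
  have dY: "d Y i = 0" for i
  proof -
    have "eX Y (i + 1) * d Y i = d Y i" "d Y i * eX Y i = d Y i" using complexD(2)[OF Y(1), of i] by (auto simp: rhom_def)
    moreover have "eX Y i = 0 \<or> eX Y (i + 1) = (0 :: 'k linop)" using Y(2) by (cases "i = b") auto
    ultimately show ?thesis by auto
  qed
  have "exact_at Z b" "exact_at Z (b + 1)" using exZ \<open>b + 2 \<le> a\<close> by auto
  then obtain h0 h1 k0 k1 where h: "eX Z b = d Z (b - 1) * h0 + h1 * d Z b"
    and k: "eX Z (b + 1) = d Z (b + 1 - 1) * k0 + k1 * d Z (b + 1)"
    unfolding exact_at_contraction[OF Z(1)] by blast
  \<comment> \<open>As \<open>Y\<close> has zero differentials, \<open>T b\<close> kills boundaries,
    so the contraction in degree \<open>b\<close> extends it linearly along \<open>d Z b\<close>;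
    this is the lift \<open>g0\<close> of the extension lemma.\<close>
  have "T b * (d Z (b - 1) * h0 + h1 * d Z b) = T b * h1 * d Z b"
    using Tb(2)[of "b - 1"] dY by (simp add: distrib_left flip: mult.assoc)
  then have g0: "T b * h1 * d Z b = T b" unfolding h[symmetric] using Tb(1)[of b] by (simp add: rhom_def)
  let ?P = "cobj Z (b + 1 + 1)"
  have k': "eX Z (b + 1) = d Z b * k0 + k1 * d Z (b + 1)" using k by simp
  obtain E \<kappa> \<pi> g l \<mu> where E: "is_fdmod PA E" "rhom PA (cobj Y b) E \<kappa>" "rhom PA E ?P \<pi>" "rhom PA (cobj Z (b + 1)) E g"
      "g * d Z b = \<kappa> * T b" "\<pi> * g = d Z (b + 1)" "\<pi> * \<kappa> = 0" "l * \<kappa> = eX Y b" "\<pi> * \<mu> = eM ?P" "\<kappa> * l + \<mu> * \<pi> = eM E"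
    by (rule extension[OF complexD(1)[OF Y(1), of b] complexD(1)[OF Z(1), of b] complexD(1)[OF Z(1), of "b + 1"] complexD(1)[OF Z(1), of "b + 1 + 1"]
      complexD(2)[OF Z(1), of b] complexD(2)[OF Z(1), of "b + 1"] complexD(3)[OF Z(1), of b] Tb(1)[of b] g0 k'])
  define m where "m i = (if i = b then mdim E else if i = b + 1 then mdim ?P else 0)" for i
  define R where "R i = (if i = b then rho E else if i = b + 1 then rho ?P else (\<lambda>_. 0))" for i
  define D where "D i = (if i = b then \<pi> else 0)" for i
  have "rmod PA 0 (\<lambda>_. 0 :: 'k linop)" by (simp add: rmod_def)
  then have J1: "rmod PA (m i) (R i)" for i
    using rmod_rho[OF E(1)] rmod_rho[OF complexD(1)[OF Z(1), of "b + 1 + 1"]] by (simp add: m_def R_def)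
  have J2: "e (m (i + 1)) * D i = D i" "D i * e (m i) = D i" for i using E(3) by (auto simp: m_def D_def rhom_def)
  have J3: "D i * R i x = R (i + 1) x * D i" if "x \<in> carrier PA" for i x using E(3) that by (auto simp: R_def D_def rhom_def)
  have J4: "D (i + 1) * D i = 0" for i by (simp add: D_def)
  have J5: "finite {i. m i \<noteq> 0}" by (rule finite_subset[of _ "{b, b + 1}"]) (auto simp: m_def)
  define J where "J = mkc m R D"
  note JJ = mkc_complex[of PA m R D, OF J1 J2 J3 J4 J5, folded J_def]
  define q where "q i = (if i = b then \<kappa> else 0)" for i
  have q: "rch PA Y J q"
    unfolding rch_def
  proof (intro allI conjI)
    fix i
    show "rhom PA (cobj Y i) (cobj J i) (q i)"
      using E(2) JJ(4) by (auto simp: rhom_def q_def JJ(3) m_def R_def)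
    show "q (i + 1) * d Y i = d J i * q i" using E(7) by (simp add: dY q_def JJ(2) D_def)
  qed
  have \<kappa>e: "\<kappa> * eX Y b = \<kappa>" using E(2) by (simp add: rhom_def)
  have "rq PA Y J q"
    unfolding rq_def
  proof (intro conjI allI impI, rule q)
    fix i x assume x: "app (eX Y i) x = x" "app (d Y i) x = (\<lambda>_. 0)" "\<exists>u. app (q i) x = app (d J (i - 1)) u"
    have "x = (\<lambda>_. 0)"
    proof (cases "i = b")
      case True
      then have "app \<kappa> x = (\<lambda>_. 0)" using x(3) by (auto simp: q_def JJ(2) D_def app_simps)
      then have "app (l * \<kappa>) x = (\<lambda>_. 0)" by (simp add: app_simps)
      then show ?thesis using x(1) True unfolding E(8) by simp
    next
      case False
      then show ?thesis using x(1) Y(2) by (simp add: app_simps)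
    qed
    then show "\<exists>u. x = app (d Y (i - 1)) u" by (intro exI[of _ "\<lambda>_. 0"]) simp
  next
    fix i y assume y: "app (eX J i) y = y" "app (d J i) y = (\<lambda>_. 0)"
    consider "i = b" | "i = b + 1" | "i \<noteq> b" "i \<noteq> b + 1" by blast
    then show "\<exists>x u. app (eX Y i) x = x \<and> app (d Y i) x = (\<lambda>_. 0) \<and> app (q i) x = (\<lambda>j. y j + app (d J (i - 1)) u j)"
    proof cases
      case 1
      have z: "app \<pi> y = (\<lambda>_. 0)" using y(2) 1 by (simp add: JJ(2) D_def)
      have "y = app (\<kappa> * l + \<mu> * \<pi>) y" using y(1) 1 unfolding E(10) by (simp add: JJ(3) m_def)
      also have "\<dots> = app \<kappa> (app l y)" using z by (simp add: app_simps)
      also have "\<dots> = app (\<kappa> * eX Y b) (app l y)" unfolding \<kappa>e ..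
      finally have "app \<kappa> (app (eX Y b) (app l y)) = y" by (simp add: app_simps)
      moreover have "app (eX Y b) (app (eX Y b) (app l y)) = app (eX Y b) (app l y)"
        using app_simps(3)[of "eX Y b" "eX Y b" "app l y"] by simp
      ultimately show ?thesis
        using 1 by (intro exI[of _ "app (eX Y b) (app l y)"] exI[of _ "\<lambda>_. 0"]) (simp add: q_def dY app_simps)
    next
      case 2
      have "y = app (\<pi> * \<mu>) y" using y(1) 2 unfolding E(9) by (simp add: JJ(3) m_def)
      then have "app \<pi> (\<lambda>j. - app \<mu> y j) = (\<lambda>j. - y j)" using app_neg[of \<pi> "app \<mu> y"] by (simp add: app_simps)
      then show ?thesis
        using 2 by (intro exI[of _ "\<lambda>_. 0"] exI[of _ "\<lambda>j. - app \<mu> y j"]) (simp add: JJ(2) D_def)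
    next
      case 3
      then have "y = (\<lambda>_. 0)" using y(1) by (simp add: JJ(3) m_def app_simps)
      then show ?thesis by (intro exI[of _ "\<lambda>_. 0"]) simp
    qed
  qed
  from LM_quasi_iso[OF Y(1) JJ(1) this] have qi: "iso (LM Y J q) (Lo Y) (Lo J)" .
  have "null PA Z J (\<lambda>i. q i * T i)"
  proof -
    \<comment> \<open>In degree \<open>b + 1\<close> the homotopy equation requires
      \<open>\<pi> * g\<close> to cancel \<open>d Z (b + 1)\<close>, whence the sign of the identity
      one degree higher.\<close>
    define h where "h i = (if i = b + 1 then g else if i = b + 1 + 1 then - eM ?P else 0)" for i
    have gP: "eM ?P * d Z (b + 1) = d Z (b + 1)" using complexD(2)[OF Z(1), of "b + 1"] by (simp add: rhom_def)
    have rP: "eM ?P * rho ?P x = rho ?P x" "rho ?P x * eM ?P = rho ?P x" if "x \<in> carrier PA" for x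
      using rmod_rho[OF complexD(1)[OF Z(1), of "b + 1 + 1"]] that by (auto simp: rmod_def)
    have hh: "rhom PA (cobj Z i) (cobj J (i - 1)) (h i)" for i
    proof -
      consider "i = b + 1" | "i = b + 1 + 1" | "i \<noteq> b + 1" "i \<noteq> b + 1 + 1" by blast
      then show ?thesis
      proof cases
        case 1
        then show ?thesis using E(4) JJ(4) by (auto simp: rhom_def h_def JJ(3) m_def R_def)
      next
        case 2
        then show ?thesis using rP JJ(4) by (auto simp: rhom_def h_def JJ(3) m_def R_def)
      next
        case 3
        then show ?thesis by (simp add: rhom_zero h_def)
      qed
    qed
    have "q i * T i = d J (i - 1) * h i + h (i + 1) * d Z i" for i
    proof -
      consider "i = b" | "i = b + 1" | "i \<noteq> b" "i \<noteq> b + 1" by blast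
      then show ?thesis
      proof cases
        case 1
        then show ?thesis using E(5) by (simp add: q_def JJ(2) D_def h_def)
      next
        case 2
        then show ?thesis using E(6) gP by (simp add: q_def JJ(2) D_def h_def)
      next
        case 3
        then show ?thesis by (auto simp: q_def JJ(2) D_def h_def)
      qed
    qed
    then show ?thesis unfolding null_def using hh by blast
  qed
  then have "LM Z J (\<lambda>i. q i * T i) = 0" using LM_null[OF Z(1) JJ(1) rch_comp[OF Z(3) q]] by simp
  then have "LM Y J q \<cdot> LM Z Y T = 0" using LM_comp[OF Z(1) Y(1) JJ(1) Z(3) q] by simp
  then have "LM Z Y T = 0" by (rule iso_mono0[OF qi LM_ar[OF Z(1) Y(1) Z(3)]])
  then show ?thesis using iso_epi0[OF LM_quasi_iso[OF Z(1) X(1) Z(2)] f] Z(4) by simp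
qed

text \<open>The top degree of \<open>Y\<close> is a subcomplex whose cone is quasi-isomorphic to a complex ending one degree lower.\<close>

lemma bounded_vanishing:
  assumes X: "X \<in> bc" "\<forall>i. i < a \<longrightarrow> exact_at X i"
    and Y: "Y \<in> bc" "\<forall>i. i < b - int n \<or> i > b \<longrightarrow> mdim (cobj Y i) = 0" and "b + 2 \<le> a" and f: "ar f (Lo X) (Lo Y)"
  shows "f = 0"
  using Y f \<open>b + 2 \<le> a\<close>
proof (induction n arbitrary: b Y f)
  case 0
  have "\<forall>i. i \<noteq> b \<longrightarrow> mdim (cobj Y i) = 0"
  proof (intro allI impI)
    fix i assume "i \<noteq> b"
    then have "i < b - int 0 \<or> i > b" by auto
    then show "mdim (cobj Y i) = 0" using 0(2)[rule_format, of i] by blast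
  qed
  then show ?case using single_degree_vanishing[OF X 0(1) _ 0(4,3)] by blast
next
  case (Suc n)
  note Y = Suc.prems(1,2) and f = Suc.prems(3)
  \<comment> \<open>The inclusion of the top degree, a subcomplex because the differential leaving
    degree \<open>b\<close> is 0.\<close>
  define s :: "int \<Rightarrow> 'k linop" where "s i = (if i = b then eX Y i else 0)" for i
  define m where "m i = (if i = b then mdim (cobj Y i) else 0)" for i
  have s_ops: "s i * s i = e (m i)" "eX Y i * s i = s i" "s i * e (m i) = s i" "e (m i) * s i = s i" "s i * eX Y i = s i" for i
    by (auto simp: s_def m_def)
  have rY: "eX Y i * rho (cobj Y i) x = rho (cobj Y i) x" "rho (cobj Y i) x * eX Y i = rho (cobj Y i) x" if "x \<in> carrier PA" for i x
    using rmod_rho[OF complexD(1)[OF Y(1), of i]] that by (auto simp: rmod_def)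
  have inv1: "s i * s i * (rho (cobj Y i) x * s i) = rho (cobj Y i) x * s i" if "x \<in> carrier PA" for i x
    using rY[OF that] by (simp add: s_def)
  have dYb: "d Y b = 0" using complexD(2)[OF Y(1), of b] Y(2) by (auto simp: rhom_def)
  have inv2: "s (i + 1) * s (i + 1) * (d Y i * s i) = d Y i * s i" for i
    using dYb by (cases "i = b") (auto simp: s_def)
  have m0: "mdim (cobj Y i) = 0 \<Longrightarrow> m i = 0" for i by (cases "i = b") (simp_all add: m_def)
  obtain A where A: "A \<in> bc" "rch PA A Y s" "\<forall>i. mdim (cobj A i) = m i"
    using subcomplex[of Y PA s s m, OF Y(1) s_ops inv1 inv2 m0] by blast
  interpret co: cone_data PA A Y s using A(1,2) Y(1) by unfold_locales
  let ?C = "cone A Y s"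
  \<comment> \<open>In degree \<open>b\<close> the cone carries only the top term of
    \<open>Y\<close>, and the copy of that same term in degree \<open>b - 1\<close> maps onto it
    identically.\<close>
  have ex: "exact_at ?C i" if "i > b - 1" for i
  proof (cases "i = b")
    case True
    have z: "eX A (b + 1) = 0" using A(3) by (simp add: m_def)
    then have "co.il b = 0" using co.ops(5)[of b] by simp
    moreover have "s b = eX Y b" "eX A b = eX Y b" using A(3) by (auto simp: s_def m_def)
    ultimately have "d ?C (b - 1) * (co.il (b - 1) * co.pr b) = co.ir b * co.pr b"
      unfolding co.cone_d' by (simp add: co.ops co.ops[THEN mult_l] co.ops' co.ops'[THEN mult_l] ring_norm)
    then have "eX ?C b = d ?C (b - 1) * (co.il (b - 1) * co.pr b) + 0 * d ?C b" using \<open>co.il b = 0\<close> co.cone_e[of b] by simp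
    then show ?thesis unfolding True exact_at_contraction[OF co.cone_complex] by blast
  next
    case False
    show ?thesis by (rule exact_at_zero) (use False that A(3) Y(2) in \<open>simp add: co.cone_dim m_def\<close>)
  qed
  obtain W j r H where W: "W \<in> bc" "rch PA W ?C j" "\<forall>i. i > b - 1 \<longrightarrow> mdim (cobj W i) = 0" "\<forall>i. mdim (cobj ?C i) = 0 \<longrightarrow> mdim (cobj W i) = 0"
    "\<forall>i. r i * j i = eX W i" "\<forall>i. eX W i * r i = r i \<and> r i * eX ?C i = r i" "\<forall>i. i < b - 1 \<longrightarrow> j i * r i = eX ?C i"
    "eX ?C (b - 1) = j (b - 1) * r (b - 1) + H * d ?C (b - 1)" "\<forall>i. d W i = r (i + 1) * d ?C i * j i"
    by (rule truncation[OF co.cone_complex, of "b - 1"])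
  then interpret t: trunc PA ?C W j r H "b - 1" using co.cone_complex by unfold_locales
  have iW: "isom (Lo W) (Lo ?C)" using LM_quasi_iso[OF W(1) co.cone_complex t.quasi_iso[OF ex]] by (auto simp: isom_def)
  have W0: "\<forall>i. i < (b - 1) - int n \<or> i > b - 1 \<longrightarrow> mdim (cobj W i) = 0"
  proof (intro allI impI)
    fix i assume i: "i < (b - 1) - int n \<or> i > b - 1"
    show "mdim (cobj W i) = 0"
    proof (cases "i > b - 1")
      case False
      then have "mdim (cobj ?C i) = 0" using i A(3) Y(2) by (simp add: co.cone_dim m_def)
      then show ?thesis using W(4) by blast
    qed (use W(3) in blast)
  qed
  obtain v w where tri: "S.tri (Lo A) (Lo Y) (Lo ?C) (LM A Y s) v w" using cone_tri[OF A(1) Y(1) A(2)] by blast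
  then have v: "ar v (Lo Y) (Lo ?C)" by (simp add: S.tri_def)
  have "v \<cdot> f = 0"
  proof (rule zero_transport[OF isom_refl[OF Lo_obj[OF X(1)]] iW cmp_ar[OF f v]])
    show "g = 0" if "ar g (Lo X) (Lo W)" for g by (rule Suc.IH[OF W(1) W0 that]) (use Suc.prems(4) in simp)
  qed
  then obtain t where t: "ar t (Lo X) (Lo A)" "f = LM A Y s \<cdot> t" using tri f unfolding S.tri_def by blast
  have "t = 0" by (rule single_degree_vanishing[OF X A(1) _ Suc.prems(4) t(1)]) (use A(3) in \<open>simp add: m_def\<close>)
  then show ?case using t(2) cmp_zero_right[OF Lo_obj[OF X(1)] LM_ar[OF A(1) Y(1) A(2)]] by simp
qed

lemma hereditary: assumes U: "GE a U" and W: "LE b W" and "b + 2 \<le> a" and f: "ar f U W" shows "f = 0"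
proof -
  obtain X where X: "X \<in> bc" "isom (Lo X) U" "\<forall>i. i < a \<longrightarrow> exact_at X i" using U by (auto simp: GE_def)
  obtain Y where Y: "Y \<in> bc" "isom (Lo Y) W" "\<forall>i. i > b \<longrightarrow> mdim (cobj Y i) = 0" using W by (auto simp: LE_def)
  let ?I = "{i. mdim (cobj Y i) \<noteq> 0}"
  have fin: "finite ((\<lambda>i. nat (b - i)) ` ?I)" using complexD(4)[OF Y(1)] by simp
  let ?n = "Max ((\<lambda>i. nat (b - i)) ` ?I)"
  have "\<forall>i. i < b - int ?n \<or> i > b \<longrightarrow> mdim (cobj Y i) = 0"
  proof (intro allI impI, rule ccontr)
    fix i assume i: "i < b - int ?n \<or> i > b" "mdim (cobj Y i) \<noteq> 0"
    then have "nat (b - i) \<le> ?n" using Max_ge[OF fin] by blast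
    moreover have "\<not> i > b" using i(2) Y(3)[rule_format, of i] by auto
    ultimately show False using i(1) by linarith
  qed
  then show ?thesis using zero_transport[OF X(2) Y(2) f] bounded_vanishing[OF X(1,3) Y(1) _ \<open>b + 2 \<le> a\<close>] by blast
qed

end

theorem mainTheorem2:
  fixes n :: nat
    and A :: "(nat \<times> nat) set"
    and \<Lambda> :: "('k::alg_closed_field, nat list \<Rightarrow> 'k) module"
    and D :: "('o, 'm::ab_group_add, 'k) lincat"
    and Lo :: "(nat list \<Rightarrow> 'k, 'k) cplx \<Rightarrow> 'o"
    and Lm :: "(nat list \<Rightarrow> 'k, 'k) cplx \<Rightarrow> (nat list \<Rightarrow> 'k, 'k) cplx \<Rightarrow> (int \<Rightarrow> 'k mat) \<Rightarrow> 'm"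
    and shift shift_inv \<tau> \<tau>_inv :: "('o, 'm) lfunctor"
    and AR :: "'o set tquiver"
    and T2 T3 :: "'o set set"
  assumes "n \<ge> 4"
    and "orientation_Dtilde n A"
    and "\<Lambda> = path_algebra {0..n} A"
    and "is_derived_category \<Lambda> D Lo Lm"
    and "inverse_automorphisms D shift shift_inv"
    and "is_shift_functor \<Lambda> D Lo Lm shift"
    and "inverse_automorphisms D \<tau> \<tau>_inv"
    and "is_serre_functor D (functor_comp \<tau> shift)"
    and "AR = AR_quiver (cluster_category D shift shift_inv \<tau> \<tau>_inv) \<tau>"
    and "T2 \<in> tq_components AR" and "is_stable_tube 2 (tq_restrict AR T2)"
    and "T3 \<in> tq_components AR" and "is_stable_tube 2 (tq_restrict AR T3)"
    and "T2 \<noteq> T3"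
  shows "Gamma0 \<noteq> Gamma1 \<and> tq_components Gamma = {Gamma0, Gamma1} \<and>
    tq_iso Gamma (tq_sum (tq_restrict AR T2) (tq_restrict AR T3))"
proof -
  obtain \<theta> where \<theta>: "\<forall>X\<in>bounded_complexes \<Lambda>. iso_mor D (fobj shift (Lo X)) (Lo (cplx_shift X)) (\<theta> X)"
    "\<forall>X\<in>bounded_complexes \<Lambda>. \<forall>Y\<in>bounded_complexes \<Lambda>. \<forall>f\<in>chain_maps \<Lambda> X Y.
        comp D (\<theta> Y) (fmor shift (Lm X Y f)) = comp D (Lm (cplx_shift X) (cplx_shift Y) (\<lambda>i. f (i + 1))) (\<theta> X)"
    using assms(6) unfolding is_shift_functor_def by blast
  obtain B where B: "serre_pairing D (functor_comp \<tau> shift) B" using assms(8) unfolding is_serre_functor_iff by blast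
  have "linear_category D" using assms(4) by (simp add: is_derived_category_def)
  then interpret lcat D by unfold_locales
  interpret derived_quiver D shift shift_inv "{0..n}" A Lo Lm \<theta>
    using assms(4,5) \<theta> unfolding assms(3) by unfold_locales auto
  interpret hered D shift shift_inv \<tau> \<tau>_inv B LE GE
  proof (unfold_locales)
    show "inverse_automorphisms D (functor_comp \<tau> shift) (functor_comp shift_inv \<tau>_inv)"
      by (rule inverse_automorphisms_comp[OF assms(7,5)])
  qed (fact assms(7) B tri_exists LE_isom GE_isom LE_S LE_Si GE_Si orth hereditary trunc_tri bounded)+
  \<comment> \<open>Every vertex of a tube has a predecessor inside the tube, and this arrow places
    the translate in the same component of the whole quiver.\<close>
  have closed: "trans (tq_restrict AR T0) U \<in> verts (tq_restrict AR T0)"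
    if T0: "T0 \<in> tq_components AR" "is_stable_tube 2 (tq_restrict AR T0)" and U: "U \<in> verts (tq_restrict AR T0)" for T0 U
  proof -
    obtain W where W: "W \<in> verts (tq_restrict AR T0)" "arr (tq_restrict AR T0) W U \<noteq> 0" using tube_predecessor[OF T0(2) U] by blast
    then have "trans AR U \<in> T0"
      using AR_component_trans[of T0 U W] T0(1) U by (simp add: tq_restrict_def assms(9) cluster_category_def)
    then show ?thesis using U by (simp add: tq_restrict_def)
  qed
  show ?thesis
    using tq_components_Gamma tq_iso_Gamma_tubes[OF assms(11) closed[OF assms(10,11)] assms(13) closed[OF assms(12,13)]] by blast
qed

end
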